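(* Let $\gamma>0$ be a constant. Assume $u_0\equiv0$ and $0\le f\in L^r(0,T;L^q(\Omega))$, where $r>1$, $q>1$ satisfy $$1<\frac1r+\frac{n}{2q}.$$ Further, in the case $\gamma<1$, assume that: (i) if $\frac1r<\frac{n}{n-2}\frac1q-\frac{2}{n-2}$, then $q>\left(\frac{2^*}{1-\gamma}\right)'$, and (ii) if $\frac1r\ge\frac{n}{n-2}\frac1q-\frac{2}{n-2}$, then $r>\frac{2}{1+\gamma}$. For $k\in\mathbb{N}$ let $u_k$ be the unique (non-negative) finite energy solution of $$(u_k)_t-\Delta u_k+(-\Delta)^su_k=\frac{T_k(f(x,t))}{\left(u_k+\frac1k\right)^\gamma}\ \text{in }\Omega_T,\quad u_k=0\ \text{in }(\mathbb{R}^n\setminus\Omega)\times(0,T),\quad u_k(x,0)=0\ \text{in }\Omega.$$ Then there exists a positive constant $c$, independent of $k$, such that $$\|u_k\|_{L^\infty(0,T;L^{2\sigma}(\Omega))}+\|u_k\|_{L^{2\sigma}(0,T;L^{2^*\sigma}(\Omega))}\le c,$$ where $$\sigma=\begin{cases}\dfrac{q(n-2)(\gamma+1)}{2(n-2q)}&\text{if }\frac1r<\frac{n}{n-2}\frac1q-\frac{2}{n-2},\\[2mm]\dfrac{qrn(\gamma+1)}{2(nr+2q-2qr)}&\text{if }\frac1r\ge\frac{n}{n-2}\frac1q-\frac{2}{n-2}.\end{cases}$$ Further, the function $u$ obtained as the (pointwise a.e.) limit of $u_k$ as $k\to\infty$ satisfies $u\in L^\infty(0,T;L^{2\sigma}(\Omega))\cap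 L^{2\sigma}(0,T;L^{2^*\sigma}(\Omega))$.
   Context: Standing assumptions: $n>2$, $\Omega\subset\mathbb{R}^n$ is a bounded domain with Lipschitz boundary, $s\in(0,1)$, $0<T<\infty$, $\Omega_T=\Omega\times(0,T)$. $2^*=\frac{2n}{n-2}$; $p'=\frac{p}{p-1}$ denotes the Hölder conjugate of $p>1$; $T_k(\sigma)=\max\{-k,\min\{k,\sigma\}\}$. The fractional Laplacian acts in the space variable: $(-\Delta)^su(x,t)=c_{n,s}\,\mathrm{P.V.}\int_{\mathbb{R}^n}\frac{u(x,t)-u(y,t)}{|x-y|^{n+2s}}\,dy$; in the energy formulation below the constant $c_{n,s}$ is taken to be $1$. Energy (finite energy) solution: for $g\in L^2(\Omega_T)$, $v_0\in L^2(\Omega)$, a function $v$ is an energy solution of $v_t-\Delta v+(-\Delta)^sv=g$ in $\Omega_T$, $v=0$ in $(\mathbb{R}^n\setminus\Omega)\times(0,T)$, $v(\cdot,0)=v_0$ in $\Omega$, if $v\in L^2(0,T;H_0^1(\Omega))\cap\mathcal{C}([0,T],L^2(\Omega))$, $v_t\in L^2(0,T;H^{-1}(\Omega))$, $v(\cdot,t)\to v_0$ strongly in $L^2(\Omega)$ as $t\to0$, and for all $\phi\in L^2(0,T;H_0^1(\Omega))$ $$\int_0^T\langle v_t,\phi\rangle dt+\int_0^T\!\!\int_\Omega\nabla v\cdot\nabla\phi\,dx\,dt+\frac12\int_0^T\!\!\int_{\mathbb{R}^n}\!\int_{\mathbb{R}^n}\frac{(v(x,t)-v(y,t))(\phi(x,t)-\phi(y,t))}{|x-y|^{n+2s}}dx\,dy\,dt=\int_0^T\!\!\int_\Omega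 g\phi\,dx\,dt.$$ The solution $u_k$ above is meant in this sense with $g=T_k(f)/(u_k+\frac1k)^\gamma$ and $v_0=0$. For each $k$ such a non-negative $u_k$ exists and is unique, and the sequence $\{u_k\}_k$ is increasing in $k$, so the pointwise limit $u$ is defined. *)

theory Defs
  imports "HOL-Analysis.Analysis" "HOL-Probability.Essential_Supremum"
begin

subsection \<open>Lipschitz domains\<close>

text \<open>Near each boundary point the domain is the part of a small ball lying above the graph of a
  Lipschitz function. The vector \<open>e\<close> is the vertical direction of the rotated coordinate system and
  \<open>y - (y \<bullet> e) *\<^sub>R e\<close> is the horizontal part of \<open>y\<close>.\<close>

definition lipschitz_boundary :: "'a::euclidean_space set \<Rightarrow> bool" where
  "lipschitz_boundary \<Omega> \<longleftrightarrow>
     (\<forall>x0\<in>frontier \<Omega>. \<exists>e h L \<rho>. norm e = 1 \<and> 0 < \<rho> \<and>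
        L-lipschitz_on {y. y \<bullet> e = 0} (h :: 'a \<Rightarrow> real) \<and>
        \<Omega> \<inter> ball x0 \<rho> = {y \<in> ball x0 \<rho>. h (y - (y \<bullet> e) *\<^sub>R e) < y \<bullet> e})"

definition bounded_lipschitz_domain :: "'a::euclidean_space set \<Rightarrow> bool" where
  "bounded_lipschitz_domain \<Omega> \<longleftrightarrow>
     open \<Omega> \<and> connected \<Omega> \<and> \<Omega> \<noteq> {} \<and> bounded \<Omega> \<and> lipschitz_boundary \<Omega>"

subsection \<open>Lebesgue spaces\<close>

text \<open>Function spaces are sets of representatives, not of classes; all of the (semi)norms below
  depend only on the almost-everywhere class. The exponent \<open>p\<close> is finite and positive.\<close>

definition Lp :: "real \<Rightarrow> 'a::euclidean_space set \<Rightarrow> ('a \<Rightarrow> real) set" where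
  "Lp p \<Omega> = {w. w \<in> borel_measurable (lebesgue_on \<Omega>) \<and>
                 integrable (lebesgue_on \<Omega>) (\<lambda>x. \<bar>w x\<bar> powr p)}"

definition Lp_norm :: "real \<Rightarrow> 'a::euclidean_space set \<Rightarrow> ('a \<Rightarrow> real) \<Rightarrow> real" where
  "Lp_norm p \<Omega> w = (LINT x|lebesgue_on \<Omega>. \<bar>w x\<bar> powr p) powr (1 / p)"

subsection \<open>Test functions and Sobolev spaces\<close>

primrec C_diff :: "nat \<Rightarrow> ('a::euclidean_space \<Rightarrow> real) \<Rightarrow> bool" where
  "C_diff 0 \<phi> \<longleftrightarrow> continuous_on UNIV \<phi>"
| "C_diff (Suc m) \<phi> \<longleftrightarrow> \<phi> differentiable_on UNIV \<and>
     (\<forall>b\<in>Basis. C_diff m (\<lambda>x. frechet_derivative \<phi> (at x) b))"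

definition test_functions :: "'a::euclidean_space set \<Rightarrow> ('a \<Rightarrow> real) set" where
  "test_functions \<Omega> = {\<phi>. (\<forall>m. C_diff m \<phi>) \<and>
     compact (closure {x. \<phi> x \<noteq> 0}) \<and> closure {x. \<phi> x \<noteq> 0} \<subseteq> \<Omega>}"

definition has_weak_gradient ::
    "'a::euclidean_space set \<Rightarrow> ('a \<Rightarrow> real) \<Rightarrow> ('a \<Rightarrow> 'a) \<Rightarrow> bool" where
  "has_weak_gradient \<Omega> w G \<longleftrightarrow>
     (\<forall>K. compact K \<and> K \<subseteq> \<Omega> \<longrightarrow> w absolutely_integrable_on K \<and> G absolutely_integrable_on K) \<and>
     (\<forall>\<phi>\<in>test_functions \<Omega>. \<forall>b\<in>Basis.
        (LINT x|lebesgue_on \<Omega>. w x * frechet_derivative \<phi> (at x) b) =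
        - (LINT x|lebesgue_on \<Omega>. (G x \<bullet> b) * \<phi> x))"

text \<open>The weak gradient is unique almost everywhere in \<open>\<Omega>\<close>, so the choice made here is
  irrelevant for the integrals over \<open>\<Omega>\<close> below.\<close>

definition weak_grad :: "'a::euclidean_space set \<Rightarrow> ('a \<Rightarrow> real) \<Rightarrow> 'a \<Rightarrow> 'a" where
  "weak_grad \<Omega> w = (SOME G. has_weak_gradient \<Omega> w G)"

definition H1 :: "'a::euclidean_space set \<Rightarrow> ('a \<Rightarrow> real) set" where
  "H1 \<Omega> = {w \<in> Lp 2 \<Omega>. \<exists>G. has_weak_gradient \<Omega> w G \<and> (\<lambda>x. norm (G x)) \<in> Lp 2 \<Omega>}"

definition H1_norm :: "'a::euclidean_space set \<Rightarrow> ('a \<Rightarrow> real) \<Rightarrow> real" where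
  "H1_norm \<Omega> w =
     sqrt ((Lp_norm 2 \<Omega> w)\<^sup>2 + (Lp_norm 2 \<Omega> (\<lambda>x. norm (weak_grad \<Omega> w x)))\<^sup>2)"

text \<open>The closure of the test functions in \<open>H1 \<Omega>\<close>. Its elements are functions on the whole space
  that vanish outside \<open>\<Omega>\<close>, since the nonlocal form below integrates over the whole space.\<close>

definition H01 :: "'a::euclidean_space set \<Rightarrow> ('a \<Rightarrow> real) set" where
  "H01 \<Omega> = {w \<in> H1 \<Omega>. (AE x in lebesgue. x \<notin> \<Omega> \<longrightarrow> w x = 0) \<and>
     (\<exists>\<phi> :: nat \<Rightarrow> 'a \<Rightarrow> real. (\<forall>j. \<phi> j \<in> test_functions \<Omega>) \<and>
        (\<lambda>j. H1_norm \<Omega> (\<lambda>x. w x - \<phi> j x)) \<longlonglongrightarrow> 0)}"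

text \<open>The dual space of \<open>H01 \<Omega>\<close>; the values of a functional outside \<open>H01 \<Omega>\<close> play no role.\<close>

definition Hm1 :: "'a::euclidean_space set \<Rightarrow> (('a \<Rightarrow> real) \<Rightarrow> real) set" where
  "Hm1 \<Omega> = {F.
     (\<forall>w\<in>H01 \<Omega>. \<forall>z\<in>H01 \<Omega>. \<forall>a b. F (\<lambda>x. a * w x + b * z x) = a * F w + b * F z) \<and>
     (\<exists>C. \<forall>w\<in>H01 \<Omega>. \<bar>F w\<bar> \<le> C * H1_norm \<Omega> w)}"

definition Hm1_norm :: "'a::euclidean_space set \<Rightarrow> (('a \<Rightarrow> real) \<Rightarrow> real) \<Rightarrow> real" where
  "Hm1_norm \<Omega> F = (SUP w\<in>{w \<in> H01 \<Omega>. H1_norm \<Omega> w \<le> 1}. \<bar>F w\<bar>)"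

subsection \<open>Bochner spaces over \<open>(0, T)\<close>\<close>

text \<open>The target space is given by a set \<open>X\<close> of real functions and a seminorm \<open>N\<close> on it.\<close>

definition strongly_measurable ::
    "real \<Rightarrow> ('c \<Rightarrow> real) set \<Rightarrow> (('c \<Rightarrow> real) \<Rightarrow> real) \<Rightarrow> (real \<Rightarrow> 'c \<Rightarrow> real) \<Rightarrow> bool" where
  "strongly_measurable T X N w \<longleftrightarrow>
     (AE t in lebesgue_on {0<..<T}. w t \<in> X) \<and>
     (\<exists>S :: nat \<Rightarrow> real \<Rightarrow> 'c \<Rightarrow> real.
        (\<forall>j. S j ` {0<..<T} \<subseteq> X \<and> finite (S j ` {0<..<T}) \<and>
             (\<forall>a. {t \<in> {0<..<T}. S j t = a} \<in> sets lebesgue)) \<and>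
        (AE t in lebesgue_on {0<..<T}. (\<lambda>j. N (\<lambda>x. w t x - S j t x)) \<longlonglongrightarrow> 0))"

definition bochner_Lp ::
    "real \<Rightarrow> real \<Rightarrow> ('c \<Rightarrow> real) set \<Rightarrow> (('c \<Rightarrow> real) \<Rightarrow> real) \<Rightarrow> (real \<Rightarrow> 'c \<Rightarrow> real) set" where
  "bochner_Lp p T X N = {w. strongly_measurable T X N w \<and>
     integrable (lebesgue_on {0<..<T}) (\<lambda>t. N (w t) powr p)}"

definition bochner_Lp_norm ::
    "real \<Rightarrow> real \<Rightarrow> (('c \<Rightarrow> real) \<Rightarrow> real) \<Rightarrow> (real \<Rightarrow> 'c \<Rightarrow> real) \<Rightarrow> real" where
  "bochner_Lp_norm p T N w = (LINT t|lebesgue_on {0<..<T}. N (w t) powr p) powr (1 / p)"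

definition bochner_Linf ::
    "real \<Rightarrow> ('c \<Rightarrow> real) set \<Rightarrow> (('c \<Rightarrow> real) \<Rightarrow> real) \<Rightarrow> (real \<Rightarrow> 'c \<Rightarrow> real) set" where
  "bochner_Linf T X N = {w. strongly_measurable T X N w \<and>
     esssup (lebesgue_on {0<..<T}) (\<lambda>t. ereal (N (w t))) < \<infinity>}"

definition bochner_Linf_norm ::
    "real \<Rightarrow> (('c \<Rightarrow> real) \<Rightarrow> real) \<Rightarrow> (real \<Rightarrow> 'c \<Rightarrow> real) \<Rightarrow> real" where
  "bochner_Linf_norm T N w = real_of_ereal (esssup (lebesgue_on {0<..<T}) (\<lambda>t. ereal (N (w t))))"

definition continuous_into_L2 ::
    "real \<Rightarrow> 'a::euclidean_space set \<Rightarrow> (real \<Rightarrow> 'a \<Rightarrow> real) \<Rightarrow> bool" where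
  "continuous_into_L2 T \<Omega> w \<longleftrightarrow>
     (\<forall>t\<in>{0..T}. w t \<in> Lp 2 \<Omega>) \<and>
     (\<forall>t0\<in>{0..T}. ((\<lambda>t. Lp_norm 2 \<Omega> (\<lambda>x. w t x - w t0 x)) \<longlongrightarrow> 0) (at t0 within {0..T}))"

subsection \<open>Energy solutions\<close>

definition slices :: "('a \<times> real \<Rightarrow> real) \<Rightarrow> real \<Rightarrow> 'a \<Rightarrow> real" where
  "slices v = (\<lambda>t x. v (x, t))"

text \<open>The identity \<open>\<integral> \<psi>' v dt = - \<integral> \<psi> w dt\<close> between elements of the dual space of \<open>H01 \<Omega>\<close>, evaluated
  at each element of \<open>H01 \<Omega>\<close>; here \<open>v\<close> acts on \<open>H01 \<Omega>\<close> through the inner product of \<open>L\<^sup>2\<close>.\<close>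

definition weak_time_derivative :: "'a::euclidean_space set \<Rightarrow> real \<Rightarrow>
    ('a \<times> real \<Rightarrow> real) \<Rightarrow> (real \<Rightarrow> ('a \<Rightarrow> real) \<Rightarrow> real) \<Rightarrow> bool" where
  "weak_time_derivative \<Omega> T v w \<longleftrightarrow>
     (\<forall>\<psi>\<in>test_functions {0<..<T}. \<forall>z\<in>H01 \<Omega>.
        (LINT t|lebesgue_on {0<..<T}. deriv \<psi> t * (LINT x|lebesgue_on \<Omega>. v (x, t) * z x)) =
        - (LINT t|lebesgue_on {0<..<T}. \<psi> t * w t z))"

text \<open>The bilinear form of the fractional Laplacian with the constant \<open>c\<^sub>n\<^sub>,\<^sub>s\<close> normalised to 1.\<close>

definition fractional_form ::
    "real \<Rightarrow> ('a::euclidean_space \<Rightarrow> real) \<Rightarrow> ('a \<Rightarrow> real) \<Rightarrow> real" where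
  "fractional_form s w z = 1/2 * (LINT (x, y)|(lebesgue :: ('a \<times> 'a) measure).
     (w x - w y) * (z x - z y) / norm (x - y) powr (real DIM('a) + 2 * s))"

text \<open>The function \<open>v\<close> is the representative that is continuous in time with values in \<open>L\<^sup>2\<close>, so
  that all its time slices, in particular the initial one, are meaningful.\<close>

definition energy_solution :: "'a::euclidean_space set \<Rightarrow> real \<Rightarrow> real \<Rightarrow>
    ('a \<times> real \<Rightarrow> real) \<Rightarrow> ('a \<Rightarrow> real) \<Rightarrow> ('a \<times> real \<Rightarrow> real) \<Rightarrow> bool" where
  "energy_solution \<Omega> T s g v0 v \<longleftrightarrow>
     g \<in> Lp 2 (\<Omega> \<times> {0<..<T}) \<and> v0 \<in> Lp 2 \<Omega> \<and>
     v \<in> borel_measurable (lebesgue_on (\<Omega> \<times> {0<..<T})) \<and>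
     slices v \<in> bochner_Lp 2 T (H01 \<Omega>) (H1_norm \<Omega>) \<and>
     continuous_into_L2 T \<Omega> (slices v) \<and>
     (\<forall>x t. x \<notin> \<Omega> \<and> t \<in> {0<..<T} \<longrightarrow> v (x, t) = 0) \<and>
     ((\<lambda>t. Lp_norm 2 \<Omega> (\<lambda>x. v (x, t) - v0 x)) \<longlongrightarrow> 0) (at_right 0) \<and>
     (\<exists>vt \<in> bochner_Lp 2 T (Hm1 \<Omega>) (Hm1_norm \<Omega>).
        weak_time_derivative \<Omega> T v vt \<and>
        (\<forall>\<phi> \<in> bochner_Lp 2 T (H01 \<Omega>) (H1_norm \<Omega>).
           (LINT t|lebesgue_on {0<..<T}. vt t (\<phi> t)) +
           (LINT t|lebesgue_on {0<..<T}. LINT x|lebesgue_on \<Omega>.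
              weak_grad \<Omega> (slices v t) x \<bullet> weak_grad \<Omega> (\<phi> t) x) +
           (LINT t|lebesgue_on {0<..<T}. fractional_form s (slices v t) (\<phi> t)) =
           (LINT t|lebesgue_on {0<..<T}. LINT x|lebesgue_on \<Omega>. g (x, t) * \<phi> t x)))"

subsection \<open>Truncation and exponents\<close>

definition trunc :: "real \<Rightarrow> real \<Rightarrow> real" where
  "trunc k \<tau> = max (- k) (min k \<tau>)"

definition holder_conj :: "real \<Rightarrow> real" where
  "holder_conj p = p / (p - 1)"

definition two_star :: "real \<Rightarrow> real" where
  "two_star n = 2 * n / (n - 2)"

end

theory Submission imports Defs
begin

text \<open>Testing the equation with \<open>G (u\<^sub>k)\<close>, where \<open>G\<close> is a smooth bounded substitute for
\<open>u\<^sup>2\<^sup>\<sigma>\<^sup>-\<^sup>1\<close>, controls \<open>y = u\<^sup>\<sigma>\<close> in \<open>L\<^sup>\<infinity>(0,T;L\<^sup>2) \<inter> L\<^sup>2(0,T;H\<^sup>1)\<close>: the nonlocal form is nonnegative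
because \<open>G\<close> is increasing, and the source is at most \<open>C f (1 + y\<^sup>\<kappa>)\<close> with \<open>\<kappa> = 2 - (1 + \<gamma>) / \<sigma> < 2\<close>.
The value of \<open>\<sigma>\<close> is the one for which \<open>\<kappa> = 2 (a + b)\<close> with \<open>1/q + a + b (n - 2) / n = 1\<close> and \<open>b \<le> 1 - 1/r\<close>, so
Hoelder's inequality in space, the Sobolev inequality and Young's inequality in time absorb the
source; as \<open>a + b < 1\<close>, the resulting bound is sublinear in the energy and closes. The smooth
cut-offs are removed by Fatou's lemma, and so is \<open>k\<close>.\<close>

subsection \<open>Smooth functions\<close>

text \<open>The obstacle is uniformity: no constant may see \<open>k\<close> or the cut-off level
  \<open>M\<close>. A composite with an element of \<open>H01 \<Omega>\<close> is admissible only if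
  the outer function has a bounded derivative, and near zero the factor
  \<open>1 / (u + 1 / k) powr \<gamma>\<close> is controlled by nothing but the vanishing of the
  test function. Hence \<open>G\<close> has a zero of odd order
  \<open>2 * l + 1 \<ge> \<gamma>\<close> at the origin, growth \<open>2 * \<sigma> - 1\<close> at
  infinity, and is composed with a smooth truncation. Conditions (i) and (ii) enter through
  \<open>\<sigma> > 1\<close> alone.

  The time derivative is only a curve of functionals, so there is no pointwise chain rule in time.
  Backward difference quotients and the convexity of the primitive \<open>H\<close> of
  \<open>G\<close> give an inequality in the direction that is needed.

  The sublinear bound closes only if the supremum of the energy is known to be finite; boundedness
  of the truncated power gives this, with a bound that depends on \<open>M\<close> and drops out of
  the result.

  Membership in the Bochner spaces also asks for strong measurability. The countable dense family
  for it comes from the step functions that approximate the \<open>u k\<close> in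
  \<open>H01 \<Omega>\<close>, truncated at integer levels.\<close>

definition smooth :: "('a::euclidean_space \<Rightarrow> real) \<Rightarrow> bool" where
 "smooth f \<longleftrightarrow> (\<forall>m. C_diff m f)"

lemma C_diff_SucD: "C_diff (Suc m) f \<Longrightarrow> C_diff m f"
 by (induction m arbitrary: f) (auto intro: differentiable_imp_continuous_on)

lemma C_diff_Suc_differentiable: "C_diff (Suc m) f \<Longrightarrow> f differentiable (at x)"
 by (auto simp: differentiable_on_def)

lemma C_diff_continuous: "C_diff m f \<Longrightarrow> continuous_on UNIV f"
 by (cases m) (auto intro: differentiable_imp_continuous_on)

lemma C_diff_SucI:
 assumes "\<And>x. (f has_derivative f' x) (at x)" "\<And>b. b \<in> Basis \<Longrightarrow> C_diff m (\<lambda>x. f' x b)"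
 shows "C_diff (Suc m) f"
proof -
 have "frechet_derivative f (at x) = f' x" for x
  using assms(1) frechet_derivative_at by metis
 then show ?thesis
  using assms by (auto simp: differentiable_on_def differentiable_def)
qed

lemma C_diff_Suc_has_derivative:
 "C_diff (Suc m) f \<Longrightarrow> (f has_derivative frechet_derivative f (at x)) (at x)"
 using C_diff_Suc_differentiable frechet_derivative_works by blast

lemma C_diff_const [simp]: "C_diff m (\<lambda>x. c)"
proof (induction m arbitrary: c)
 case (Suc m)
 then show ?case by (intro C_diff_SucI[where f'="\<lambda>x h. 0"]) auto
qed simp

lemma C_diff_add: "C_diff m f \<Longrightarrow> C_diff m g \<Longrightarrow> C_diff m (\<lambda>x. f x + g x)"
proof (induction m arbitrary: f g)
 case (Suc m)
 show ?case
  by (rule C_diff_SucI, rule has_derivative_add; (rule C_diff_Suc_has_derivative Suc.prems)?)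
    (use Suc in auto)
qed (auto intro: continuous_intros)

lemma C_diff_mult: "C_diff m f \<Longrightarrow> C_diff m g \<Longrightarrow> C_diff m (\<lambda>x. f x * g x)"
proof (induction m arbitrary: f g)
 case (Suc m)
 show ?case
  by (rule C_diff_SucI, rule has_derivative_mult; (rule C_diff_Suc_has_derivative Suc.prems)?)
    (use Suc C_diff_SucD in \<open>auto intro!: C_diff_add Suc.IH\<close>)
qed (auto intro: continuous_intros)

text \<open>The outer function has one real variable, so its derivative is multiplication by the
  scalar \<open>?g'\<close>, and the derivative of the composite is a product whose second factor is
  again a composite. Differentiability of \<open>g\<close> to all orders is assumed because
  \<open>?g'\<close> takes the place of \<open>g\<close> in the induction hypothesis.\<close>

lemma C_diff_compose:
 "C_diff m f \<Longrightarrow> (\<And>k. C_diff k g) \<Longrightarrow> C_diff m (\<lambda>x. g (f x))"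
proof (induction m arbitrary: f g)
 case 0
 then show ?case
  using C_diff_continuous[of 0 f] C_diff_continuous[of 0 g]
  by (auto intro: continuous_on_compose2)
next
 case (Suc m)
 let ?g' = "\<lambda>y. frechet_derivative g (at y) 1"
 have lin: "frechet_derivative g (at y) z = z * ?g' y" for y z
 proof -
  have "linear (frechet_derivative g (at y))"
   by (rule linear_frechet_derivative[OF C_diff_Suc_differentiable[OF Suc.prems(2)]])
  from linear_scale[OF this, of z 1] show ?thesis by (simp only: real_scaleR_def mult_1_right)
 qed
 have "((\<lambda>x. g (f x)) has_derivative
   (\<lambda>h. frechet_derivative f (at x) h * ?g' (f x))) (at x)" for x
  using has_derivative_compose[OF C_diff_Suc_has_derivative[OF Suc.prems(1), of x]
    C_diff_Suc_has_derivative[OF Suc.prems(2)[of "Suc 0"]]]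
  unfolding lin[of _ "frechet_derivative f (at x) _"] .
 moreover have "C_diff k ?g'" for k
  using Suc.prems(2)[of "Suc k"] by auto
 moreover from this have "C_diff m (\<lambda>x. ?g' (f x))"
  by (rule Suc.IH[OF C_diff_SucD[OF Suc.prems(1)]])
 moreover have "C_diff m (\<lambda>x. frechet_derivative f (at x) b)" if "b \<in> Basis" for b
  using Suc.prems(1) that by simp
 ultimately show ?case
  by (intro C_diff_SucI[where f'="\<lambda>x h. frechet_derivative f (at x) h * ?g' (f x)"] C_diff_mult)
qed

lemma C_diff_real_SucI:
 assumes "\<And>x::real. (f has_real_derivative f' x) (at x)" "C_diff m f'"
 shows "C_diff (Suc m) f"
 by (rule C_diff_SucI[where f'="\<lambda>x h. f' x * h"])
   (use assms in \<open>auto simp: has_field_derivative_def\<close>)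

lemma smooth_const [simp]: "smooth (\<lambda>x. c)"
 and smooth_add: "smooth f \<Longrightarrow> smooth g \<Longrightarrow> smooth (\<lambda>x. f x + g x)"
 and smooth_mult: "smooth f \<Longrightarrow> smooth g \<Longrightarrow> smooth (\<lambda>x. f x * g x)"
 and smooth_compose: "smooth f \<Longrightarrow> smooth h \<Longrightarrow> smooth (\<lambda>x. h (f x))"
 by (auto simp: smooth_def C_diff_add C_diff_mult C_diff_compose)

lemma smooth_diff: "smooth f \<Longrightarrow> smooth g \<Longrightarrow> smooth (\<lambda>x. f x - g x)"
 using smooth_add[of f "\<lambda>x. -1 * g x"] smooth_mult[of "\<lambda>x. -1" g] by simp

lemma smooth_prod: "finite A \<Longrightarrow> (\<And>i. i \<in> A \<Longrightarrow> smooth (f i)) \<Longrightarrow> smooth (\<lambda>x. \<Prod>i\<in>A. f i x)"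
 by (induction A rule: finite_induct) (auto intro: smooth_mult)

lemma smooth_inner: "smooth (\<lambda>x. x \<bullet> i)"
 unfolding smooth_def
proof
 show "C_diff m (\<lambda>x. x \<bullet> i)" for m
 proof (cases m)
  case (Suc k)
  then show ?thesis
   by (auto intro!: C_diff_SucI[where f'="\<lambda>x h. h \<bullet> i"] derivative_eq_intros simp del: C_diff.simps)
 qed (auto intro: continuous_intros)
qed

lemma smooth_frechet: "smooth f \<Longrightarrow> b \<in> Basis \<Longrightarrow> smooth (\<lambda>x. frechet_derivative f (at x) b)"
 unfolding smooth_def by (metis C_diff.simps(2))

lemma smooth_continuous: "smooth f \<Longrightarrow> continuous_on S f"
 unfolding smooth_def by (meson C_diff_continuous continuous_on_subset subset_UNIV)

lemma smooth_has_derivative: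
 "smooth f \<Longrightarrow> (f has_derivative frechet_derivative f (at x)) (at x)"
 unfolding smooth_def by (meson C_diff_Suc_has_derivative)

lemma smooth_borel: "smooth f \<Longrightarrow> f \<in> borel_measurable borel"
 by (intro borel_measurable_continuous_onI smooth_continuous)

lemma smooth_DERIV:
 fixes f :: "real \<Rightarrow> real"
 shows "smooth f \<Longrightarrow> (f has_real_derivative deriv f x) (at x)"
 using smooth_has_derivative[of f x]
 by (metis DERIV_deriv_iff_real_differentiable differentiable_def)

lemma smooth_deriv:
 fixes f :: "real \<Rightarrow> real"
 assumes "smooth f" shows "smooth (deriv f)"
proof -
 have "frechet_derivative f (at x) 1 = deriv f x" for x
  using frechet_derivative_at[OF smooth_DERIV[OF assms, unfolded has_field_derivative_def]]
  by (metis mult.right_neutral)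
 then show ?thesis using smooth_frechet[OF assms, of 1] by simp
qed

lemma smooth_real_antiderivative:
 assumes "\<And>x::real. (f has_real_derivative f' x) (at x)" "smooth f'"
 shows "smooth f"
proof -
 have "C_diff (Suc m) f" for m
  using assms by (intro C_diff_real_SucI) (auto simp: smooth_def)
 then show ?thesis unfolding smooth_def by (metis C_diff_SucD)
qed

lemma frechet_derivative_compose_real:
 fixes g :: "real \<Rightarrow> real"
 assumes "smooth f" "smooth g"
 shows "frechet_derivative (\<lambda>x. g (f x)) (at x) h = deriv g (f x) * frechet_derivative f (at x) h"
proof -
 have "((\<lambda>x. g (f x)) has_derivative (\<lambda>h. deriv g (f x) * frechet_derivative f (at x) h)) (at x)"
  using has_derivative_compose[OF smooth_has_derivative[OF assms(1)]
    smooth_DERIV[OF assms(2), unfolded has_field_derivative_def]] by simp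
 then show ?thesis using frechet_derivative_at by metis
qed

text \<open>Derivatives of \<open>exp (- 1 / t)\<close> are combinations of these functions.\<close>

definition flat :: "nat \<Rightarrow> real \<Rightarrow> real" where
 "flat i t = (if t \<le> 0 then 0 else (1 / t) ^ i * exp (- (1 / t)))"

lemma flat_tendsto_0: "(flat i \<longlongrightarrow> 0) (at 0)"
proof -
 have "((\<lambda>t. (1/t)^i / exp (1/t)) \<longlongrightarrow> 0) (at_right (0::real))"
  using filterlim_compose[OF tendsto_power_div_exp_0 filterlim_inverse_at_top_right, of i]
  by (simp add: divide_inverse)
 then have "(flat i \<longlongrightarrow> 0) (at_right 0)"
  by (rule Lim_transform_eventually)
    (auto simp: flat_def exp_minus field_simps eventually_at_right_less
       intro!: eventually_mono[OF eventually_at_right_less[of 0]])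
 moreover have "(flat i \<longlongrightarrow> 0) (at_left 0)"
  by (rule Lim_transform_eventually[of "\<lambda>_. 0"])
    (auto simp: flat_def eventually_at_left_field intro: exI[of _ "-1"])
 ultimately show ?thesis by (simp add: filterlim_split_at)
qed

text \<open>Derivatives of \<open>flat i\<close> stay in the span of the family, which turns
  smoothness into an induction over the order. At the origin the difference quotient
  \<open>flat i y / y\<close> is \<open>flat (i + 1) y\<close>, which tends to zero.\<close>

lemma flat_DERIV:
 "(flat i has_real_derivative flat (i + 2) t - real i * flat (i + 1) t) (at t)"
proof -
 consider "t < 0" | "t = 0" | "t > 0" by linarith
 then show ?thesis
 proof cases
  case 1
  have "(flat i has_real_derivative 0) (at t)"
   by (rule has_field_derivative_transform_within_open[of "\<lambda>_. 0" 0 t "{..<0}"])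
     (use 1 in \<open>auto simp: flat_def\<close>)
  then show ?thesis using 1 by (simp add: flat_def)
 next
  case 2
  have "((\<lambda>y. flat i y / y) \<longlongrightarrow> 0) (at 0)"
   by (rule Lim_transform_eventually[OF flat_tendsto_0[of "i+1"]])
     (auto simp: flat_def intro!: always_eventually)
  then show ?thesis using 2 by (simp add: has_field_derivative_iff flat_def)
 next
  case 3
  have r: "((\<lambda>t. 1 / t) has_real_derivative - ((1 / t)\<^sup>2)) (at t)"
   using DERIV_inverse[of t UNIV] 3 by (simp add: divide_inverse power2_eq_square)
  have "((\<lambda>t. (1 / t) ^ i * exp (- (1 / t))) has_real_derivative
    real i * (- ((1 / t)\<^sup>2) * (1 / t) ^ (i - Suc 0)) * exp (- (1 / t)) +
    exp (- (1 / t)) * - (- ((1 / t)\<^sup>2)) * (1 / t) ^ i) (at t)"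
   by (intro DERIV_mult DERIV_power r DERIV_fun_exp DERIV_minus)
  also have "real i * (- ((1 / t)\<^sup>2) * (1 / t) ^ (i - Suc 0)) * exp (- (1 / t)) +
    exp (- (1 / t)) * - (- ((1 / t)\<^sup>2)) * (1 / t) ^ i
   = flat (i + 2) t - real i * flat (i + 1) t"
   using 3 by (cases i) (auto simp: flat_def power2_eq_square algebra_simps)
  finally have "((\<lambda>t. (1 / t) ^ i * exp (- (1 / t))) has_real_derivative
    flat (i + 2) t - real i * flat (i + 1) t) (at t)" .
  then show ?thesis
   by (rule has_field_derivative_transform_within_open[of _ _ t "{0<..}"])
     (use 3 in \<open>auto simp: flat_def\<close>)
 qed
qed

lemma smooth_flat: "smooth (flat i)"
 unfolding smooth_def
proof
 show "C_diff m (flat i)" for m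
 proof (induction m arbitrary: i)
  case 0
  show ?case using flat_DERIV by (auto intro!: DERIV_continuous_on)
 next
  case (Suc m)
  have "C_diff m (\<lambda>t. flat (i + 2) t + (- real i) * flat (i + 1) t)"
   by (intro C_diff_add C_diff_mult Suc C_diff_const)
  then show ?case by (intro C_diff_real_SucI[OF flat_DERIV]) simp
 qed
qed

text \<open>One flat factor for each face of the box, hence positive inside for \<open>k > 0\<close>
  and zero outside. The parameter \<open>k\<close> is a steepness: for large \<open>k\<close> every
  factor tends to one inside, so the bumps approximate the indicator of the open box.\<close>

definition bump :: "nat \<Rightarrow> 'a::euclidean_space \<Rightarrow> 'a \<Rightarrow> 'a \<Rightarrow> real" where
 "bump k a b x = (\<Prod>i\<in>Basis. flat 0 (real k * (x \<bullet> i - a \<bullet> i)) * flat 0 (real k * (b \<bullet> i - x \<bullet> i)))"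

lemma smooth_bump: "smooth (bump k a b)"
 unfolding bump_def
 by (intro smooth_prod smooth_mult smooth_diff smooth_const smooth_inner
    smooth_compose[OF _ smooth_flat] finite_Basis)

lemma flat_nonneg: "0 \<le> flat 0 t" and flat_le_1: "flat 0 t \<le> 1"
 by (auto simp: flat_def)

lemma bump_nonneg: "0 \<le> bump k a b x"
 unfolding bump_def by (intro prod_nonneg mult_nonneg_nonneg flat_nonneg ballI)

lemma bump_le_1: "bump k a b x \<le> 1"
 unfolding bump_def
 by (intro prod_le_1 conjI mult_nonneg_nonneg flat_nonneg mult_le_one flat_le_1)

lemma bump_eq_0: "x \<notin> box a b \<Longrightarrow> bump k a b x = 0"
 by (force simp: bump_def box_def flat_def mult_le_0_iff not_less)

lemma bump_pos: "x \<in> box a b \<Longrightarrow> k > 0 \<Longrightarrow> bump k a b x > 0"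
 by (auto simp: bump_def box_def flat_def mult_le_0_iff not_less intro!: prod_pos)

lemma bump_tendsto: "(\<lambda>k. bump k a b x) \<longlonglongrightarrow> indicator (box a b) x"
proof (cases "x \<in> box a b")
 case True
 have *: "(\<lambda>k. flat 0 (real k * c)) \<longlonglongrightarrow> 1" if "c > 0" for c
 proof -
  have "(\<lambda>k. exp (- (inverse c * inverse (real k)))) \<longlonglongrightarrow> exp (- (inverse c * 0))"
   by (intro tendsto_intros LIMSEQ_inverse_real_of_nat lim_inverse_n)
  then show ?thesis
   using that
   by (auto simp: flat_def mult_le_0_iff field_simps
     elim!: Lim_transform_eventually intro!: eventually_sequentiallyI[of 1])
 qed
 have "(\<lambda>k. bump k a b x) \<longlonglongrightarrow> (\<Prod>i\<in>(Basis::'a set). 1 * 1)"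
  unfolding bump_def
  by (intro tendsto_prod tendsto_mult *) (use True in \<open>auto simp: box_def\<close>)
 then show ?thesis using True by simp
next
 case False
 then show ?thesis by (simp add: bump_eq_0)
qed

lemma smooth_test_function:
 assumes "smooth f" "\<And>x. x \<notin> K \<Longrightarrow> f x = 0" "compact K" "K \<subseteq> S"
 shows "f \<in> test_functions S"
proof -
 have "closure {x. f x \<noteq> 0} \<subseteq> K"
  using assms by (intro closure_minimal compact_imp_closed) auto
 then show ?thesis
  using assms by (auto simp: test_functions_def smooth_def
    intro: compact_closure[THEN iffD2] bounded_subset[OF compact_imp_bounded])
qed

lemma bump_test_function: "cbox a b \<subseteq> S \<Longrightarrow> bump k a b \<in> test_functions S"
 using box_subset_cbox[of a b]
 by (intro smooth_test_function[OF smooth_bump, where K="cbox a b"]) (auto intro: bump_eq_0)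

lemma test_functionE:
 assumes "f \<in> test_functions S"
 obtains K where "smooth f" "compact K" "K \<subseteq> S" "\<And>x. x \<notin> K \<Longrightarrow> f x = 0"
  "\<And>x b. x \<notin> K \<Longrightarrow> frechet_derivative f (at x) b = 0"
proof -
 define K where "K = closure {x. f x \<noteq> 0}"
 have K: "smooth f" "compact K" "K \<subseteq> S" "closed K"
  using assms by (auto simp: test_functions_def smooth_def K_def)
 have 0: "f x = 0" if "x \<notin> K" for x
  using that closure_subset[of "{x. f x \<noteq> 0}"] unfolding K_def by auto
 have "frechet_derivative f (at x) b = 0" if x: "x \<notin> K" for x b
 proof -
  have "(f has_derivative (\<lambda>h. 0)) (at x)"
   by (rule has_derivative_transform_within_open[of "\<lambda>_. 0" "\<lambda>_. 0" x UNIV "- K" f])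
     (use 0 x K in auto)
  from fun_cong[OF frechet_derivative_at[OF this], of b] show ?thesis by simp
 qed
 then show ?thesis using that K 0 by blast
qed

subsection \<open>Weak gradients\<close>

lemma smooth_gradient_bound:
 fixes f :: "'a::euclidean_space \<Rightarrow> real"
 assumes "smooth f" "compact K" "b \<in> Basis"
  and K: "\<And>x. x \<notin> K \<Longrightarrow> frechet_derivative f (at x) b = 0"
 obtains B where "B > 0" "\<And>x. \<bar>frechet_derivative f (at x) b\<bar> \<le> B"
proof -
 have "bounded ((\<lambda>x. frechet_derivative f (at x) b) ` K)"
  by (intro compact_imp_bounded compact_continuous_image smooth_continuous smooth_frechet assms)
 then obtain B where B: "B > 0" "\<And>x. x \<in> K \<Longrightarrow> \<bar>frechet_derivative f (at x) b\<bar> \<le> B"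
  by (auto simp: bounded_pos)
 show ?thesis
  by (rule that[OF B(1)]) (use B K in \<open>metis abs_zero less_imp_le\<close>)
qed

lemma test_function_bound:
 assumes "f \<in> test_functions S"
 obtains B where "B > 0" "\<And>x. \<bar>f x\<bar> \<le> B"
proof -
 from assms obtain K where K: "smooth f" "compact K" "\<And>x. x \<notin> K \<Longrightarrow> f x = 0"
  by (rule test_functionE) blast
 have "bounded (f ` K)"
  by (intro compact_imp_bounded compact_continuous_image smooth_continuous K)
 then obtain B where B: "B > 0" "\<And>x. x \<in> K \<Longrightarrow> \<bar>f x\<bar> \<le> B"
  by (auto simp: bounded_pos)
 show ?thesis
  by (rule that[OF B(1)]) (use B K in \<open>metis abs_zero less_imp_le\<close>)
qed

lemma smooth_DERIV_line:
 assumes "smooth f"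
 shows "((\<lambda>t. f (x + t *\<^sub>R b)) has_real_derivative frechet_derivative f (at (x + t *\<^sub>R b)) b) (at t)"
proof -
 have "((\<lambda>t. f (x + t *\<^sub>R b)) has_derivative
   (\<lambda>h. frechet_derivative f (at (x + t *\<^sub>R b)) (h *\<^sub>R b))) (at t)"
  by (rule has_derivative_compose[OF _ smooth_has_derivative[OF assms]])
    (auto intro!: derivative_eq_intros)
 moreover have "linear (frechet_derivative f (at (x + t *\<^sub>R b)))"
  using smooth_has_derivative[OF assms] has_derivative_linear by blast
 ultimately show ?thesis
  by (simp add: has_field_derivative_def linear_scale mult.commute[of _ "frechet_derivative _ _ _"] 
    fun_eq_iff)
qed

text \<open>By translation invariance the integral of every difference quotient vanishes.\<close>

lemma test_function_integral_derivative_0: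
 fixes f :: "'a::euclidean_space \<Rightarrow> real"
 assumes f: "f \<in> test_functions S" and b: "b \<in> Basis"
 shows "(LINT x|lborel. frechet_derivative f (at x) b) = 0"
proof -
 from f obtain K where K: "smooth f" "compact K" "\<And>x. x \<notin> K \<Longrightarrow> f x = 0"
   "\<And>x b. x \<notin> K \<Longrightarrow> frechet_derivative f (at x) b = 0"
  by (rule test_functionE) blast
 obtain B where B: "B > 0" "\<And>x. \<bar>frechet_derivative f (at x) b\<bar> \<le> B"
  using smooth_gradient_bound[OF K(1,2) b K(4)] by blast
 obtain R where R: "R > 0" "\<And>x. x \<in> K \<Longrightarrow> norm x \<le> R"
  using compact_imp_bounded[OF K(2)] by (auto simp: bounded_pos)
 have int_f: "integrable lborel f"
 proof -
  have "integrable lborel (\<lambda>x. indicator K x *\<^sub>R f x)"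
   using borel_integrable_compact[OF K(2) smooth_continuous[OF K(1)]] by simp
  also have "(\<lambda>x. indicator K x *\<^sub>R f x) = f"
   using K(3) by (auto simp: fun_eq_iff indicator_def)
  finally show ?thesis .
 qed
 define q where "q j x = real (Suc j) * (f (x + (1 / real (Suc j)) *\<^sub>R b) - f x)" for j x
 have q0: "(LINT x|lborel. q j x) = 0" for j
 proof -
  have "integrable lborel (\<lambda>x. f (x + (1 / real (Suc j)) *\<^sub>R b))"
   using integrable_distr[of "(+) ((1 / real (Suc j)) *\<^sub>R b)" lborel borel f] int_f
   by (simp add: lborel_distr_plus add.commute)
  moreover have "(LINT x|lborel. f (x + (1 / real (Suc j)) *\<^sub>R b)) = (LINT x|lborel. f x)"
   using integral_distr[of "(+) ((1 / real (Suc j)) *\<^sub>R b)" lborel borel f] int_f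
   by (simp add: lborel_distr_plus add.commute)
  ultimately show ?thesis
   using int_f unfolding q_def by simp
 qed
 have "(\<lambda>j. LINT x|lborel. q j x) \<longlonglongrightarrow> (LINT x|lborel. frechet_derivative f (at x) b)"
 proof (rule integral_dominated_convergence[where w="\<lambda>x. B * indicator (cball 0 (R + 1)) x"])
  show "integrable lborel (\<lambda>x. B * indicator (cball 0 (R + 1)) x)"
   by (intro integrable_mult_right integrable_real_indicator) (use emeasure_bounded_finite[OF bounded_cball] in auto)
  show "AE x in lborel. (\<lambda>j. q j x) \<longlonglongrightarrow> frechet_derivative f (at x) b"
  proof (rule AE_I2)
   fix x
   have "((\<lambda>t. (f (x + t *\<^sub>R b) - f x) / t) \<longlongrightarrow> frechet_derivative f (at x) b) (at 0)"
    using smooth_DERIV_line[OF K(1), of x b 0] by (simp add: has_field_derivative_iff)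
   moreover have "filterlim (\<lambda>j. 1 / real (Suc j)) (at 0) sequentially"
    using LIMSEQ_inverse_real_of_nat by (auto simp: filterlim_at divide_inverse)
   ultimately show "(\<lambda>j. q j x) \<longlonglongrightarrow> frechet_derivative f (at x) b"
    using filterlim_compose by (fastforce simp: q_def mult.commute)
  qed
  \<comment> \<open>By the mean value theorem each quotient is a directional derivative at a point
    at distance less than one from \<open>x\<close>. It is bounded by \<open>B\<close> and vanishes
    unless \<open>x\<close> lies within distance one of the support.\<close>
  show "AE x in lborel. norm (q j x) \<le> B * indicator (cball 0 (R + 1)) x" for j
  proof (rule AE_I2)
   fix x :: 'a
   let ?h = "1 / real (Suc j)"
   have h: "0 < ?h" "?h \<le> 1" by auto
   have "\<exists>z. 0 < z \<and> z < ?h \<and> f (x + ?h *\<^sub>R b) - f (x + 0 *\<^sub>R b)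
     = (?h - 0) * frechet_derivative f (at (x + z *\<^sub>R b)) b"
    by (rule MVT2) (auto intro: smooth_DERIV_line K)
   then obtain z where z: "0 < z" "z < ?h" "q j x = frechet_derivative f (at (x + z *\<^sub>R b)) b"
    unfolding q_def by auto
   show "norm (q j x) \<le> B * indicator (cball 0 (R + 1)) x"
   proof (cases "x + z *\<^sub>R b \<in> K")
    case True
    have "norm x \<le> norm (x + z *\<^sub>R b) + norm (z *\<^sub>R b)"
     using norm_triangle_ineq4[of "x + z *\<^sub>R b" "z *\<^sub>R b"] by simp
    also have "\<dots> \<le> R + 1"
    proof -
     have "z \<le> 1" using z(2) h(2) by linarith
     then show ?thesis using R(2)[OF True] z(1) b by simp
    qed
    finally show ?thesis using z(3) B by simp
   next
    case False
    then show ?thesis using z(3) K(4) B by simp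
   qed
  qed
  show "q j \<in> borel_measurable lborel" for j
   unfolding q_def using int_f by measurable
  show "(\<lambda>x. frechet_derivative f (at x) b) \<in> borel_measurable lborel"
   using smooth_borel[OF smooth_frechet[OF K(1) b]] by simp
 qed
 then show ?thesis using q0 by (simp add: LIMSEQ_const_iff)
qed

lemma integrable_bounded_mult:
 fixes f :: "'a \<Rightarrow> real" and g :: "'a \<Rightarrow> 'b::{banach,second_countable_topology}"
 assumes "integrable M g" "f \<in> borel_measurable M" "AE x in M. \<bar>f x\<bar> \<le> B"
 shows "integrable M (\<lambda>x. f x *\<^sub>R g x)"
proof (rule Bochner_Integration.integrable_bound)
 show "integrable M (\<lambda>x. B * norm (g x))" using assms(1) by auto
 show "AE x in M. norm (f x *\<^sub>R g x) \<le> norm (B * norm (g x))"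
  using assms(3)
 proof eventually_elim
  case (elim x)
  then have "\<bar>f x\<bar> * norm (g x) \<le> \<bar>B\<bar> * norm (g x)" by (intro mult_right_mono) auto
  then show ?case by (simp add: abs_mult)
 qed
qed (use assms in auto)

lemma integrable_locally_mult:
 fixes g :: "'a::euclidean_space \<Rightarrow> real"
 assumes g: "g absolutely_integrable_on K" and K: "compact K" "K \<subseteq> \<Omega>" and \<Omega>: "open \<Omega>"
  and f: "continuous_on UNIV f" "\<And>x. x \<notin> K \<Longrightarrow> f x = 0"
 shows "integrable (lebesgue_on \<Omega>) (\<lambda>x. g x * f x)"
proof -
 have "bounded (f ` K)"
  by (intro compact_imp_bounded compact_continuous_image K continuous_on_subset[OF f(1)]) auto
 then obtain B where B: "B > 0" "\<And>x. x \<in> K \<Longrightarrow> \<bar>f x\<bar> \<le> B"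
  by (auto simp: bounded_pos)
 have "\<bar>f x\<bar> \<le> B" for x using B f(2) by (metis abs_zero less_imp_le)
 moreover have "f \<in> borel_measurable lebesgue"
  using borel_measurable_continuous_onI[OF f(1)] by (simp add: measurable_completion)
 ultimately have "integrable lebesgue (\<lambda>x. f x *\<^sub>R (indicator K x *\<^sub>R g x))"
  by (intro integrable_bounded_mult g[unfolded set_integrable_def] AE_I2)
 also have "(\<lambda>x. f x *\<^sub>R (indicator K x *\<^sub>R g x)) = (\<lambda>x. indicator \<Omega> x *\<^sub>R (g x * f x))"
  using f(2) K(2) by (auto simp: fun_eq_iff indicator_def)
 finally show ?thesis
  using \<Omega> by (simp add: integrable_restrict_space)
qed

text \<open>Open boxes are stable under intersection and generate the Borel sets, and the sets with
  vanishing integral form a Dynkin system. The passage from Borel to Lebesgue sets changes a set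
  only by a null set, and the level sets \<open>h x > 0\<close> and \<open>h x < 0\<close> then
  force \<open>h\<close> to vanish.\<close>

lemma AE_zero_of_box_integrals:
 fixes g :: "'a::euclidean_space \<Rightarrow> real"
 assumes g: "integrable (lebesgue_on (box c d)) g"
  and 0: "\<And>a b. box a b \<subseteq> box c d \<Longrightarrow> (LINT x|lebesgue_on (box a b). g x) = 0"
 shows "AE x in lebesgue_on (box c d). g x = 0"
proof -
 let ?B = "box c d"
 have gi: "set_integrable lebesgue ?B g"
  using g by (simp add: set_integrable_def integrable_restrict_space)
 have sub: "set_integrable lebesgue (A \<inter> ?B) g" if "A \<in> sets lebesgue" for A
  by (rule set_integrable_subset[OF gi]) (use that in auto)
 have int_st: "Int_stable (range (\<lambda>(a, b). box a b :: 'a set))"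
   "range (\<lambda>(a, b). box a b :: 'a set) \<subseteq> Pow UNIV"
  by (auto simp: Int_stable_def box_Int_box)
 have sig: "A \<in> sets lebesgue" if "A \<in> sigma_sets UNIV (range (\<lambda>(a, b). box a b :: 'a set))" for A
 proof -
  have "A \<in> sets borel" by (subst borel_eq_box) (simp add: that)
  then show ?thesis by simp
 qed
 have "(LINT x:(A \<inter> ?B)|lebesgue. g x) = 0" if "A \<in> sets borel" for A
 proof -
  have "A \<in> sigma_sets UNIV (range (\<lambda>(a, b). box a b :: 'a set))"
   using that by (simp add: borel_eq_box)
  with int_st show ?thesis
  proof (induction rule: sigma_sets_induct_disjoint[where \<Omega>=UNIV])
   case (basic A)
   then obtain a b where "A \<inter> ?B = box a b" by (auto simp: box_Int_box)
   then show ?case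
    using 0[of a b] by (auto simp: set_lebesgue_integral_def integral_restrict_space)
  next
   case empty
   then show ?case by (simp add: set_lebesgue_integral_def)
  next
   case (compl A)
   then have A: "A \<in> sets lebesgue" by (intro sig)
   have "(LINT x:((UNIV - A) \<inter> ?B)|lebesgue. g x) + (LINT x:(A \<inter> ?B)|lebesgue. g x)
     = (LINT x:((UNIV - A) \<inter> ?B \<union> A \<inter> ?B)|lebesgue. g x)"
    by (rule set_integral_Un[symmetric]) (use A in \<open>auto intro!: sub\<close>)
   also have "(UNIV - A) \<inter> ?B \<union> A \<inter> ?B = ?B" by auto
   finally show ?case using compl 0[of c d]
    by (auto simp: set_lebesgue_integral_def integral_restrict_space)
  next
   case (union A)
   then have A: "A i \<in> sets lebesgue" for i by (intro sig) auto
   have "(LINT x:(\<Union>i. A i \<inter> ?B)|lebesgue. g x) = (\<Sum>i. LINT x:(A i \<inter> ?B)|lebesgue. g x)"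
    by (rule lebesgue_integral_countable_add)
      (use A union in \<open>auto simp: disjoint_family_on_def intro!: set_integrable_subset[OF gi]\<close>)
   then show ?case using union by simp
  qed
 qed
 note borel = this
 have leb: "(LINT x:(A \<inter> ?B)|lebesgue. g x) = 0" if A: "A \<in> sets lebesgue" for A
 proof -
  have ae: "AE x in lebesgue. x \<in> main_part lborel A \<longleftrightarrow> x \<in> A"
   using AE_not_in[OF null_part_null_sets[OF A]]
    main_part_null_part_Un[OF A] by (auto elim!: eventually_mono)
  have mp: "main_part lborel A \<in> sets borel"
   using main_part_sets[OF A] by simp
  have "(LINT x:(A \<inter> ?B)|lebesgue. g x) = (LINT x:(main_part lborel A \<inter> ?B)|lebesgue. g x)"
   by (rule set_integral_cong_set)
     (use ae sub[OF A] sub[of "main_part lborel A"] mp in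
      \<open>auto simp: set_borel_measurable_def set_integrable_def elim: borel_measurable_integrable\<close>)
  then show ?thesis using borel[OF mp] by simp
 qed
 define h where "h x = indicator ?B x * g x" for x
 have h: "integrable lebesgue h" using gi by (simp add: h_def[abs_def] set_integrable_def)
 have "AE x in lebesgue. h x = 0"
 proof -
  have pos: "AE x in lebesgue. indicator A x * h x = 0"
   if "A \<in> sets lebesgue" "(\<forall>x. 0 \<le> indicator A x * h x) \<or> (\<forall>x. indicator A x * h x \<le> 0)" for A
  proof -
   have i: "integrable lebesgue (\<lambda>x. indicator A x * h x)"
    using integrable_mult_indicator[OF that(1) h] by simp
   have "(LINT x|lebesgue. indicator A x * h x) = 0"
    using leb[OF that(1)] by (simp add: set_lebesgue_integral_def h_def indicator_inter_arith mult.assoc)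
   then show ?thesis
    using that(2) integral_nonneg_eq_0_iff_AE[OF i]
     integral_nonneg_eq_0_iff_AE[OF integrable_minus[OF i]] by auto
  qed
  have [measurable]: "h \<in> borel_measurable lebesgue" using h by simp
  have "{x \<in> space lebesgue. h x > 0} \<in> sets lebesgue" "{x \<in> space lebesgue. h x < 0} \<in> sets lebesgue"
   by measurable
  then have lv: "{x. h x > 0} \<in> sets lebesgue" "{x. h x < 0} \<in> sets lebesgue"
   by (simp_all only: space_completion space_lborel space_borel UNIV_I simp_thms)
  have sg: "\<forall>x. 0 \<le> indicator {x. h x > 0} x * h x" "\<forall>x. indicator {x. h x < 0} x * h x \<le> 0"
   by (auto simp: indicator_def)
  show ?thesis
   using pos[OF lv(1) disjI1[OF sg(1)]] pos[OF lv(2) disjI2[OF sg(2)]]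
   by eventually_elim (auto simp: indicator_def not_less split: if_splits)
 qed
 then have "AE x in lebesgue. x \<in> ?B \<longrightarrow> g x = 0"
  by eventually_elim (auto simp: h_def indicator_def)
 then show ?thesis by (simp add: AE_restrict_space_iff)
qed

text \<open>Bumps converge boundedly to the indicator of a box, so every box inside a compact box of
  \<open>\<Omega>\<close> has integral zero. Countably many closed boxes exhaust
  \<open>\<Omega>\<close>, and their boundaries are negligible.\<close>

lemma fundamental_lemma_real:
 fixes g :: "'a::euclidean_space \<Rightarrow> real"
 assumes \<Omega>: "open \<Omega>" and g: "\<And>K. compact K \<Longrightarrow> K \<subseteq> \<Omega> \<Longrightarrow> g absolutely_integrable_on K"
  and 0: "\<And>\<phi>. \<phi> \<in> test_functions \<Omega> \<Longrightarrow> (LINT x|lebesgue_on \<Omega>. g x * \<phi> x) = 0"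
 shows "AE x in lebesgue_on \<Omega>. g x = 0"
proof -
 have box: "AE x in lebesgue. x \<in> cbox c d \<longrightarrow> g x = 0" if cd: "cbox c d \<subseteq> \<Omega>" for c d
 proof -
  have gC: "integrable lebesgue (\<lambda>x. indicator (cbox c d) x *\<^sub>R g x)"
   using g[OF compact_cbox cd] by (simp add: set_integrable_def)
  have "AE x in lebesgue_on (box c d). g x = 0"
  proof (rule AE_zero_of_box_integrals)
   have "set_integrable lebesgue (box c d) g"
    by (rule set_integrable_subset[OF g[OF compact_cbox cd]]) (auto simp: box_subset_cbox)
   then show "integrable (lebesgue_on (box c d)) g"
    by (simp add: set_integrable_def integrable_restrict_space)
  next
   fix a b assume ab: "box a b \<subseteq> box c d"
   show "(LINT x|lebesgue_on (box a b). g x) = 0"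
   proof (cases "box a b = {}")
    case False
    then have "cbox a b \<subseteq> cbox c d"
     using closure_mono[OF ab] closure_box[OF False] ab
     by (metis closure_box bot.extremum_uniqueI)
    then have t: "bump k a b \<in> test_functions \<Omega>" for k
     using cd by (intro bump_test_function) auto
    let ?I = "\<lambda>k. LINT x|lebesgue. (indicator (cbox c d) x *\<^sub>R g x) * bump k a b x"
    have "?I k = (LINT x|lebesgue_on \<Omega>. g x * bump k a b x)" for k
    proof -
     have eq: "(indicator (cbox c d) x *\<^sub>R g x) * bump k a b x = indicator \<Omega> x *\<^sub>R (g x * bump k a b x)" for x
      using ab box_subset_cbox[of c d] cd
      by (cases "x \<in> box a b") (auto simp: bump_eq_0 indicator_def)
     show ?thesis unfolding eq using \<Omega> by (simp add: integral_restrict_space)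
    qed
    then have "?I k = 0" for k using 0[OF t] by simp
    moreover have "?I \<longlonglongrightarrow> (LINT x|lebesgue. (indicator (cbox c d) x *\<^sub>R g x) * indicator (box a b) x)"
    proof (rule integral_dominated_convergence[where w="\<lambda>x. norm (indicator (cbox c d) x *\<^sub>R g x)"])
     show "integrable lebesgue (\<lambda>x. norm (indicator (cbox c d) x *\<^sub>R g x))"
      using gC by (rule integrable_norm)
     show "(\<lambda>x. (indicator (cbox c d) x *\<^sub>R g x) * bump k a b x) \<in> borel_measurable lebesgue" for k
      by (rule borel_measurable_times[OF borel_measurable_integrable[OF gC] measurable_completion])
        (simp add: smooth_borel[OF smooth_bump])
     show "(\<lambda>x. (indicator (cbox c d) x *\<^sub>R g x) * indicator (box a b) x) \<in> borel_measurable lebesgue"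
      using borel_measurable_integrable[OF gC]
      by (intro borel_measurable_times borel_measurable_indicator) auto
     show "AE x in lebesgue. (\<lambda>k. (indicator (cbox c d) x *\<^sub>R g x) * bump k a b x)
       \<longlonglongrightarrow> (indicator (cbox c d) x *\<^sub>R g x) * indicator (box a b) x"
      by (intro AE_I2 tendsto_intros bump_tendsto)
     show "AE x in lebesgue. norm ((indicator (cbox c d) x *\<^sub>R g x) * bump k a b x)
       \<le> norm (indicator (cbox c d) x *\<^sub>R g x)" for k
     proof (rule AE_I2)
      fix x show "norm ((indicator (cbox c d) x *\<^sub>R g x) * bump k a b x)
       \<le> norm (indicator (cbox c d) x *\<^sub>R g x)"
       using mult_left_mono[OF bump_le_1[of k a b x] norm_ge_zero[of "indicator (cbox c d) x *\<^sub>R g x"]]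
        bump_nonneg[of k a b x] by (simp only: real_norm_def abs_mult abs_of_nonneg mult_1_right)
     qed
    qed
    ultimately have "(LINT x|lebesgue. (indicator (cbox c d) x *\<^sub>R g x) * indicator (box a b) x) = 0"
     by (simp add: LIMSEQ_const_iff)
    also have "(LINT x|lebesgue. (indicator (cbox c d) x *\<^sub>R g x) * indicator (box a b) x)
     = (LINT x|lebesgue_on (box a b). g x)"
    proof -
     have eq: "(indicator (cbox c d) x *\<^sub>R g x) * indicator (box a b) x = indicator (box a b) x *\<^sub>R g x" for x
      using ab box_subset_cbox[of c d] by (auto simp: indicator_def)
     show ?thesis unfolding eq by (simp add: integral_restrict_space)
    qed
    finally show ?thesis .
   qed (simp add: integral_restrict_space)
  qed
  then have "AE x in lebesgue. x \<in> box c d \<longrightarrow> g x = 0"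
   by (simp add: AE_restrict_space_iff)
  moreover have "AE x in lebesgue. x \<notin> cbox c d - box c d"
   by (rule AE_not_in) (use negligible_frontier_interval[of c d] in \<open>simp add: negligible_iff_null_sets\<close>)
  ultimately show ?thesis by eventually_elim auto
 qed
 obtain D where D: "countable D" "D \<subseteq> Pow \<Omega>" "\<And>X. X \<in> D \<Longrightarrow> \<exists>a b. X = cbox a b" "\<Union>D = \<Omega>"
  using open_countable_Union_open_cbox[OF \<Omega>] by blast
 have "AE x in lebesgue. \<forall>X\<in>D. x \<in> X \<longrightarrow> g x = 0"
  using D(1)
 proof (rule AE_ball_countable[THEN iffD2, rule_format])
  fix X assume "X \<in> D"
  then show "AE x in lebesgue. x \<in> X \<longrightarrow> g x = 0"
   using D(2,3) box by blast
 qed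
 then have "AE x in lebesgue. x \<in> \<Omega> \<longrightarrow> g x = 0"
  by eventually_elim (use D(4) in blast)
 then show ?thesis using \<Omega> by (simp add: AE_restrict_space_iff)
qed

lemma has_weak_gradient_unique:
 fixes \<Omega> :: "'a::euclidean_space set"
 assumes \<Omega>: "open \<Omega>" and G: "has_weak_gradient \<Omega> w G" "has_weak_gradient \<Omega> w H"
 shows "AE x in lebesgue_on \<Omega>. G x = H x"
proof -
 have "AE x in lebesgue_on \<Omega>. G x \<bullet> b - H x \<bullet> b = 0" if b: "b \<in> Basis" for b
 proof (rule fundamental_lemma_real[OF \<Omega>])
  fix K assume K: "compact K" "K \<subseteq> \<Omega>"
  then have "G absolutely_integrable_on K" "H absolutely_integrable_on K"
   using G by (auto simp: has_weak_gradient_def)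
  then show "(\<lambda>x. G x \<bullet> b - H x \<bullet> b) absolutely_integrable_on K"
   by (intro set_integral_diff absolutely_integrable_component)
 next
  fix \<phi> assume \<phi>: "\<phi> \<in> test_functions \<Omega>"
  then obtain K where K: "smooth \<phi>" "compact K" "K \<subseteq> \<Omega>" "\<And>x. x \<notin> K \<Longrightarrow> \<phi> x = 0"
   by (rule test_functionE) blast
  have i: "integrable (lebesgue_on \<Omega>) (\<lambda>x. (F x \<bullet> b) * \<phi> x)" if "has_weak_gradient \<Omega> w F" for F
  proof -
   have "F absolutely_integrable_on K" using that K(2,3) unfolding has_weak_gradient_def by blast
   from integrable_locally_mult[OF absolutely_integrable_component[OF this] K(2,3) \<Omega> smooth_continuous[OF K(1)] K(4)]
   show ?thesis by blast
  qed
  have "(LINT x|lebesgue_on \<Omega>. (G x \<bullet> b) * \<phi> x) = (LINT x|lebesgue_on \<Omega>. (H x \<bullet> b) * \<phi> x)"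
  proof -
   have "(LINT x|lebesgue_on \<Omega>. w x * frechet_derivative \<phi> (at x) b)
     = - (LINT x|lebesgue_on \<Omega>. (F x \<bullet> b) * \<phi> x)" if "has_weak_gradient \<Omega> w F" for F
    using that \<phi> b unfolding has_weak_gradient_def by blast
   from this[OF G(1)] this[OF G(2)] show ?thesis by simp
  qed
  then show "(LINT x|lebesgue_on \<Omega>. (G x \<bullet> b - H x \<bullet> b) * \<phi> x) = 0"
   using i[OF G(1)] i[OF G(2)] by (simp add: left_diff_distrib)
 qed
 then have "AE x in lebesgue_on \<Omega>. \<forall>b\<in>Basis. G x \<bullet> b - H x \<bullet> b = 0"
  by (intro AE_finite_allI) auto
 then show ?thesis by eventually_elim (auto intro: euclidean_eqI)
qed

subsection \<open>The Sobolev inequality\<close>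

text \<open>The convention is \<open>epow x 0 = 1\<close> for every \<open>x\<close>, including zero
  and infinity, so that a factor of weight zero disappears from a product. The real power differs
  here, as \<open>0 powr 0 = 0\<close>.\<close>

definition epow :: "ennreal \<Rightarrow> real \<Rightarrow> ennreal" where
 "epow x p = (if p = 0 then 1 else if x = \<infinity> then \<infinity> else ennreal (enn2real x powr p))"

lemma epow_0 [simp]: "epow x 0 = 1"
 by (simp add: epow_def)

lemma epow_zero [simp]: "p \<noteq> 0 \<Longrightarrow> epow 0 p = 0"
 by (simp add: epow_def)

lemma epow_ennreal: "0 \<le> x \<Longrightarrow> p \<noteq> 0 \<Longrightarrow> epow (ennreal x) p = ennreal (x powr p)"
 by (simp add: epow_def)

lemma epow_top [simp]: "p \<noteq> 0 \<Longrightarrow> epow top p = top"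
 by (simp add: epow_def)

lemma epow_measurable [measurable]:
 assumes [measurable]: "f \<in> borel_measurable M"
 shows "(\<lambda>x. epow (f x) p) \<in> borel_measurable M"
 unfolding epow_def by measurable

lemma epow_mono: "x \<le> y \<Longrightarrow> 0 \<le> p \<Longrightarrow> epow x p \<le> epow y p"
 by (cases x; cases y) (auto simp: epow_def top_unique intro!: powr_mono2 ennreal_leI)

lemma epow_add: "0 \<le> p \<Longrightarrow> 0 \<le> q \<Longrightarrow> epow x (p + q) = epow x p * epow x q"
 by (cases x; cases "p = 0"; cases "q = 0")
   (auto simp: epow_def powr_add ennreal_mult' ennreal_top_mult add_nonneg_eq_0_iff)

lemma epow_mult: "0 \<le> p \<Longrightarrow> epow (x * y) p = epow x p * epow y p"
proof (cases "p = 0")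
 case False
 assume "0 \<le> p"
 with False have "p > 0" by simp
 then show ?thesis
  by (cases x; cases y)
    (auto simp: epow_def ennreal_mult[symmetric] powr_mult ennreal_top_mult ennreal_mult_top)
qed simp

section \<open>Hoelder's inequality for finitely many factors\<close>

lemma weighted_am_gm:
 fixes a y :: "'i \<Rightarrow> real"
 assumes "finite J" and a: "\<And>j. j \<in> J \<Longrightarrow> 0 < a j" "sum a J = 1"
  and y: "\<And>j. j \<in> J \<Longrightarrow> 0 \<le> y j"
 shows "(\<Prod>j\<in>J. y j powr a j) \<le> (\<Sum>j\<in>J. a j * y j)"
proof (cases "\<exists>j\<in>J. y j = 0")
 case True
 then have "(\<Prod>j\<in>J. y j powr a j) = 0"
  using assms(1) by (auto intro!: prod_zero)
 moreover have "0 \<le> (\<Sum>j\<in>J. a j * y j)"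
  by (intro sum_nonneg mult_nonneg_nonneg less_imp_le[OF a(1)] y)
 ultimately show ?thesis by simp
next
 case False
 then have pos: "y j > 0" if "j \<in> J" for j using y[OF that] that by force
 have ne: "J \<noteq> {}" using a(2) by auto
 have "(\<Sum>j\<in>J. a j * ln (y j)) \<le> ln (\<Sum>j\<in>J. a j *\<^sub>R y j)"
  using concave_on_sum[OF assms(1) ne ln_concave a(2), of y] a(1) pos less_imp_le by auto
 moreover have "(\<Sum>j\<in>J. a j * y j) > 0"
  using assms(1) ne a(1) pos by (intro sum_pos mult_pos_pos) auto
 ultimately have "exp (\<Sum>j\<in>J. a j * ln (y j)) \<le> (\<Sum>j\<in>J. a j * y j)"
  by (simp flip: ln_ge_iff)
 also have "exp (\<Sum>j\<in>J. a j * ln (y j)) = (\<Prod>j\<in>J. y j powr a j)"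
 proof -
  have "y j \<noteq> 0" if "j \<in> J" for j using pos[OF that] by simp
  then show ?thesis by (simp add: exp_sum[OF assms(1)] powr_def cong: prod.cong)
 qed
 finally show ?thesis .
qed

lemma epow_am_gm:
 assumes "finite J" and a: "\<And>j. j \<in> J \<Longrightarrow> 0 < a j" "sum a J = 1"
 shows "(\<Prod>j\<in>J. epow (y j) (a j)) \<le> (\<Sum>j\<in>J. ennreal (a j) * y j)"
proof (cases "\<exists>j\<in>J. y j = \<infinity>")
 case True
 then obtain j where j: "j \<in> J" "y j = \<infinity>" by blast
 then have "ennreal (a j) * y j = \<infinity>"
  using a(1)[of j] by (auto simp: ennreal_mult_top)
 then have "(\<Sum>j\<in>J. ennreal (a j) * y j) = \<infinity>"
  using assms(1) j(1) by (subst sum.remove[of J j]) auto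
 then show ?thesis by simp
next
 case False
 define z where "z j = enn2real (y j)" for j
 have z: "y j = ennreal (z j)" "0 \<le> z j" if "j \<in> J" for j
  using False that by (auto simp: z_def less_top)
 have "(\<Prod>j\<in>J. epow (y j) (a j)) = ennreal (\<Prod>j\<in>J. z j powr a j)"
  using z a(1) by (subst prod_ennreal[symmetric]) (force intro!: prod.cong simp: epow_ennreal)+
 also have "\<dots> \<le> ennreal (\<Sum>j\<in>J. a j * z j)"
  by (intro ennreal_leI weighted_am_gm assms z)
 also have "\<dots> = (\<Sum>j\<in>J. ennreal (a j) * y j)"
 proof -
  have "ennreal (a j * z j) = ennreal (a j) * y j" "0 \<le> a j * z j" if "j \<in> J" for j
   using z[OF that] a(1)[OF that] by (auto simp: ennreal_mult)
  then show ?thesis by (simp add: sum_ennreal[symmetric] cong: sum.cong)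
 qed
 finally show ?thesis .
qed

text \<open>Dividing each \<open>f j\<close> by its integral reduces the claim to the weighted
  inequality of arithmetic and geometric means under the integral sign. The degenerate cases come
  first: a zero integral makes the product vanish almost everywhere, and an infinite integral among
  nonzero ones makes the right side infinite.\<close>

lemma nn_integral_Holder_pos:
 assumes J: "finite J" and a: "\<And>j. j \<in> J \<Longrightarrow> 0 < a j" "sum a J = 1"
  and f [measurable]: "\<And>j. j \<in> J \<Longrightarrow> f j \<in> borel_measurable M"
 shows "(\<integral>\<^sup>+x. (\<Prod>j\<in>J. epow (f j x) (a j)) \<partial>M) \<le> (\<Prod>j\<in>J. epow (\<integral>\<^sup>+x. f j x \<partial>M) (a j))"
proof -
 define I where "I j = (\<integral>\<^sup>+x. f j x \<partial>M)" for j
 consider (zero) j where "j \<in> J" "I j = 0" | (top) j where "j \<in> J" "I j = \<infinity>" "\<forall>j\<in>J. I j \<noteq> 0"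
  | (fin) "\<forall>j\<in>J. I j \<noteq> 0 \<and> I j \<noteq> \<infinity>" by blast
 then show ?thesis
 proof cases
  case zero
  then have "AE x in M. f j x = 0"
   by (simp add: I_def nn_integral_0_iff_AE)
  then have "AE x in M. (\<Prod>j\<in>J. epow (f j x) (a j)) = 0"
  proof eventually_elim
   case (elim x)
   then show ?case
    using zero(1) J a(1)[of j] by (intro prod_zero) (auto intro!: bexI[of _ j])
  qed
  then have "(\<integral>\<^sup>+x. (\<Prod>j\<in>J. epow (f j x) (a j)) \<partial>M) = 0"
   by (subst nn_integral_0_iff_AE) auto
  then show ?thesis by simp
 next
  case top
  have "(\<Prod>j\<in>J. epow (I j) (a j)) = epow (I j) (a j) * (\<Prod>j\<in>J - {j}. epow (I j) (a j))"
   using top J by (simp add: prod.remove)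
  moreover have "(\<Prod>j\<in>J - {j}. epow (I j) (a j)) \<noteq> 0"
   using top J by (auto simp: epow_def enn2real_eq_0_iff)
  moreover have "epow (I j) (a j) = \<infinity>" using top a(1)[of j] by auto
  ultimately have "(\<Prod>j\<in>J. epow (I j) (a j)) = top"
   by (simp add: ennreal_top_mult del: prod_zero_iff)
  then show ?thesis by (simp add: I_def[symmetric])
 next
  case fin
  have "(\<Prod>j\<in>J. epow (f j x) (a j)) \<le> (\<Prod>j\<in>J. epow (I j) (a j)) * (\<Sum>j\<in>J. ennreal (a j) * (f j x / I j))" for x
  proof -
   have "epow (f j x) (a j) = epow (I j) (a j) * epow (f j x / I j) (a j)" if "j \<in> J" for j
   proof -
    have "f j x = I j * (f j x / I j)"
     using fin that mult_divide_eq_ennreal[of "I j" "f j x"]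
     by (simp add: ennreal_times_divide mult.commute)
    then show ?thesis using epow_mult[of "a j" "I j" "f j x / I j"] a(1)[OF that] by simp
   qed
   then have "(\<Prod>j\<in>J. epow (f j x) (a j)) = (\<Prod>j\<in>J. epow (I j) (a j)) * (\<Prod>j\<in>J. epow (f j x / I j) (a j))"
    by (simp add: prod.distrib)
   also have "\<dots> \<le> (\<Prod>j\<in>J. epow (I j) (a j)) * (\<Sum>j\<in>J. ennreal (a j) * (f j x / I j))"
    by (intro mult_left_mono epow_am_gm J a) auto
   finally show ?thesis .
  qed
  then have "(\<integral>\<^sup>+x. (\<Prod>j\<in>J. epow (f j x) (a j)) \<partial>M)
    \<le> (\<integral>\<^sup>+x. (\<Prod>j\<in>J. epow (I j) (a j)) * (\<Sum>j\<in>J. ennreal (a j) * (f j x / I j)) \<partial>M)"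
   by (intro nn_integral_mono)
  also have "\<dots> = (\<Prod>j\<in>J. epow (I j) (a j)) * (\<Sum>j\<in>J. ennreal (a j) * (I j / I j))"
   using f by (subst nn_integral_cmult; (subst nn_integral_sum)?)
    (auto simp: nn_integral_cmult nn_integral_divide I_def intro!: borel_measurable_sum)
  also have "(\<Sum>j\<in>J. ennreal (a j) * (I j / I j)) = (\<Sum>j\<in>J. ennreal (a j))"
   using fin by (intro sum.cong) (auto simp: ennreal_divide_self less_top zero_less_iff_neq_zero)
  also have "\<dots> = 1" using a by (subst sum_ennreal) (auto intro: less_imp_le)
  finally show ?thesis by (simp add: I_def)
 qed
qed

lemma nn_integral_Holder:
 assumes J: "finite J" and a: "\<And>j. j \<in> J \<Longrightarrow> 0 \<le> a j" "sum a J = 1"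
  and f: "\<And>j. j \<in> J \<Longrightarrow> f j \<in> borel_measurable M"
 shows "(\<integral>\<^sup>+x. (\<Prod>j\<in>J. epow (f j x) (a j)) \<partial>M) \<le> (\<Prod>j\<in>J. epow (\<integral>\<^sup>+x. f j x \<partial>M) (a j))"
proof -
 let ?J = "{j \<in> J. a j \<noteq> 0}"
 have prod: "(\<Prod>j\<in>J. epow (y j) (a j)) = (\<Prod>j\<in>?J. epow (y j) (a j))" for y
  using J by (intro prod.mono_neutral_right) auto
 have "sum a ?J = 1"
  using a(2) J by (subst sum.mono_neutral_left[of J]) auto
 then show ?thesis
  unfolding prod using J a(1) f
  by (intro nn_integral_Holder_pos) (auto simp: less_le)
qed

text \<open>The grid-lines inequality of van Doorn and Macbeth: an interpolation between Fubini's theorem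
 and the inequality of Gagliardo, set up so that it can be proved by integrating out one coordinate
 at a time.\<close>

lemma grid_lines:
 assumes "finite A" "0 < p" "(real (card A) - 1) * p \<le> 1"
  and "f \<in> borel_measurable (PiM A (\<lambda>_. lborel :: real measure))"
 shows "(\<integral>\<^sup>+x. epow (f x) (1 - (real (card A) - 1) * p) *
    (\<Prod>j\<in>A. epow (\<integral>\<^sup>+y. f (x(j := y)) \<partial>lborel) p) \<partial>PiM A (\<lambda>_. lborel))
  \<le> epow (\<integral>\<^sup>+x. f x \<partial>PiM A (\<lambda>_. lborel)) (1 + p)"
 using assms
proof (induction A arbitrary: f rule: finite_induct)
 case empty
 interpret product_sigma_finite "\<lambda>_::'a. lborel :: real measure" ..
 show ?case by (simp add: PiM_empty nn_integral_count_space_finite)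
next
 case (insert i A)
 interpret product_sigma_finite "\<lambda>_::'a. lborel :: real measure" ..
 let ?M = "\<lambda>A. PiM A (\<lambda>_::'a. lborel :: real measure)"
 have f [measurable]: "f \<in> borel_measurable (?M (insert i A))" by fact
 have card: "real (card (insert i A)) - 1 = card A" using insert by simp
 have pA: "card A * p \<le> 1" using insert.prems(2) card by simp
 define F where "F x = (\<integral>\<^sup>+y. f (x(i := y)) \<partial>lborel)" for x
 have upd1 [measurable]: "(\<lambda>y. x(i := y)) \<in> measurable lborel (?M (insert i A))" if "x \<in> space (?M A)" for x
  using that by (intro measurable_fun_upd[where J=A]) auto
 have upd2 [measurable]: "(\<lambda>(x, y). x(i := y)) \<in> measurable (?M A \<Otimes>\<^sub>M lborel) (?M (insert i A))"
  by (rule measurable_add_dim)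
 have F [measurable]: "F \<in> borel_measurable (?M A)"
  unfolding F_def using measurable_compose[OF upd2 f]
  by (intro lborel.borel_measurable_nn_integral) (simp add: split_beta')
 have upd3: "(\<lambda>(y, z). x(i := y, j := z)) \<in> measurable (lborel \<Otimes>\<^sub>M lborel) (?M (insert i A))"
  if "x \<in> space (?M A)" "j \<in> A" for x j
  unfolding split_beta' using that
  by (intro measurable_fun_upd[where J="insert i A"] measurable_fun_upd[where J=A]) auto
 have swap: "(\<integral>\<^sup>+y. \<integral>\<^sup>+z. f (x(i := y, j := z)) \<partial>lborel \<partial>lborel) = (\<integral>\<^sup>+z. F (x(j := z)) \<partial>lborel)"
  if "x \<in> space (?M A)" "j \<in> A" for x j
 proof -
  have "i \<noteq> j" using that insert by auto
  have "(\<integral>\<^sup>+y. \<integral>\<^sup>+z. f (x(i := y, j := z)) \<partial>lborel \<partial>lborel)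
    = (\<integral>\<^sup>+z. \<integral>\<^sup>+y. f (x(i := y, j := z)) \<partial>lborel \<partial>lborel)"
   using measurable_compose[OF upd3[OF that] f]
   by (intro lborel_pair.Fubini'[symmetric]) (simp add: split_beta')
  then show ?thesis
   using \<open>i \<noteq> j\<close> by (simp add: F_def fun_upd_twist)
 qed
 let ?H = "\<lambda>x. epow (f x) (1 - card A * p) * (\<Prod>j\<in>insert i A. epow (\<integral>\<^sup>+y. f (x(j := y)) \<partial>lborel) p)"
 have Hm: "?H \<in> borel_measurable (?M (insert i A))"
 proof -
  have "(\<lambda>x. \<integral>\<^sup>+y. f (x(j := y)) \<partial>lborel) \<in> borel_measurable (?M (insert i A))" if "j \<in> insert i A" for j
  proof -
   have "(\<lambda>(x, y). x(j := y)) \<in> measurable (?M (insert i A) \<Otimes>\<^sub>M lborel) (?M (insert i A))"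
    unfolding split_beta' using that by (intro measurable_fun_upd[where J="insert i A"]) auto
   from measurable_compose[OF this f] show ?thesis
    by (intro lborel.borel_measurable_nn_integral) (simp add: split_beta')
  qed
  then show ?thesis by measurable
 qed
 \<comment> \<open>Hoelder in the new coordinate \<open>y\<close> alone, with weight
   \<open>p\<close> for each line integral in a direction of \<open>A\<close> and the remaining
   weight for \<open>f\<close>. The line integral in direction \<open>i\<close> does not depend on
   \<open>y\<close> and leaves the integral as \<open>epow (F x) p\<close>; it joins the power of
   \<open>F x\<close> produced by Hoelder to give the exponent for \<open>A\<close>.\<close>
 have step: "(\<integral>\<^sup>+y. ?H (x(i := y)) \<partial>lborel) \<le>
   epow (F x) (1 - (real (card A) - 1) * p) * (\<Prod>j\<in>A. epow (\<integral>\<^sup>+z. F (x(j := z)) \<partial>lborel) p)"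
  if x: "x \<in> space (?M A)" for x
 proof -
  define h where "h k y = (if k = i then f (x(i := y)) else (\<integral>\<^sup>+z. f (x(i := y, k := z)) \<partial>lborel))" for k y
  define a where "a k = (if k = i then 1 - card A * p else p)" for k
  have h: "h k \<in> borel_measurable lborel" if "k \<in> insert i A" for k
  proof (cases "k = i")
   case True
   then show ?thesis unfolding h_def using measurable_compose[OF upd1[OF x] f] by simp
  next
   case False
   with that have "k \<in> A" by simp
   from False measurable_compose[OF upd3[OF x this] f] show ?thesis unfolding h_def
    by (simp, intro lborel.borel_measurable_nn_integral) (simp add: split_beta')
  qed
  have ni: "k \<noteq> i" if "k \<in> A" for k using that insert by auto
  have "?H (x(i := y)) = epow (F x) p * (\<Prod>k\<in>insert i A. epow (h k y) (a k))" for y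
  proof -
   have "(\<Prod>k\<in>A. epow (h k y) (a k)) = (\<Prod>j\<in>A. epow (\<integral>\<^sup>+z. f (x(i := y, j := z)) \<partial>lborel) p)"
    using ni by (intro prod.cong) (auto simp: h_def a_def)
   then show ?thesis using insert.hyps by (simp add: h_def a_def F_def ac_simps)
  qed
  then have "(\<integral>\<^sup>+y. ?H (x(i := y)) \<partial>lborel)
    = epow (F x) p * (\<integral>\<^sup>+y. (\<Prod>k\<in>insert i A. epow (h k y) (a k)) \<partial>lborel)"
   using h by (subst nn_integral_cmult[symmetric])
    (auto intro!: borel_measurable_prod epow_measurable simp del: prod.insert)
  also have "\<dots> \<le> epow (F x) p * (\<Prod>k\<in>insert i A. epow (\<integral>\<^sup>+y. h k y \<partial>lborel) (a k))"
  proof (intro mult_left_mono nn_integral_Holder h)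
   show "sum a (insert i A) = 1"
   proof -
    have "sum a A = (\<Sum>k\<in>A. p)" using ni by (intro sum.cong) (auto simp: a_def)
    then show ?thesis using insert.hyps by (simp add: a_def)
   qed
   show "0 \<le> a j" for j using pA insert.prems(1) by (simp add: a_def)
  qed (use insert in auto)
  also have "(\<Prod>k\<in>insert i A. epow (\<integral>\<^sup>+y. h k y \<partial>lborel) (a k))
    = epow (F x) (1 - card A * p) * (\<Prod>j\<in>A. epow (\<integral>\<^sup>+z. F (x(j := z)) \<partial>lborel) p)"
  proof -
   have "(\<Prod>k\<in>A. epow (\<integral>\<^sup>+y. h k y \<partial>lborel) (a k)) = (\<Prod>j\<in>A. epow (\<integral>\<^sup>+z. F (x(j := z)) \<partial>lborel) p)"
    using ni swap[OF x] by (intro prod.cong) (auto simp: h_def a_def)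
   then show ?thesis using insert.hyps by (simp add: h_def a_def F_def)
  qed
  also have "epow (F x) p * (epow (F x) (1 - card A * p) * (\<Prod>j\<in>A. epow (\<integral>\<^sup>+z. F (x(j := z)) \<partial>lborel) p))
    = epow (F x) (1 - (real (card A) - 1) * p) * (\<Prod>j\<in>A. epow (\<integral>\<^sup>+z. F (x(j := z)) \<partial>lborel) p)"
   using epow_add[of p "1 - card A * p" "F x"] insert.prems(1) pA
   by (simp add: algebra_simps)
  finally show ?thesis .
 qed
 have "(\<integral>\<^sup>+x. ?H x \<partial>?M (insert i A)) = (\<integral>\<^sup>+x. \<integral>\<^sup>+y. ?H (x(i := y)) \<partial>lborel \<partial>?M A)"
  using insert.hyps Hm by (rule product_nn_integral_insert)
 also have "\<dots> \<le> (\<integral>\<^sup>+x. epow (F x) (1 - (real (card A) - 1) * p) *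
   (\<Prod>j\<in>A. epow (\<integral>\<^sup>+z. F (x(j := z)) \<partial>lborel) p) \<partial>?M A)"
  by (intro nn_integral_mono step)
 also have "\<dots> \<le> epow (\<integral>\<^sup>+x. F x \<partial>?M A) (1 + p)"
 proof (rule insert.IH[OF insert.prems(1) _ F])
  show "(real (card A) - 1) * p \<le> 1" using pA insert.prems(1) by (simp add: left_diff_distrib)
 qed
 also have "(\<integral>\<^sup>+x. F x \<partial>?M A) = (\<integral>\<^sup>+x. f x \<partial>?M (insert i A))"
  unfolding F_def using insert.hyps f by (intro product_nn_integral_insert[symmetric])
 finally show ?case unfolding card .
qed

section \<open>The Sobolev inequality for test functions\<close>

definition grad :: "('a::euclidean_space \<Rightarrow> real) \<Rightarrow> 'a \<Rightarrow> 'a" where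
 "grad f x = (\<Sum>b\<in>Basis. frechet_derivative f (at x) b *\<^sub>R b)"

lemma grad_inner: "b \<in> Basis \<Longrightarrow> grad f x \<bullet> b = frechet_derivative f (at x) b"
 unfolding grad_def by (simp add: inner_sum_left_Basis)

lemma continuous_on_grad: "smooth f \<Longrightarrow> continuous_on S (grad f)"
 unfolding grad_def by (intro continuous_intros smooth_continuous smooth_frechet)

lemma grad_compose_real: "smooth f \<Longrightarrow> smooth g \<Longrightarrow> grad (\<lambda>x. g (f x)) x = deriv g (f x) *\<^sub>R grad f x"
 by (simp add: grad_def frechet_derivative_compose_real scaleR_sum_right)

text \<open>For \<open>p = 1 / (n - 1)\<close> the exponent of \<open>f\<close> itself in
  \<open>grid_lines\<close> is zero and only the line integrals remain. Fixing all coordinates but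
  one and moving along a basis vector describe the same line, up to a translation of the
  parameter.\<close>

lemma gagliardo:
 fixes f :: "'a::euclidean_space \<Rightarrow> ennreal"
 assumes f [measurable]: "f \<in> borel_measurable borel" and n: "DIM('a) \<ge> 2"
 shows "(\<integral>\<^sup>+x. (\<Prod>i\<in>Basis. epow (\<integral>\<^sup>+t. f (x + t *\<^sub>R i) \<partial>lborel) (1 / (real DIM('a) - 1))) \<partial>lborel)
  \<le> epow (\<integral>\<^sup>+x. f x \<partial>lborel) (real DIM('a) / (real DIM('a) - 1))"
proof -
 let ?p = "1 / (real DIM('a) - 1)"
 let ?P = "PiM Basis (\<lambda>_::'a. lborel :: real measure)"
 let ?S = "\<lambda>\<xi>. \<Sum>b\<in>Basis. \<xi> b *\<^sub>R b :: 'a"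
 have S [measurable]: "?S \<in> measurable ?P borel" by measurable
 have p: "0 < ?p" "(real (card (Basis :: 'a set)) - 1) * ?p = 1"
   "1 + ?p = real DIM('a) / (real DIM('a) - 1)" using n by (auto simp: field_simps)
 have line: "(\<integral>\<^sup>+y. f (?S (\<xi>(i := y))) \<partial>lborel) = (\<integral>\<^sup>+t. f (?S \<xi> + t *\<^sub>R i) \<partial>lborel)"
  if i: "i \<in> Basis" for \<xi> i
 proof -
  have upd: "?S (\<xi>(i := y)) = ?S \<xi> + (y - \<xi> i) *\<^sub>R i" for y
   using i by (simp add: sum.remove[of _ i] scaleR_diff_left)
  have "(\<integral>\<^sup>+t. f (?S \<xi> + t *\<^sub>R i) \<partial>lborel)
    = (\<integral>\<^sup>+t. f (?S \<xi> + t *\<^sub>R i) \<partial>distr lborel borel ((+) (- \<xi> i)))"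
   by (simp add: lborel_distr_plus)
  also have "\<dots> = (\<integral>\<^sup>+y. f (?S \<xi> + (y - \<xi> i) *\<^sub>R i) \<partial>lborel)"
   by (subst nn_integral_distr) simp_all
  finally show ?thesis unfolding upd ..
 qed
 have m: "(\<lambda>x. \<integral>\<^sup>+t. f (x + t *\<^sub>R i) \<partial>lborel) \<in> borel_measurable borel" for i
  by (intro lborel.borel_measurable_nn_integral) simp
 have "(\<integral>\<^sup>+x. (\<Prod>i\<in>Basis. epow (\<integral>\<^sup>+t. f (x + t *\<^sub>R i) \<partial>lborel) ?p) \<partial>lborel)
   = (\<integral>\<^sup>+\<xi>. (\<Prod>i\<in>Basis. epow (\<integral>\<^sup>+t. f (?S \<xi> + t *\<^sub>R i) \<partial>lborel) ?p) \<partial>?P)"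
  by (subst lborel_eq, subst nn_integral_distr) (use m in measurable)
 also have "\<dots> = (\<integral>\<^sup>+\<xi>. epow (f (?S \<xi>)) (1 - (real (card (Basis :: 'a set)) - 1) * ?p) *
   (\<Prod>i\<in>Basis. epow (\<integral>\<^sup>+y. f (?S (\<xi>(i := y))) \<partial>lborel) ?p) \<partial>?P)"
  unfolding p(2) using line by (simp cong: prod.cong)
 also have "\<dots> \<le> epow (\<integral>\<^sup>+\<xi>. f (?S \<xi>) \<partial>?P) (1 + ?p)"
  using p by (intro grid_lines) auto
 also have "(\<integral>\<^sup>+\<xi>. f (?S \<xi>) \<partial>?P) = (\<integral>\<^sup>+x. f x \<partial>lborel)"
  by (subst lborel_eq, subst nn_integral_distr) simp_all
 finally show ?thesis unfolding p(3) .
qed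

lemma DERIV_abs_powr:
 fixes z :: real
 assumes "p > 2"
 shows "((\<lambda>z. \<bar>z\<bar> powr p) has_real_derivative p * z * \<bar>z\<bar> powr (p - 2)) (at z)"
proof -
 consider "z > 0" | "z = 0" | "z < 0" by linarith
 then show ?thesis
 proof cases
  case 1
  have "((\<lambda>z. z powr p) has_real_derivative p * z powr (p - 1)) (at z)"
   using 1 by (intro has_real_derivative_powr)
  also have "p * z powr (p - 1) = p * z * \<bar>z\<bar> powr (p - 2)"
   using 1 powr_add[of z 1 "p - 2"] by simp
  finally show ?thesis
   by (rule has_field_derivative_transform_within_open[of _ _ z "{0<..}"]) (use 1 in auto)
 next
  case 2
  have "((\<lambda>h. h * \<bar>h\<bar> powr (p - 2)) \<longlongrightarrow> 0) (at (0::real))"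
   using assms by (auto intro!: tendsto_eq_intros tendsto_powr'[of _ "\<bar>0\<bar>" _ _ "p - 2"])
  then have "((\<lambda>h. \<bar>h\<bar> powr p / h) \<longlongrightarrow> 0) (at (0::real))"
  proof (rule Lim_transform_eventually)
   have "h * \<bar>h\<bar> powr (p - 2) = \<bar>h\<bar> powr p / h" if "h \<noteq> 0" for h
    using that powr_add[of "\<bar>h\<bar>" 2 "p - 2"] by (simp add: field_simps power2_eq_square)
   then show "\<forall>\<^sub>F h in at 0. h * \<bar>h\<bar> powr (p - 2) = \<bar>h\<bar> powr p / h"
    by (auto simp: eventually_at intro: exI[of _ 1])
  qed
  then show ?thesis using 2 by (simp add: has_field_derivative_iff)
 next
  case 3
  have "((\<lambda>z. (- z) powr p) has_real_derivative - (p * (- z) powr (p - 1))) (at z)"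
   using 3 by (auto intro!: derivative_eq_intros)
  also have "- (p * (- z) powr (p - 1)) = p * z * \<bar>z\<bar> powr (p - 2)"
   using 3 powr_add[of "- z" 1 "p - 2"] by simp
  finally show ?thesis
   by (rule has_field_derivative_transform_within_open[of _ _ z "{..<0}"]) (use 3 in auto)
 qed
qed

lemma abs_grad_component_le: "b \<in> Basis \<Longrightarrow> \<bar>frechet_derivative f (at x) b\<bar> \<le> norm (grad f x)"
 using Basis_le_norm[of b "grad f x"] by (simp add: grad_inner)

text \<open>The fundamental theorem of calculus along the line through \<open>x\<close> in direction
  \<open>i\<close>, started at parameter \<open>- R\<close>, where the line is outside the
  support.\<close>

lemma test_function_line_bound:
 fixes f :: "'a::euclidean_space \<Rightarrow> real"
 assumes f: "f \<in> test_functions S" and i: "i \<in> Basis" and p: "p > 2"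
 shows "ennreal (\<bar>f x\<bar> powr p)
  \<le> (\<integral>\<^sup>+t. ennreal (p * \<bar>f (x + t *\<^sub>R i)\<bar> powr (p - 1) * norm (grad f (x + t *\<^sub>R i))) \<partial>lborel)"
proof -
 from f obtain K where K: "smooth f" "compact K" "\<And>x. x \<notin> K \<Longrightarrow> f x = 0"
  by (rule test_functionE) blast
 obtain B where B: "B > 0" "\<And>x. x \<in> K \<Longrightarrow> norm x \<le> B"
  using compact_imp_bounded[OF K(2)] by (auto simp: bounded_pos)
 define R where "R = norm x + B + 1"
 have "R - norm x \<le> norm (x + (- R) *\<^sub>R i)"
  using norm_triangle_ineq4[of x "x + (- R) *\<^sub>R i"] i B(1) by (simp add: R_def)
 then have "x + (- R) *\<^sub>R i \<notin> K" using B(2) R_def by fastforce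
 then have fR: "f (x + (- R) *\<^sub>R i) = 0" by (rule K)
 have R: "R > 0" using B(1) by (simp add: R_def add_nonneg_pos)
 define \<psi> where "\<psi> t = p * f (x + t *\<^sub>R i) * \<bar>f (x + t *\<^sub>R i)\<bar> powr (p - 2) *
   frechet_derivative f (at (x + t *\<^sub>R i)) i" for t
 have D: "((\<lambda>t. \<bar>f (x + t *\<^sub>R i)\<bar> powr p) has_real_derivative \<psi> t) (at t)" for t
  using DERIV_chain2[OF DERIV_abs_powr[OF p] smooth_DERIV_line[OF K(1), of x i t]] by (simp add: \<psi>_def)
 have cont: "continuous_on UNIV \<psi>"
  unfolding \<psi>_def using p
  by (intro continuous_intros continuous_on_powr' continuous_on_compose2[OF smooth_continuous[OF K(1)]]
    continuous_on_compose2[OF smooth_continuous[OF smooth_frechet[OF K(1) i]]]) auto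
 have "(LINT t|lborel. \<psi> t * indicator {- R..0} t) = \<bar>f (x + 0 *\<^sub>R i)\<bar> powr p - \<bar>f (x + (- R) *\<^sub>R i)\<bar> powr p"
  using R D cont by (intro integral_FTC_Icc_real) (auto simp: continuous_on_eq_continuous_at)
 then have "\<bar>f x\<bar> powr p = (LINT t|lborel. \<psi> t * indicator {- R..0} t)"
  using fR p by simp
 moreover have "integrable lborel (\<lambda>t. \<psi> t * indicator {- R..0} t)"
  using borel_integrable_atLeastAtMost[of "- R" 0 \<psi>] cont by (auto simp: continuous_on_eq_continuous_at)
 ultimately have "ennreal (\<bar>f x\<bar> powr p) \<le> (\<integral>\<^sup>+t. norm (\<psi> t * indicator {- R..0} t) \<partial>lborel)"
  using integral_norm_bound_ennreal[of lborel "\<lambda>t. \<psi> t * indicator {- R..0} t"]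
  by (metis abs_of_nonneg powr_ge_zero real_norm_def)
 also have "\<dots> \<le> (\<integral>\<^sup>+t. ennreal (p * \<bar>f (x + t *\<^sub>R i)\<bar> powr (p - 1) * norm (grad f (x + t *\<^sub>R i))) \<partial>lborel)"
 proof (intro nn_integral_mono ennreal_leI)
  fix t
  let ?z = "x + t *\<^sub>R i"
  have "\<bar>f ?z\<bar> * \<bar>f ?z\<bar> powr (p - 2) = \<bar>f ?z\<bar> powr (p - 1)"
   using powr_add[of "\<bar>f ?z\<bar>" 1 "p - 2"] by (cases "f ?z = 0") auto
  then have "\<bar>\<psi> t\<bar> = p * \<bar>f ?z\<bar> powr (p - 1) * \<bar>frechet_derivative f (at ?z) i\<bar>"
   using p by (simp add: \<psi>_def abs_mult)
  also have "\<dots> \<le> p * \<bar>f ?z\<bar> powr (p - 1) * norm (grad f ?z)"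
   using p by (intro mult_left_mono abs_grad_component_le i) auto
  finally show "norm (\<psi> t * indicator {- R..0} t) \<le> p * \<bar>f ?z\<bar> powr (p - 1) * norm (grad f ?z)"
   using p by (auto simp: indicator_def)
 qed
 finally show ?thesis .
qed

lemma prod_mono_ennreal:
 fixes f g :: "'i \<Rightarrow> ennreal"
 shows "finite A \<Longrightarrow> (\<And>i. i \<in> A \<Longrightarrow> f i \<le> g i) \<Longrightarrow> prod f A \<le> prod g A"
 by (induction A rule: finite_induct) (auto intro!: mult_mono)

text \<open>The inequality of Gagliardo is applied to the gradient of
  \<open>\<bar>f\<bar> powr p\<close> with \<open>p = 2 * (n - 1) / (n - 2)\<close>, for which
  \<open>p * n / (n - 1)\<close> is the Sobolev exponent. With \<open>A\<close> and \<open>B\<close>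
  the two integrals, Cauchy-Schwarz gives
  \<open>A powr (2 * (n - 1) / n) \<le> p\<^sup>2 * A * B\<close>; division by \<open>A\<close>
  leaves the claim, and the constant is \<open>p\<^sup>2\<close>.\<close>

lemma sobolev_test_function:
 fixes f :: "'a::euclidean_space \<Rightarrow> real"
 assumes f: "f \<in> test_functions S" and n: "n = real DIM('a)" "n > 2"
 shows "integrable lborel (\<lambda>x. \<bar>f x\<bar> powr (2 * n / (n - 2)))"
  "integrable lborel (\<lambda>x. (norm (grad f x))\<^sup>2)"
  "(LINT x|lborel. \<bar>f x\<bar> powr (2 * n / (n - 2))) powr ((n - 2) / n)
   \<le> (2 * (n - 1) / (n - 2))\<^sup>2 * (LINT x|lborel. (norm (grad f x))\<^sup>2)"
proof -
 from f obtain K where K: "smooth f" "compact K" "\<And>x. x \<notin> K \<Longrightarrow> f x = 0"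
   "\<And>x b. x \<notin> K \<Longrightarrow> frechet_derivative f (at x) b = 0"
  by (rule test_functionE) blast
 let ?q = "2 * n / (n - 2)"
 define p where "p = 2 * (n - 1) / (n - 2)"
 have p: "p > 2" and q: "?q > 0" using n(2) by (auto simp: p_def field_simps)
 have cs: "integrable lborel h" if "continuous_on UNIV h" "\<And>x. x \<notin> K \<Longrightarrow> h x = 0" for h :: "'a \<Rightarrow> real"
 proof -
  have "integrable lborel (\<lambda>x. indicator K x *\<^sub>R h x)"
   using borel_integrable_compact[OF K(2) continuous_on_subset[OF that(1)]] by simp
  also have "(\<lambda>x. indicator K x *\<^sub>R h x) = h"
   using that(2) by (auto simp: fun_eq_iff indicator_def)
  finally show ?thesis .
 qed
 have gr0: "grad f x = 0" if "x \<notin> K" for x using K(4)[OF that] by (simp add: grad_def)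
 have cf: "continuous_on UNIV (\<lambda>x. \<bar>f x\<bar> powr a)" if "a > 0" for a
  using that by (intro continuous_intros continuous_on_powr' smooth_continuous K) auto
 show i1: "integrable lborel (\<lambda>x. \<bar>f x\<bar> powr ?q)"
  by (intro cs cf q) (use K(3) q in auto)
 show i2: "integrable lborel (\<lambda>x. (norm (grad f x))\<^sup>2)"
  by (intro cs continuous_intros continuous_on_grad K(1)) (use gr0 in auto)
 define A where "A = (LINT x|lborel. \<bar>f x\<bar> powr ?q)"
 define B where "B = (LINT x|lborel. (norm (grad f x))\<^sup>2)"
 have AB: "0 \<le> A" "0 \<le> B" by (auto simp: A_def B_def)
 define h where "h x = p * \<bar>f x\<bar> powr (p - 1) * norm (grad f x)" for x
 have h0: "0 \<le> h x" for x using p by (simp add: h_def)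
 have hi: "integrable lborel h" unfolding h_def
  by (intro cs continuous_intros cf continuous_on_grad K(1)) (use gr0 p in auto)
 define C where "C = (LINT x|lborel. h x)"
 have C0: "0 \<le> C" using h0 by (simp add: C_def)
 have nC: "(\<integral>\<^sup>+x. ennreal (h x) \<partial>lborel) = ennreal C"
  using hi h0 by (simp add: C_def nn_integral_eq_integral)
 \<comment> \<open>Cauchy-Schwarz for \<open>\<bar>f x\<bar> powr (p - 1)\<close> and the gradient,
   obtained from Young's inequality with a free weight \<open>s\<close>. The square of the first
   factor has the Sobolev exponent \<open>2 * (p - 1)\<close>.\<close>
 have CAB: "C\<^sup>2 \<le> p\<^sup>2 * (A * B)"
 proof -
  have "C \<le> (p * s / 2) * A + (p / (2 * s)) * B" if "s > 0" for s :: real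
  proof -
   have "h x \<le> (p * s / 2) * \<bar>f x\<bar> powr ?q + (p / (2 * s)) * (norm (grad f x))\<^sup>2" for x
   proof -
    let ?a = "\<bar>f x\<bar> powr (p - 1)" and ?b = "norm (grad f x)"
    have "2 * (p - 1) = ?q" using n(2) by (simp add: p_def field_simps)
    then have "?a\<^sup>2 = \<bar>f x\<bar> powr ?q"
     by (simp add: power2_eq_square flip: powr_add)
    moreover have "2 * s * ?a * ?b \<le> s\<^sup>2 * ?a\<^sup>2 + ?b\<^sup>2"
     using sum_squares_bound[of "s * ?a" ?b] by (simp add: power_mult_distrib)
    then have "p * ?a * ?b \<le> (p * s / 2) * ?a\<^sup>2 + (p / (2 * s)) * ?b\<^sup>2"
    proof -
     assume *: "2 * s * ?a * ?b \<le> s\<^sup>2 * ?a\<^sup>2 + ?b\<^sup>2"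
     have "(p / (2 * s)) * (2 * s * ?a * ?b) \<le> (p / (2 * s)) * (s\<^sup>2 * ?a\<^sup>2 + ?b\<^sup>2)"
      using * p that by (intro mult_left_mono) auto
     then show ?thesis using that by (simp add: field_simps power2_eq_square)
    qed
    ultimately show ?thesis by (simp add: h_def)
   qed
   then have "C \<le> (LINT x|lborel. (p * s / 2) * \<bar>f x\<bar> powr ?q + (p / (2 * s)) * (norm (grad f x))\<^sup>2)"
    unfolding C_def using hi i1 i2 by (intro integral_mono) auto
   then show ?thesis using i1 i2 by (simp add: A_def B_def)
  qed
  note young = this
  show ?thesis
  proof (cases "A = 0 \<or> B = 0")
   case False
   then have pos: "A > 0" "B > 0" using AB by auto
   \<comment> \<open>The weight \<open>sqrt B / sqrt A\<close> minimises the right side of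
     \<open>young\<close>.\<close>
   have "C \<le> (p * (sqrt B / sqrt A) / 2) * A + (p / (2 * (sqrt B / sqrt A))) * B"
    using pos by (intro young) simp
   also have "\<dots> = p * (sqrt A * sqrt B)"
   proof -
    have "A = (sqrt A)\<^sup>2" "B = (sqrt B)\<^sup>2" using pos by auto
    moreover have "p * (v / u) / 2 * u\<^sup>2 + p / (2 * (v / u)) * v\<^sup>2 = p * (u * v)"
     if "u > 0" "v > 0" for u v :: real
     using that by (simp add: field_simps power2_eq_square)
    ultimately show ?thesis using pos by (metis real_sqrt_gt_0_iff)
   qed
   finally have "C\<^sup>2 \<le> (p * (sqrt A * sqrt B))\<^sup>2" using C0 by (intro power_mono)
   then show ?thesis using pos by (simp add: power_mult_distrib)
  next
   case True
   have "C \<le> 0"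
   proof (rule field_le_epsilon)
    fix e :: real assume "e > 0"
    \<comment> \<open>If \<open>A\<close> vanishes, a large weight makes the term with
      \<open>B\<close> at most \<open>e\<close>; if \<open>B\<close> vanishes, a small weight makes
      the term with \<open>A\<close> equal to \<open>e\<close>.\<close>
    define s where "s = (if A = 0 then p * (B + 1) / (2 * e) else 2 * e / (p * A))"
    have "s > 0" using \<open>e > 0\<close> p AB by (auto simp: s_def)
    show "C \<le> 0 + e"
    proof (cases "A = 0")
     case True
     have "C \<le> (p / (2 * s)) * B" using young[OF \<open>s > 0\<close>] True by simp
     also have "\<dots> = e * (B / (B + 1))" using True \<open>e > 0\<close> p AB by (simp add: s_def)
     also have "\<dots> \<le> e * 1" using \<open>e > 0\<close> AB by (intro mult_left_mono) auto
     finally show ?thesis by simp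
    next
     case False
     then show ?thesis using True young[OF \<open>s > 0\<close>] p AB by (simp add: s_def)
    qed
   qed
   then show ?thesis using C0 AB by simp
  qed
 qed
 let ?m = "n / (n - 1)"
 have "ennreal A = (\<integral>\<^sup>+x. ennreal (\<bar>f x\<bar> powr ?q) \<partial>lborel)"
  using i1 by (simp add: A_def nn_integral_eq_integral)
 also have "\<dots> \<le> (\<integral>\<^sup>+x. (\<Prod>i\<in>Basis. epow (\<integral>\<^sup>+t. ennreal (h (x + t *\<^sub>R i)) \<partial>lborel) (1 / (real DIM('a) - 1))) \<partial>lborel)"
 proof (rule nn_integral_mono)
  fix x
  \<comment> \<open>The product has \<open>n\<close> equal factors, and
    \<open>p * n / (n - 1) = ?q\<close>.\<close>
  have "ennreal (\<bar>f x\<bar> powr ?q) = (\<Prod>i\<in>(Basis::'a set). epow (ennreal (\<bar>f x\<bar> powr p)) (1 / (n - 1)))"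
  proof -
   have "p * (1 / (n - 1)) = 2 / (n - 2)" using n(2) by (simp add: p_def divide_simps)
   then have "?q = p * (1 / (n - 1)) * n" by simp
   then show ?thesis using n
    by (simp add: epow_ennreal powr_powr ennreal_power powr_powr flip: powr_realpow' powr_power)
  qed
  also have "\<dots> \<le> (\<Prod>i\<in>Basis. epow (\<integral>\<^sup>+t. ennreal (h (x + t *\<^sub>R i)) \<partial>lborel) (1 / (n - 1)))"
   using n(2) unfolding h_def by (intro prod_mono_ennreal epow_mono test_function_line_bound[OF f _ p]) auto
  finally show "ennreal (\<bar>f x\<bar> powr ?q) \<le> (\<Prod>i\<in>Basis. epow (\<integral>\<^sup>+t. ennreal (h (x + t *\<^sub>R i)) \<partial>lborel) (1 / (real DIM('a) - 1)))"
   by (simp add: n)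
 qed
 also have "\<dots> \<le> epow (\<integral>\<^sup>+x. ennreal (h x) \<partial>lborel) ?m"
  unfolding n(1) using n borel_measurable_integrable[OF hi] by (intro gagliardo) auto
 also have "\<dots> = ennreal (C powr ?m)"
  using n(2) C0 by (simp add: nC epow_ennreal)
 finally have AC: "A \<le> C powr ?m" by (simp add: AB)
 show "A powr ((n - 2) / n) \<le> (2 * (n - 1) / (n - 2))\<^sup>2 * B"
 proof (cases "A = 0")
  case False
  then have A: "A > 0" using AB by simp
  have C: "C > 0" using AC A C0 by (cases "C = 0") auto
  have "A powr (2 * (n - 1) / n) \<le> (C powr ?m) powr (2 * (n - 1) / n)"
   using AC A n(2) by (intro powr_mono2) auto
  also have "\<dots> = C powr 2"
  proof -
   have "?m * (2 * (n - 1) / n) = 2" using n(2) by (simp add: divide_simps)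
   then show ?thesis by (simp only: powr_powr)
  qed
  also have "\<dots> = C\<^sup>2" using C by simp
  also have "\<dots> \<le> p\<^sup>2 * (A * B)" by (rule CAB)
  also have "A powr (2 * (n - 1) / n) = A powr ((n - 2) / n) * A"
  proof -
   have "2 * (n - 1) / n = (n - 2) / n + 1" using n(2) by (simp add: field_simps)
   then show ?thesis using A by (simp add: powr_add)
  qed
  finally have "A powr ((n - 2) / n) * A \<le> (p\<^sup>2 * B) * A" by (simp add: ac_simps)
  then show ?thesis using A by (simp add: p_def)
 qed (use AB in simp)
qed

subsection \<open>Square integrable functions\<close>

text \<open>Values in an arbitrary Euclidean space are allowed so that scalar functions, gradients
  and pairs of both are covered at once; the norm of \<open>H1\<close> then becomes a norm of this
  kind.\<close>

definition L2n :: "'x measure \<Rightarrow> ('x \<Rightarrow> 'b::euclidean_space) \<Rightarrow> real" where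
 "L2n M f = sqrt (LINT x|M. (norm (f x))\<^sup>2)"

definition sqi :: "'x measure \<Rightarrow> ('x \<Rightarrow> 'b::euclidean_space) \<Rightarrow> bool" where
 "sqi M f \<longleftrightarrow> f \<in> borel_measurable M \<and> integrable M (\<lambda>x. (norm (f x))\<^sup>2)"

lemma L2n_nonneg [simp]: "0 \<le> L2n M f"
 by (simp add: L2n_def)

lemma L2n_sq: "(L2n M f)\<^sup>2 = (LINT x|M. (norm (f x))\<^sup>2)"
 by (simp add: L2n_def)

lemma sqi_measurable: "sqi M f \<Longrightarrow> f \<in> borel_measurable M"
 and sqi_integrable: "sqi M f \<Longrightarrow> integrable M (\<lambda>x. (norm (f x))\<^sup>2)"
 by (auto simp: sqi_def)

lemma sqi_bound:
 assumes "sqi M g" "f \<in> borel_measurable M" "AE x in M. norm (f x) \<le> B * norm (g x)"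
 shows "sqi M f"
 unfolding sqi_def
proof
 show "integrable M (\<lambda>x. (norm (f x))\<^sup>2)"
 proof (rule Bochner_Integration.integrable_bound)
  show "integrable M (\<lambda>x. B\<^sup>2 * (norm (g x))\<^sup>2)" using sqi_integrable[OF assms(1)] by simp
  show "(\<lambda>x. (norm (f x))\<^sup>2) \<in> borel_measurable M" using assms(2) by measurable
  show "AE x in M. norm ((norm (f x))\<^sup>2) \<le> norm (B\<^sup>2 * (norm (g x))\<^sup>2)"
   using assms(3)
  proof eventually_elim
   case (elim x)
   from power_mono[OF this, of 2] show ?case by (simp add: power_mult_distrib)
  qed
 qed
qed fact

lemma sqi_add:
 assumes "sqi M f" "sqi M g" shows "sqi M (\<lambda>x. f x + g x)"
 unfolding sqi_def
proof
 show m: "(\<lambda>x. f x + g x) \<in> borel_measurable M" using assms by (auto simp: sqi_def)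
 show "integrable M (\<lambda>x. (norm (f x + g x))\<^sup>2)"
 proof (rule Bochner_Integration.integrable_bound)
  show "integrable M (\<lambda>x. 2 * (norm (f x))\<^sup>2 + 2 * (norm (g x))\<^sup>2)"
   using assms by (simp add: sqi_def)
  show "(\<lambda>x. (norm (f x + g x))\<^sup>2) \<in> borel_measurable M" using m by measurable
  show "AE x in M. norm ((norm (f x + g x))\<^sup>2) \<le> norm (2 * (norm (f x))\<^sup>2 + 2 * (norm (g x))\<^sup>2)"
  proof (rule AE_I2)
   fix x
   have "(norm (f x + g x))\<^sup>2 \<le> (norm (f x) + norm (g x))\<^sup>2"
    by (intro power_mono norm_triangle_ineq) simp
   also have "\<dots> \<le> 2 * (norm (f x))\<^sup>2 + 2 * (norm (g x))\<^sup>2"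
    using sum_squares_bound[of "norm (f x)" "norm (g x)"] by (simp add: power2_sum)
   finally show "norm ((norm (f x + g x))\<^sup>2) \<le> norm (2 * (norm (f x))\<^sup>2 + 2 * (norm (g x))\<^sup>2)"
    by simp
  qed
 qed
qed

lemma sqi_scaleR: "sqi M f \<Longrightarrow> sqi M (\<lambda>x. c *\<^sub>R f x)"
 by (auto simp: sqi_def power_mult_distrib)

lemma sqi_uminus: "sqi M f \<Longrightarrow> sqi M (\<lambda>x. - f x)"
 by (auto simp: sqi_def)

lemma sqi_diff: "sqi M f \<Longrightarrow> sqi M g \<Longrightarrow> sqi M (\<lambda>x. f x - g x)"
 using sqi_add[OF _ sqi_uminus] by fastforce

lemma sqi_inner_integrable:
 assumes "sqi M f" "sqi M g" shows "integrable M (\<lambda>x. f x \<bullet> g x)"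
proof (rule Bochner_Integration.integrable_bound)
 show "integrable M (\<lambda>x. (norm (f x))\<^sup>2 + (norm (g x))\<^sup>2)" using assms by (simp add: sqi_def)
 show "(\<lambda>x. f x \<bullet> g x) \<in> borel_measurable M" using assms by (auto simp: sqi_def)
 show "AE x in M. norm (f x \<bullet> g x) \<le> norm ((norm (f x))\<^sup>2 + (norm (g x))\<^sup>2)"
 proof (rule AE_I2)
  fix x
  have "\<bar>f x \<bullet> g x\<bar> \<le> norm (f x) * norm (g x)" by (rule Cauchy_Schwarz_ineq2)
  also have "\<dots> \<le> (norm (f x))\<^sup>2 + (norm (g x))\<^sup>2"
  proof -
   have "2 * (norm (f x) * norm (g x)) \<le> (norm (f x))\<^sup>2 + (norm (g x))\<^sup>2"
    using sum_squares_bound[of "norm (f x)" "norm (g x)"] by (simp add: mult.assoc)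
   moreover have "0 \<le> norm (f x) * norm (g x)" by simp
   ultimately show ?thesis by linarith
  qed
  finally show "norm (f x \<bullet> g x) \<le> norm ((norm (f x))\<^sup>2 + (norm (g x))\<^sup>2)" by simp
 qed
qed

lemma L2n_Cauchy_Schwarz:
 assumes f: "sqi M f" and g: "sqi M g"
 shows "\<bar>LINT x|M. f x \<bullet> g x\<bar> \<le> L2n M f * L2n M g"
proof -
 define a where "a = (LINT x|M. (norm (f x))\<^sup>2)"
 define b where "b = (LINT x|M. f x \<bullet> g x)"
 define c where "c = (LINT x|M. (norm (g x))\<^sup>2)"
 note [simp] = sqi_inner_integrable[OF f g] sqi_integrable[OF f] sqi_integrable[OF g]
 have q: "0 \<le> a - 2 * t * b + t\<^sup>2 * c" for t
 proof -
  have "0 \<le> (LINT x|M. (norm (f x - t *\<^sub>R g x))\<^sup>2)" by simp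
  also have "(\<lambda>x. (norm (f x - t *\<^sub>R g x))\<^sup>2) = (\<lambda>x. (norm (f x))\<^sup>2 - 2 * t * (f x \<bullet> g x) + t\<^sup>2 * (norm (g x))\<^sup>2)"
   unfolding power2_norm_eq_inner
   by (simp add: fun_eq_iff inner_diff inner_commute algebra_simps power2_eq_square)
  also have "(LINT x|M. (norm (f x))\<^sup>2 - 2 * t * (f x \<bullet> g x) + t\<^sup>2 * (norm (g x))\<^sup>2) = a - 2 * t * b + t\<^sup>2 * c"
   by (simp add: a_def b_def c_def)
  finally show ?thesis .
 qed
 have ac: "0 \<le> a" "0 \<le> c" by (auto simp: a_def c_def)
 have "b\<^sup>2 \<le> a * c"
 proof (cases "c = 0")
  case True
  have "b = 0"
  proof (rule ccontr)
   assume "b \<noteq> 0"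
   \<comment> \<open>At this \<open>t\<close> the nonnegative polynomial would take the value
     -1.\<close>
   then show False using q[of "(a + 1) / (2 * b)"] True by simp
  qed
  then show ?thesis using ac by simp
 next
  case False
  then have "c > 0" using ac by simp
  have "0 \<le> c * (a - 2 * (b / c) * b + (b / c)\<^sup>2 * c)" using q[of "b / c"] ac by (intro mult_nonneg_nonneg)
  also have "\<dots> = a * c - b\<^sup>2" using \<open>c > 0\<close> by (simp add: field_simps power2_eq_square)
  finally show ?thesis by simp
 qed
 then have "\<bar>b\<bar> \<le> sqrt (a * c)" by (simp add: real_le_rsqrt)
 then show ?thesis by (simp add: L2n_def a_def b_def c_def real_sqrt_mult)
qed

lemma L2n_triangle:
 assumes f: "sqi M f" and g: "sqi M g"
 shows "L2n M (\<lambda>x. f x + g x) \<le> L2n M f + L2n M g"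
proof -
 have "(L2n M (\<lambda>x. f x + g x))\<^sup>2 = (LINT x|M. (norm (f x))\<^sup>2 + 2 * (f x \<bullet> g x) + (norm (g x))\<^sup>2)"
  by (simp add: L2n_sq power2_norm_eq_inner inner_add inner_commute algebra_simps)
 also have "\<dots> = (L2n M f)\<^sup>2 + 2 * (LINT x|M. f x \<bullet> g x) + (L2n M g)\<^sup>2"
  using sqi_inner_integrable[OF f g] sqi_integrable[OF f] sqi_integrable[OF g] by (simp add: L2n_sq)
 also have "\<dots> \<le> (L2n M f)\<^sup>2 + 2 * (L2n M f * L2n M g) + (L2n M g)\<^sup>2"
  using L2n_Cauchy_Schwarz[OF f g] by simp
 also have "\<dots> = (L2n M f + L2n M g)\<^sup>2" by (simp add: power2_sum)
 finally show ?thesis by (rule power2_le_imp_le) simp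
qed

lemma L2n_scaleR: "L2n M (\<lambda>x. c *\<^sub>R f x) = \<bar>c\<bar> * L2n M f"
 by (simp add: L2n_def power_mult_distrib real_sqrt_mult)

lemma L2n_minus_commute: "L2n M (\<lambda>x. f x - g x) = L2n M (\<lambda>x. g x - f x)"
 by (simp add: L2n_def norm_minus_commute)

lemma L2n_reverse_triangle:
 assumes f: "sqi M f" and g: "sqi M g"
 shows "\<bar>L2n M f - L2n M g\<bar> \<le> L2n M (\<lambda>x. f x - g x)"
 using L2n_triangle[OF sqi_diff[OF f g] g] L2n_triangle[OF sqi_diff[OF g f] f] L2n_minus_commute[of M f g]
 by simp

lemma L2n_cong_AE:
 assumes "AE x in M. f x = g x" "f \<in> borel_measurable M" "g \<in> borel_measurable M"
 shows "L2n M f = L2n M g"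
 unfolding L2n_def using assms by (intro arg_cong[of _ _ sqrt] integral_cong_AE) auto

lemma L2n_mono_AE:
 assumes "sqi M g" "f \<in> borel_measurable M" "AE x in M. norm (f x) \<le> B * norm (g x)" "0 \<le> B"
 shows "L2n M f \<le> B * L2n M g"
proof -
 have "(LINT x|M. (norm (f x))\<^sup>2) \<le> (LINT x|M. B\<^sup>2 * (norm (g x))\<^sup>2)"
 proof (rule integral_mono_AE)
  show "AE x in M. (norm (f x))\<^sup>2 \<le> B\<^sup>2 * (norm (g x))\<^sup>2"
   using assms(3)
  proof eventually_elim
   case (elim x)
   from power_mono[OF this, of 2] show ?case by (simp add: power_mult_distrib)
  qed
 qed (use sqi_bound[OF assms(1-3)] assms(1) in \<open>auto simp: sqi_def\<close>)
 also have "\<dots> = B\<^sup>2 * (LINT x|M. (norm (g x))\<^sup>2)" by simp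
 finally have "L2n M f \<le> sqrt (B\<^sup>2 * (LINT x|M. (norm (g x))\<^sup>2))"
  unfolding L2n_def by (rule real_sqrt_le_mono)
 then show ?thesis using assms(4) by (simp add: L2n_def real_sqrt_mult)
qed

lemma sqi_AE_cong:
 assumes "sqi M f" "g \<in> borel_measurable M" "AE x in M. g x = f x" shows "sqi M g"
 by (rule sqi_bound[OF assms(1,2), of 1]) (use assms(3) in \<open>auto elim: eventually_mono\<close>)

lemma L2n_Pair:
 assumes "sqi M f" "sqi M g"
 shows "sqi M (\<lambda>x. (f x, g x))" "L2n M (\<lambda>x. (f x, g x)) = sqrt ((L2n M f)\<^sup>2 + (L2n M g)\<^sup>2)"
proof -
 have n: "(norm (f x, g x))\<^sup>2 = (norm (f x))\<^sup>2 + (norm (g x))\<^sup>2" for x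
  by (simp add: norm_Pair)
 show "sqi M (\<lambda>x. (f x, g x))"
  using assms unfolding sqi_def n by (auto intro: borel_measurable_Pair)
 show "L2n M (\<lambda>x. (f x, g x)) = sqrt ((L2n M f)\<^sup>2 + (L2n M g)\<^sup>2)"
  using assms unfolding L2n_sq unfolding L2n_def n by (simp add: sqi_def)
qed

lemma L2n_AE_subseq:
 fixes F :: "nat \<Rightarrow> 'x \<Rightarrow> 'b::euclidean_space"
 assumes F: "\<And>j. sqi M (F j)" "sqi M f" and lim: "(\<lambda>j. L2n M (\<lambda>x. F j x - f x)) \<longlonglongrightarrow> 0"
 obtains r where "strict_mono r" "AE x in M. (\<lambda>j. F (r j) x) \<longlonglongrightarrow> f x"
proof -
 have "(\<lambda>j. (L2n M (\<lambda>x. F j x - f x))\<^sup>2) \<longlonglongrightarrow> 0\<^sup>2" by (intro tendsto_intros lim)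
 then have "(\<lambda>j. LINT x|M. norm ((norm (F j x - f x))\<^sup>2)) \<longlonglongrightarrow> 0" by (simp add: L2n_sq)
 from tendsto_L1_AE_subseq[OF sqi_integrable[OF sqi_diff[OF F]] this]
 obtain r where r: "strict_mono r" "AE x in M. (\<lambda>n. (norm (F (r n) x - f x))\<^sup>2) \<longlonglongrightarrow> 0" by auto
 have "AE x in M. (\<lambda>j. F (r j) x) \<longlonglongrightarrow> f x"
  using r(2)
 proof eventually_elim
  case (elim x)
  then have "(\<lambda>n. sqrt ((norm (F (r n) x - f x))\<^sup>2)) \<longlonglongrightarrow> sqrt 0" by (intro tendsto_intros)
  then show ?case by (simp add: tendsto_norm_zero_iff LIM_zero_iff)
 qed
 with r(1) show ?thesis by (rule that)
qed

text \<open>The subsequence principle: convergence in mean yields almost everywhere convergence only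
  along subsequences, and this carries the outcome back to the whole sequence.\<close>

lemma LIMSEQ_subsubseq:
 fixes X :: "nat \<Rightarrow> real"
 assumes "\<And>r. strict_mono r \<Longrightarrow> \<exists>s::nat\<Rightarrow>nat. strict_mono s \<and> (\<lambda>j. X (r (s j))) \<longlonglongrightarrow> l"
 shows "X \<longlonglongrightarrow> l"
proof (rule ccontr)
 assume "\<not> X \<longlonglongrightarrow> l"
 then obtain e where e: "e > 0" "\<not> (\<forall>\<^sub>F j in sequentially. dist (X j) l < e)"
  by (auto simp: tendsto_iff)
 then have "infinite {j. \<not> dist (X j) l < e}"
  by (simp add: frequently_cofinite[symmetric] cofinite_eq_sequentially frequently_def)
 then obtain r :: "nat \<Rightarrow> nat" where r: "strict_mono r" "\<And>j. r j \<in> {j. \<not> dist (X j) l < e}"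
  using infinite_enumerate by metis
 from assms[OF r(1)] obtain s where "(\<lambda>j. X (r (s j))) \<longlonglongrightarrow> l" by blast
 then have "\<forall>\<^sub>F j in sequentially. dist (X (r (s j))) l < e" using e(1) by (simp add: tendsto_iff)
 then show False using r(2) by (auto simp: eventually_sequentially)
qed

text \<open>The difference splits into \<open>k (wj j x) *\<^sub>R (gj j x - g x)\<close>, small
  because \<open>k\<close> is bounded, and \<open>(k (wj j x) - k (w x)) *\<^sub>R g x\<close>,
  where dominated convergence works along subsequences on which \<open>wj\<close> converges almost
  everywhere. It will be used with \<open>k\<close> the derivative of a nonlinearity and
  \<open>g\<close> a gradient; continuity of \<open>k\<close> suffices, at the price of having no
  rate.\<close>

lemma nemytskii_tendsto:
 fixes g :: "'x \<Rightarrow> 'b::euclidean_space" and w :: "'x \<Rightarrow> real"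
 assumes wj: "\<And>j. sqi M (wj j)" "sqi M w" and gj: "\<And>j. sqi M (gj j)" "sqi M g"
  and lw: "(\<lambda>j. L2n M (\<lambda>x. wj j x - w x)) \<longlonglongrightarrow> 0"
  and lg: "(\<lambda>j. L2n M (\<lambda>x. gj j x - g x)) \<longlonglongrightarrow> 0"
  and k: "continuous_on UNIV k" "\<And>z. \<bar>k z\<bar> \<le> B"
 shows "(\<lambda>j. L2n M (\<lambda>x. k (wj j x) *\<^sub>R gj j x - k (w x) *\<^sub>R g x)) \<longlonglongrightarrow> 0"
proof -
 have B: "0 \<le> B" using k(2)[of 0] by simp
 have km [measurable]: "k \<in> borel_measurable borel" using k(1) by (rule borel_measurable_continuous_onI)
 have [measurable]: "wj j \<in> borel_measurable M" "w \<in> borel_measurable M" "gj j \<in> borel_measurable M"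
   "g \<in> borel_measurable M" for j using wj gj by (auto simp: sqi_def)
 have k2: "\<bar>k a - k b\<bar> \<le> 2 * B" for a b using k(2)[of a] k(2)[of b] by linarith
 have s1: "sqi M (\<lambda>x. k (wj j x) *\<^sub>R (gj j x - g x))" for j
  by (rule sqi_bound[OF sqi_diff[OF gj(1)[of j] gj(2)], of _ B]) (auto intro!: mult_right_mono k)
 have s2: "sqi M (\<lambda>x. (k (wj j x) - k (w x)) *\<^sub>R g x)" for j
  by (rule sqi_bound[OF gj(2), of _ "2 * B"]) (auto intro!: mult_right_mono k2)
 have t1: "(\<lambda>j. L2n M (\<lambda>x. k (wj j x) *\<^sub>R (gj j x - g x))) \<longlonglongrightarrow> 0"
 proof (rule tendsto_sandwich[of "\<lambda>_. 0" _ _ "\<lambda>j. B * L2n M (\<lambda>x. gj j x - g x)"])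
  show "\<forall>\<^sub>F j in sequentially. L2n M (\<lambda>x. k (wj j x) *\<^sub>R (gj j x - g x)) \<le> B * L2n M (\<lambda>x. gj j x - g x)"
   using B by (intro always_eventually allI L2n_mono_AE sqi_diff gj) (auto intro!: mult_right_mono k)
  show "(\<lambda>j. B * L2n M (\<lambda>x. gj j x - g x)) \<longlonglongrightarrow> 0" using tendsto_mult[OF tendsto_const lg] by simp
 qed auto
 have t2: "(\<lambda>j. L2n M (\<lambda>x. (k (wj j x) - k (w x)) *\<^sub>R g x)) \<longlonglongrightarrow> 0"
 proof (rule LIMSEQ_subsubseq)
  fix r :: "nat \<Rightarrow> nat" assume r: "strict_mono r"
  have "(\<lambda>j. L2n M (\<lambda>x. wj (r j) x - w x)) \<longlonglongrightarrow> 0"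
   using LIMSEQ_subseq_LIMSEQ[OF lw r] by (simp add: o_def)
  from L2n_AE_subseq[OF wj(1) wj(2) this]
  obtain s where s: "strict_mono s" "AE x in M. (\<lambda>j. wj (r (s j)) x) \<longlonglongrightarrow> w x" by blast
  have "(\<lambda>j. LINT x|M. (norm ((k (wj (r (s j)) x) - k (w x)) *\<^sub>R g x))\<^sup>2) \<longlonglongrightarrow> (LINT x|M. 0)"
  proof (rule integral_dominated_convergence[where w="\<lambda>x. (2 * B)\<^sup>2 * (norm (g x))\<^sup>2"])
   show "integrable M (\<lambda>x. (2 * B)\<^sup>2 * (norm (g x))\<^sup>2)" using gj(2) by (simp add: sqi_def)
   show "AE x in M. norm ((norm ((k (wj (r (s j)) x) - k (w x)) *\<^sub>R g x))\<^sup>2) \<le> (2 * B)\<^sup>2 * (norm (g x))\<^sup>2" for j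
   proof (rule AE_I2)
    fix x
    have "norm ((k (wj (r (s j)) x) - k (w x)) *\<^sub>R g x) \<le> 2 * B * norm (g x)"
     by (auto intro!: mult_right_mono k2)
    from power_mono[OF this, of 2] show "norm ((norm ((k (wj (r (s j)) x) - k (w x)) *\<^sub>R g x))\<^sup>2) \<le> (2 * B)\<^sup>2 * (norm (g x))\<^sup>2"
     by (simp add: power_mult_distrib)
   qed
   show "AE x in M. (\<lambda>j. (norm ((k (wj (r (s j)) x) - k (w x)) *\<^sub>R g x))\<^sup>2) \<longlonglongrightarrow> 0"
    using s(2)
   proof eventually_elim
    case (elim x)
    have "(\<lambda>j. k (wj (r (s j)) x)) \<longlonglongrightarrow> k (w x)"
     using continuous_on_tendsto_compose[OF k(1) elim] by simp
    then have "(\<lambda>j. (norm ((k (wj (r (s j)) x) - k (w x)) *\<^sub>R g x))\<^sup>2) \<longlonglongrightarrow> (norm ((k (w x) - k (w x)) *\<^sub>R g x))\<^sup>2"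
     by (intro tendsto_intros)
    then show ?case by simp
   qed
  qed (measurable)
  then have "(\<lambda>j. sqrt (LINT x|M. (norm ((k (wj (r (s j)) x) - k (w x)) *\<^sub>R g x))\<^sup>2)) \<longlonglongrightarrow> sqrt (LINT x|M. 0)"
   by (rule tendsto_real_sqrt)
  with s(1) show "\<exists>s. strict_mono s \<and> (\<lambda>j. L2n M (\<lambda>x. (k (wj (r (s j)) x) - k (w x)) *\<^sub>R g x)) \<longlonglongrightarrow> 0"
   by (auto simp: L2n_def)
 qed
 show ?thesis
 proof (rule tendsto_sandwich[OF _ _ tendsto_const tendsto_add_zero[OF t1 t2]])
  have "(\<lambda>x. k (wj j x) *\<^sub>R gj j x - k (w x) *\<^sub>R g x)
    = (\<lambda>x. k (wj j x) *\<^sub>R (gj j x - g x) + (k (wj j x) - k (w x)) *\<^sub>R g x)" for j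
   by (simp add: fun_eq_iff algebra_simps)
  then show "\<forall>\<^sub>F j in sequentially. L2n M (\<lambda>x. k (wj j x) *\<^sub>R gj j x - k (w x) *\<^sub>R g x)
   \<le> L2n M (\<lambda>x. k (wj j x) *\<^sub>R (gj j x - g x)) + L2n M (\<lambda>x. (k (wj j x) - k (w x)) *\<^sub>R g x)"
   using L2n_triangle[OF s1 s2] by simp
 qed auto
qed

section \<open>The space H1 as a space of square integrable pairs\<close>

lemma Lp_2_iff: "w \<in> Lp 2 \<Omega> \<longleftrightarrow> sqi (lebesgue_on \<Omega>) w"
proof -
 have "\<bar>w x\<bar> powr 2 = (norm (w x))\<^sup>2" for x by (cases "w x = 0") auto
 then show ?thesis by (simp add: Lp_def sqi_def)
qed

lemma Lp_norm_2: "Lp_norm 2 \<Omega> w = L2n (lebesgue_on \<Omega>) w"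
proof -
 have "\<bar>w x\<bar> powr 2 = (norm (w x))\<^sup>2" for x by (cases "w x = 0") auto
 then show ?thesis by (simp add: Lp_norm_def L2n_def powr_half_sqrt)
qed

lemma H01_H1: "w \<in> H01 \<Omega> \<Longrightarrow> w \<in> H1 \<Omega>"
 by (simp add: H01_def)

lemma H1_norm_nonneg: "0 \<le> H1_norm \<Omega> w"
 by (simp add: H1_norm_def)

context
 fixes \<Omega> :: "'a::euclidean_space set"
 assumes op: "open \<Omega>" and bd: "bounded \<Omega>"
begin

lemma sets_leb [simp, measurable]: "\<Omega> \<in> sets lebesgue"
 using op by auto

lemma finite_measure_leb: "finite_measure (lebesgue_on \<Omega>)"
proof
 have "emeasure lebesgue \<Omega> < \<infinity>" using emeasure_bounded_finite[OF bd] op by simp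
 then show "emeasure (lebesgue_on \<Omega>) (space (lebesgue_on \<Omega>)) \<noteq> \<infinity>"
  by (simp add: emeasure_restrict_space)
qed

lemma const_integrable: "integrable (lebesgue_on \<Omega>) (\<lambda>x. c :: real)"
 using finite_measure.integrable_const[OF finite_measure_leb] .

lemma borel_lebesgue_on: "f \<in> borel_measurable borel \<Longrightarrow> f \<in> borel_measurable (lebesgue_on \<Omega>)"
 by (intro measurable_restrict_space1 measurable_completion) simp

lemma sqi_integrable1:
 fixes f :: "'a \<Rightarrow> 'b::euclidean_space"
 assumes "sqi (lebesgue_on \<Omega>) f" shows "integrable (lebesgue_on \<Omega>) f"
proof (rule Bochner_Integration.integrable_bound)
 show "integrable (lebesgue_on \<Omega>) (\<lambda>x. 1 + (norm (f x))\<^sup>2)"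
  using assms const_integrable by (simp add: sqi_def)
 show "AE x in lebesgue_on \<Omega>. norm (f x) \<le> norm (1 + (norm (f x))\<^sup>2)"
 proof (rule AE_I2)
  fix x
  have "2 * norm (f x) \<le> 1 + (norm (f x))\<^sup>2" using sum_squares_bound[of 1 "norm (f x)"] by simp
  moreover have "norm (1 + (norm (f x))\<^sup>2) = 1 + (norm (f x))\<^sup>2" by simp
  ultimately show "norm (f x) \<le> norm (1 + (norm (f x))\<^sup>2)" using norm_ge_zero[of "f x"] by linarith
 qed
qed (use assms in \<open>auto simp: sqi_def\<close>)

lemma sqi_abs_integrable_on:
 fixes f :: "'a \<Rightarrow> 'b::euclidean_space"
 assumes "sqi (lebesgue_on \<Omega>) f" "K \<in> sets lebesgue" "K \<subseteq> \<Omega>" shows "f absolutely_integrable_on K"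
proof -
 have "set_integrable lebesgue \<Omega> f"
  using sqi_integrable1[OF assms(1)] by (simp add: set_integrable_def integrable_restrict_space)
 then show ?thesis by (rule set_integrable_subset) (use assms in auto)
qed

lemma sqi_bounded:
 fixes f :: "'a \<Rightarrow> 'b::euclidean_space"
 assumes "f \<in> borel_measurable (lebesgue_on \<Omega>)" "\<And>x. norm (f x) \<le> B"
 shows "sqi (lebesgue_on \<Omega>) f"
 unfolding sqi_def
proof (intro conjI assms finite_measure.integrable_const_bound[OF finite_measure_leb, of _ "B\<^sup>2"])
 show "AE x in lebesgue_on \<Omega>. norm ((norm (f x))\<^sup>2) \<le> B\<^sup>2"
  using power_mono[OF assms(2), of _ 2] by simp
 show "(\<lambda>x. (norm (f x))\<^sup>2) \<in> borel_measurable (lebesgue_on \<Omega>)" using assms(1) by measurable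
qed

lemma test_sqi:
 assumes "f \<in> test_functions S"
 shows "sqi (lebesgue_on \<Omega>) f" "sqi (lebesgue_on \<Omega>) (grad f)"
  "b \<in> Basis \<Longrightarrow> sqi (lebesgue_on \<Omega>) (\<lambda>x. frechet_derivative f (at x) b)"
proof -
 obtain B where "\<And>x. \<bar>f x\<bar> \<le> B" using test_function_bound[OF assms] by blast
 from assms obtain K where K: "smooth f" "compact K"
   "\<And>x b. x \<notin> K \<Longrightarrow> frechet_derivative f (at x) b = 0"
  by (rule test_functionE) blast
 show "sqi (lebesgue_on \<Omega>) f"
  by (rule sqi_bounded[of f B]) (simp_all add: borel_lebesgue_on smooth_borel K(1) \<open>\<And>x. \<bar>f x\<bar> \<le> B\<close>)
 show *: "sqi (lebesgue_on \<Omega>) (\<lambda>x. frechet_derivative f (at x) b)" if b: "b \<in> Basis" for b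
 proof -
  obtain B where "\<And>x. \<bar>frechet_derivative f (at x) b\<bar> \<le> B"
   using smooth_gradient_bound[OF K(1,2) b K(3)] by blast
  then show ?thesis
   by (intro sqi_bounded[of _ B]) (simp_all add: borel_lebesgue_on smooth_borel smooth_frechet K(1) b)
 qed
 have "sqi (lebesgue_on \<Omega>) (\<lambda>x. \<Sum>b\<in>A. frechet_derivative f (at x) b *\<^sub>R b)" if "finite A" "A \<subseteq> Basis" for A
  using that
 proof (induction A rule: finite_induct)
  case (insert c A)
  have "sqi (lebesgue_on \<Omega>) (\<lambda>x. frechet_derivative f (at x) c *\<^sub>R c)"
   by (rule sqi_bound[OF *, of c _ 1])
     (use insert * sqi_measurable in \<open>auto intro!: borel_measurable_scaleR\<close>)
  then show ?case using insert by (simp add: sqi_add)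
 qed (simp add: sqi_def)
 then show "sqi (lebesgue_on \<Omega>) (grad f)" unfolding grad_def[abs_def] by simp
qed

lemma has_weak_gradientI:
 assumes "sqi (lebesgue_on \<Omega>) w" "sqi (lebesgue_on \<Omega>) G"
  and "\<And>\<phi> b. \<phi> \<in> test_functions \<Omega> \<Longrightarrow> b \<in> Basis \<Longrightarrow>
    (LINT x|lebesgue_on \<Omega>. w x * frechet_derivative \<phi> (at x) b) =
    - (LINT x|lebesgue_on \<Omega>. (G x \<bullet> b) * \<phi> x)"
 shows "has_weak_gradient \<Omega> w G"
 unfolding has_weak_gradient_def
 using assms by (auto intro!: sqi_abs_integrable_on lmeasurable_compact fmeasurableD)

text \<open>A weak gradient is only known to be integrable on compact subsets. Countably many closed
  boxes cover \<open>\<Omega>\<close>, so measurability may be checked piecewise.\<close>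

lemma locally_integrable_measurable:
 fixes G :: "'a \<Rightarrow> 'b::euclidean_space"
 assumes "\<And>K. compact K \<Longrightarrow> K \<subseteq> \<Omega> \<Longrightarrow> G absolutely_integrable_on K"
 shows "G \<in> borel_measurable (lebesgue_on \<Omega>)"
proof -
 obtain D where D: "countable D" "D \<subseteq> Pow \<Omega>" "\<And>X. X \<in> D \<Longrightarrow> \<exists>a b. X = cbox a b" "\<Union>D = \<Omega>"
  using open_countable_Union_open_cbox[OF op] by blast
 show ?thesis
 proof (rule measurable_piecewise_restrict[OF D(1)])
  show "X \<inter> space (lebesgue_on \<Omega>) \<in> sets (lebesgue_on \<Omega>)" if "X \<in> D" for X
  proof -
   obtain a b where "X = cbox a b" using D(3)[OF \<open>X \<in> D\<close>] by blast
   then have X: "X \<in> sets lebesgue" "X \<subseteq> \<Omega>" using D(2) that by auto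
   then have "X \<inter> space (lebesgue_on \<Omega>) = X" by auto
   then show ?thesis using X by (simp add: sets_restrict_space_iff)
  qed
  show "space (lebesgue_on \<Omega>) \<subseteq> \<Union>D" using D(4) by simp
  show "G \<in> borel_measurable (restrict_space (lebesgue_on \<Omega>) X)" if "X \<in> D" for X
  proof -
   obtain a b where "X = cbox a b" using D(3)[OF \<open>X \<in> D\<close>] by blast
   then have X: "X \<in> sets lebesgue" "X \<subseteq> \<Omega>" "compact X" using D(2) that by auto
   have "set_integrable lebesgue X G" by (rule assms[OF X(3,2)])
   then have "(\<lambda>x. indicator X x *\<^sub>R G x) \<in> borel_measurable lebesgue"
    by (auto simp: set_integrable_def)
   then have "G \<in> borel_measurable (lebesgue_on X)"
    using X by (simp add: borel_measurable_restrict_space_iff)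
   then show ?thesis using X by (simp add: restrict_restrict_space Int_absorb1)
  qed
 qed
qed

text \<open>Uniqueness of weak gradients makes the arbitrary choice in \<open>weak_grad\<close>
  harmless: any gradient found by hand may be substituted for it under an integral.\<close>

lemma weak_gradient_AE:
 assumes "has_weak_gradient \<Omega> w G"
 shows "has_weak_gradient \<Omega> w (weak_grad \<Omega> w)" "AE x in lebesgue_on \<Omega>. weak_grad \<Omega> w x = G x"
  "weak_grad \<Omega> w \<in> borel_measurable (lebesgue_on \<Omega>)" "G \<in> borel_measurable (lebesgue_on \<Omega>)"
proof -
 show 1: "has_weak_gradient \<Omega> w (weak_grad \<Omega> w)"
  unfolding weak_grad_def by (rule someI[where P="has_weak_gradient \<Omega> w", OF assms])
 show "AE x in lebesgue_on \<Omega>. weak_grad \<Omega> w x = G x"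
  by (rule has_weak_gradient_unique[OF op 1 assms])
 show "weak_grad \<Omega> w \<in> borel_measurable (lebesgue_on \<Omega>)" "G \<in> borel_measurable (lebesgue_on \<Omega>)"
  using 1 assms by (auto intro!: locally_integrable_measurable simp: has_weak_gradient_def)
qed

lemma H1_D:
 assumes "w \<in> H1 \<Omega>"
 shows "has_weak_gradient \<Omega> w (weak_grad \<Omega> w)" "sqi (lebesgue_on \<Omega>) w" "sqi (lebesgue_on \<Omega>) (weak_grad \<Omega> w)"
proof -
 from assms obtain G where G: "w \<in> Lp 2 \<Omega>" "has_weak_gradient \<Omega> w G" "(\<lambda>x. norm (G x)) \<in> Lp 2 \<Omega>"
  by (auto simp: H1_def)
 show "has_weak_gradient \<Omega> w (weak_grad \<Omega> w)" by (rule weak_gradient_AE[OF G(2)])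
 show "sqi (lebesgue_on \<Omega>) w" using G by (simp add: Lp_2_iff)
 have "sqi (lebesgue_on \<Omega>) (\<lambda>x. norm (G x))" using G by (simp add: Lp_2_iff)
 then have "sqi (lebesgue_on \<Omega>) G" using weak_gradient_AE(4)[OF G(2)] by (simp add: sqi_def)
 then show "sqi (lebesgue_on \<Omega>) (weak_grad \<Omega> w)"
  by (rule sqi_AE_cong) (use weak_gradient_AE[OF G(2)] in auto)
qed

lemma H1_I:
 assumes "has_weak_gradient \<Omega> w G" "sqi (lebesgue_on \<Omega>) w" "sqi (lebesgue_on \<Omega>) G"
 shows "w \<in> H1 \<Omega>"
 using assms by (auto simp: H1_def Lp_2_iff sqi_def intro!: exI[of _ G])

text \<open>Through this identity the triangle inequalities of \<open>L2n\<close> serve for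
  \<open>H1_norm\<close> as well.\<close>

lemma H1_norm_L2n:
 assumes "w \<in> H1 \<Omega>"
 shows "H1_norm \<Omega> w = L2n (lebesgue_on \<Omega>) (\<lambda>x. (w x, weak_grad \<Omega> w x))"
  "sqi (lebesgue_on \<Omega>) (\<lambda>x. (w x, weak_grad \<Omega> w x))"
proof -
 have "L2n (lebesgue_on \<Omega>) (\<lambda>x. norm (weak_grad \<Omega> w x)) = L2n (lebesgue_on \<Omega>) (weak_grad \<Omega> w)"
  by (simp add: L2n_def)
 then show "H1_norm \<Omega> w = L2n (lebesgue_on \<Omega>) (\<lambda>x. (w x, weak_grad \<Omega> w x))"
  using H1_D[OF assms] by (simp add: H1_norm_def Lp_norm_2 L2n_Pair)
 show "sqi (lebesgue_on \<Omega>) (\<lambda>x. (w x, weak_grad \<Omega> w x))"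
  by (rule L2n_Pair(1)[OF H1_D(2,3)[OF assms]])
qed

lemma weak_gradient_test_integrable:
 assumes "has_weak_gradient \<Omega> w G" "\<phi> \<in> test_functions \<Omega>" "b \<in> Basis"
 shows "integrable (lebesgue_on \<Omega>) (\<lambda>x. w x * frechet_derivative \<phi> (at x) b)"
  "integrable (lebesgue_on \<Omega>) (\<lambda>x. (G x \<bullet> b) * \<phi> x)"
proof -
 from assms(2) obtain K where K: "smooth \<phi>" "compact K" "K \<subseteq> \<Omega>" "\<And>x. x \<notin> K \<Longrightarrow> \<phi> x = 0"
   "\<And>x b. x \<notin> K \<Longrightarrow> frechet_derivative \<phi> (at x) b = 0"
  by (rule test_functionE) blast
 have a: "w absolutely_integrable_on K" "G absolutely_integrable_on K"
  using assms(1) K unfolding has_weak_gradient_def by blast+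
 show "integrable (lebesgue_on \<Omega>) (\<lambda>x. w x * frechet_derivative \<phi> (at x) b)"
  by (rule integrable_locally_mult[OF a(1) K(2,3) op smooth_continuous[OF smooth_frechet[OF K(1) assms(3)]] K(5)])
 show "integrable (lebesgue_on \<Omega>) (\<lambda>x. (G x \<bullet> b) * \<phi> x)"
  by (rule integrable_locally_mult[OF absolutely_integrable_component[OF a(2)] K(2,3) op smooth_continuous[OF K(1)] K(4)])
qed

lemma H1_lincomb:
 assumes w: "w \<in> H1 \<Omega>" and z: "z \<in> H1 \<Omega>"
 shows "(\<lambda>x. a * w x + b * z x) \<in> H1 \<Omega>"
  "AE x in lebesgue_on \<Omega>. weak_grad \<Omega> (\<lambda>x. a * w x + b * z x) x = a *\<^sub>R weak_grad \<Omega> w x + b *\<^sub>R weak_grad \<Omega> z x"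
proof -
 let ?G = "\<lambda>x. a *\<^sub>R weak_grad \<Omega> w x + b *\<^sub>R weak_grad \<Omega> z x"
 have s: "sqi (lebesgue_on \<Omega>) (\<lambda>x. a * w x + b * z x)" "sqi (lebesgue_on \<Omega>) ?G"
  using sqi_add[OF sqi_scaleR[OF H1_D(2)[OF w], of a] sqi_scaleR[OF H1_D(2)[OF z], of b]]
   sqi_add[OF sqi_scaleR[OF H1_D(3)[OF w], of a] sqi_scaleR[OF H1_D(3)[OF z], of b]] by simp_all
 have g: "has_weak_gradient \<Omega> (\<lambda>x. a * w x + b * z x) ?G"
 proof (rule has_weak_gradientI[OF s])
  fix \<phi> and c :: 'a assume \<phi>: "\<phi> \<in> test_functions \<Omega>" "c \<in> Basis"
  have 1: "(LINT x|lebesgue_on \<Omega>. y x * frechet_derivative \<phi> (at x) c) =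
    - (LINT x|lebesgue_on \<Omega>. (weak_grad \<Omega> y x \<bullet> c) * \<phi> x)" if "y \<in> H1 \<Omega>" for y
   using H1_D(1)[OF that] \<phi> unfolding has_weak_gradient_def by blast
  note i = weak_gradient_test_integrable[OF H1_D(1)[OF w] \<phi>] weak_gradient_test_integrable[OF H1_D(1)[OF z] \<phi>]
  have "(LINT x|lebesgue_on \<Omega>. (a * w x + b * z x) * frechet_derivative \<phi> (at x) c)
    = (LINT x|lebesgue_on \<Omega>. a * (w x * frechet_derivative \<phi> (at x) c) + b * (z x * frechet_derivative \<phi> (at x) c))"
   by (simp add: algebra_simps)
  also have "\<dots> = a * (LINT x|lebesgue_on \<Omega>. w x * frechet_derivative \<phi> (at x) c)
    + b * (LINT x|lebesgue_on \<Omega>. z x * frechet_derivative \<phi> (at x) c)"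
   using i by simp
  also have "\<dots> = - (a * (LINT x|lebesgue_on \<Omega>. (weak_grad \<Omega> w x \<bullet> c) * \<phi> x)
    + b * (LINT x|lebesgue_on \<Omega>. (weak_grad \<Omega> z x \<bullet> c) * \<phi> x))"
   using 1[OF w] 1[OF z] by simp
  also have "\<dots> = - (LINT x|lebesgue_on \<Omega>. a * ((weak_grad \<Omega> w x \<bullet> c) * \<phi> x) + b * ((weak_grad \<Omega> z x \<bullet> c) * \<phi> x))"
   using i by simp
  also have "\<dots> = - (LINT x|lebesgue_on \<Omega>. (?G x \<bullet> c) * \<phi> x)"
   by (simp add: inner_add_left algebra_simps)
  finally show "(LINT x|lebesgue_on \<Omega>. (a * w x + b * z x) * frechet_derivative \<phi> (at x) c) = \<dots>" .
 qed
 show "(\<lambda>x. a * w x + b * z x) \<in> H1 \<Omega>" by (rule H1_I[OF g s])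
 show "AE x in lebesgue_on \<Omega>. weak_grad \<Omega> (\<lambda>x. a * w x + b * z x) x = ?G x"
  by (rule weak_gradient_AE[OF g])
qed

lemma H1_norm_lincomb:
 assumes w: "w \<in> H1 \<Omega>" and z: "z \<in> H1 \<Omega>"
 shows "H1_norm \<Omega> (\<lambda>x. a * w x + b * z x) =
   L2n (lebesgue_on \<Omega>) (\<lambda>x. a *\<^sub>R (w x, weak_grad \<Omega> w x) + b *\<^sub>R (z x, weak_grad \<Omega> z x))"
  "H1_norm \<Omega> (\<lambda>x. a * w x + b * z x) \<le> \<bar>a\<bar> * H1_norm \<Omega> w + \<bar>b\<bar> * H1_norm \<Omega> z"
proof -
 note J = H1_norm_L2n
 have s: "sqi (lebesgue_on \<Omega>) (\<lambda>x. a *\<^sub>R (w x, weak_grad \<Omega> w x))"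
   "sqi (lebesgue_on \<Omega>) (\<lambda>x. b *\<^sub>R (z x, weak_grad \<Omega> z x))"
  by (intro sqi_scaleR J w z)+
 show 1: "H1_norm \<Omega> (\<lambda>x. a * w x + b * z x) =
   L2n (lebesgue_on \<Omega>) (\<lambda>x. a *\<^sub>R (w x, weak_grad \<Omega> w x) + b *\<^sub>R (z x, weak_grad \<Omega> z x))"
  unfolding J(1)[OF H1_lincomb(1)[OF w z]]
 proof (rule L2n_cong_AE)
  show "AE x in lebesgue_on \<Omega>. (a * w x + b * z x, weak_grad \<Omega> (\<lambda>x. a * w x + b * z x) x) =
    a *\<^sub>R (w x, weak_grad \<Omega> w x) + b *\<^sub>R (z x, weak_grad \<Omega> z x)"
   using H1_lincomb(2)[OF w z] by eventually_elim simp
 qed (rule sqi_measurable, rule J H1_lincomb w z, intro H1_lincomb w z, rule sqi_measurable, rule sqi_add[OF s])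
 show "H1_norm \<Omega> (\<lambda>x. a * w x + b * z x) \<le> \<bar>a\<bar> * H1_norm \<Omega> w + \<bar>b\<bar> * H1_norm \<Omega> z"
  unfolding 1 J(1)[OF w] J(1)[OF z] L2n_scaleR[symmetric]
  by (rule L2n_triangle[OF s])
qed

lemma H1_norm_diff:
 assumes w: "w \<in> H1 \<Omega>" and z: "z \<in> H1 \<Omega>"
 shows "(\<lambda>x. w x - z x) \<in> H1 \<Omega>"
  "H1_norm \<Omega> (\<lambda>x. w x - z x) = L2n (lebesgue_on \<Omega>) (\<lambda>x. (w x, weak_grad \<Omega> w x) - (z x, weak_grad \<Omega> z x))"
 using H1_lincomb(1)[OF w z, of 1 "-1"] H1_norm_lincomb(1)[OF w z, of 1 "-1"] by simp_all

lemma H1_norm_reverse_triangle: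
 assumes w: "w \<in> H1 \<Omega>" and z: "z \<in> H1 \<Omega>"
 shows "\<bar>H1_norm \<Omega> w - H1_norm \<Omega> z\<bar> \<le> H1_norm \<Omega> (\<lambda>x. w x - z x)"
 unfolding H1_norm_diff(2)[OF w z] H1_norm_L2n(1)[OF w] H1_norm_L2n(1)[OF z]
 by (rule L2n_reverse_triangle) (intro H1_norm_L2n w z)+

lemma H1_L2n_le:
 assumes w: "w \<in> H1 \<Omega>"
 shows "L2n (lebesgue_on \<Omega>) w \<le> H1_norm \<Omega> w" "L2n (lebesgue_on \<Omega>) (weak_grad \<Omega> w) \<le> H1_norm \<Omega> w"
 unfolding H1_norm_L2n(1)[OF w] L2n_Pair(2)[OF H1_D(2,3)[OF w]]
 by (auto intro!: real_le_rsqrt)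

lemma H1_diff_L2n_le:
 assumes w: "w \<in> H1 \<Omega>" and z: "z \<in> H1 \<Omega>"
 shows "L2n (lebesgue_on \<Omega>) (\<lambda>x. w x - z x) \<le> H1_norm \<Omega> (\<lambda>x. w x - z x)"
  "L2n (lebesgue_on \<Omega>) (\<lambda>x. weak_grad \<Omega> w x - weak_grad \<Omega> z x) \<le> H1_norm \<Omega> (\<lambda>x. w x - z x)"
  "H1_norm \<Omega> (\<lambda>x. w x - z x) \<le> L2n (lebesgue_on \<Omega>) (\<lambda>x. w x - z x)
   + L2n (lebesgue_on \<Omega>) (\<lambda>x. weak_grad \<Omega> w x - weak_grad \<Omega> z x)"
proof -
 have s: "sqi (lebesgue_on \<Omega>) (\<lambda>x. w x - z x)" "sqi (lebesgue_on \<Omega>) (\<lambda>x. weak_grad \<Omega> w x - weak_grad \<Omega> z x)"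
  by (intro sqi_diff H1_D w z)+
 have eq: "H1_norm \<Omega> (\<lambda>x. w x - z x) = sqrt ((L2n (lebesgue_on \<Omega>) (\<lambda>x. w x - z x))\<^sup>2
   + (L2n (lebesgue_on \<Omega>) (\<lambda>x. weak_grad \<Omega> w x - weak_grad \<Omega> z x))\<^sup>2)"
  unfolding H1_norm_diff(2)[OF w z] L2n_Pair(2)[OF s, symmetric] by simp
 show "L2n (lebesgue_on \<Omega>) (\<lambda>x. w x - z x) \<le> H1_norm \<Omega> (\<lambda>x. w x - z x)"
  "L2n (lebesgue_on \<Omega>) (\<lambda>x. weak_grad \<Omega> w x - weak_grad \<Omega> z x) \<le> H1_norm \<Omega> (\<lambda>x. w x - z x)"
  "H1_norm \<Omega> (\<lambda>x. w x - z x) \<le> L2n (lebesgue_on \<Omega>) (\<lambda>x. w x - z x)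
   + L2n (lebesgue_on \<Omega>) (\<lambda>x. weak_grad \<Omega> w x - weak_grad \<Omega> z x)"
  unfolding eq by (auto intro!: real_le_rsqrt sqrt_sum_squares_le_sum)
qed

text \<open>The product of two test functions is a test function, so its derivative integrates to
  zero. This makes the classical gradient a weak gradient.\<close>

lemma test_function_mult_integral:
 assumes f: "f \<in> test_functions \<Omega>" and g: "g \<in> test_functions \<Omega>" and b: "b \<in> Basis"
 shows "(LINT x|lebesgue_on \<Omega>. f x * frechet_derivative g (at x) b) =
  - (LINT x|lebesgue_on \<Omega>. frechet_derivative f (at x) b * g x)"
proof -
 from f obtain K where K: "smooth f" "compact K" "K \<subseteq> \<Omega>" "\<And>x. x \<notin> K \<Longrightarrow> f x = 0"
   "\<And>x b. x \<notin> K \<Longrightarrow> frechet_derivative f (at x) b = 0"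
  by (rule test_functionE) blast
 from g have sg: "smooth g" by (rule test_functionE)
 have fg: "(\<lambda>x. f x * g x) \<in> test_functions \<Omega>"
  by (rule smooth_test_function[OF smooth_mult[OF K(1) sg] _ K(2,3)]) (use K(4) in auto)
 have D: "frechet_derivative (\<lambda>x. f x * g x) (at x) b = f x * frechet_derivative g (at x) b + frechet_derivative f (at x) b * g x" for x
  using fun_cong[OF frechet_derivative_at[OF has_derivative_mult[OF smooth_has_derivative[OF K(1)] smooth_has_derivative[OF sg]]], of x b]
  by simp
 have i: "integrable (lebesgue_on \<Omega>) (\<lambda>x. f x * frechet_derivative g (at x) b)"
   "integrable (lebesgue_on \<Omega>) (\<lambda>x. frechet_derivative f (at x) b * g x)"
  using sqi_inner_integrable[OF test_sqi(1)[OF f] test_sqi(3)[OF g b]]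
   sqi_inner_integrable[OF test_sqi(3)[OF f b] test_sqi(1)[OF g]] by simp_all
 have "0 = (LINT x|lborel. frechet_derivative (\<lambda>x. f x * g x) (at x) b)"
  using test_function_integral_derivative_0[OF fg b] ..
 also have "\<dots> = (LINT x|lebesgue. indicator \<Omega> x *\<^sub>R (f x * frechet_derivative g (at x) b + frechet_derivative f (at x) b * g x))"
 proof -
  have "frechet_derivative (\<lambda>x. f x * g x) (at x) b = indicator \<Omega> x *\<^sub>R (f x * frechet_derivative g (at x) b + frechet_derivative f (at x) b * g x)" for x
  proof (cases "x \<in> \<Omega>")
   case False
   then have "x \<notin> K" using K(3) by blast
   then show ?thesis unfolding D using False by (simp add: K(4,5))
  qed (simp add: D)
  moreover have "(LINT x|lborel. frechet_derivative (\<lambda>x. f x * g x) (at x) b) = (LINT x|lebesgue. frechet_derivative (\<lambda>x. f x * g x) (at x) b)"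
   by (rule integral_completion[symmetric]) (simp add: smooth_borel smooth_frechet smooth_mult K(1) sg b)
  ultimately show ?thesis by simp
 qed
 also have "\<dots> = (LINT x|lebesgue_on \<Omega>. f x * frechet_derivative g (at x) b + frechet_derivative f (at x) b * g x)"
  by (simp add: integral_restrict_space)
 also have "\<dots> = (LINT x|lebesgue_on \<Omega>. f x * frechet_derivative g (at x) b) + (LINT x|lebesgue_on \<Omega>. frechet_derivative f (at x) b * g x)"
  using i by simp
 finally show ?thesis by simp
qed

lemma test_function_H1:
 assumes f: "f \<in> test_functions \<Omega>"
 shows "f \<in> H1 \<Omega>" "AE x in lebesgue_on \<Omega>. weak_grad \<Omega> f x = grad f x"
proof -
 have g: "has_weak_gradient \<Omega> f (grad f)"
  by (rule has_weak_gradientI[OF test_sqi(1,2)[OF f]])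
    (simp add: test_function_mult_integral[OF f] grad_inner)
 show "f \<in> H1 \<Omega>" by (rule H1_I[OF g test_sqi(1,2)[OF f]])
 show "AE x in lebesgue_on \<Omega>. weak_grad \<Omega> f x = grad f x" by (rule weak_gradient_AE[OF g])
qed

end

subsection \<open>Chain rule and Sobolev inequality for \<open>H01\<close>\<close>

context
 fixes \<Omega> :: "'a::euclidean_space set"
 assumes op: "open \<Omega>" and bd: "bounded \<Omega>"
begin

lemma test_function_compose:
 assumes f: "f \<in> test_functions \<Omega>" and G: "smooth G" "G 0 = 0"
 shows "(\<lambda>x. G (f x)) \<in> test_functions \<Omega>"
proof -
 from f obtain K where K: "smooth f" "compact K" "K \<subseteq> \<Omega>" "\<And>x. x \<notin> K \<Longrightarrow> f x = 0"
  by (rule test_functionE) blast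
 show ?thesis
  by (rule smooth_test_function[OF smooth_compose[OF K(1) G(1)] _ K(2,3)]) (simp add: K(4) G)
qed

lemma Lipschitz_of_deriv_bound:
 fixes G :: "real \<Rightarrow> real"
 assumes "smooth G" "\<And>z. \<bar>deriv G z\<bar> \<le> B"
 shows "\<bar>G a - G b\<bar> \<le> B * \<bar>a - b\<bar>"
 using field_differentiable_bound[of UNIV G "deriv G" B a b] smooth_DERIV[OF assms(1)] assms(2)
 by (auto simp: field_differentiable_def)

text \<open>Both sides of the defining identity are inner products with a fixed square integrable
  function, hence continuous under convergence in \<open>L2n\<close>.\<close>

lemma weak_gradient_limit:
 assumes f: "\<And>j. has_weak_gradient \<Omega> (wj j) (gj j)"
  and s: "\<And>j. sqi (lebesgue_on \<Omega>) (wj j)" "\<And>j. sqi (lebesgue_on \<Omega>) (gj j)"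
   "sqi (lebesgue_on \<Omega>) w" "sqi (lebesgue_on \<Omega>) g"
  and lw: "(\<lambda>j. L2n (lebesgue_on \<Omega>) (\<lambda>x. wj j x - w x)) \<longlonglongrightarrow> 0"
  and lg: "(\<lambda>j. L2n (lebesgue_on \<Omega>) (\<lambda>x. gj j x - g x)) \<longlonglongrightarrow> 0"
 shows "has_weak_gradient \<Omega> w g"
proof (rule has_weak_gradientI[OF op bd s(3,4)])
 fix \<phi> and b :: 'a assume \<phi>: "\<phi> \<in> test_functions \<Omega>" and b: "b \<in> Basis"
 note t = test_sqi[OF op bd \<phi>]
 have lim: "(\<lambda>j. LINT x|lebesgue_on \<Omega>. F j x \<bullet> H x) \<longlonglongrightarrow> (LINT x|lebesgue_on \<Omega>. f x \<bullet> H x)"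
  if "\<And>j. sqi (lebesgue_on \<Omega>) (F j)" "sqi (lebesgue_on \<Omega>) f" "sqi (lebesgue_on \<Omega>) H"
   "(\<lambda>j. L2n (lebesgue_on \<Omega>) (\<lambda>x. F j x - f x)) \<longlonglongrightarrow> 0"
  for F :: "nat \<Rightarrow> 'a \<Rightarrow> 'b::euclidean_space" and f H
 proof (rule LIM_zero_cancel, rule Lim_null_comparison)
  show "(\<lambda>j. L2n (lebesgue_on \<Omega>) (\<lambda>x. F j x - f x) * L2n (lebesgue_on \<Omega>) H) \<longlonglongrightarrow> 0"
   using tendsto_mult[OF that(4) tendsto_const] by simp
  show "\<forall>\<^sub>F j in sequentially. norm ((LINT x|lebesgue_on \<Omega>. F j x \<bullet> H x) - (LINT x|lebesgue_on \<Omega>. f x \<bullet> H x))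
   \<le> L2n (lebesgue_on \<Omega>) (\<lambda>x. F j x - f x) * L2n (lebesgue_on \<Omega>) H"
  proof (intro always_eventually allI)
   fix j
   have "(LINT x|lebesgue_on \<Omega>. F j x \<bullet> H x) - (LINT x|lebesgue_on \<Omega>. f x \<bullet> H x) = (LINT x|lebesgue_on \<Omega>. (F j x - f x) \<bullet> H x)"
    using sqi_inner_integrable[OF that(1)[of j] that(3)] sqi_inner_integrable[OF that(2,3)]
    by (simp add: inner_diff_left)
   then show "norm ((LINT x|lebesgue_on \<Omega>. F j x \<bullet> H x) - (LINT x|lebesgue_on \<Omega>. f x \<bullet> H x))
    \<le> L2n (lebesgue_on \<Omega>) (\<lambda>x. F j x - f x) * L2n (lebesgue_on \<Omega>) H"
    using L2n_Cauchy_Schwarz[OF sqi_diff[OF that(1)[of j] that(2)] that(3)] by simp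
  qed
 qed
 have 1: "(\<lambda>j. LINT x|lebesgue_on \<Omega>. wj j x * frechet_derivative \<phi> (at x) b)
   \<longlonglongrightarrow> (LINT x|lebesgue_on \<Omega>. w x * frechet_derivative \<phi> (at x) b)"
  using lim[OF s(1,3) t(3)[OF b] lw] by simp
 have sb: "sqi (lebesgue_on \<Omega>) (\<lambda>x. \<phi> x *\<^sub>R b)"
  by (rule sqi_bound[OF t(1), of _ 1]) (use b sqi_measurable[OF t(1)] in auto)
 have "(\<lambda>j. LINT x|lebesgue_on \<Omega>. (gj j x \<bullet> b) * \<phi> x) \<longlonglongrightarrow> (LINT x|lebesgue_on \<Omega>. (g x \<bullet> b) * \<phi> x)"
  using lim[OF s(2,4) sb lg] by (simp add: mult.commute)
 then have "(\<lambda>j. - (LINT x|lebesgue_on \<Omega>. (gj j x \<bullet> b) * \<phi> x)) \<longlonglongrightarrow> - (LINT x|lebesgue_on \<Omega>. (g x \<bullet> b) * \<phi> x)"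
  by (rule tendsto_minus)
 moreover have "- (LINT x|lebesgue_on \<Omega>. (gj j x \<bullet> b) * \<phi> x) = (LINT x|lebesgue_on \<Omega>. wj j x * frechet_derivative \<phi> (at x) b)" for j
  using f[of j] \<phi> b unfolding has_weak_gradient_def by simp
 ultimately show "(LINT x|lebesgue_on \<Omega>. w x * frechet_derivative \<phi> (at x) b) = - (LINT x|lebesgue_on \<Omega>. (g x \<bullet> b) * \<phi> x)"
  using 1 LIMSEQ_unique by auto
qed

lemma H01_approx:
 assumes "w \<in> H01 \<Omega>"
 obtains \<phi> where "\<And>j::nat. \<phi> j \<in> test_functions \<Omega>" "(\<lambda>j. H1_norm \<Omega> (\<lambda>x. w x - \<phi> j x)) \<longlonglongrightarrow> 0"
  "(\<lambda>j. L2n (lebesgue_on \<Omega>) (\<lambda>x. \<phi> j x - w x)) \<longlonglongrightarrow> 0"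
  "(\<lambda>j. L2n (lebesgue_on \<Omega>) (\<lambda>x. grad (\<phi> j) x - weak_grad \<Omega> w x)) \<longlonglongrightarrow> 0"
proof -
 from assms obtain \<phi> where \<phi>: "\<And>j::nat. \<phi> j \<in> test_functions \<Omega>" "(\<lambda>j. H1_norm \<Omega> (\<lambda>x. w x - \<phi> j x)) \<longlonglongrightarrow> 0"
  by (auto simp: H01_def)
 note w = H01_H1[OF assms]
 note t = test_function_H1[OF op bd \<phi>(1)]
 have 1: "(\<lambda>j. L2n (lebesgue_on \<Omega>) (\<lambda>x. w x - \<phi> j x)) \<longlonglongrightarrow> 0"
  by (rule tendsto_sandwich[OF _ _ tendsto_const \<phi>(2)])
    (use H1_diff_L2n_le(1)[OF op bd w t(1)] in auto)
 have 2: "(\<lambda>j. L2n (lebesgue_on \<Omega>) (\<lambda>x. weak_grad \<Omega> w x - weak_grad \<Omega> (\<phi> j) x)) \<longlonglongrightarrow> 0"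
  by (rule tendsto_sandwich[OF _ _ tendsto_const \<phi>(2)])
    (use H1_diff_L2n_le(2)[OF op bd w t(1)] in auto)
 have "L2n (lebesgue_on \<Omega>) (\<lambda>x. grad (\<phi> j) x - weak_grad \<Omega> w x) = L2n (lebesgue_on \<Omega>) (\<lambda>x. weak_grad \<Omega> w x - weak_grad \<Omega> (\<phi> j) x)" for j
  unfolding L2n_minus_commute[of _ "grad (\<phi> j)"]
 proof (rule L2n_cong_AE)
  show "AE x in lebesgue_on \<Omega>. weak_grad \<Omega> w x - grad (\<phi> j) x = weak_grad \<Omega> w x - weak_grad \<Omega> (\<phi> j) x"
   using t(2)[of j] by eventually_elim simp
 qed (intro borel_measurable_diff sqi_measurable H1_D(3)[OF op bd w] test_sqi[OF op bd \<phi>(1)] H1_D(3)[OF op bd t(1)])+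
 with 2 have "(\<lambda>j. L2n (lebesgue_on \<Omega>) (\<lambda>x. grad (\<phi> j) x - weak_grad \<Omega> w x)) \<longlonglongrightarrow> 0" by simp
 moreover have "(\<lambda>j. L2n (lebesgue_on \<Omega>) (\<lambda>x. \<phi> j x - w x)) \<longlonglongrightarrow> 0"
  using 1 by (simp add: L2n_minus_commute[of _ w])
 ultimately show ?thesis using \<phi> by (intro that)
qed

lemma deriv_scaleR_sqi:
 assumes "smooth G" "\<And>z. \<bar>deriv G z\<bar> \<le> B" "sqi (lebesgue_on \<Omega>) w" "sqi (lebesgue_on \<Omega>) g"
 shows "sqi (lebesgue_on \<Omega>) (\<lambda>x. deriv G (w x) *\<^sub>R g x)"
proof -
 have [measurable]: "deriv G \<in> borel_measurable borel" "w \<in> borel_measurable (lebesgue_on \<Omega>)" "g \<in> borel_measurable (lebesgue_on \<Omega>)"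
  using assms by (auto simp: smooth_borel smooth_deriv sqi_def)
 show ?thesis
  by (rule sqi_bound[OF assms(4), of _ B]) (auto intro!: mult_right_mono assms(2))
qed

lemma compose_sqi:
 assumes "smooth G" "G 0 = 0" "\<And>z. \<bar>deriv G z\<bar> \<le> B" "sqi (lebesgue_on \<Omega>) w"
 shows "sqi (lebesgue_on \<Omega>) (\<lambda>x. G (w x))"
proof -
 have [measurable]: "G \<in> borel_measurable borel" "w \<in> borel_measurable (lebesgue_on \<Omega>)"
  using assms by (auto simp: smooth_borel sqi_def)
 show ?thesis
  by (rule sqi_bound[OF assms(4), of _ B])
    (use Lipschitz_of_deriv_bound[OF assms(1,3), of _ 0] assms(2) in auto)
qed

text \<open>Composition with \<open>G\<close> maps test functions to test functions, since
  \<open>G 0 = 0\<close> keeps the support compact. Along an approximating sequence the functions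
  converge by the Lipschitz bound and the gradients
  \<open>deriv G (\<phi> j x) *\<^sub>R grad (\<phi> j) x\<close> by
  \<open>nemytskii_tendsto\<close>, which gives the chain rule and membership in the closure
  together.\<close>

lemma H01_compose:
 assumes w: "w \<in> H01 \<Omega>" and G: "smooth G" "G 0 = 0" "\<And>z. \<bar>deriv G z\<bar> \<le> B"
 shows "(\<lambda>x. G (w x)) \<in> H01 \<Omega>"
  "AE x in lebesgue_on \<Omega>. weak_grad \<Omega> (\<lambda>x. G (w x)) x = deriv G (w x) *\<^sub>R weak_grad \<Omega> w x"
proof -
 from H01_approx[OF w] obtain \<phi> where \<phi>: "\<And>j::nat. \<phi> j \<in> test_functions \<Omega>"
  and l: "(\<lambda>j. L2n (lebesgue_on \<Omega>) (\<lambda>x. \<phi> j x - w x)) \<longlonglongrightarrow> 0"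
   "(\<lambda>j. L2n (lebesgue_on \<Omega>) (\<lambda>x. grad (\<phi> j) x - weak_grad \<Omega> w x)) \<longlonglongrightarrow> 0" by blast
 note wH = H01_H1[OF w]
 note ws = H1_D(2,3)[OF op bd wH]
 note t = test_sqi[OF op bd \<phi>]
 let ?g = "\<lambda>x. deriv G (w x) *\<^sub>R weak_grad \<Omega> w x"
 have gs: "sqi (lebesgue_on \<Omega>) (\<lambda>x. G (w x))" "sqi (lebesgue_on \<Omega>) ?g"
  by (rule compose_sqi[OF G ws(1)], rule deriv_scaleR_sqi[OF G(1,3) ws])
 have Gt: "(\<lambda>x. G (\<phi> j x)) \<in> test_functions \<Omega>" for j
  by (rule test_function_compose[OF \<phi> G(1,2)])
 have gradt: "grad (\<lambda>x. G (\<phi> j x)) = (\<lambda>x. deriv G (\<phi> j x) *\<^sub>R grad (\<phi> j) x)" for j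
  using \<phi>[of j] G(1) by (auto simp: fun_eq_iff grad_compose_real elim: test_functionE)
 have B: "0 \<le> B" using G(3)[of 0] by simp
 have l1: "(\<lambda>j. L2n (lebesgue_on \<Omega>) (\<lambda>x. G (\<phi> j x) - G (w x))) \<longlonglongrightarrow> 0"
 proof (rule tendsto_sandwich[OF _ _ tendsto_const])
  show "(\<lambda>j. B * L2n (lebesgue_on \<Omega>) (\<lambda>x. \<phi> j x - w x)) \<longlonglongrightarrow> 0"
   using tendsto_mult[OF tendsto_const l(1)] by simp
  show "\<forall>\<^sub>F j in sequentially. L2n (lebesgue_on \<Omega>) (\<lambda>x. G (\<phi> j x) - G (w x)) \<le> B * L2n (lebesgue_on \<Omega>) (\<lambda>x. \<phi> j x - w x)"
   by (intro always_eventually allI L2n_mono_AE sqi_diff t ws B sqi_measurable gs test_sqi(1)[OF op bd Gt])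
     (simp add: Lipschitz_of_deriv_bound[OF G(1,3)])
 qed auto
 have l2: "(\<lambda>j. L2n (lebesgue_on \<Omega>) (\<lambda>x. grad (\<lambda>x. G (\<phi> j x)) x - ?g x)) \<longlonglongrightarrow> 0"
  unfolding gradt
  by (rule nemytskii_tendsto[OF t(1) ws(1) t(2) ws(2) l smooth_continuous[OF smooth_deriv[OF G(1)]] G(3)])
 have wg: "has_weak_gradient \<Omega> (\<lambda>x. G (w x)) ?g"
 proof (rule weak_gradient_limit[OF _ _ _ gs l1 l2])
  show "sqi (lebesgue_on \<Omega>) (\<lambda>x. G (\<phi> j x))" "sqi (lebesgue_on \<Omega>) (grad (\<lambda>x. G (\<phi> j x)))" for j
   by (intro test_sqi[OF op bd Gt])+
  show "has_weak_gradient \<Omega> (\<lambda>x. G (\<phi> j x)) (grad (\<lambda>x. G (\<phi> j x)))" for j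
   by (rule has_weak_gradientI[OF op bd test_sqi(1,2)[OF op bd Gt]])
     (simp add: test_function_mult_integral[OF op bd Gt] grad_inner)
 qed
 show ae: "AE x in lebesgue_on \<Omega>. weak_grad \<Omega> (\<lambda>x. G (w x)) x = ?g x"
  by (rule weak_gradient_AE[OF op bd wg])
 have GH: "(\<lambda>x. G (w x)) \<in> H1 \<Omega>" by (rule H1_I[OF op bd wg gs])
 have "(\<lambda>j. H1_norm \<Omega> (\<lambda>x. G (w x) - G (\<phi> j x))) \<longlonglongrightarrow> 0"
 proof (rule tendsto_sandwich[OF _ _ tendsto_const tendsto_add_zero[OF l1 l2]])
  show "\<forall>\<^sub>F j in sequentially. H1_norm \<Omega> (\<lambda>x. G (w x) - G (\<phi> j x)) \<le>
    L2n (lebesgue_on \<Omega>) (\<lambda>x. G (\<phi> j x) - G (w x)) + L2n (lebesgue_on \<Omega>) (\<lambda>x. grad (\<lambda>x. G (\<phi> j x)) x - ?g x)"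
  proof (intro always_eventually allI)
   fix j
   have "L2n (lebesgue_on \<Omega>) (\<lambda>x. grad (\<lambda>x. G (\<phi> j x)) x - ?g x) =
     L2n (lebesgue_on \<Omega>) (\<lambda>x. weak_grad \<Omega> (\<lambda>x. G (w x)) x - weak_grad \<Omega> (\<lambda>x. G (\<phi> j x)) x)"
    unfolding L2n_minus_commute[of _ "grad (\<lambda>x. G (\<phi> j x))"]
   proof (rule L2n_cong_AE)
    show "AE x in lebesgue_on \<Omega>. ?g x - grad (\<lambda>x. G (\<phi> j x)) x =
      weak_grad \<Omega> (\<lambda>x. G (w x)) x - weak_grad \<Omega> (\<lambda>x. G (\<phi> j x)) x"
     using ae test_function_H1(2)[OF op bd Gt[of j]] by eventually_elim simp
   qed (intro borel_measurable_diff sqi_measurable gs test_sqi[OF op bd Gt] H1_D(3)[OF op bd GH]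
     H1_D(3)[OF op bd test_function_H1(1)[OF op bd Gt]])+
   then show "H1_norm \<Omega> (\<lambda>x. G (w x) - G (\<phi> j x)) \<le>
    L2n (lebesgue_on \<Omega>) (\<lambda>x. G (\<phi> j x) - G (w x)) + L2n (lebesgue_on \<Omega>) (\<lambda>x. grad (\<lambda>x. G (\<phi> j x)) x - ?g x)"
    using H1_diff_L2n_le(3)[OF op bd GH test_function_H1(1)[OF op bd Gt[of j]]]
    by (simp add: L2n_minus_commute[of _ "\<lambda>x. G (\<phi> j x)"])
  qed
 qed (auto simp: H1_norm_nonneg)
 moreover have "AE x in lebesgue. x \<notin> \<Omega> \<longrightarrow> G (w x) = 0"
  using w G(2) by (auto simp: H01_def elim: eventually_mono)
 ultimately show "(\<lambda>x. G (w x)) \<in> H01 \<Omega>"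
  using GH Gt by (auto simp: H01_def intro!: exI[of _ "\<lambda>j x. G (\<phi> j x)"])
qed

lemma H01_compose_norm_le:
 assumes w: "w \<in> H01 \<Omega>" and G: "smooth G" "G 0 = 0" "\<And>z. \<bar>deriv G z\<bar> \<le> B"
 shows "H1_norm \<Omega> (\<lambda>x. G (w x)) \<le> B * H1_norm \<Omega> w"
proof -
 note wH = H01_H1[OF w] and GH = H01_H1[OF H01_compose(1)[OF w G]]
 show ?thesis
  unfolding H1_norm_L2n(1)[OF op bd wH] H1_norm_L2n(1)[OF op bd GH]
 proof (rule L2n_mono_AE)
  show "0 \<le> B" using G(3)[of 0] by simp
  show "AE x in lebesgue_on \<Omega>. norm (G (w x), weak_grad \<Omega> (\<lambda>x. G (w x)) x) \<le> B * norm (w x, weak_grad \<Omega> w x)"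
   using H01_compose(2)[OF w G]
  proof eventually_elim
   case (elim x)
   have "\<bar>G (w x)\<bar> \<le> B * \<bar>w x\<bar>" using Lipschitz_of_deriv_bound[OF G(1,3), of "w x" 0] G(2) by simp
   moreover have "norm (weak_grad \<Omega> (\<lambda>x. G (w x)) x) \<le> B * norm (weak_grad \<Omega> w x)"
    unfolding elim by (auto intro!: mult_right_mono G)
   ultimately have "(G (w x))\<^sup>2 + (norm (weak_grad \<Omega> (\<lambda>x. G (w x)) x))\<^sup>2 \<le> (B * \<bar>w x\<bar>)\<^sup>2 + (B * norm (weak_grad \<Omega> w x))\<^sup>2"
    by (intro add_mono) (auto intro: power_mono abs_le_square_iff[THEN iffD1] order_trans[OF _ abs_ge_self])
   also have "\<dots> = (B * norm (w x, weak_grad \<Omega> w x))\<^sup>2"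
    by (simp add: norm_Pair power_mult_distrib distrib_left)
   finally have "sqrt ((G (w x))\<^sup>2 + (norm (weak_grad \<Omega> (\<lambda>x. G (w x)) x))\<^sup>2) \<le> B * norm (w x, weak_grad \<Omega> w x)"
    using \<open>0 \<le> B\<close> by (intro real_le_lsqrt) auto
   then show ?case by (simp add: norm_Pair)
  qed
 qed (intro H1_norm_L2n[OF op bd] sqi_measurable wH GH)+
qed

text \<open>Composition is continuous on \<open>H01 \<Omega>\<close>, although a bounded derivative
  does not make it Lipschitz there. Continuity is what transports step function approximations, and
  with them strong measurability, through \<open>G\<close>.\<close>

lemma H01_compose_tendsto:
 assumes w: "\<And>j. wj j \<in> H01 \<Omega>" "w \<in> H01 \<Omega>" and G: "smooth G" "G 0 = 0" "\<And>z. \<bar>deriv G z\<bar> \<le> B"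
  and lim: "(\<lambda>j. H1_norm \<Omega> (\<lambda>x. w x - wj j x)) \<longlonglongrightarrow> 0"
 shows "(\<lambda>j. H1_norm \<Omega> (\<lambda>x. G (w x) - G (wj j x))) \<longlonglongrightarrow> 0"
proof -
 note H = w[THEN H01_H1]
 note GH = w[THEN H01_compose(1)[OF _ G], THEN H01_H1]
 note s = H[THEN H1_D(2)[OF op bd]] H[THEN H1_D(3)[OF op bd]]
 note Gs = GH[THEN H1_D(2)[OF op bd]] GH[THEN H1_D(3)[OF op bd]]
 have B: "0 \<le> B" using G(3)[of 0] by simp
 have l: "(\<lambda>j. L2n (lebesgue_on \<Omega>) (\<lambda>x. wj j x - w x)) \<longlonglongrightarrow> 0"
  by (rule tendsto_sandwich[OF _ _ tendsto_const lim])
    (use H1_diff_L2n_le(1)[OF op bd H(2,1)] in \<open>auto simp: L2n_minus_commute[of _ _ w]\<close>)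
 have l': "(\<lambda>j. L2n (lebesgue_on \<Omega>) (\<lambda>x. weak_grad \<Omega> (wj j) x - weak_grad \<Omega> w x)) \<longlonglongrightarrow> 0"
  by (rule tendsto_sandwich[OF _ _ tendsto_const lim])
    (use H1_diff_L2n_le(2)[OF op bd H(2,1)] in \<open>auto simp: L2n_minus_commute[of _ _ "weak_grad \<Omega> w"]\<close>)
 have l1: "(\<lambda>j. L2n (lebesgue_on \<Omega>) (\<lambda>x. G (w x) - G (wj j x))) \<longlonglongrightarrow> 0"
 proof (rule tendsto_sandwich[OF _ _ tendsto_const])
  show "(\<lambda>j. B * L2n (lebesgue_on \<Omega>) (\<lambda>x. wj j x - w x)) \<longlonglongrightarrow> 0"
   using tendsto_mult[OF tendsto_const l] by simp
  show "\<forall>\<^sub>F j in sequentially. L2n (lebesgue_on \<Omega>) (\<lambda>x. G (w x) - G (wj j x)) \<le> B * L2n (lebesgue_on \<Omega>) (\<lambda>x. wj j x - w x)"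
   unfolding L2n_minus_commute[of _ "\<lambda>x. G (w x)"]
   by (intro always_eventually allI L2n_mono_AE sqi_diff s B sqi_measurable Gs)
     (simp add: Lipschitz_of_deriv_bound[OF G(1,3)])
 qed auto
 have l2: "(\<lambda>j. L2n (lebesgue_on \<Omega>) (\<lambda>x. deriv G (wj j x) *\<^sub>R weak_grad \<Omega> (wj j) x - deriv G (w x) *\<^sub>R weak_grad \<Omega> w x)) \<longlonglongrightarrow> 0"
  by (rule nemytskii_tendsto[OF s(1-4) l l' smooth_continuous[OF smooth_deriv[OF G(1)]] G(3)])
 show ?thesis
 proof (rule tendsto_sandwich[OF _ _ tendsto_const tendsto_add_zero[OF l1 l2]])
  show "\<forall>\<^sub>F j in sequentially. H1_norm \<Omega> (\<lambda>x. G (w x) - G (wj j x)) \<le>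
    L2n (lebesgue_on \<Omega>) (\<lambda>x. G (w x) - G (wj j x)) +
    L2n (lebesgue_on \<Omega>) (\<lambda>x. deriv G (wj j x) *\<^sub>R weak_grad \<Omega> (wj j) x - deriv G (w x) *\<^sub>R weak_grad \<Omega> w x)"
  proof (intro always_eventually allI)
   fix j
   have "L2n (lebesgue_on \<Omega>) (\<lambda>x. deriv G (wj j x) *\<^sub>R weak_grad \<Omega> (wj j) x - deriv G (w x) *\<^sub>R weak_grad \<Omega> w x) =
     L2n (lebesgue_on \<Omega>) (\<lambda>x. weak_grad \<Omega> (\<lambda>x. G (w x)) x - weak_grad \<Omega> (\<lambda>x. G (wj j x)) x)"
    unfolding L2n_minus_commute[of _ "\<lambda>x. weak_grad \<Omega> (\<lambda>x. G (w x)) x"]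
   proof (rule L2n_cong_AE)
    show "AE x in lebesgue_on \<Omega>. deriv G (wj j x) *\<^sub>R weak_grad \<Omega> (wj j) x - deriv G (w x) *\<^sub>R weak_grad \<Omega> w x =
      weak_grad \<Omega> (\<lambda>x. G (wj j x)) x - weak_grad \<Omega> (\<lambda>x. G (w x)) x"
     using H01_compose(2)[OF w(1)[of j] G] H01_compose(2)[OF w(2) G] by eventually_elim simp
   qed (intro borel_measurable_diff sqi_measurable Gs deriv_scaleR_sqi[OF G(1,3)] s)+
   then show "H1_norm \<Omega> (\<lambda>x. G (w x) - G (wj j x)) \<le>
    L2n (lebesgue_on \<Omega>) (\<lambda>x. G (w x) - G (wj j x)) +
    L2n (lebesgue_on \<Omega>) (\<lambda>x. deriv G (wj j x) *\<^sub>R weak_grad \<Omega> (wj j) x - deriv G (w x) *\<^sub>R weak_grad \<Omega> w x)"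
    using H1_diff_L2n_le(3)[OF op bd GH(2) GH(1)[of j]] by simp
  qed
 qed (auto simp: H1_norm_nonneg)
qed

lemma H01_lincomb:
 assumes w: "w \<in> H01 \<Omega>" and z: "z \<in> H01 \<Omega>"
 shows "(\<lambda>x. a * w x + b * z x) \<in> H01 \<Omega>"
proof -
 note H = H01_H1[OF w] H01_H1[OF z]
 from w obtain \<phi> where \<phi>: "\<And>j::nat. \<phi> j \<in> test_functions \<Omega>" "(\<lambda>j. H1_norm \<Omega> (\<lambda>x. w x - \<phi> j x)) \<longlonglongrightarrow> 0"
  by (auto simp: H01_def)
 from z obtain \<psi> where \<psi>: "\<And>j::nat. \<psi> j \<in> test_functions \<Omega>" "(\<lambda>j. H1_norm \<Omega> (\<lambda>x. z x - \<psi> j x)) \<longlonglongrightarrow> 0"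
  by (auto simp: H01_def)
 have t: "(\<lambda>x. a * \<phi> j x + b * \<psi> j x) \<in> test_functions \<Omega>" for j
 proof -
  from \<phi>(1)[of j] obtain K where K: "smooth (\<phi> j)" "compact K" "K \<subseteq> \<Omega>" "\<And>x. x \<notin> K \<Longrightarrow> \<phi> j x = 0"
   by (rule test_functionE) blast
  from \<psi>(1)[of j] obtain L where L: "smooth (\<psi> j)" "compact L" "L \<subseteq> \<Omega>" "\<And>x. x \<notin> L \<Longrightarrow> \<psi> j x = 0"
   by (rule test_functionE) blast
  show ?thesis
   by (rule smooth_test_function[where K="K \<union> L"])
     (use K L in \<open>auto intro!: smooth_add smooth_mult\<close>)
 qed
 have "(\<lambda>j. H1_norm \<Omega> (\<lambda>x. (a * w x + b * z x) - (a * \<phi> j x + b * \<psi> j x))) \<longlonglongrightarrow> 0"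
 proof (rule tendsto_sandwich[OF _ _ tendsto_const])
  show "(\<lambda>j. \<bar>a\<bar> * H1_norm \<Omega> (\<lambda>x. w x - \<phi> j x) + \<bar>b\<bar> * H1_norm \<Omega> (\<lambda>x. z x - \<psi> j x)) \<longlonglongrightarrow> 0"
   using tendsto_add[OF tendsto_mult[OF tendsto_const \<phi>(2), of "\<bar>a\<bar>"] tendsto_mult[OF tendsto_const \<psi>(2), of "\<bar>b\<bar>"]] by simp
  show "\<forall>\<^sub>F j in sequentially. H1_norm \<Omega> (\<lambda>x. (a * w x + b * z x) - (a * \<phi> j x + b * \<psi> j x)) \<le>
    \<bar>a\<bar> * H1_norm \<Omega> (\<lambda>x. w x - \<phi> j x) + \<bar>b\<bar> * H1_norm \<Omega> (\<lambda>x. z x - \<psi> j x)"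
  proof (intro always_eventually allI)
   fix j
   have "(\<lambda>x. (a * w x + b * z x) - (a * \<phi> j x + b * \<psi> j x)) = (\<lambda>x. a * (w x - \<phi> j x) + b * (z x - \<psi> j x))"
    by (simp add: fun_eq_iff algebra_simps)
   then show "H1_norm \<Omega> (\<lambda>x. (a * w x + b * z x) - (a * \<phi> j x + b * \<psi> j x)) \<le>
    \<bar>a\<bar> * H1_norm \<Omega> (\<lambda>x. w x - \<phi> j x) + \<bar>b\<bar> * H1_norm \<Omega> (\<lambda>x. z x - \<psi> j x)"
    using H1_norm_lincomb(2)[OF op bd H1_norm_diff(1)[OF op bd H(1) test_function_H1(1)[OF op bd \<phi>(1)]]
      H1_norm_diff(1)[OF op bd H(2) test_function_H1(1)[OF op bd \<psi>(1)]], of a j b j] by simp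
  qed
 qed (auto simp: H1_norm_nonneg)
 moreover have "AE x in lebesgue. x \<notin> \<Omega> \<longrightarrow> w x = 0" "AE x in lebesgue. x \<notin> \<Omega> \<longrightarrow> z x = 0"
  using w z by (auto simp: H01_def)
 then have "AE x in lebesgue. x \<notin> \<Omega> \<longrightarrow> a * w x + b * z x = 0" by eventually_elim simp
 ultimately show ?thesis
  using H1_lincomb(1)[OF op bd H, of a b] t by (auto simp: H01_def intro!: exI[of _ "\<lambda>j x. a * \<phi> j x + b * \<psi> j x"])
qed

lemma H01_zero: "(\<lambda>x. 0) \<in> H01 \<Omega>" "H1_norm \<Omega> (\<lambda>x. 0) = 0"
proof -
 have t: "(\<lambda>x. 0 :: real) \<in> test_functions \<Omega>"
  by (rule smooth_test_function[where K="{}"]) auto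
 note H = test_function_H1(1)[OF op bd t]
 show 0: "H1_norm \<Omega> (\<lambda>x. 0) = 0"
  using H1_norm_lincomb(2)[OF op bd H H, of 0 0] H1_norm_nonneg[of \<Omega> "\<lambda>x. 0"] by simp
 show "(\<lambda>x. 0) \<in> H01 \<Omega>"
  using H t 0 by (auto simp: H01_def intro!: exI[of _ "\<lambda>_ _. 0"])
qed

text \<open>The inequality for test functions passes to the limit by Fatou's lemma along a
  subsequence that converges almost everywhere, while the gradient norms converge.\<close>

lemma sobolev_H01:
 assumes w: "w \<in> H01 \<Omega>" and n: "n = real DIM('a)" "n > 2"
 shows "integrable (lebesgue_on \<Omega>) (\<lambda>x. \<bar>w x\<bar> powr (2 * n / (n - 2)))"
  "(LINT x|lebesgue_on \<Omega>. \<bar>w x\<bar> powr (2 * n / (n - 2))) powr ((n - 2) / n)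
   \<le> (2 * (n - 1) / (n - 2))\<^sup>2 * (L2n (lebesgue_on \<Omega>) (weak_grad \<Omega> w))\<^sup>2"
proof -
 let ?q = "2 * n / (n - 2)" and ?C = "2 * (n - 1) / (n - 2)"
 let ?M = "lebesgue_on \<Omega>"
 have q: "?q > 0" "(n - 2) / n > 0" using n(2) by auto
 from H01_approx[OF w] obtain \<phi> where \<phi>: "\<And>j::nat. \<phi> j \<in> test_functions \<Omega>"
  and l: "(\<lambda>j. L2n ?M (\<lambda>x. \<phi> j x - w x)) \<longlonglongrightarrow> 0"
   "(\<lambda>j. L2n ?M (\<lambda>x. grad (\<phi> j) x - weak_grad \<Omega> w x)) \<longlonglongrightarrow> 0" by blast
 note ws = H1_D(2,3)[OF op bd H01_H1[OF w]]
 note t = test_sqi[OF op bd \<phi>]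
 obtain r where r: "strict_mono r" "AE x in ?M. (\<lambda>j. \<phi> (r j) x) \<longlonglongrightarrow> w x"
  using L2n_AE_subseq[OF t(1) ws(1) l(1)] by blast
 have wm [measurable]: "w \<in> borel_measurable ?M" using ws by (simp add: sqi_def)
 have pm [measurable]: "\<phi> j \<in> borel_measurable ?M" for j using t by (simp add: sqi_def)
 have sob: "(LINT x|?M. \<bar>\<phi> j x\<bar> powr ?q) powr ((n - 2) / n) \<le> ?C\<^sup>2 * (L2n ?M (grad (\<phi> j)))\<^sup>2"
   "integrable ?M (\<lambda>x. \<bar>\<phi> j x\<bar> powr ?q)" for j
 proof -
  from \<phi>[of j] obtain K where K: "smooth (\<phi> j)" "K \<subseteq> \<Omega>" "\<And>x. x \<notin> K \<Longrightarrow> \<phi> j x = 0"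
    "\<And>x b. x \<notin> K \<Longrightarrow> frechet_derivative (\<phi> j) (at x) b = 0"
   by (rule test_functionE) blast
  have trans: "integrable ?M h \<and> (LINT x|?M. h x) = (LINT x|lborel. h x)"
   if "integrable lborel h" "\<And>x. x \<notin> K \<Longrightarrow> h x = 0" for h :: "'a \<Rightarrow> real"
  proof -
   have h: "indicator \<Omega> x *\<^sub>R h x = h x" for x using that(2)[of x] K(2) by (auto simp: indicator_def)
   moreover have "h \<in> borel_measurable lborel" using that(1) by auto
   ultimately show ?thesis
    using that(1) sets_leb[OF op bd]
    by (simp add: integrable_restrict_space integral_restrict_space integrable_completion integral_completion
      h del: real_scaleR_def)
  qed
  have g: "grad (\<phi> j) x = 0" if "x \<notin> K" for x using K(4)[OF that] by (simp add: grad_def)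
  note S = sobolev_test_function[OF \<phi>[of j] n]
  have 1: "integrable ?M (\<lambda>x. \<bar>\<phi> j x\<bar> powr ?q) \<and> (LINT x|?M. \<bar>\<phi> j x\<bar> powr ?q) = (LINT x|lborel. \<bar>\<phi> j x\<bar> powr ?q)"
   by (rule trans[OF S(1)]) (use K(3) q in simp)
  have 2: "(LINT x|?M. (norm (grad (\<phi> j) x))\<^sup>2) = (LINT x|lborel. (norm (grad (\<phi> j) x))\<^sup>2)"
   using trans[OF S(2)] g by simp
  show "integrable ?M (\<lambda>x. \<bar>\<phi> j x\<bar> powr ?q)" using 1 by blast
  show "(LINT x|?M. \<bar>\<phi> j x\<bar> powr ?q) powr ((n - 2) / n) \<le> ?C\<^sup>2 * (L2n ?M (grad (\<phi> j)))\<^sup>2"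
   using S(3) 1 by (simp add: L2n_sq 2)
 qed
 let ?D = "L2n ?M (weak_grad \<Omega> w)"
 \<comment> \<open>The inequality is solved for the integral itself, because Fatou's lemma applies
   to the integral and not to its power.\<close>
 let ?R = "\<lambda>d. (?C\<^sup>2 * d\<^sup>2) powr (n / (n - 2))"
 have Dl: "(\<lambda>j. L2n ?M (grad (\<phi> j))) \<longlonglongrightarrow> ?D"
 proof (rule LIM_zero_cancel, rule Lim_null_comparison[OF _ l(2)])
  show "\<forall>\<^sub>F j in sequentially. norm (L2n ?M (grad (\<phi> j)) - ?D) \<le> L2n ?M (\<lambda>x. grad (\<phi> j) x - weak_grad \<Omega> w x)"
   using L2n_reverse_triangle[OF t(2) ws(2)] by simp
 qed
 have le: "(LINT x|?M. \<bar>\<phi> j x\<bar> powr ?q) \<le> ?R (L2n ?M (grad (\<phi> j)))" for j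
 proof -
  have "((LINT x|?M. \<bar>\<phi> j x\<bar> powr ?q) powr ((n - 2) / n)) powr (n / (n - 2)) \<le> ?R (L2n ?M (grad (\<phi> j)))"
   using n(2) sob(1)[of j] by (intro powr_mono2) auto
  then show ?thesis using n(2) by (simp add: powr_powr)
 qed
 have lim: "(\<lambda>j. ?R (L2n ?M (grad (\<phi> (r j))))) \<longlonglongrightarrow> ?R ?D"
  using LIMSEQ_subseq_LIMSEQ[OF Dl r(1)] n(2)
  by (intro tendsto_powr' tendsto_intros) (auto simp: o_def)
 have "(\<integral>\<^sup>+x. ennreal (\<bar>w x\<bar> powr ?q) \<partial>?M) = (\<integral>\<^sup>+x. liminf (\<lambda>j. ennreal (\<bar>\<phi> (r j) x\<bar> powr ?q)) \<partial>?M)"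
 proof (rule nn_integral_cong_AE)
  show "AE x in ?M. ennreal (\<bar>w x\<bar> powr ?q) = liminf (\<lambda>j. ennreal (\<bar>\<phi> (r j) x\<bar> powr ?q))"
   using r(2)
  proof eventually_elim
   case (elim x)
   have "(\<lambda>j. ennreal (\<bar>\<phi> (r j) x\<bar> powr ?q)) \<longlonglongrightarrow> ennreal (\<bar>w x\<bar> powr ?q)"
    using q elim by (intro tendsto_ennrealI tendsto_powr' tendsto_intros) auto
   from lim_imp_Liminf[OF _ this] show ?case by simp
  qed
 qed
 also have "\<dots> \<le> liminf (\<lambda>j. \<integral>\<^sup>+x. ennreal (\<bar>\<phi> (r j) x\<bar> powr ?q) \<partial>?M)"
  by (intro nn_integral_liminf) measurable
 also have "\<dots> \<le> liminf (\<lambda>j. ennreal (?R (L2n ?M (grad (\<phi> (r j))))))"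
 proof (intro Liminf_mono always_eventually allI)
  fix j
  show "(\<integral>\<^sup>+x. ennreal (\<bar>\<phi> (r j) x\<bar> powr ?q) \<partial>?M) \<le> ennreal (?R (L2n ?M (grad (\<phi> (r j)))))"
   using le[of "r j"] sob(2)[of "r j"] by (subst nn_integral_eq_integral) (auto intro: ennreal_leI)
 qed
 also have "\<dots> = ennreal (?R ?D)"
  using lim_imp_Liminf[OF _ tendsto_ennrealI[OF lim]] by simp
 finally have fin: "(\<integral>\<^sup>+x. ennreal (\<bar>w x\<bar> powr ?q) \<partial>?M) \<le> ennreal (?R ?D)" .
 show i: "integrable ?M (\<lambda>x. \<bar>w x\<bar> powr ?q)"
  by (rule integrableI_bounded) (use fin in \<open>auto simp: le_less_trans\<close>)
 have "(LINT x|?M. \<bar>w x\<bar> powr ?q) \<le> ?R ?D"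
  using fin i by (subst (asm) nn_integral_eq_integral) auto
 then have "(LINT x|?M. \<bar>w x\<bar> powr ?q) powr ((n - 2) / n) \<le> (?R ?D) powr ((n - 2) / n)"
  using q by (intro powr_mono2) auto
 then show "(LINT x|?M. \<bar>w x\<bar> powr ?q) powr ((n - 2) / n) \<le> ?C\<^sup>2 * ?D\<^sup>2"
  using n(2) by (simp add: powr_powr)
qed

end

subsection \<open>Strong measurability\<close>

text \<open>Completeness of Lebesgue measure: a change on a null set keeps measurability.\<close>

lemma measurable_AE_lebesgue_on:
 fixes f g :: "'a::euclidean_space \<Rightarrow> real"
 assumes S: "S \<in> sets lebesgue" and f: "f \<in> borel_measurable (lebesgue_on S)"
  and ae: "AE x in lebesgue_on S. f x = g x"
 shows "g \<in> borel_measurable (lebesgue_on S)"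
proof -
 have "(\<lambda>x. indicator S x *\<^sub>R f x) \<in> borel_measurable lebesgue"
  using f S by (simp add: borel_measurable_restrict_space_iff)
 moreover have "AE x in lebesgue. x \<in> S \<longrightarrow> f x = g x"
  using ae S by (simp add: AE_restrict_space_iff)
 then have "AE x in lebesgue. indicator S x *\<^sub>R f x = indicator S x *\<^sub>R g x"
  by eventually_elim (auto simp: indicator_def)
 ultimately have "(\<lambda>x. indicator S x *\<^sub>R g x) \<in> borel_measurable lebesgue"
  by (rule borel_measurable_AE)
 then show ?thesis using S by (simp add: borel_measurable_restrict_space_iff)
qed

lemma measurable_limit_lebesgue_on:
 fixes f :: "nat \<Rightarrow> 'a::euclidean_space \<Rightarrow> real"
 assumes S: "S \<in> sets lebesgue" and f: "\<And>j. f j \<in> borel_measurable (lebesgue_on S)"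
  and ae: "AE x in lebesgue_on S. (\<lambda>j. f j x) \<longlonglongrightarrow> g x"
 shows "g \<in> borel_measurable (lebesgue_on S)"
proof (rule measurable_AE_lebesgue_on[OF S])
 show "(\<lambda>x. lim (\<lambda>j. f j x)) \<in> borel_measurable (lebesgue_on S)"
  using f by (rule borel_measurable_lim_metric)
 show "AE x in lebesgue_on S. lim (\<lambda>j. f j x) = g x"
  using ae by eventually_elim (rule limI)
qed

definition step_fun :: "real \<Rightarrow> ('c \<Rightarrow> real) set \<Rightarrow> (real \<Rightarrow> 'c \<Rightarrow> real) \<Rightarrow> bool" where
 "step_fun T X S \<longleftrightarrow> S ` {0<..<T} \<subseteq> X \<and> finite (S ` {0<..<T}) \<and>
   (\<forall>a. {t \<in> {0<..<T}. S t = a} \<in> sets lebesgue)"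

lemma step_funD: "step_fun T X S \<Longrightarrow> t \<in> space (lebesgue_on {0<..<T}) \<Longrightarrow> S t \<in> X"
 by (auto simp: step_fun_def)

lemma strongly_measurable_iff:
 "strongly_measurable T X N w \<longleftrightarrow> (AE t in lebesgue_on {0<..<T}. w t \<in> X) \<and>
   (\<exists>S. (\<forall>j::nat. step_fun T X (S j)) \<and>
    (AE t in lebesgue_on {0<..<T}. (\<lambda>j. N (\<lambda>x. w t x - S j t x)) \<longlonglongrightarrow> 0))"
 unfolding strongly_measurable_def step_fun_def by blast

text \<open>A step function has finitely many values, each on a measurable set. Any expression in
  its value is therefore measurable as soon as it is so for every fixed value, and no measurable
  structure on the function space is involved.\<close>

lemma step_fun_measurable:
 assumes S: "step_fun T X S" and F: "\<And>a. a \<in> X \<Longrightarrow> F a \<in> measurable (lebesgue_on {0<..<T}) N"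
 shows "(\<lambda>t. F (S t) t) \<in> measurable (lebesgue_on {0<..<T}) N"
proof (rule measurable_compose_countable'[of "S ` {0<..<T}"])
 show "S \<in> measurable (lebesgue_on {0<..<T}) (count_space (S ` {0<..<T}))"
 proof (subst measurable_count_space_eq2)
  have "S -` {a} \<inter> {0<..<T} \<in> sets (lebesgue_on {0<..<T})" for a
  proof -
   have "{t \<in> {0<..<T}. S t = a} \<in> sets lebesgue" using S by (auto simp: step_fun_def)
   moreover have "S -` {a} \<inter> {0<..<T} = {t \<in> {0<..<T}. S t = a}" by auto
   ultimately show ?thesis by (auto simp: sets_restrict_space_iff)
  qed
  then show "S \<in> space (lebesgue_on {0<..<T}) \<rightarrow> S ` {0<..<T} \<and>
    (\<forall>a\<in>S ` {0<..<T}. S -` {a} \<inter> space (lebesgue_on {0<..<T}) \<in> sets (lebesgue_on {0<..<T}))"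
   by auto
 qed (use S in \<open>simp add: step_fun_def\<close>)
 show "countable (S ` {0<..<T})" using S by (auto simp: step_fun_def intro: countable_finite)
 show "(\<lambda>t. F a t) \<in> measurable (lebesgue_on {0<..<T}) N" if "a \<in> S ` {0<..<T}" for a
  using that S by (intro F) (auto simp: step_fun_def)
qed

lemma step_fun_map:
 assumes S: "step_fun T X S" and F: "\<And>a. a \<in> X \<Longrightarrow> F a \<in> Y" and z: "z \<in> Y"
  and P: "{t \<in> {0<..<T}. P t} \<in> sets lebesgue"
 shows "step_fun T Y (\<lambda>t. if P t then F (S t) else z)"
 unfolding step_fun_def
proof (intro conjI allI)
 let ?I = "{0<..<T}"
 show "(\<lambda>t. if P t then F (S t) else z) ` ?I \<subseteq> Y"
  using S F z by (auto simp: step_fun_def)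
 have "(\<lambda>t. if P t then F (S t) else z) ` ?I \<subseteq> insert z (F ` S ` ?I)" by auto
 then show "finite ((\<lambda>t. if P t then F (S t) else z) ` ?I)"
  by (rule finite_subset) (use S in \<open>auto simp: step_fun_def\<close>)
 fix a
 have I: "?I \<in> sets lebesgue" by simp
 have B: "(\<Union>b\<in>{b \<in> S ` ?I. F b = a}. {t \<in> ?I. S t = b}) \<in> sets lebesgue"
  by (rule sets.finite_UN) (use S in \<open>auto simp: step_fun_def\<close>)
 have D: "?I - {t \<in> ?I. P t} \<in> sets lebesgue" using P I by (rule sets.Diff[rotated])
 have eq: "{t \<in> ?I. (if P t then F (S t) else z) = a} =
   ({t \<in> ?I. P t} \<inter> (\<Union>b\<in>{b \<in> S ` ?I. F b = a}. {t \<in> ?I. S t = b})) \<union> (if z = a then ?I - {t \<in> ?I. P t} else {})"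
  by auto
 have "(if z = a then ?I - {t \<in> ?I. P t} else {}) \<in> sets lebesgue" using D by (cases "z = a") simp_all
 then show "{t \<in> ?I. (if P t then F (S t) else z) = a} \<in> sets lebesgue"
  unfolding eq by (rule sets.Un[OF sets.Int[OF P B]])
qed

lemma lebesgue_on_sets:
 assumes "f \<in> borel_measurable (lebesgue_on S)" "S \<in> sets lebesgue" "B \<in> sets borel"
 shows "{x \<in> S. f x \<in> B} \<in> sets lebesgue"
proof -
 have "f -` B \<inter> space (lebesgue_on S) \<in> sets (lebesgue_on S)"
  using assms by (intro measurable_sets[of f _ borel])
 moreover have "f -` B \<inter> space (lebesgue_on S) = {x \<in> S. f x \<in> B}" by auto
 ultimately show ?thesis using assms(2) by (auto simp: sets_restrict_space_iff)
qed

context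
 fixes \<Omega> :: "'a::euclidean_space set" and T :: real
 assumes op: "open \<Omega>" and bd: "bounded \<Omega>" and T: "0 < T"
begin

text \<open>The norm of a step function is trivially measurable, and the reverse triangle inequality
  makes these norms converge to the norm of the limit.\<close>

lemma H1_norm_borel:
 assumes w: "strongly_measurable T (H01 \<Omega>) (H1_norm \<Omega>) w"
 shows "(\<lambda>t. H1_norm \<Omega> (w t)) \<in> borel_measurable (lebesgue_on {0<..<T})"
proof -
 from w obtain S where S: "\<And>j::nat. step_fun T (H01 \<Omega>) (S j)"
  and l: "AE t in lebesgue_on {0<..<T}. (\<lambda>j. H1_norm \<Omega> (\<lambda>x. w t x - S j t x)) \<longlonglongrightarrow> 0"
  and X: "AE t in lebesgue_on {0<..<T}. w t \<in> H01 \<Omega>"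
  unfolding strongly_measurable_iff by blast
 show ?thesis
 proof (rule measurable_limit_lebesgue_on[of _ "\<lambda>j t. H1_norm \<Omega> (S j t)"])
  show "(\<lambda>t. H1_norm \<Omega> (S j t)) \<in> borel_measurable (lebesgue_on {0<..<T})" for j
   by (rule step_fun_measurable[OF S]) simp
  show "AE t in lebesgue_on {0<..<T}. (\<lambda>j. H1_norm \<Omega> (S j t)) \<longlonglongrightarrow> H1_norm \<Omega> (w t)"
   using l X AE_space
  proof eventually_elim
   case (elim t)
   have SH: "S j t \<in> H01 \<Omega>" for j by (rule step_funD[OF S elim(3)])
   have "norm (H1_norm \<Omega> (S j t) - H1_norm \<Omega> (w t)) \<le> H1_norm \<Omega> (\<lambda>x. w t x - S j t x)" for j
    using H1_norm_reverse_triangle[OF op bd H01_H1[OF elim(2)] H01_H1[OF SH[of j]]]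
    by (simp only: real_norm_def abs_minus_commute)
   then show ?case
    by (intro LIM_zero_cancel[OF Lim_null_comparison[OF _ elim(1)]]) auto
  qed
 qed simp
qed

lemma powr2: "0 \<le> (x::real) \<Longrightarrow> x powr 2 = x\<^sup>2"
 by (cases "x = 0") auto

lemma bochner_H01_iff:
 "w \<in> bochner_Lp 2 T (H01 \<Omega>) (H1_norm \<Omega>) \<longleftrightarrow> strongly_measurable T (H01 \<Omega>) (H1_norm \<Omega>) w \<and>
   integrable (lebesgue_on {0<..<T}) (\<lambda>t. (H1_norm \<Omega> (w t))\<^sup>2)"
 by (simp add: bochner_Lp_def powr2 H1_norm_nonneg)

text \<open>This supplies the admissible test functions of the energy inequality. The switch to zero
  from time \<open>\<tau>\<close> on is what allows an estimate at an individual time.\<close>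

lemma bochner_H01_compose:
 assumes w: "w \<in> bochner_Lp 2 T (H01 \<Omega>) (H1_norm \<Omega>)"
  and G: "smooth G" "G 0 = 0" "\<And>z. \<bar>deriv G z\<bar> \<le> B"
 shows "(\<lambda>t. if t < \<tau> then (\<lambda>x. G (w t x)) else (\<lambda>x. 0)) \<in> bochner_Lp 2 T (H01 \<Omega>) (H1_norm \<Omega>)"
  (is "?\<phi> \<in> _")
proof -
 from w obtain S where S: "\<And>j::nat. step_fun T (H01 \<Omega>) (S j)"
  and l: "AE t in lebesgue_on {0<..<T}. (\<lambda>j. H1_norm \<Omega> (\<lambda>x. w t x - S j t x)) \<longlonglongrightarrow> 0"
  and X: "AE t in lebesgue_on {0<..<T}. w t \<in> H01 \<Omega>"
  unfolding bochner_H01_iff strongly_measurable_iff by blast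
 note Gw = H01_compose(1)[OF op bd _ G]
 have sm: "strongly_measurable T (H01 \<Omega>) (H1_norm \<Omega>) ?\<phi>"
  unfolding strongly_measurable_iff
 proof (intro conjI exI allI)
  show "AE t in lebesgue_on {0<..<T}. ?\<phi> t \<in> H01 \<Omega>"
   using X by eventually_elim (auto intro: Gw H01_zero[OF op bd])
  have "{t \<in> {0<..<T}. t < \<tau>} = {0<..<T} \<inter> {..<\<tau>}" by auto
  then have "{t \<in> {0<..<T}. t < \<tau>} \<in> sets lebesgue" by simp
  then show "step_fun T (H01 \<Omega>) (\<lambda>t. if t < \<tau> then (\<lambda>x. G (S j t x)) else (\<lambda>x. 0))" for j
   by (intro step_fun_map[OF S, of "\<lambda>a x. G (a x)"] Gw H01_zero[OF op bd])
  show "AE t in lebesgue_on {0<..<T}. (\<lambda>j. H1_norm \<Omega> (\<lambda>x. ?\<phi> t x - (if t < \<tau> then (\<lambda>x. G (S j t x)) else (\<lambda>x. 0)) x)) \<longlonglongrightarrow> 0"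
   using l X AE_space
  proof eventually_elim
   case (elim t)
   have "S j t \<in> H01 \<Omega>" for j by (rule step_funD[OF S elim(3)])
   from H01_compose_tendsto[OF op bd this elim(2) G elim(1)]
   show ?case by (simp add: H01_zero[OF op bd])
  qed
 qed
 have "integrable (lebesgue_on {0<..<T}) (\<lambda>t. (H1_norm \<Omega> (?\<phi> t))\<^sup>2)"
 proof (rule Bochner_Integration.integrable_bound)
  show "integrable (lebesgue_on {0<..<T}) (\<lambda>t. B\<^sup>2 * (H1_norm \<Omega> (w t))\<^sup>2)"
   using w by (simp add: bochner_H01_iff)
  show "(\<lambda>t. (H1_norm \<Omega> (?\<phi> t))\<^sup>2) \<in> borel_measurable (lebesgue_on {0<..<T})"
   using H1_norm_borel[OF sm] by (intro borel_measurable_power)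
  show "AE t in lebesgue_on {0<..<T}. norm ((H1_norm \<Omega> (?\<phi> t))\<^sup>2) \<le> norm (B\<^sup>2 * (H1_norm \<Omega> (w t))\<^sup>2)"
   using X
  proof eventually_elim
   case (elim t)
   have "H1_norm \<Omega> (?\<phi> t) \<le> B * H1_norm \<Omega> (w t)"
    using H01_compose_norm_le[OF op bd elim G] G(3)[of 0] H1_norm_nonneg[of \<Omega> "w t"]
    by (auto simp: H01_zero[OF op bd])
   from power_mono[OF this H1_norm_nonneg, of 2]
   show ?case by (simp only: power_mult_distrib real_norm_def abs_mult abs_power2)
  qed
 qed
 with sm show ?thesis by (simp add: bochner_H01_iff)
qed

text \<open>Strong measurability gives convergence at almost every time without a dominating
  function. Discarding the values whose norm exceeds twice that of \<open>w t\<close> creates one: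
  the error is then at most \<open>3 * H1_norm \<Omega> (w t)\<close>, and dominated convergence
  yields convergence in the mean square.\<close>

lemma bochner_H01_approx:
 assumes w: "w \<in> bochner_Lp 2 T (H01 \<Omega>) (H1_norm \<Omega>)"
 obtains S where "\<And>j::nat. step_fun T (H01 \<Omega>) (S j)"
  "\<And>j. sqi (lebesgue_on {0<..<T}) (\<lambda>t. H1_norm \<Omega> (\<lambda>x. w t x - S j t x))"
  "(\<lambda>j. L2n (lebesgue_on {0<..<T}) (\<lambda>t. H1_norm \<Omega> (\<lambda>x. w t x - S j t x))) \<longlonglongrightarrow> 0"
  "AE t in lebesgue_on {0<..<T}. (\<lambda>j. H1_norm \<Omega> (\<lambda>x. w t x - S j t x)) \<longlonglongrightarrow> 0"
proof -
 let ?M = "lebesgue_on {0<..<T}"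
 from w obtain S where S: "\<And>j::nat. step_fun T (H01 \<Omega>) (S j)"
  and l: "AE t in ?M. (\<lambda>j. H1_norm \<Omega> (\<lambda>x. w t x - S j t x)) \<longlonglongrightarrow> 0"
  and X: "AE t in ?M. w t \<in> H01 \<Omega>"
  unfolding bochner_H01_iff strongly_measurable_iff by blast
 have sm: "strongly_measurable T (H01 \<Omega>) (H1_norm \<Omega>) w" and wi: "integrable ?M (\<lambda>t. (H1_norm \<Omega> (w t))\<^sup>2)"
  using w by (auto simp: bochner_H01_iff)
 note wm [measurable] = H1_norm_borel[OF sm]
 note z = H01_zero[OF op bd]
 \<comment> \<open>Where the norm of \<open>w t\<close> is positive, the condition holds for all
   large \<open>j\<close> and nothing changes in the limit; where it is zero, the error of
   \<open>R\<close> is zero by the bound.\<close>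
 define R where "R j t = (if H1_norm \<Omega> (S j t) \<le> 2 * H1_norm \<Omega> (w t) then S j t else (\<lambda>x. 0))" for j t
 have R: "step_fun T (H01 \<Omega>) (R j)" for j
 proof -
  have [measurable]: "(\<lambda>t. H1_norm \<Omega> (S j t)) \<in> borel_measurable ?M"
   by (rule step_fun_measurable[OF S]) simp
  have "(\<lambda>t. 2 * H1_norm \<Omega> (w t) - H1_norm \<Omega> (S j t)) \<in> borel_measurable ?M" by measurable
  then have "{t \<in> {0<..<T}. 2 * H1_norm \<Omega> (w t) - H1_norm \<Omega> (S j t) \<in> {0..}} \<in> sets lebesgue"
   by (rule lebesgue_on_sets) simp_all
  also have "{t \<in> {0<..<T}. 2 * H1_norm \<Omega> (w t) - H1_norm \<Omega> (S j t) \<in> {0..}} =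
    {t \<in> {0<..<T}. H1_norm \<Omega> (S j t) \<le> 2 * H1_norm \<Omega> (w t)}" by auto
  finally have "{t \<in> {0<..<T}. H1_norm \<Omega> (S j t) \<le> 2 * H1_norm \<Omega> (w t)} \<in> sets lebesgue" .
  then show ?thesis
   unfolding R_def by (intro step_fun_map[OF S, of "\<lambda>a. a"] z)
 qed
 have Rd: "(\<lambda>t. H1_norm \<Omega> (\<lambda>x. w t x - R j t x)) \<in> borel_measurable ?M" for j
 proof (rule measurable_limit_lebesgue_on[of _ "\<lambda>i t. H1_norm \<Omega> (\<lambda>x. S i t x - R j t x)"])
  show "(\<lambda>t. H1_norm \<Omega> (\<lambda>x. S i t x - R j t x)) \<in> borel_measurable ?M" for i
   by (rule step_fun_measurable[OF S], rule step_fun_measurable[OF R[of j]]) simp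
  show "AE t in ?M. (\<lambda>i. H1_norm \<Omega> (\<lambda>x. S i t x - R j t x)) \<longlonglongrightarrow> H1_norm \<Omega> (\<lambda>x. w t x - R j t x)"
   using l X AE_space
  proof eventually_elim
   case (elim t)
   have SH: "S i t \<in> H1 \<Omega>" for i by (rule H01_H1[OF step_funD[OF S elim(3)]])
   have RH: "R j t \<in> H1 \<Omega>" by (rule H01_H1[OF step_funD[OF R elim(3)]])
   have "norm (H1_norm \<Omega> (\<lambda>x. S i t x - R j t x) - H1_norm \<Omega> (\<lambda>x. w t x - R j t x))
     \<le> H1_norm \<Omega> (\<lambda>x. w t x - S i t x)" for i
    using H1_norm_reverse_triangle[OF op bd H1_norm_diff(1)[OF op bd H01_H1[OF elim(2)] RH] H1_norm_diff(1)[OF op bd SH[of i] RH]]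
    by (simp add: abs_minus_commute)
   then show ?case
    by (intro LIM_zero_cancel[OF Lim_null_comparison[OF _ elim(1)]]) auto
  qed
 qed simp
 have bound: "AE t in ?M. \<forall>j. H1_norm \<Omega> (\<lambda>x. w t x - R j t x) \<le> 3 * H1_norm \<Omega> (w t)"
  using X AE_space
 proof eventually_elim
  case (elim t)
  show ?case
  proof
   fix j
   have RH: "R j t \<in> H1 \<Omega>" by (rule H01_H1[OF step_funD[OF R elim(2)]])
   have "H1_norm \<Omega> (\<lambda>x. w t x - R j t x) \<le> H1_norm \<Omega> (w t) + H1_norm \<Omega> (R j t)"
    using H1_norm_lincomb(2)[OF op bd H01_H1[OF elim(1)] RH, of 1 "-1"] by simp
   moreover have "H1_norm \<Omega> (R j t) \<le> 2 * H1_norm \<Omega> (w t)"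
    using H1_norm_nonneg[of \<Omega> "w t"] z by (auto simp: R_def)
   ultimately show "H1_norm \<Omega> (\<lambda>x. w t x - R j t x) \<le> 3 * H1_norm \<Omega> (w t)" by simp
  qed
 qed
 have lR: "AE t in ?M. (\<lambda>j. H1_norm \<Omega> (\<lambda>x. w t x - R j t x)) \<longlonglongrightarrow> 0"
  using l X AE_space bound
 proof eventually_elim
  case (elim t)
  have SH: "S i t \<in> H1 \<Omega>" for i by (rule H01_H1[OF step_funD[OF S elim(3)]])
  show ?case
  proof (cases "H1_norm \<Omega> (w t) = 0")
   case True
   then have "H1_norm \<Omega> (\<lambda>x. w t x - R j t x) = 0" for j
    using elim(4) H1_norm_nonneg by (metis antisym mult_zero_right)
   then show ?thesis by simp
  next
   case False
   then have pos: "H1_norm \<Omega> (w t) > 0" using H1_norm_nonneg[of \<Omega> "w t"] by simp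
   then have "\<forall>\<^sub>F j in sequentially. H1_norm \<Omega> (\<lambda>x. w t x - S j t x) < H1_norm \<Omega> (w t)"
    using elim(1) by (intro order_tendstoD(2))
   then have "\<forall>\<^sub>F j in sequentially. H1_norm \<Omega> (\<lambda>x. w t x - S j t x) = H1_norm \<Omega> (\<lambda>x. w t x - R j t x)"
   proof eventually_elim
    case (elim j)
    have "H1_norm \<Omega> (S j t) \<le> 2 * H1_norm \<Omega> (w t)"
     using H1_norm_reverse_triangle[OF op bd H01_H1[OF \<open>w t \<in> H01 \<Omega>\<close>] SH[of j]] elim by linarith
    then show ?case by (simp add: R_def)
   qed
   from Lim_transform_eventually[OF elim(1) this] show ?thesis .
  qed
 qed
 have sq: "sqi ?M (\<lambda>t. H1_norm \<Omega> (\<lambda>x. w t x - R j t x))" for j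
 proof (rule sqi_bound[of _ "\<lambda>t. H1_norm \<Omega> (w t)" _ 3])
  show "AE t in ?M. norm (H1_norm \<Omega> (\<lambda>x. w t x - R j t x)) \<le> 3 * norm (H1_norm \<Omega> (w t))"
   using bound by eventually_elim (simp add: H1_norm_nonneg)
 qed (use wi wm Rd in \<open>simp_all add: sqi_def\<close>)
 have "(\<lambda>j. LINT t|?M. (H1_norm \<Omega> (\<lambda>x. w t x - R j t x))\<^sup>2) \<longlonglongrightarrow> (LINT t|?M. 0)"
 proof (rule integral_dominated_convergence[where w="\<lambda>t. 9 * (H1_norm \<Omega> (w t))\<^sup>2"])
  show "AE t in ?M. (\<lambda>j. (H1_norm \<Omega> (\<lambda>x. w t x - R j t x))\<^sup>2) \<longlonglongrightarrow> 0"
   using lR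
  proof eventually_elim
   case (elim t)
   from tendsto_power[OF this, of 2] show ?case by simp
  qed
  show "AE t in ?M. norm ((H1_norm \<Omega> (\<lambda>x. w t x - R j t x))\<^sup>2) \<le> 9 * (H1_norm \<Omega> (w t))\<^sup>2" for j
   using bound
  proof eventually_elim
   case (elim t)
   from power_mono[OF elim[rule_format, of j] H1_norm_nonneg, of 2] show ?case
    by (simp add: power_mult_distrib)
  qed
 qed (use wi Rd in auto)
 then have "(\<lambda>j. L2n ?M (\<lambda>t. H1_norm \<Omega> (\<lambda>x. w t x - R j t x))) \<longlonglongrightarrow> sqrt 0"
  unfolding L2n_def by (intro tendsto_intros) simp
 then show ?thesis using that[OF R sq _ lR] by simp
qed

text \<open>Scaling reduces the estimate to the unit ball over which the supremum is taken. As
  \<open>H1_norm\<close> is only a seminorm on representatives, an argument of norm zero cannot be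
  scaled; there the boundedness required in \<open>Hm1\<close> gives \<open>F z = 0\<close>.\<close>

lemma Hm1_bound:
 assumes F: "F \<in> Hm1 \<Omega>" and z: "z \<in> H01 \<Omega>"
 shows "\<bar>F z\<bar> \<le> Hm1_norm \<Omega> F * H1_norm \<Omega> z" "0 \<le> Hm1_norm \<Omega> F"
proof -
 have "\<exists>C. \<forall>w\<in>H01 \<Omega>. \<bar>F w\<bar> \<le> C * H1_norm \<Omega> w" using F by (simp add: Hm1_def)
 then obtain C where C: "\<And>w. w \<in> H01 \<Omega> \<Longrightarrow> \<bar>F w\<bar> \<le> C * H1_norm \<Omega> w" by blast
 let ?X = "{w \<in> H01 \<Omega>. H1_norm \<Omega> w \<le> 1}"
 have bdd: "bdd_above ((\<lambda>w. \<bar>F w\<bar>) ` ?X)"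
 proof (rule bdd_aboveI2)
  fix w assume w: "w \<in> ?X"
  then have "\<bar>F w\<bar> \<le> C * H1_norm \<Omega> w" using C by simp
  also have "\<dots> \<le> \<bar>C\<bar> * 1"
   using w H1_norm_nonneg by (intro mult_mono) auto
  finally show "\<bar>F w\<bar> \<le> \<bar>C\<bar>" by simp
 qed
 have le: "\<bar>F w\<bar> \<le> Hm1_norm \<Omega> F" if "w \<in> ?X" for w
  unfolding Hm1_norm_def using that bdd by (rule cSUP_upper)
 have "(\<lambda>x. 0) \<in> ?X" using H01_zero[OF op bd] by simp
 from le[OF this] show "0 \<le> Hm1_norm \<Omega> F" by linarith
 show "\<bar>F z\<bar> \<le> Hm1_norm \<Omega> F * H1_norm \<Omega> z"
 proof (cases "H1_norm \<Omega> z = 0")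
  case True
  then show ?thesis using C[OF z] by simp
 next
  case False
  then have pos: "H1_norm \<Omega> z > 0" using H1_norm_nonneg[of \<Omega> z] by simp
  let ?c = "1 / H1_norm \<Omega> z"
  have "(\<lambda>x. ?c * z x + 0 * z x) \<in> ?X"
   using H01_lincomb[OF op bd z z, of ?c 0] H1_norm_lincomb(2)[OF op bd H01_H1[OF z] H01_H1[OF z], of ?c 0] pos by simp
  note 1 = le[OF this]
  have 2: "F (\<lambda>x. ?c * z x + 0 * z x) = ?c * F z + 0 * F z"
   using F z unfolding Hm1_def by blast
  have "\<bar>?c * F z\<bar> \<le> Hm1_norm \<Omega> F" using 1 unfolding 2 by simp
  then show ?thesis using pos by (simp add: abs_mult field_simps)
 qed
qed

lemma Hm1_diff: "F \<in> Hm1 \<Omega> \<Longrightarrow> F' \<in> Hm1 \<Omega> \<Longrightarrow> (\<lambda>w. F w - F' w) \<in> Hm1 \<Omega>"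
proof -
 assume F: "F \<in> Hm1 \<Omega>" "F' \<in> Hm1 \<Omega>"
 have "\<exists>C. \<forall>w\<in>H01 \<Omega>. \<bar>F w\<bar> \<le> C * H1_norm \<Omega> w" "\<exists>C. \<forall>w\<in>H01 \<Omega>. \<bar>F' w\<bar> \<le> C * H1_norm \<Omega> w"
  using F by (simp_all add: Hm1_def)
 then obtain C C' where C: "\<And>w. w \<in> H01 \<Omega> \<Longrightarrow> \<bar>F w\<bar> \<le> C * H1_norm \<Omega> w" "\<And>w. w \<in> H01 \<Omega> \<Longrightarrow> \<bar>F' w\<bar> \<le> C' * H1_norm \<Omega> w"
  by blast
 have "\<bar>F w - F' w\<bar> \<le> (C + C') * H1_norm \<Omega> w" if "w \<in> H01 \<Omega>" for w
  using C(1)[OF that] C(2)[OF that] by (simp add: distrib_right)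
 moreover have "F (\<lambda>x. a * w x + b * z x) - F' (\<lambda>x. a * w x + b * z x) = a * (F w - F' w) + b * (F z - F' z)"
  if "w \<in> H01 \<Omega>" "z \<in> H01 \<Omega>" for w z a b
 proof -
  have "F (\<lambda>x. a * w x + b * z x) = a * F w + b * F z" "F' (\<lambda>x. a * w x + b * z x) = a * F' w + b * F' z"
   using F that unfolding Hm1_def by blast+
  then show ?thesis by (simp add: algebra_simps)
 qed
 ultimately show ?thesis unfolding Hm1_def by blast
qed

lemma Hm1_linear_diff: "F \<in> Hm1 \<Omega> \<Longrightarrow> w \<in> H01 \<Omega> \<Longrightarrow> z \<in> H01 \<Omega> \<Longrightarrow> F (\<lambda>x. w x - z x) = F w - F z"
proof -
 assume a: "F \<in> Hm1 \<Omega>" "w \<in> H01 \<Omega>" "z \<in> H01 \<Omega>"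
 then have "F (\<lambda>x. 1 * w x + (-1) * z x) = 1 * F w + (-1) * F z" unfolding Hm1_def by blast
 then show ?thesis by simp
qed

text \<open>Functional and argument are approximated by step functions at the same time; the paired
  step functions are measurable, and the two errors are controlled by the dual norm and by
  \<open>H1_norm\<close>.\<close>

lemma pairing_measurable:
 assumes F: "strongly_measurable T (Hm1 \<Omega>) (Hm1_norm \<Omega>) F"
  and \<phi>: "strongly_measurable T (H01 \<Omega>) (H1_norm \<Omega>) \<phi>"
 shows "(\<lambda>t. F t (\<phi> t)) \<in> borel_measurable (lebesgue_on {0<..<T})"
proof -
 let ?M = "lebesgue_on {0<..<T}"
 from F obtain S where S: "\<And>j::nat. step_fun T (Hm1 \<Omega>) (S j)"
  and l: "AE t in ?M. (\<lambda>j. Hm1_norm \<Omega> (\<lambda>x. F t x - S j t x)) \<longlonglongrightarrow> 0"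
  and X: "AE t in ?M. F t \<in> Hm1 \<Omega>"
  unfolding strongly_measurable_iff by blast
 from \<phi> obtain R where R: "\<And>j::nat. step_fun T (H01 \<Omega>) (R j)"
  and lR: "AE t in ?M. (\<lambda>j. H1_norm \<Omega> (\<lambda>x. \<phi> t x - R j t x)) \<longlonglongrightarrow> 0"
  and XR: "AE t in ?M. \<phi> t \<in> H01 \<Omega>"
  unfolding strongly_measurable_iff by blast
 show ?thesis
 proof (rule measurable_limit_lebesgue_on[of _ "\<lambda>j t. S j t (R j t)"])
  show "(\<lambda>t. S j t (R j t)) \<in> borel_measurable ?M" for j
  proof (rule step_fun_measurable[OF S, of "\<lambda>a t. a (R j t)"])
   show "(\<lambda>t. a (R j t)) \<in> borel_measurable ?M" for a
    by (rule step_fun_measurable[OF R, of "\<lambda>b t. a b"]) simp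
  qed
  show "AE t in ?M. (\<lambda>j. S j t (R j t)) \<longlonglongrightarrow> F t (\<phi> t)"
   using l X lR XR AE_space
  proof eventually_elim
   case (elim t)
   have SH: "S j t \<in> Hm1 \<Omega>" and RH: "R j t \<in> H01 \<Omega>" for j
    by (rule step_funD[OF S elim(5)], rule step_funD[OF R elim(5)])
   let ?e = "\<lambda>j. H1_norm \<Omega> (\<lambda>x. \<phi> t x - R j t x)" and ?d = "\<lambda>j. Hm1_norm \<Omega> (\<lambda>x. F t x - S j t x)"
   have "norm (S j t (R j t) - F t (\<phi> t)) \<le> ?d j * (H1_norm \<Omega> (\<phi> t) + ?e j) + Hm1_norm \<Omega> (F t) * ?e j" for j
   proof -
    have d: "(\<lambda>x. \<phi> t x - R j t x) \<in> H01 \<Omega>"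
     using H01_lincomb[OF op bd elim(4) RH, of 1 "-1"] by simp
    have "\<bar>F t (R j t) - S j t (R j t)\<bar> \<le> ?d j * H1_norm \<Omega> (R j t)"
     by (rule Hm1_bound(1)[OF Hm1_diff[OF elim(2) SH] RH])
    also have "\<dots> \<le> ?d j * (H1_norm \<Omega> (\<phi> t) + ?e j)"
     using H1_norm_reverse_triangle[OF op bd H01_H1[OF elim(4)] H01_H1[OF RH[of j]]]
     by (intro mult_left_mono Hm1_bound(2)[OF Hm1_diff[OF elim(2) SH] RH]) linarith
    finally have 1: "\<bar>F t (R j t) - S j t (R j t)\<bar> \<le> ?d j * (H1_norm \<Omega> (\<phi> t) + ?e j)" .
    have "\<bar>F t (\<phi> t) - F t (R j t)\<bar> \<le> Hm1_norm \<Omega> (F t) * ?e j"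
     using Hm1_bound(1)[OF elim(2) d] Hm1_linear_diff[OF elim(2,4) RH] by simp
    with 1 show ?thesis by simp
   qed
   note A = this
   have B: "(\<lambda>j. ?d j * (H1_norm \<Omega> (\<phi> t) + ?e j) + Hm1_norm \<Omega> (F t) * ?e j)
     \<longlonglongrightarrow> 0 * (H1_norm \<Omega> (\<phi> t) + 0) + Hm1_norm \<Omega> (F t) * 0"
    by (intro tendsto_intros elim)
   show ?case
    by (rule LIM_zero_cancel, rule Lim_null_comparison[OF _ B[simplified]]) (use A in simp)
  qed
 qed simp
qed

lemma grad_pairing_measurable:
 assumes w: "strongly_measurable T (H01 \<Omega>) (H1_norm \<Omega>) w"
  and \<phi>: "strongly_measurable T (H01 \<Omega>) (H1_norm \<Omega>) \<phi>"
 shows "(\<lambda>t. LINT x|lebesgue_on \<Omega>. weak_grad \<Omega> (w t) x \<bullet> weak_grad \<Omega> (\<phi> t) x) \<in> borel_measurable (lebesgue_on {0<..<T})"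
proof -
 let ?M = "lebesgue_on {0<..<T}"
 let ?a = "\<lambda>w z. LINT x|lebesgue_on \<Omega>. weak_grad \<Omega> w x \<bullet> weak_grad \<Omega> z x"
 from w obtain S where S: "\<And>j::nat. step_fun T (H01 \<Omega>) (S j)"
  and l: "AE t in ?M. (\<lambda>j. H1_norm \<Omega> (\<lambda>x. w t x - S j t x)) \<longlonglongrightarrow> 0"
  and X: "AE t in ?M. w t \<in> H01 \<Omega>"
  unfolding strongly_measurable_iff by blast
 from \<phi> obtain R where R: "\<And>j::nat. step_fun T (H01 \<Omega>) (R j)"
  and lR: "AE t in ?M. (\<lambda>j. H1_norm \<Omega> (\<lambda>x. \<phi> t x - R j t x)) \<longlonglongrightarrow> 0"
  and XR: "AE t in ?M. \<phi> t \<in> H01 \<Omega>"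
  unfolding strongly_measurable_iff by blast
 show ?thesis
 proof (rule measurable_limit_lebesgue_on[of _ "\<lambda>j t. ?a (S j t) (R j t)"])
  show "(\<lambda>t. ?a (S j t) (R j t)) \<in> borel_measurable ?M" for j
  proof (rule step_fun_measurable[OF S, of "\<lambda>a t. ?a a (R j t)"])
   show "(\<lambda>t. ?a a (R j t)) \<in> borel_measurable ?M" for a
    by (rule step_fun_measurable[OF R, of "\<lambda>b t. ?a a b"]) simp
  qed
  show "AE t in ?M. (\<lambda>j. ?a (S j t) (R j t)) \<longlonglongrightarrow> ?a (w t) (\<phi> t)"
   using l X lR XR AE_space
  proof eventually_elim
   case (elim t)
   have SH: "S j t \<in> H1 \<Omega>" and RH: "R j t \<in> H1 \<Omega>" for j
    by (rule H01_H1[OF step_funD[OF S elim(5)]], rule H01_H1[OF step_funD[OF R elim(5)]])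
   note H = H01_H1[OF elim(2)] H01_H1[OF elim(4)]
   note g = H1_D(3)[OF op bd]
   let ?e = "\<lambda>j. H1_norm \<Omega> (\<lambda>x. \<phi> t x - R j t x)" and ?d = "\<lambda>j. H1_norm \<Omega> (\<lambda>x. w t x - S j t x)"
   have "norm (?a (S j t) (R j t) - ?a (w t) (\<phi> t)) \<le> ?d j * (H1_norm \<Omega> (\<phi> t) + ?e j) + H1_norm \<Omega> (w t) * ?e j" for j
   proof -
    have eq: "?a (w t) (\<phi> t) - ?a (S j t) (R j t) =
      (LINT x|lebesgue_on \<Omega>. (weak_grad \<Omega> (w t) x - weak_grad \<Omega> (S j t) x) \<bullet> weak_grad \<Omega> (R j t) x) +
      (LINT x|lebesgue_on \<Omega>. weak_grad \<Omega> (w t) x \<bullet> (weak_grad \<Omega> (\<phi> t) x - weak_grad \<Omega> (R j t) x))"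
     using sqi_inner_integrable[OF g[OF H(1)] g[OF H(2)]] sqi_inner_integrable[OF g[OF H(1)] g[OF RH[of j]]]
      sqi_inner_integrable[OF g[OF SH[of j]] g[OF RH[of j]]]
     by (simp add: inner_diff_left inner_diff_right)
    have "\<bar>LINT x|lebesgue_on \<Omega>. (weak_grad \<Omega> (w t) x - weak_grad \<Omega> (S j t) x) \<bullet> weak_grad \<Omega> (R j t) x\<bar>
      \<le> L2n (lebesgue_on \<Omega>) (\<lambda>x. weak_grad \<Omega> (w t) x - weak_grad \<Omega> (S j t) x) * L2n (lebesgue_on \<Omega>) (weak_grad \<Omega> (R j t))"
     by (intro L2n_Cauchy_Schwarz sqi_diff g H SH RH)
    also have "\<dots> \<le> ?d j * (H1_norm \<Omega> (\<phi> t) + ?e j)"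
     using H1_norm_reverse_triangle[OF op bd H(2) RH[of j]] H1_L2n_le(2)[OF op bd RH[of j]]
     by (intro mult_mono H1_diff_L2n_le(2)[OF op bd H(1) SH]) (auto simp: H1_norm_nonneg)
    finally have 1: "\<bar>LINT x|lebesgue_on \<Omega>. (weak_grad \<Omega> (w t) x - weak_grad \<Omega> (S j t) x) \<bullet> weak_grad \<Omega> (R j t) x\<bar>
      \<le> ?d j * (H1_norm \<Omega> (\<phi> t) + ?e j)" .
    have "\<bar>LINT x|lebesgue_on \<Omega>. weak_grad \<Omega> (w t) x \<bullet> (weak_grad \<Omega> (\<phi> t) x - weak_grad \<Omega> (R j t) x)\<bar>
      \<le> L2n (lebesgue_on \<Omega>) (weak_grad \<Omega> (w t)) * L2n (lebesgue_on \<Omega>) (\<lambda>x. weak_grad \<Omega> (\<phi> t) x - weak_grad \<Omega> (R j t) x)"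
     by (intro L2n_Cauchy_Schwarz sqi_diff g H SH RH)
    also have "\<dots> \<le> H1_norm \<Omega> (w t) * ?e j"
     by (intro mult_mono H1_diff_L2n_le(2)[OF op bd H(2) RH] H1_L2n_le(2)[OF op bd H(1)]) (auto simp: H1_norm_nonneg)
    finally show ?thesis using 1 eq by simp
   qed
   note A = this
   have B: "(\<lambda>j. ?d j * (H1_norm \<Omega> (\<phi> t) + ?e j) + H1_norm \<Omega> (w t) * ?e j)
     \<longlonglongrightarrow> 0 * (H1_norm \<Omega> (\<phi> t) + 0) + H1_norm \<Omega> (w t) * 0"
    by (intro tendsto_intros elim)
   show ?case
    by (rule LIM_zero_cancel, rule Lim_null_comparison[OF _ B[simplified]]) (use A in simp)
  qed
 qed simp
qed

end

section \<open>Borel representatives, mollifiers and averages on the line\<close>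

lemma borel_representative:
 fixes f :: "'a::euclidean_space \<Rightarrow> real"
 assumes f: "f \<in> borel_measurable (lebesgue_on S)" and S: "S \<in> sets borel"
 obtains g where "g \<in> borel_measurable borel" "\<And>x. x \<notin> S \<Longrightarrow> g x = 0"
  "AE x in lebesgue_on S. g x = f x" "AE x in lborel. x \<in> S \<longrightarrow> g x = f x"
proof -
 have "(\<lambda>x. indicator S x * f x) \<in> borel_measurable lebesgue"
  using f S by (simp add: borel_measurable_restrict_space_iff)
 then obtain g where g: "g \<in> borel_measurable lborel" "AE x in lborel. indicator S x * f x = g x"
  using completion_ex_borel_measurable_real by blast
 have gb [measurable]: "g \<in> borel_measurable borel" using g by simp
 have Sm [measurable]: "S \<in> sets borel" by fact
 have ae: "AE x in lborel. x \<in> S \<longrightarrow> indicator S x * g x = f x"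
  using g(2) by eventually_elim auto
 show ?thesis
 proof (rule that)
  show "(\<lambda>x. indicator S x * g x) \<in> borel_measurable borel" by measurable
  show "AE x in lborel. x \<in> S \<longrightarrow> indicator S x * g x = f x" by (rule ae)
  show "AE x in lebesgue_on S. indicator S x * g x = f x"
   using AE_completion[OF ae] S by (simp add: AE_restrict_space_iff)
 qed simp
qed

lemma integrable_indicator_interval:
 "integrable lborel (indicat_real {a<..<b})" "integrable lborel (indicat_real (cbox a b))"
 for a b :: real
proof -
 have "emeasure lborel {a<..<b} < \<infinity>"
  using emeasure_bounded_finite[OF bounded_box[of a b]] by (simp add: box_real)
 then show "integrable lborel (indicat_real {a<..<b})"
  by (rule integrable_real_indicator[rotated]) simp
 show "integrable lborel (indicat_real (cbox a b))"
  by (rule integrable_real_indicator[OF _ emeasure_bounded_finite[OF bounded_cbox]]) simp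
qed

text \<open>The normalised primitive of a bump on the unit interval. Its derivative \<open>r\<close>
  has total mass one and serves as a one-sided mollifier.\<close>

lemma smooth_step_exists:
 obtains R r :: "real \<Rightarrow> real" where "smooth R" "\<And>t. (R has_real_derivative r t) (at t)"
  "continuous_on UNIV r" "\<And>t. t \<le> 0 \<Longrightarrow> R t = 0" "\<And>t. t \<ge> 1 \<Longrightarrow> R t = 1"
  "\<And>t. t \<notin> {0<..<1} \<Longrightarrow> r t = 0" "\<And>t. 0 \<le> R t" "\<And>t. R t \<le> 1"
proof -
 let ?b = "bump 1 0 (1::real)"
 have box: "box 0 (1::real) = {0<..<1}" by (simp add: box_real)
 have cont: "isCont ?b x" for x
  using smooth_continuous[OF smooth_bump] continuous_on_eq_continuous_at[OF open_UNIV] by blast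
 have "\<exists>B. \<forall>x::real. -\<infinity> < ereal x \<longrightarrow> ereal x < \<infinity> \<longrightarrow> (B has_vector_derivative ?b x) (at x)"
  by (rule einterval_antiderivative) (use cont in auto)
 then obtain B where B: "\<And>x. (B has_real_derivative ?b x) (at x)"
  by (auto simp: has_real_derivative_iff_has_vector_derivative)
 have mono: "B x \<le> B y" if "x \<le> y" for x y
  using DERIV_nonneg_imp_nondecreasing[OF that, of B] B bump_nonneg by blast
 have const: "B x = B y" if "x \<le> y" "\<And>t. x < t \<Longrightarrow> t < y \<Longrightarrow> ?b t = 0" for x y
 proof (cases "x = y")
  case False
  with that have "x < y" by simp
  from MVT2[OF this, of B ?b] B obtain z where "x < z" "z < y" "B y - B x = (y - x) * ?b z" by blast
  then show ?thesis using that(2)[of z] by simp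
 qed simp
 define c where "c = B 1 - B 0"
 have c: "c > 0"
 proof -
  from MVT2[of 0 1 B ?b] B obtain z :: real where z: "0 < z" "z < 1" "B 1 - B 0 = (1 - 0) * ?b z" by auto
  then show ?thesis using bump_pos[of z 0 1 1] box by (simp add: c_def)
 qed
 let ?R = "\<lambda>t. (B t - B 0) * (1 / c)" and ?r = "\<lambda>t. ?b t * (1 / c)"
 show ?thesis
 proof (rule that[of ?R ?r])
  show D: "(?R has_real_derivative ?r t) (at t)" for t
   by (rule derivative_eq_intros B refl | simp)+
  show "continuous_on UNIV ?r" by (intro continuous_intros smooth_continuous smooth_bump)
  show "smooth ?R"
   by (rule smooth_real_antiderivative[OF D]) (intro smooth_mult smooth_bump smooth_const)
  have b0: "?b t = 0" if "t \<notin> {0<..<1}" for t by (rule bump_eq_0) (use that box in simp)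
  then show "?r t = 0" if "t \<notin> {0<..<1}" for t using that by simp
  show R0: "?R t = 0" if "t \<le> 0" for t
  proof -
   have "B t = B 0" by (rule const[OF that], rule b0) simp
   then show ?thesis by simp
  qed
  show R1: "?R t = 1" if "t \<ge> 1" for t
  proof -
   have "B 1 = B t" by (rule const[OF that], rule b0) simp
   then have "B t - B 0 = c" by (simp add: c_def)
   then show ?thesis using c by simp
  qed
  show "0 \<le> ?R t" for t
   using R0[of t] mono[of 0 t] c by (cases "t \<le> 0") auto
  show "?R t \<le> 1" for t
  proof (cases "t \<ge> 1")
   case True
   show ?thesis using R1[OF True] by (rule eq_refl)
  next
   case False
   then have "B t - B 0 \<le> c" using mono[of t 1] by (simp add: c_def)
   then show ?thesis using c by simp
  qed
 qed
qed

text \<open>After the substitution \<open>t = c j + e j * s\<close> the kernel no longer depends on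
  \<open>j\<close>, and dominated convergence applies. The centres \<open>c j\<close> may move,
  which lets the kernels sit strictly inside an interval while converging to its end points.\<close>

lemma mollified_point_value:
 fixes r V :: "real \<Rightarrow> real"
 assumes r: "continuous_on UNIV r" "\<And>t. t \<notin> {0<..<1} \<Longrightarrow> r t = 0" "(LINT s|lborel. r s) = 1"
  and V: "continuous_on UNIV V" "\<And>t. \<bar>V t\<bar> \<le> B"
  and c: "c \<longlonglongrightarrow> c0" and e: "e \<longlonglongrightarrow> 0" "\<And>j::nat. e j > 0"
 shows "(\<lambda>j. LINT t|lborel. (1 / e j) * r ((t - c j) / e j) * V t) \<longlonglongrightarrow> V c0"
proof -
 have rm [measurable]: "r \<in> borel_measurable borel" and Vm [measurable]: "V \<in> borel_measurable borel"
  using r(1) V(1) by (auto intro: borel_measurable_continuous_onI)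
 have ri: "integrable lborel r"
 proof -
  have "integrable lborel (\<lambda>x. indicator {0..1} x *\<^sub>R r x)"
   using borel_integrable_compact[of "{0..1}" r] continuous_on_subset[OF r(1)] by simp
  also have "(\<lambda>x. indicator {0..1} x *\<^sub>R r x) = r"
  proof
   show "indicator {0..1} x *\<^sub>R r x = r x" for x
    using r(2)[of x] by (cases "x \<in> {0<..<1}") auto
  qed
  finally show ?thesis .
 qed
 have eq: "(LINT t|lborel. (1 / e j) * r ((t - c j) / e j) * V t) = (LINT s|lborel. r s * V (c j + e j * s))" for j
  using e(2)[of j] lborel_integral_real_affine[of "e j" "\<lambda>t. (1 / e j) * r ((t - c j) / e j) * V t" "c j"]
  by simp
 have "(\<lambda>j. LINT s|lborel. r s * V (c j + e j * s)) \<longlonglongrightarrow> (LINT s|lborel. r s * V c0)"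
 proof (rule integral_dominated_convergence[where w="\<lambda>s. B * \<bar>r s\<bar>"])
  show "integrable lborel (\<lambda>s. B * \<bar>r s\<bar>)" using ri by simp
  show "AE s in lborel. (\<lambda>j. r s * V (c j + e j * s)) \<longlonglongrightarrow> r s * V c0"
  proof (rule AE_I2)
   fix s
   have "(\<lambda>j. c j + e j * s) \<longlonglongrightarrow> c0 + 0 * s" by (intro tendsto_intros c e)
   then have "(\<lambda>j. V (c j + e j * s)) \<longlonglongrightarrow> V c0"
    using continuous_on_tendsto_compose[OF V(1)] by simp
   then show "(\<lambda>j. r s * V (c j + e j * s)) \<longlonglongrightarrow> r s * V c0" by (intro tendsto_intros)
  qed
  show "AE s in lborel. norm (r s * V (c j + e j * s)) \<le> B * \<bar>r s\<bar>" for j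
   using V(2) by (auto simp: abs_mult mult.commute[of "\<bar>r _\<bar>"] intro!: mult_right_mono)
 qed measurable
 then show ?thesis unfolding eq using r(3) by simp
qed

text \<open>Lebesgue's differentiation theorem along intervals to the right. Indicators are enough,
  because Fubini's theorem will move all averaging onto an indicator.\<close>

lemma lebesgue_differentiation_indicator:
 fixes E :: "real set"
 assumes E: "E \<in> sets borel"
 shows "AE s in lborel. (\<lambda>j. real (Suc j) * (LINT t|lborel. indicator {s<..<s + 1 / real (Suc j)} t * indicator E t))
  \<longlonglongrightarrow> indicator E s"
proof -
 have int: "set_integrable lborel (cbox a b) (indicat_real E)" for a b
  unfolding set_integrable_def
  by (rule Bochner_Integration.integrable_bound[OF integrable_indicator_interval(2)[of a b]])
    (use E in \<open>auto simp: indicator_def\<close>)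
 have "indicat_real E integrable_on cbox a b" for a b
  using set_borel_integral_eq_integral(1)[OF int[unfolded]] .
 then obtain N where N: "negligible N" "\<And>x e. x \<notin> N \<Longrightarrow> 0 < e \<Longrightarrow> \<exists>d>0. \<forall>h. 0 < h \<and> h < d \<longrightarrow>
   norm (integral (cbox x (x + h *\<^sub>R One)) (indicat_real E) /\<^sub>R h ^ DIM(real) - indicator E x) < e"
  using integrable_ccontinuous_explicit[of "indicat_real E"] by blast
 have eq: "(LINT t|lborel. indicator {s<..<s + h} t * indicator E t) = integral {s..s + h} (indicat_real E)" if "h > 0" for s h
 proof -
  have "(LINT t|lborel. indicator {s<..<s + h} t * indicator E t) = (LINT t:{s..s + h}|lborel. indicat_real E t)"
   unfolding set_lebesgue_integral_def
  proof (rule integral_cong_AE)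
   have "AE t in lborel. t \<noteq> s" "AE t in lborel. t \<noteq> s + h" by (rule AE_lborel_singleton)+
   then show "AE t in lborel. indicator {s<..<s + h} t * indicat_real E t = indicat_real {s..s + h} t *\<^sub>R indicator E t"
    by eventually_elim (auto simp: indicator_def)
  qed (use E in measurable)
  also have "\<dots> = integral {s..s + h} (indicat_real E)"
   using set_borel_integral_eq_integral(2)[OF int[of s "s + h"]] by simp
  finally show ?thesis .
 qed
 have "AE s in lebesgue. s \<notin> N" using N(1) by (intro AE_not_in) (simp add: negligible_iff_null_sets)
 then have "AE s in lebesgue. (\<lambda>j. real (Suc j) * (LINT t|lborel. indicator {s<..<s + 1 / real (Suc j)} t * indicator E t))
  \<longlonglongrightarrow> indicator E s"
 proof eventually_elim
  case (elim s)
  show ?case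
  proof (rule LIMSEQ_I)
   fix e :: real assume "e > 0"
   from N(2)[OF elim this] obtain d where d: "d > 0" "\<And>h. 0 < h \<and> h < d \<Longrightarrow>
     norm (integral {s..s + h} (indicat_real E) / h - indicator E s) < e"
    by (auto simp: divide_inverse mult.commute)
   obtain j0 :: nat where j0: "1 / d < real j0" using reals_Archimedean2 by blast
   have "norm (real (Suc j) * (LINT t|lborel. indicator {s<..<s + 1 / real (Suc j)} t * indicator E t) - indicator E s) < e"
    if "j \<ge> j0" for j
   proof -
    have "1 / d < real (Suc j)" using j0 that by simp
    then have "0 < 1 / real (Suc j) \<and> 1 / real (Suc j) < d" using d(1) by (simp add: field_simps)
    from d(2)[OF this] show ?thesis using eq[of "1 / real (Suc j)" s] by (simp add: mult.commute)
   qed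
   then show "\<exists>j0. \<forall>j\<ge>j0. norm (real (Suc j) * (LINT t|lborel. indicator {s<..<s + 1 / real (Suc j)} t * indicator E t) - indicator E s) < e"
    by blast
  qed
 qed
 then show ?thesis by (simp add: AE_completion_iff)
qed

text \<open>Fubini's theorem for the strip in which \<open>t - h < s < t\<close>, read from the
  other side as \<open>s < t < s + h\<close>: averaging backwards in one factor becomes averaging
  forwards in the other.\<close>

lemma average_Fubini:
 fixes g k :: "real \<Rightarrow> real"
 assumes g: "integrable lborel g" and k [measurable]: "k \<in> borel_measurable borel" and kB: "\<And>t. \<bar>k t\<bar> \<le> B" and h: "h > 0"
 shows "integrable lborel (\<lambda>t. k t * (LINT s|lborel. indicator {t - h<..<t} s * g s))"
  "(LINT t|lborel. k t * (LINT s|lborel. indicator {t - h<..<t} s * g s))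
   = (LINT s|lborel. g s * (LINT t|lborel. indicator {s<..<s + h} t * k t))"
proof -
 have gm [measurable]: "g \<in> borel_measurable borel" using g by auto
 let ?f = "\<lambda>(s, t). g s * (indicator {s<..<s + h} t * k t)"
 have ind: "(\<lambda>(s, t). indicator {s<..<s + h} t :: real) \<in> borel_measurable (lborel \<Otimes>\<^sub>M lborel)"
 proof -
  have "(\<lambda>(s, t). indicator {s<..<s + h} t :: real) = (\<lambda>x. if fst x < snd x \<and> snd x < fst x + h then 1 else 0)"
   by (auto simp: fun_eq_iff indicator_def)
  then show ?thesis by simp
 qed
 have fm: "?f \<in> borel_measurable (lborel \<Otimes>\<^sub>M lborel)"
  using ind by (simp add: split_beta')
 have kint: "integrable lborel (\<lambda>t. indicator {s<..<s + h} t * k t)" for s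
  by (rule Bochner_Integration.integrable_bound[OF integrable_mult_right[OF integrable_indicator_interval(1)[of s "s + h"], of B]])
    (use kB order_trans[OF kB abs_ge_self] in \<open>auto simp: indicator_def\<close>)
 have kb: "(LINT t|lborel. \<bar>indicator {s<..<s + h} t * k t\<bar>) \<le> B * h" for s
 proof -
  have "(LINT t|lborel. \<bar>indicator {s<..<s + h} t * k t\<bar>) \<le> (LINT t|lborel. B * indicator {s<..<s + h} t)"
   using kB
   by (intro integral_mono integrable_abs kint integrable_mult_right integrable_indicator_interval)
     (auto simp: indicator_def)
  also have "\<dots> = B * h" using h by simp
  finally show ?thesis .
 qed
 have B: "0 \<le> B" using kB[of 0] by simp
 have fi: "integrable (lborel \<Otimes>\<^sub>M lborel) ?f"
 proof (rule lborel_pair.Fubini_integrable[OF fm])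
  have "integrable lborel (\<lambda>s. \<bar>g s\<bar> * (LINT t|lborel. \<bar>indicator {s<..<s + h} t * k t\<bar>))"
  proof (rule Bochner_Integration.integrable_bound)
   show "integrable lborel (\<lambda>s. \<bar>g s\<bar> * (B * h))" using g by simp
   have "(\<lambda>s. LINT t|lborel. \<bar>indicator {s<..<s + h} t * k t\<bar>) \<in> borel_measurable lborel"
    using ind by (intro lborel.borel_measurable_lebesgue_integral) (simp add: split_beta')
   then show "(\<lambda>s. \<bar>g s\<bar> * (LINT t|lborel. \<bar>indicator {s<..<s + h} t * k t\<bar>)) \<in> borel_measurable lborel"
    by measurable
   show "AE s in lborel. norm (\<bar>g s\<bar> * (LINT t|lborel. \<bar>indicator {s<..<s + h} t * k t\<bar>)) \<le> norm (\<bar>g s\<bar> * (B * h))"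
   proof (rule AE_I2)
    fix s
    have "0 \<le> (LINT t|lborel. \<bar>indicator {s<..<s + h} t * k t\<bar>)" by simp
    then show "norm (\<bar>g s\<bar> * (LINT t|lborel. \<bar>indicator {s<..<s + h} t * k t\<bar>)) \<le> norm (\<bar>g s\<bar> * (B * h))"
     using kb[of s] B h by (simp add: abs_mult mult_left_mono)
   qed
  qed
  then show "integrable lborel (\<lambda>s. LINT t|lborel. norm (?f (s, t)))"
   by (simp add: abs_mult)
  show "AE s in lborel. integrable lborel (\<lambda>t. ?f (s, t))" using kint by simp
 qed
 have inner: "(LINT s|lborel. g s * (indicator {s<..<s + h} t * k t)) = k t * (LINT s|lborel. indicator {t - h<..<t} s * g s)" for t
 proof -
  have "(\<lambda>s. g s * (indicator {s<..<s + h} t * k t)) = (\<lambda>s. k t * (indicator {t - h<..<t} s * g s))"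
   by (auto simp: fun_eq_iff indicator_def)
  then show ?thesis by simp
 qed
 show "integrable lborel (\<lambda>t. k t * (LINT s|lborel. indicator {t - h<..<t} s * g s))"
  using lborel_pair.integrable_snd[OF fi] by (simp only: inner case_prod_conv)
 show "(LINT t|lborel. k t * (LINT s|lborel. indicator {t - h<..<t} s * g s))
   = (LINT s|lborel. g s * (LINT t|lborel. indicator {s<..<s + h} t * k t))"
  using lborel_pair.Fubini_integral[of "\<lambda>s t. g s * (indicator {s<..<s + h} t * k t)", OF fi]
  by (simp only: inner integral_mult_right_zero)
qed

text \<open>The backward averages of \<open>g\<close> are traded for forward averages of the
  indicator of \<open>E\<close>. These lie between zero and one, so \<open>\<bar>g\<bar>\<close>
  dominates and convergence follows from the differentiation theorem.\<close>

lemma average_tendsto: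
 fixes g :: "real \<Rightarrow> real"
 assumes g: "integrable lborel g" and E [measurable]: "E \<in> sets borel"
 shows "(\<lambda>j. real (Suc j) * (LINT t|lborel. indicator E t * (LINT s|lborel. indicator {t - 1 / real (Suc j)<..<t} s * g s)))
  \<longlonglongrightarrow> (LINT s|lborel. g s * indicator E s)"
proof -
 have gm [measurable]: "g \<in> borel_measurable borel" using g by auto
 let ?d = "\<lambda>j s. real (Suc j) * (LINT t|lborel. indicator {s<..<s + 1 / real (Suc j)} t * indicat_real E t)"
 have d: "?d j \<in> borel_measurable lborel" for j
 proof -
  have "(\<lambda>(s, t). indicator {s<..<s + 1 / real (Suc j)} t :: real) = (\<lambda>x. if fst x < snd x \<and> snd x < fst x + 1 / real (Suc j) then 1 else 0)"
   by (auto simp: fun_eq_iff indicator_def)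
  then have ind: "(\<lambda>(s, t). indicator {s<..<s + 1 / real (Suc j)} t :: real) \<in> borel_measurable (lborel \<Otimes>\<^sub>M lborel)" by simp
  have "(\<lambda>s. LINT t|lborel. indicator {s<..<s + 1 / real (Suc j)} t * indicat_real E t) \<in> borel_measurable lborel"
   using ind by (intro lborel.borel_measurable_lebesgue_integral) (simp add: split_beta')
  then show ?thesis by measurable
 qed
 have db: "\<bar>?d j s\<bar> \<le> 1" for j s
 proof -
  have "(LINT t|lborel. indicator {s<..<s + 1 / real (Suc j)} t * indicat_real E t) \<le> (LINT t|lborel. indicator {s<..<s + 1 / real (Suc j)} t)"
  proof (rule integral_mono)
   show "integrable lborel (\<lambda>t. indicator {s<..<s + 1 / real (Suc j)} t * indicat_real E t)"
    by (rule Bochner_Integration.integrable_bound[OF integrable_indicator_interval(1)[of s "s + 1 / real (Suc j)"]]) (auto simp: indicator_def)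
  qed (rule integrable_indicator_interval, auto simp: indicator_def)
  also have "\<dots> = 1 / real (Suc j)" by simp
  finally have "?d j s \<le> real (Suc j) * (1 / real (Suc j))" by (intro mult_left_mono) auto
  moreover have "0 \<le> ?d j s" by (intro mult_nonneg_nonneg integral_nonneg_AE) auto
  ultimately show ?thesis by simp
 qed
 have "(\<lambda>j. LINT s|lborel. g s * ?d j s) \<longlonglongrightarrow> (LINT s|lborel. g s * indicator E s)"
 proof (rule integral_dominated_convergence[where w="\<lambda>s. \<bar>g s\<bar>"])
  show "AE s in lborel. (\<lambda>j. g s * ?d j s) \<longlonglongrightarrow> g s * indicator E s"
   using lebesgue_differentiation_indicator[OF E] by eventually_elim (intro tendsto_intros)
  show "AE s in lborel. norm (g s * ?d j s) \<le> \<bar>g s\<bar>" for j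
   using mult_left_mono[OF db abs_ge_zero] by (auto simp: abs_mult)
 qed (use g d in auto)
 moreover have "real (Suc j) * (LINT t|lborel. indicator E t * (LINT s|lborel. indicator {t - 1 / real (Suc j)<..<t} s * g s))
   = (LINT s|lborel. g s * ?d j s)" for j
  using average_Fubini(2)[OF g, of "indicator E" 1 "1 / real (Suc j)"]
  by (subst average_Fubini(2)[OF g, of "indicator E" 1]) (auto simp: indicator_def mult.left_commute simp flip: integral_mult_right_zero)
 ultimately show ?thesis by simp
qed

subsection \<open>Differentiation of convex functionals along an evolution\<close>

definition ip :: "'a::euclidean_space set \<Rightarrow> ('a \<Rightarrow> real) \<Rightarrow> ('a \<Rightarrow> real) \<Rightarrow> real" where
 "ip \<Omega> f g = (LINT x|lebesgue_on \<Omega>. f x * g x)"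

lemma ip_L2n:
 assumes "sqi (lebesgue_on \<Omega>) f" "sqi (lebesgue_on \<Omega>) g"
 shows "\<bar>ip \<Omega> f g\<bar> \<le> L2n (lebesgue_on \<Omega>) f * L2n (lebesgue_on \<Omega>) g"
  "integrable (lebesgue_on \<Omega>) (\<lambda>x. f x * g x)"
 using L2n_Cauchy_Schwarz[OF assms] sqi_inner_integrable[OF assms] by (simp_all add: ip_def)

lemma ip_diff_left:
 assumes "sqi (lebesgue_on \<Omega>) f" "sqi (lebesgue_on \<Omega>) h" "sqi (lebesgue_on \<Omega>) g"
 shows "ip \<Omega> (\<lambda>x. f x - h x) g = ip \<Omega> f g - ip \<Omega> h g"
 using ip_L2n(2)[OF assms(1,3)] ip_L2n(2)[OF assms(2,3)] by (simp add: ip_def left_diff_distrib)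

lemma ip_diff_right:
 assumes "sqi (lebesgue_on \<Omega>) f" "sqi (lebesgue_on \<Omega>) h" "sqi (lebesgue_on \<Omega>) g"
 shows "ip \<Omega> f (\<lambda>x. g x - h x) = ip \<Omega> f g - ip \<Omega> f h"
 using ip_L2n(2)[OF assms(1,3)] ip_L2n(2)[OF assms(1,2)] by (simp add: ip_def right_diff_distrib)

text \<open>The evolution triple behind an energy solution: a continuous curve in \<open>L\<^sup>2\<close> whose weak
 derivative is a square integrable curve in the dual of \<open>H01 \<Omega>\<close>.\<close>

locale evolution =
 fixes \<Omega> :: "'a::euclidean_space set" and T :: real and w :: "real \<Rightarrow> 'a \<Rightarrow> real"
  and vt :: "real \<Rightarrow> ('a \<Rightarrow> real) \<Rightarrow> real"
 assumes op: "open \<Omega>" and bd: "bounded \<Omega>" and T: "0 < T"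
  and cont: "continuous_into_L2 T \<Omega> w"
  and vt: "vt \<in> bochner_Lp 2 T (Hm1 \<Omega>) (Hm1_norm \<Omega>)"
  and wtd: "\<And>\<psi> z. \<psi> \<in> test_functions {0<..<T} \<Longrightarrow> z \<in> H01 \<Omega> \<Longrightarrow>
    (LINT t|lebesgue_on {0<..<T}. deriv \<psi> t * ip \<Omega> (w t) z) =
    - (LINT t|lebesgue_on {0<..<T}. \<psi> t * vt t z)"
begin

lemma w_sqi: "t \<in> {0..T} \<Longrightarrow> sqi (lebesgue_on \<Omega>) (w t)"
 using cont by (auto simp: continuous_into_L2_def Lp_2_iff)

lemma w_tendsto: "t0 \<in> {0..T} \<Longrightarrow> ((\<lambda>t. L2n (lebesgue_on \<Omega>) (\<lambda>x. w t x - w t0 x)) \<longlongrightarrow> 0) (at t0 within {0..T})"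
 using cont by (auto simp: continuous_into_L2_def Lp_norm_2)

lemma H01_sqi: "z \<in> H01 \<Omega> \<Longrightarrow> sqi (lebesgue_on \<Omega>) z"
 by (rule H1_D(2)[OF op bd H01_H1])

lemma continuous_of_L2_bound:
 assumes "\<And>t t0. t \<in> {0..T} \<Longrightarrow> t0 \<in> {0..T} \<Longrightarrow> \<bar>V t - V t0\<bar> \<le> L2n (lebesgue_on \<Omega>) (\<lambda>x. w t x - w t0 x) * B"
 shows "continuous_on {0..T} V"
 unfolding continuous_on_def
proof
 fix t0 assume t0: "t0 \<in> {0..T}"
 have l: "((\<lambda>t. L2n (lebesgue_on \<Omega>) (\<lambda>x. w t x - w t0 x) * B) \<longlongrightarrow> 0) (at t0 within {0..T})"
  using tendsto_mult[OF w_tendsto[OF t0] tendsto_const, of B] by simp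
 show "(V \<longlongrightarrow> V t0) (at t0 within {0..T})"
  by (rule LIM_zero_cancel, rule Lim_null_comparison[OF _ l])
    (use assms[OF _ t0] in \<open>auto simp: eventually_at intro!: exI[of _ 1]\<close>)
qed

lemma ip_continuous:
 assumes "sqi (lebesgue_on \<Omega>) z" shows "continuous_on {0..T} (\<lambda>t. ip \<Omega> (w t) z)"
proof (rule continuous_of_L2_bound)
 fix t t0 assume "t \<in> {0..T}" "t0 \<in> {0..T}"
 then show "\<bar>ip \<Omega> (w t) z - ip \<Omega> (w t0) z\<bar> \<le> L2n (lebesgue_on \<Omega>) (\<lambda>x. w t x - w t0 x) * L2n (lebesgue_on \<Omega>) z"
  using ip_L2n(1)[OF sqi_diff[OF w_sqi w_sqi] assms, of t t0] ip_diff_left[OF w_sqi w_sqi assms, of t t0] by simp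
qed

text \<open>Composition with this retraction extends functions on the time interval by their end
  values, so that mollification and difference quotients can be carried out on the whole
  line.\<close>

definition clamp0 :: "real \<Rightarrow> real" where "clamp0 t = max 0 (min T t)"

lemma clamp0: "clamp0 t \<in> {0..T}" "t \<in> {0..T} \<Longrightarrow> clamp0 t = t" "continuous_on UNIV clamp0"
 using T by (auto simp: clamp0_def intro!: continuous_intros)

lemma clamp0_continuous: fixes V :: "real \<Rightarrow> real" shows "continuous_on {0..T} V \<Longrightarrow> continuous_on UNIV (\<lambda>t. V (clamp0 t))"
 by (rule continuous_on_compose2[OF _ clamp0(3)]) (use clamp0(1) in auto)

lemma clamp0_bounded:
 fixes V :: "real \<Rightarrow> real"
 assumes "continuous_on {0..T} V"
 obtains B where "\<And>t. \<bar>V (clamp0 t)\<bar> \<le> B"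
proof -
 have "bounded (V ` {0..T})" by (intro compact_imp_bounded compact_continuous_image assms) simp
 then obtain B where "\<forall>t\<in>{0..T}. \<bar>V t\<bar> \<le> B" by (auto simp: bounded_iff)
 then have B: "\<bar>V t\<bar> \<le> B" if "t \<in> {0..T}" for t using that by blast
 show ?thesis by (rule that, rule B, rule clamp0(1))
qed

lemma vt_sm: "strongly_measurable T (Hm1 \<Omega>) (Hm1_norm \<Omega>) vt"
 using vt by (simp add: bochner_Lp_def)

lemma vt_Hm1: "AE t in lebesgue_on {0<..<T}. vt t \<in> Hm1 \<Omega>"
 using vt_sm by (simp add: strongly_measurable_def)

lemma const_sm: "z \<in> H01 \<Omega> \<Longrightarrow> strongly_measurable T (H01 \<Omega>) (H1_norm \<Omega>) (\<lambda>_. z)"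
 unfolding strongly_measurable_iff
proof (intro conjI exI allI)
 assume z: "z \<in> H01 \<Omega>"
 have "{t \<in> {0<..<T}. z = a} \<in> sets lebesgue" for a by (cases "z = a") simp_all
 moreover have "(\<lambda>_. z) ` {0<..<T} \<subseteq> {z}" by auto
 then have "finite ((\<lambda>_. z) ` {0<..<T})" using finite_subset by blast
 ultimately show "step_fun T (H01 \<Omega>) (\<lambda>_. z)" using z by (auto simp: step_fun_def)
qed (auto simp: H01_zero[OF op bd])

text \<open>A Borel bound on the whole line for the dual norms, which makes Fubini's theorem
  applicable. One null set of times is excluded for all \<open>z\<close> simultaneously.\<close>

lemma dual_norm_representative:
 obtains N where "N \<in> borel_measurable borel" "\<And>s. 0 \<le> N s" "\<And>s. s \<notin> {0<..<T} \<Longrightarrow> N s = 0"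
  "sqi lborel N" "AE s in lebesgue_on {0<..<T}. \<forall>z\<in>H01 \<Omega>. \<bar>vt s z\<bar> \<le> N s * H1_norm \<Omega> z"
proof -
 let ?M = "lebesgue_on {0<..<T}"
 \<comment> \<open>Integrability delivers measurability of the squared norm only; the square root
   recovers the absolute value of the norm.\<close>
 let ?N = "\<lambda>s. sqrt (Hm1_norm \<Omega> (vt s) powr 2)"
 have i: "integrable ?M (\<lambda>s. Hm1_norm \<Omega> (vt s) powr 2)" using vt by (simp add: bochner_Lp_def)
 then have "?N \<in> borel_measurable ?M" by measurable
 from borel_representative[OF this] obtain g where g: "g \<in> borel_measurable borel" "\<And>x. x \<notin> {0<..<T} \<Longrightarrow> g x = 0"
  "AE x in ?M. g x = ?N x" by auto
 show ?thesis
 proof (rule that[of "\<lambda>s. \<bar>g s\<bar>"])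
  show "(\<lambda>s. \<bar>g s\<bar>) \<in> borel_measurable borel" using g(1) by measurable
  show "\<bar>g s\<bar> = 0" if "s \<notin> {0<..<T}" for s using g(2)[OF that] by simp
  have "integrable ?M (\<lambda>s. (g s)\<^sup>2)"
  proof (rule integrable_cong_AE_imp[OF i])
   show "(\<lambda>s. (g s)\<^sup>2) \<in> borel_measurable ?M"
    using g(1) by (intro measurable_restrict_space1 measurable_completion) simp
   show "AE s in ?M. Hm1_norm \<Omega> (vt s) powr 2 = (g s)\<^sup>2"
    using g(3) by eventually_elim simp
  qed
  then have "integrable lebesgue (\<lambda>s. indicator {0<..<T} s *\<^sub>R (g s)\<^sup>2)" by (simp add: integrable_restrict_space)
  also have "(\<lambda>s. indicator {0<..<T} s *\<^sub>R (g s)\<^sup>2) = (\<lambda>s. (g s)\<^sup>2)"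
   using g(2) by (force simp: fun_eq_iff indicator_def)
  finally have "integrable lborel (\<lambda>s. (g s)\<^sup>2)" using g(1) by (simp add: integrable_completion)
  then show "sqi lborel (\<lambda>s. \<bar>g s\<bar>)" using g(1) by (simp add: sqi_def)
  show "AE s in ?M. \<forall>z\<in>H01 \<Omega>. \<bar>vt s z\<bar> \<le> \<bar>g s\<bar> * H1_norm \<Omega> z"
   using g(3) vt_Hm1
  proof eventually_elim
   case (elim s)
   show ?case
   proof
    fix z assume z: "z \<in> H01 \<Omega>"
    have "\<bar>g s\<bar> = Hm1_norm \<Omega> (vt s)"
     using elim(1) Hm1_bound(2)[OF op bd T elim(2) z] by (simp add: powr2)
    then show "\<bar>vt s z\<bar> \<le> \<bar>g s\<bar> * H1_norm \<Omega> z" using Hm1_bound(1)[OF op bd T elim(2) z] by simp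
   qed
  qed
 qed simp
qed

lemma dual_pairing_integrable:
 assumes z: "z \<in> H01 \<Omega>" shows "integrable (lebesgue_on {0<..<T}) (\<lambda>t. vt t z)"
proof -
 obtain N where N: "N \<in> borel_measurable borel" "\<And>s. 0 \<le> N s" "\<And>s. s \<notin> {0<..<T} \<Longrightarrow> N s = 0"
  "sqi lborel N" "AE s in lebesgue_on {0<..<T}. \<forall>z\<in>H01 \<Omega>. \<bar>vt s z\<bar> \<le> N s * H1_norm \<Omega> z"
  by (rule dual_norm_representative) blast
 have NM: "N \<in> borel_measurable (lebesgue_on {0<..<T})"
  using N(1) by (intro measurable_restrict_space1 measurable_completion) simp
 have "integrable lebesgue (\<lambda>s. (norm (N s))\<^sup>2)"
  using N(1,4) by (subst integrable_completion) (simp_all add: sqi_def)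
 then have "integrable (lebesgue_on {0<..<T}) (\<lambda>s. (norm (N s))\<^sup>2)"
  using integrable_mult_indicator[of "{0<..<T}" lebesgue "\<lambda>s. (norm (N s))\<^sup>2"]
  by (simp add: integrable_restrict_space)
 then have "sqi (lebesgue_on {0<..<T}) N" using NM by (simp add: sqi_def)
 then have "integrable (lebesgue_on {0<..<T}) N"
  by (intro sqi_integrable1) auto
 then have i: "integrable (lebesgue_on {0<..<T}) (\<lambda>s. N s * H1_norm \<Omega> z)" by simp
 show ?thesis
 proof (rule Bochner_Integration.integrable_bound[OF i])
  show "(\<lambda>t. vt t z) \<in> borel_measurable (lebesgue_on {0<..<T})"
   by (rule pairing_measurable[OF op bd T vt_sm const_sm[OF z]])
  show "AE s in lebesgue_on {0<..<T}. norm (vt s z) \<le> norm (N s * H1_norm \<Omega> z)"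
   using N(5) by eventually_elim (use z N(2) in \<open>simp add: H1_norm_nonneg\<close>)
 qed
qed

text \<open>The weak derivative is tested with smooth functions that tend to the indicator of the
  interval from \<open>a\<close> to \<open>b\<close>. Their derivatives are two mollifiers of
  opposite sign, and by continuity of the curve in \<open>L2n\<close> these pick out the values at
  the end points.\<close>

lemma increment:
 assumes ab: "0 \<le> a" "a < b" "b \<le> T" and z: "z \<in> H01 \<Omega>"
 shows "ip \<Omega> (w b) z - ip \<Omega> (w a) z = (LINT s|lebesgue_on {0<..<T}. indicator {a<..<b} s * vt s z)"
proof -
 obtain R r :: "real \<Rightarrow> real" where R: "smooth R" "\<And>t. (R has_real_derivative r t) (at t)"
  "continuous_on UNIV r" "\<And>t. t \<le> 0 \<Longrightarrow> R t = 0" "\<And>t. t \<ge> 1 \<Longrightarrow> R t = 1"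
  "\<And>t. t \<notin> {0<..<1} \<Longrightarrow> r t = 0" "\<And>t. 0 \<le> R t" "\<And>t. R t \<le> 1"
  by (rule smooth_step_exists) blast
 have rm [measurable]: "r \<in> borel_measurable borel" using R(3) by (rule borel_measurable_continuous_onI)
 have r1: "(LINT s|lborel. r s) = 1"
 proof -
  have "(LINT s|lborel. r s * indicator {0..1} s) = R 1 - R 0"
   using R(2,3) by (intro integral_FTC_Icc_real) (auto simp: continuous_on_eq_continuous_at)
  also have "(\<lambda>s. r s * indicator {0..1} s) = r"
  proof
   show "r s * indicator {0..1} s = r s" for s using R(6)[of s] by (cases "s \<in> {0<..<1}") auto
  qed
  finally show ?thesis using R(4,5) by simp
 qed
 define V where "V t = ip \<Omega> (w t) z" for t
 have Vc: "continuous_on {0..T} V" unfolding V_def by (rule ip_continuous[OF H01_sqi[OF z]])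
 define U where "U t = V (clamp0 t)" for t
 have Uc: "continuous_on UNIV U" unfolding U_def by (rule clamp0_continuous[OF Vc])
 obtain B where UB: "\<And>t. \<bar>U t\<bar> \<le> B" unfolding U_def using clamp0_bounded[OF Vc] by blast
 have Um [measurable]: "U \<in> borel_measurable borel" using Uc by (rule borel_measurable_continuous_onI)
 \<comment> \<open>The ramp up occupies the interval from \<open>a + e j\<close> to
   \<open>a + 2 * e j\<close>, the ramp down that from \<open>b - 2 * e j\<close> to
   \<open>b - e j\<close>. The summand 3 in the denominator yields
   \<open>3 * e j \<le> b - a\<close>, that is \<open>c j \<le> d j\<close>, so that
   \<open>\<psi> j\<close> vanishes outside the interval from \<open>a + e j\<close> to
   \<open>b - e j\<close>.\<close>
 define e where "e j = (b - a) / (real j + 3)" for j :: nat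
 have e: "e j > 0" "3 * e j \<le> b - a" for j
 proof -
  show "e j > 0" using ab by (simp add: e_def)
  have "(b - a) * 3 \<le> (b - a) * (real j + 3)" using ab by (intro mult_left_mono) auto
  then show "3 * e j \<le> b - a" by (simp add: e_def field_simps)
 qed
 have el: "e \<longlonglongrightarrow> 0"
  unfolding e_def by (rule tendsto_divide_0[OF tendsto_const]) 
    (intro filterlim_at_top_imp_at_infinity filterlim_tendsto_add_at_top filterlim_real_sequentially
     filterlim_tendsto_add_at_top[OF tendsto_const, of _ _ 3, simplified add.commute])
 define c where "c j = a + e j" for j
 define d where "d j = b - 2 * e j" for j
 define \<psi> where "\<psi> j t = R ((t - c j) / e j) - R ((t - d j) / e j)" for j t
 define D where "D j t = (1 / e j) * r ((t - c j) / e j) - (1 / e j) * r ((t - d j) / e j)" for j t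
 have pd: "(\<psi> j has_real_derivative D j t) (at t)" for j t
  unfolding \<psi>_def D_def using e(1)[of j]
  by (auto intro!: derivative_eq_intros DERIV_chain2[OF R(2)])
 have psm: "smooth (\<psi> j)" for j
  unfolding \<psi>_def
 proof -
  have "smooth (\<lambda>t. R (t * (1 / e j) - x * (1 / e j)))" for x
   using smooth_inner[of "1::real"] by (intro smooth_compose[OF _ R(1)] smooth_diff smooth_mult smooth_const) simp_all
  from smooth_diff[OF this[of "c j"] this[of "d j"]] show "smooth (\<lambda>t. R ((t - c j) / e j) - R ((t - d j) / e j))"
   by (simp add: diff_divide_distrib)
 qed
 have out: "\<psi> j t = 0" if "t \<notin> {a + e j..b - e j}" for j t
 proof -
  from that consider "t < a + e j" | "t > b - e j" by force
  then show ?thesis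
  proof cases
   case 1
   then have "(t - c j) / e j \<le> 0" "(t - d j) / e j \<le> 0"
    using e[of j] by (auto simp: c_def d_def divide_le_0_iff)
   then show ?thesis using R(4) by (simp add: \<psi>_def)
  next
   case 2
   then have "(t - c j) / e j \<ge> 1" "(t - d j) / e j \<ge> 1"
    using e[of j] by (auto simp: c_def d_def)
   then show ?thesis using R(5) by (simp add: \<psi>_def)
  qed
 qed
 have pt: "\<psi> j \<in> test_functions {0<..<T}" for j
  by (rule smooth_test_function[OF psm, where K="{a + e j..b - e j}"]) (use out e[of j] ab in auto)
 have I1: "(LINT t|lebesgue_on {0<..<T}. deriv (\<psi> j) t * V t)
   = (LINT t|lborel. (1 / e j) * r ((t - c j) / e j) * U t) - (LINT t|lborel. (1 / e j) * r ((t - d j) / e j) * U t)" for j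
 proof -
  have Dz: "D j t = 0" if "t \<notin> {0<..<T}" for t
  proof -
   have "(t - c j) / e j \<notin> {0<..<1}" "(t - d j) / e j \<notin> {0<..<1}"
    using that e[of j] ab by (auto simp: c_def d_def zero_less_divide_iff divide_less_eq)
   then show ?thesis using R(6) by (simp add: D_def)
  qed
  have ri: "integrable lborel (\<lambda>t. (1 / e j) * r ((t - x) / e j) * U t)" for x
  proof -
   have "integrable lborel (\<lambda>s. r s * U (x + e j * s))"
   proof -
    have "integrable lborel (\<lambda>s. indicator {0..1} s *\<^sub>R (r s * U (x + e j * s)))"
     by (rule borel_integrable_compact)
       (auto intro!: continuous_intros continuous_on_compose2[OF Uc] continuous_on_subset[OF R(3)])
    also have "(\<lambda>s. indicator {0..1} s *\<^sub>R (r s * U (x + e j * s))) = (\<lambda>s. r s * U (x + e j * s))"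
    proof
     show "indicator {0..1} s *\<^sub>R (r s * U (x + e j * s)) = r s * U (x + e j * s)" for s
      using R(6)[of s] by (cases "s \<in> {0<..<1}") auto
    qed
    finally show ?thesis .
   qed
   then show ?thesis
    using lborel_integrable_real_affine_iff[of "e j" "\<lambda>t. (1 / e j) * r ((t - x) / e j) * U t" x] e(1)[of j] by simp
  qed
  have "(LINT t|lebesgue_on {0<..<T}. deriv (\<psi> j) t * V t) = (LINT t|lebesgue_on {0<..<T}. D j t * U t)"
  proof (rule Bochner_Integration.integral_cong[OF refl])
   fix t assume "t \<in> space (lebesgue_on {0<..<T})"
   then show "deriv (\<psi> j) t * V t = D j t * U t"
    using DERIV_imp_deriv[OF pd] clamp0(2)[of t] by (simp add: U_def)
  qed
  also have "\<dots> = (LINT t|lebesgue. D j t * U t)"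
  proof -
   have "indicator {0<..<T} t *\<^sub>R (D j t * U t) = D j t * U t" for t
    using Dz[of t] by (cases "t \<in> {0<..<T}") auto
   then show ?thesis by (simp add: integral_restrict_space del: real_scaleR_def)
  qed
  also have "\<dots> = (LINT t|lborel. D j t * U t)"
   by (rule integral_completion) (simp add: D_def)
  also have "\<dots> = (LINT t|lborel. (1 / e j) * r ((t - c j) / e j) * U t - (1 / e j) * r ((t - d j) / e j) * U t)"
   by (simp add: D_def left_diff_distrib)
  also have "\<dots> = (LINT t|lborel. (1 / e j) * r ((t - c j) / e j) * U t) - (LINT t|lborel. (1 / e j) * r ((t - d j) / e j) * U t)"
   by (rule Bochner_Integration.integral_diff[OF ri ri])
  finally show ?thesis .
 qed
 have l1: "(\<lambda>j. LINT t|lebesgue_on {0<..<T}. deriv (\<psi> j) t * V t) \<longlonglongrightarrow> U a - U b"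
  unfolding I1
 proof (rule tendsto_diff)
  have "c \<longlonglongrightarrow> a + 0" unfolding c_def by (intro tendsto_intros el)
  then show "(\<lambda>j. LINT t|lborel. (1 / e j) * r ((t - c j) / e j) * U t) \<longlonglongrightarrow> U a"
   by (intro mollified_point_value[OF R(3,6) r1 Uc UB _ el e(1)]) auto
  have "d \<longlonglongrightarrow> b - 2 * 0" unfolding d_def by (intro tendsto_intros el)
  then show "(\<lambda>j. LINT t|lborel. (1 / e j) * r ((t - d j) / e j) * U t) \<longlonglongrightarrow> U b"
   by (intro mollified_point_value[OF R(3,6) r1 Uc UB _ el e(1)]) auto
 qed
 have gi: "integrable (lebesgue_on {0<..<T}) (\<lambda>t. vt t z)" by (rule dual_pairing_integrable[OF z])
 have l2: "(\<lambda>j. LINT t|lebesgue_on {0<..<T}. \<psi> j t * vt t z) \<longlonglongrightarrow> (LINT t|lebesgue_on {0<..<T}. indicator {a<..<b} t * vt t z)"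
 proof (rule integral_dominated_convergence[where w="\<lambda>t. \<bar>vt t z\<bar>"])
  show "integrable (lebesgue_on {0<..<T}) (\<lambda>t. \<bar>vt t z\<bar>)" using gi by simp
  show "(\<lambda>t. indicator {a<..<b} t * vt t z) \<in> borel_measurable (lebesgue_on {0<..<T})"
  proof (rule borel_measurable_times)
   show "indicat_real {a<..<b} \<in> borel_measurable (lebesgue_on {0<..<T})"
    by (intro measurable_restrict_space1 measurable_completion) simp
  qed (use gi in auto)
  show "(\<lambda>t. \<psi> j t * vt t z) \<in> borel_measurable (lebesgue_on {0<..<T})" for j
  proof (rule borel_measurable_times)
   show "\<psi> j \<in> borel_measurable (lebesgue_on {0<..<T})"
    using smooth_borel[OF psm] by (intro measurable_restrict_space1 measurable_completion) simp
  qed (use gi in auto)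
  have "\<bar>\<psi> j t\<bar> \<le> 1" for j t
   unfolding \<psi>_def using R(7,8)[of "(t - c j) / e j"] R(7,8)[of "(t - d j) / e j"] by linarith
  then show "AE t in lebesgue_on {0<..<T}. norm (\<psi> j t * vt t z) \<le> \<bar>vt t z\<bar>" for j
   by (auto simp: abs_mult intro!: mult_left_le_one_le)
  show "AE t in lebesgue_on {0<..<T}. (\<lambda>j. \<psi> j t * vt t z) \<longlonglongrightarrow> indicator {a<..<b} t * vt t z"
  proof (intro AE_I2 tendsto_intros)
   fix t
   show "(\<lambda>j. \<psi> j t) \<longlonglongrightarrow> indicator {a<..<b} t"
   proof (cases "t \<in> {a<..<b}")
    case False
    then have "t \<notin> {a + e j..b - e j}" for j using e(1)[of j] by auto
    then show ?thesis using out False by simp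
   next
    case True
    then have pos: "(t - a) / 2 > 0" "(b - t) / 2 > 0" by auto
    from order_tendstoD(2)[OF el pos(1)] order_tendstoD(2)[OF el pos(2)]
    have "\<forall>\<^sub>F j in sequentially. \<psi> j t = 1"
    proof eventually_elim
     case (elim j)
     then have "(t - c j) / e j \<ge> 1" "(t - d j) / e j \<le> 0"
      using e[of j] by (auto simp: c_def d_def divide_le_0_iff field_simps)
     then show ?case using R(4,5) by (simp add: \<psi>_def)
    qed
    then show ?thesis using True tendsto_eventually by (simp add: tendsto_eventually)
   qed
  qed
 qed
 have "(LINT t|lebesgue_on {0<..<T}. deriv (\<psi> j) t * V t) = - (LINT t|lebesgue_on {0<..<T}. \<psi> j t * vt t z)" for j
  unfolding V_def by (rule wtd[OF pt z])
 with l1 have "(\<lambda>j. - (LINT t|lebesgue_on {0<..<T}. \<psi> j t * vt t z)) \<longlonglongrightarrow> U a - U b" by simp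
 with tendsto_minus[OF l2] have "U a - U b = - (LINT t|lebesgue_on {0<..<T}. indicator {a<..<b} t * vt t z)"
  using LIMSEQ_unique by blast
 then show ?thesis using ab clamp0(2)[of a] clamp0(2)[of b] by (simp add: U_def V_def)
qed

end

lemma sqi_lborel_restrict:
 fixes f :: "'a::euclidean_space \<Rightarrow> real"
 assumes f: "sqi lborel f" and S: "S \<in> sets lebesgue"
 shows "sqi (lebesgue_on S) f" "L2n (lebesgue_on S) f \<le> L2n lborel f"
proof -
 have fm: "f \<in> borel_measurable borel" using sqi_measurable[OF f] by simp
 have i: "integrable lebesgue (\<lambda>s. (norm (f s))\<^sup>2)"
  using fm f by (subst integrable_completion) (simp_all add: sqi_def)
 have iS: "integrable lebesgue (\<lambda>s. indicator S s *\<^sub>R (norm (f s))\<^sup>2)"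
  using integrable_mult_indicator[OF S i] .
 show "sqi (lebesgue_on S) f"
  unfolding sqi_def
 proof
  show "f \<in> borel_measurable (lebesgue_on S)"
   using fm by (intro measurable_restrict_space1 measurable_completion) simp
  show "integrable (lebesgue_on S) (\<lambda>x. (norm (f x))\<^sup>2)"
   using iS S by (simp add: integrable_restrict_space)
 qed
 have "(LINT s|lebesgue_on S. (norm (f s))\<^sup>2) = (LINT s|lebesgue. indicator S s *\<^sub>R (norm (f s))\<^sup>2)"
  using S by (simp add: integral_restrict_space)
 also have "\<dots> \<le> (LINT s|lebesgue. (norm (f s))\<^sup>2)"
  using i iS by (intro integral_mono) (auto simp: indicator_def)
 also have "\<dots> = (LINT s|lborel. (norm (f s))\<^sup>2)"
  by (rule integral_completion) (use fm in simp)
 finally show "L2n (lebesgue_on S) f \<le> L2n lborel f" by (simp add: L2n_def)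
qed

lemma integral_abs_bound_AE:
 fixes f g :: "'x \<Rightarrow> real"
 assumes "AE x in M. \<bar>f x\<bar> \<le> g x" "integrable M f" "integrable M g"
 shows "\<bar>LINT x|M. f x\<bar> \<le> (LINT x|M. g x)"
proof -
 have "\<bar>LINT x|M. f x\<bar> \<le> (LINT x|M. \<bar>f x\<bar>)" by (rule integral_abs_bound)
 also have "\<dots> \<le> (LINT x|M. g x)" using assms by (intro integral_mono_AE) auto
 finally show ?thesis .
qed

text \<open>The usual argument with three errors: the approximation is uniform in \<open>j\<close>,
  so the limits in \<open>i\<close> and \<open>j\<close> may be interchanged.\<close>

lemma tendsto_of_approximations:
 fixes X :: "nat \<Rightarrow> real"
 assumes d: "d \<longlonglongrightarrow> 0" and XY: "\<And>i. Y i \<longlonglongrightarrow> L i"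
  and 1: "\<And>i j. \<bar>X j - Y i j\<bar> \<le> C * d i" and 2: "\<And>i. \<bar>l - L i\<bar> \<le> C * d i"
 shows "X \<longlonglongrightarrow> l"
proof (rule LIMSEQ_I)
 fix e :: real assume e: "e > 0"
 have "(\<lambda>i. C * d i) \<longlonglongrightarrow> C * 0" by (intro tendsto_intros d)
 then have "\<forall>\<^sub>F i in sequentially. C * d i < e / 3" using e by (intro order_tendstoD(2)) auto
 then obtain i where i: "C * d i < e / 3" by (auto simp: eventually_sequentially)
 from LIMSEQ_D[OF XY[of i], of "e / 3"] e obtain j0 where j0: "\<And>j. j \<ge> j0 \<Longrightarrow> norm (Y i j - L i) < e / 3" by auto
 have "norm (X j - l) < e" if "j \<ge> j0" for j
  using 1[of j i] 2[of i] i j0[OF that] unfolding real_norm_def by linarith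
 then show "\<exists>no. \<forall>n\<ge>no. norm (X n - l) < e" by blast
qed

section \<open>Backward difference quotients and their limit\<close>

context evolution
begin

text \<open>The quotient looks backwards in time, so that convexity can be used with the slope at
  the later time, where the test function is evaluated. Before time zero the curve is continued by
  its initial value.\<close>

definition dq :: "nat \<Rightarrow> real \<Rightarrow> ('a \<Rightarrow> real) \<Rightarrow> real" where
 "dq j t z = real (Suc j) * (ip \<Omega> (w t) z - ip \<Omega> (w (max 0 (t - 1 / real (Suc j)))) z)"

lemma dq_eq:
 assumes t: "t \<in> {0<..<T}" and z: "z \<in> H01 \<Omega>"
 shows "dq j t z = real (Suc j) * (LINT s|lebesgue_on {0<..<T}. indicator {t - 1 / real (Suc j)<..<t} s * vt s z)"
proof -
 let ?h = "1 / real (Suc j)"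
 have "ip \<Omega> (w t) z - ip \<Omega> (w (max 0 (t - ?h))) z
   = (LINT s|lebesgue_on {0<..<T}. indicator {max 0 (t - ?h)<..<t} s * vt s z)"
  by (rule increment) (use t z in auto)
 also have "\<dots> = (LINT s|lebesgue_on {0<..<T}. indicator {t - ?h<..<t} s * vt s z)"
  by (rule Bochner_Integration.integral_cong) (auto simp: indicator_def)
 finally show ?thesis by (simp add: dq_def)
qed

lemma dq_diff:
 assumes "t \<in> {0<..<T}" "z \<in> H01 \<Omega>" "y \<in> H01 \<Omega>"
 shows "dq j t (\<lambda>x. z x - y x) = dq j t z - dq j t y"
proof -
 have "sqi (lebesgue_on \<Omega>) (w t)" "sqi (lebesgue_on \<Omega>) (w (max 0 (t - 1 / real (Suc j))))"
 proof -
  have "t - 1 / real (Suc j) \<le> T" by (rule order_trans[of _ t]) (use assms(1) in simp_all)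
  then have "t \<in> {0..T}" "max 0 (t - 1 / real (Suc j)) \<in> {0..T}" using assms(1) T by auto
  then show "sqi (lebesgue_on \<Omega>) (w t)" "sqi (lebesgue_on \<Omega>) (w (max 0 (t - 1 / real (Suc j))))"
   by (auto intro: w_sqi)
 qed
 then show ?thesis
  using assms by (simp add: dq_def ip_diff_right H01_sqi algebra_simps)
qed

lemma H01_diff: "z \<in> H01 \<Omega> \<Longrightarrow> y \<in> H01 \<Omega> \<Longrightarrow> (\<lambda>x. z x - y x) \<in> H01 \<Omega>"
 using H01_lincomb[OF op bd, of z y 1 "-1"] by simp

text \<open>The quotient is an average of the functionals over an interval of length
  \<open>1 / real (Suc j)\<close>. By Cauchy-Schwarz its dual norm is at most the root of the
  average of \<open>(N s)\<^sup>2\<close>, which is taken as \<open>\<kappa> j\<close>. By Fubini's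
  theorem averaging preserves the integral of \<open>(N s)\<^sup>2\<close>, whence a bound in mean
  square that does not depend on \<open>j\<close>.\<close>

lemma dq_bound:
 obtains N \<kappa> E where "sqi lborel N" "\<And>s. 0 \<le> N s" "L2n lborel N \<le> E"
  "AE s in lebesgue_on {0<..<T}. \<forall>z\<in>H01 \<Omega>. \<bar>vt s z\<bar> \<le> N s * H1_norm \<Omega> z"
  "\<And>j::nat. sqi lborel (\<kappa> j)" "\<And>j. L2n lborel (\<kappa> j) \<le> E" "\<And>j s. 0 \<le> \<kappa> j s"
  "\<And>j t z. t \<in> {0<..<T} \<Longrightarrow> z \<in> H01 \<Omega> \<Longrightarrow> \<bar>dq j t z\<bar> \<le> \<kappa> j t * H1_norm \<Omega> z"
proof -
 let ?M = "lebesgue_on {0<..<T}"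
 obtain N where N: "N \<in> borel_measurable borel" "\<And>s. 0 \<le> N s" "\<And>s. s \<notin> {0<..<T} \<Longrightarrow> N s = 0"
  "sqi lborel N" "AE s in ?M. \<forall>z\<in>H01 \<Omega>. \<bar>vt s z\<bar> \<le> N s * H1_norm \<Omega> z"
  by (rule dual_norm_representative) blast
 note Nm [measurable] = N(1)
 have Nint: "integrable lborel (\<lambda>s. (N s)\<^sup>2)" using N(4) by (simp add: sqi_def)
 define m where "m j t = real (Suc j) * (LINT s|lborel. indicator {t - 1 / real (Suc j)<..<t} s * (N s)\<^sup>2)" for j t
 define \<kappa> where "\<kappa> j t = sqrt (m j t)" for j t
 have m0: "0 \<le> m j t" for j t
  unfolding m_def by (intro mult_nonneg_nonneg integral_nonneg_AE AE_I2) auto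
 have mi: "integrable lborel (m j)" "(LINT t|lborel. m j t) = (LINT s|lborel. (N s)\<^sup>2)" for j
 proof -
  note A = average_Fubini[OF Nint, of "\<lambda>_. 1" 1 "1 / real (Suc j)", simplified]
  show "integrable lborel (m j)" using A(1) by (simp add: m_def[abs_def])
  have "(LINT t|lborel. m j t) = real (Suc j) * (LINT s|lborel. (N s)\<^sup>2 * (1 / real (Suc j)))"
   using A(2) by (simp add: m_def[abs_def])
  then show "(LINT t|lborel. m j t) = (LINT s|lborel. (N s)\<^sup>2)" by simp
 qed
 show ?thesis
 proof (rule that[of N "L2n lborel N" \<kappa>])
  show "0 \<le> \<kappa> j s" for j s by (simp add: \<kappa>_def m0)
  show "sqi lborel (\<kappa> j)" for j
   using mi(1)[of j] borel_measurable_integrable[OF mi(1)[of j]] unfolding sqi_def \<kappa>_def[abs_def]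
   by (simp add: m0)
  show "L2n lborel (\<kappa> j) \<le> L2n lborel N" for j
   using mi(2)[of j] by (simp add: L2n_def \<kappa>_def m0)
  fix j t z assume t: "t \<in> {0<..<T}" and z: "z \<in> H01 \<Omega>"
  let ?I = "{t - 1 / real (Suc j)<..<t}"
  have Ni: "integrable lborel (\<lambda>s. indicator ?I s * N s)" and
   CS: "(LINT s|lborel. indicator ?I s * N s) \<le> sqrt (1 / real (Suc j)) * sqrt (LINT s|lborel. indicator ?I s * (N s)\<^sup>2)"
  proof -
   have i1: "sqi lborel (indicat_real ?I)"
   proof -
    have "(\<lambda>s. (norm (indicat_real ?I s))\<^sup>2) = indicat_real ?I" by (auto simp: fun_eq_iff indicator_def)
    then show ?thesis
     unfolding sqi_def using integrable_indicator_interval(1)[of "t - 1 / real (Suc j)" t] by simp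
   qed
   have eq: "(\<lambda>s. indicator ?I s * (N s)\<^sup>2) = (\<lambda>s. (norm (indicator ?I s * N s))\<^sup>2)"
    by (auto simp: fun_eq_iff indicator_def)
   have i2: "sqi lborel (\<lambda>s. indicator ?I s * N s)"
    by (rule sqi_bound[OF N(4), of _ 1]) (auto simp: indicator_def)
   have p: "(\<lambda>s. indicat_real ?I s \<bullet> (indicator ?I s * N s)) = (\<lambda>s. indicator ?I s * N s)"
    by (auto simp: fun_eq_iff indicator_def)
   show "integrable lborel (\<lambda>s. indicator ?I s * N s)" using sqi_inner_integrable[OF i1 i2] unfolding p .
   have "(\<lambda>s. (norm (indicat_real ?I s))\<^sup>2) = indicat_real ?I" by (auto simp: fun_eq_iff indicator_def)
   then have "L2n lborel (indicat_real ?I) = sqrt (1 / real (Suc j))" by (simp add: L2n_def)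
   moreover have "L2n lborel (\<lambda>s. indicator ?I s * N s) = sqrt (LINT s|lborel. indicator ?I s * (N s)\<^sup>2)"
    unfolding L2n_def eq ..
   ultimately show "(LINT s|lborel. indicator ?I s * N s) \<le> sqrt (1 / real (Suc j)) * sqrt (LINT s|lborel. indicator ?I s * (N s)\<^sup>2)"
    using L2n_Cauchy_Schwarz[OF i1 i2] unfolding p by simp
  qed
  have Nl: "integrable lebesgue (\<lambda>s. indicator ?I s * N s)"
   using Ni by (subst integrable_completion) auto
  have iN: "integrable ?M (\<lambda>s. indicator ?I s * N s * H1_norm \<Omega> z)"
   using integrable_mult_indicator[OF _ Nl, of "{0<..<T}"] by (simp add: integrable_restrict_space)
  have "\<bar>LINT s|?M. indicator ?I s * vt s z\<bar> \<le> (LINT s|?M. indicator ?I s * N s * H1_norm \<Omega> z)"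
  proof (rule integral_abs_bound_AE)
   have im: "indicat_real ?I \<in> borel_measurable ?M"
    by (intro measurable_restrict_space1 measurable_completion) simp
   show "AE s in ?M. \<bar>indicator ?I s * vt s z\<bar> \<le> indicator ?I s * N s * H1_norm \<Omega> z"
    using N(5) by eventually_elim (use z in \<open>auto simp: indicator_def\<close>)
   note ae = this
   show "integrable ?M (\<lambda>s. indicator ?I s * vt s z)"
    using dual_pairing_integrable[OF z] im
   proof (intro Bochner_Integration.integrable_bound[OF iN] borel_measurable_times)
    show "AE s in ?M. norm (indicator ?I s * vt s z) \<le> norm (indicator ?I s * N s * H1_norm \<Omega> z)"
     using ae by eventually_elim auto
   qed auto
  qed (rule iN)
  also have "\<dots> = (LINT s|lborel. indicator ?I s * N s) * H1_norm \<Omega> z"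
  proof -
   have "(LINT s|?M. indicator ?I s * N s) = (LINT s|lebesgue. indicator {0<..<T} s *\<^sub>R (indicator ?I s * N s))"
    by (simp add: integral_restrict_space)
   also have "(\<lambda>s. indicator {0<..<T} s *\<^sub>R (indicator ?I s * N s)) = (\<lambda>s. indicator ?I s * N s)"
   proof
    show "indicator {0<..<T} s *\<^sub>R (indicator ?I s * N s) = indicator ?I s * N s" for s
     using N(3)[of s] by (cases "s \<in> {0<..<T}") auto
   qed
   also have "(LINT s|lebesgue. indicator ?I s * N s) = (LINT s|lborel. indicator ?I s * N s)"
    by (rule integral_completion) simp
   finally show ?thesis by simp
  qed
  also have "\<dots> \<le> sqrt (1 / real (Suc j)) * sqrt (LINT s|lborel. indicator ?I s * (N s)\<^sup>2) * H1_norm \<Omega> z"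
   using CS by (intro mult_right_mono) (auto simp: H1_norm_nonneg)
  finally have "real (Suc j) * \<bar>LINT s|?M. indicator ?I s * vt s z\<bar>
    \<le> real (Suc j) * (sqrt (1 / real (Suc j)) * sqrt (LINT s|lborel. indicator ?I s * (N s)\<^sup>2) * H1_norm \<Omega> z)"
   by (intro mult_left_mono) auto
  also have "\<dots> = (real (Suc j) * sqrt (1 / real (Suc j))) * sqrt (LINT s|lborel. indicator ?I s * (N s)\<^sup>2) * H1_norm \<Omega> z"
   by (simp only: mult.assoc)
  also have "real (Suc j) * sqrt (1 / real (Suc j)) = sqrt (real (Suc j))"
   by (simp add: real_sqrt_divide real_div_sqrt)
  also have "sqrt (real (Suc j)) * sqrt (LINT s|lborel. indicator ?I s * (N s)\<^sup>2) = \<kappa> j t"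
   unfolding \<kappa>_def m_def by (simp only: real_sqrt_mult)
  finally show "\<bar>dq j t z\<bar> \<le> \<kappa> j t * H1_norm \<Omega> z"
   unfolding dq_eq[OF t z] by (simp add: abs_mult)
 qed (use N in auto)
qed

lemma dq_average:
 assumes z: "z \<in> H01 \<Omega>"
 obtains g where "integrable lborel g" "g \<in> borel_measurable borel" "AE s in lebesgue_on {0<..<T}. g s = vt s z"
  "\<And>j t. t \<in> {0<..<T} \<Longrightarrow> dq j t z = real (Suc j) * (LINT s|lborel. indicator {t - 1 / real (Suc j)<..<t} s * g s)"
proof -
 let ?M = "lebesgue_on {0<..<T}"
 have vi: "integrable ?M (\<lambda>t. vt t z)" by (rule dual_pairing_integrable[OF z])
 obtain g where g: "g \<in> borel_measurable borel" "\<And>x. x \<notin> {0<..<T} \<Longrightarrow> g x = 0" "AE x in ?M. g x = vt x z"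
  using borel_representative[OF borel_measurable_integrable[OF vi]] by auto
 have gM: "g \<in> borel_measurable ?M"
  using g(1) by (intro measurable_restrict_space1 measurable_completion) simp
 have gI: "indicator {0<..<T} s *\<^sub>R (c * g s) = c * g s" for s c
  using g(2)[of s] by (cases "s \<in> {0<..<T}") auto
 have "integrable ?M g"
  by (rule integrable_cong_AE_imp[OF vi gM]) (use g(3) in \<open>auto elim: eventually_mono\<close>)
 moreover have "(\<lambda>s. indicator {0<..<T} s *\<^sub>R g s) = g"
 proof
  show "indicator {0<..<T} s *\<^sub>R g s = g s" for s using gI[of s 1] by (simp only: mult_1)
 qed
 ultimately have "integrable lebesgue g" by (simp add: integrable_restrict_space del: real_scaleR_def)
 then have gi: "integrable lborel g" using g(1) by (simp add: integrable_completion)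
 show ?thesis
 proof (rule that[OF gi g(1,3)])
  fix j t assume t: "t \<in> {0<..<T}"
  let ?I = "{t - 1 / real (Suc j)<..<t}"
  have "(LINT s|?M. indicator ?I s * vt s z) = (LINT s|?M. indicator ?I s * g s)"
  proof (rule integral_cong_AE)
   have "indicat_real ?I \<in> borel_measurable ?M"
    by (intro measurable_restrict_space1 measurable_completion) simp
   then show "(\<lambda>s. indicator ?I s * vt s z) \<in> borel_measurable ?M" "(\<lambda>s. indicator ?I s * g s) \<in> borel_measurable ?M"
    using gM borel_measurable_integrable[OF vi] by (auto intro!: borel_measurable_times)
   show "AE s in ?M. indicator ?I s * vt s z = indicator ?I s * g s"
    using g(3) by eventually_elim simp
  qed
  also have "\<dots> = (LINT s|lebesgue. indicator ?I s * g s)"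
   using gI by (simp add: integral_restrict_space del: real_scaleR_def)
  also have "\<dots> = (LINT s|lborel. indicator ?I s * g s)"
   by (rule integral_completion) (use g(1) in measurable)
  finally show "dq j t z = real (Suc j) * (LINT s|lborel. indicator ?I s * g s)"
   by (simp add: dq_eq[OF t z])
 qed
qed

lemma dq_integrable:
 assumes z: "z \<in> H01 \<Omega>" shows "integrable (lebesgue_on {0<..<T}) (\<lambda>t. dq j t z)"
proof -
 obtain g where g: "integrable lborel g" "g \<in> borel_measurable borel"
  "\<And>j t. t \<in> {0<..<T} \<Longrightarrow> dq j t z = real (Suc j) * (LINT s|lborel. indicator {t - 1 / real (Suc j)<..<t} s * g s)"
  by (rule dq_average[OF z]) blast
 let ?X = "\<lambda>t. real (Suc j) * (LINT s|lborel. indicator {t - 1 / real (Suc j)<..<t} s * g s)"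
 have "integrable lborel ?X"
  using average_Fubini(1)[OF g(1), of "\<lambda>_. 1" 1 "1 / real (Suc j)"] by simp
 then have "integrable lebesgue ?X" by (subst integrable_completion) auto
 then have "integrable lebesgue (\<lambda>t. indicator {0<..<T} t *\<^sub>R ?X t)"
  by (intro integrable_mult_indicator) simp
 then have "integrable (lebesgue_on {0<..<T}) ?X"
  by (subst integrable_restrict_space) (simp, assumption)
 then show ?thesis
  by (rule Bochner_Integration.integrable_cong[THEN iffD1, rotated -1]) (use g(3) in auto)
qed

lemma indicator_integrable:
 assumes "integrable (lebesgue_on {0<..<T}) f" "E \<in> sets lebesgue" "E \<subseteq> {0<..<T}"
 shows "integrable (lebesgue_on {0<..<T}) (\<lambda>t. indicator E t * f t :: real)"
 using integrable_mult_indicator[OF _ assms(1), of E] assms(2,3) by (simp add: sets_restrict_space_iff)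

text \<open>For a fixed argument \<open>z\<close> the quotients are backward averages of one
  integrable function, so \<open>average_tendsto\<close> applies once \<open>E\<close> is replaced
  by its Borel part.\<close>

lemma dq_set_tendsto:
 assumes z: "z \<in> H01 \<Omega>" and E: "E \<in> sets lebesgue" "E \<subseteq> {0<..<T}"
 shows "(\<lambda>j. LINT t|lebesgue_on {0<..<T}. indicator E t * dq j t z) \<longlonglongrightarrow> (LINT t|lebesgue_on {0<..<T}. indicator E t * vt t z)"
proof -
 let ?M = "lebesgue_on {0<..<T}"
 obtain g where g: "integrable lborel g" "g \<in> borel_measurable borel" "AE s in ?M. g s = vt s z"
  "\<And>j t. t \<in> {0<..<T} \<Longrightarrow> dq j t z = real (Suc j) * (LINT s|lborel. indicator {t - 1 / real (Suc j)<..<t} s * g s)"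
  by (rule dq_average[OF z]) blast
 let ?F = "main_part lborel E"
 have F: "?F \<in> sets borel" using main_part_sets[OF E(1)] by simp
 have ae: "AE x in lebesgue. x \<in> ?F \<longleftrightarrow> x \<in> E"
  using AE_not_in[OF null_part_null_sets[OF E(1)]]
  by eventually_elim (use main_part_null_part_Un[OF E(1)] in blast)
 have trans: "(LINT t|?M. indicator E t * X t) = (LINT t|lborel. indicator ?F t * X t)"
  if X: "X \<in> borel_measurable borel" for X :: "real \<Rightarrow> real"
 proof -
  have Xl: "X \<in> borel_measurable lebesgue" using X by (intro measurable_completion) simp
  have "indicator {0<..<T} t *\<^sub>R (indicator E t * X t) = indicator E t * X t" for t
   using E(2) by (auto simp: indicator_def)
  then have "(LINT t|?M. indicator E t * X t) = (LINT t|lebesgue. indicator E t * X t)"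
   by (simp add: integral_restrict_space del: real_scaleR_def)
  also have "\<dots> = (LINT t|lebesgue. indicator ?F t * X t)"
  proof (rule integral_cong_AE)
   have "indicat_real ?F \<in> borel_measurable lebesgue" "indicat_real E \<in> borel_measurable lebesgue"
    using F E(1) by (auto intro!: borel_measurable_indicator)
   then show "(\<lambda>t. indicator E t * X t) \<in> borel_measurable lebesgue" "(\<lambda>t. indicator ?F t * X t) \<in> borel_measurable lebesgue"
    using Xl by (auto intro!: borel_measurable_times)
   show "AE t in lebesgue. indicator E t * X t = indicator ?F t * X t"
    using ae by eventually_elim (auto simp: indicator_def)
  qed
  also have "\<dots> = (LINT t|lborel. indicator ?F t * X t)"
   by (rule integral_completion) (use X F in measurable)
  finally show ?thesis .
 qed
 let ?X = "\<lambda>j t. LINT s|lborel. indicator {t - 1 / real (Suc j)<..<t} s * g s"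
 have Xm: "?X j \<in> borel_measurable borel" for j
  using borel_measurable_integrable[OF average_Fubini(1)[OF g(1), of "\<lambda>_. 1" 1 "1 / real (Suc j)"]] by simp
 have "(LINT t|?M. indicator E t * dq j t z) = real (Suc j) * (LINT t|lborel. indicator ?F t * ?X j t)" for j
 proof -
  have "(LINT t|?M. indicator E t * dq j t z) = (LINT t|?M. real (Suc j) * (indicator E t * ?X j t))"
   by (rule Bochner_Integration.integral_cong) (auto simp: g(4))
  also have "\<dots> = real (Suc j) * (LINT t|?M. indicator E t * ?X j t)" by simp
  finally show ?thesis by (simp only: trans[OF Xm])
 qed
 moreover have "(LINT t|?M. indicator E t * vt t z) = (LINT s|lborel. g s * indicator ?F s)"
 proof -
  have Ei: "indicat_real E \<in> borel_measurable ?M"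
   using E by (intro borel_measurable_indicator) (simp add: sets_restrict_space_iff)
  have gM: "g \<in> borel_measurable ?M"
   using g(2) by (intro measurable_restrict_space1 measurable_completion) simp
  have "(LINT t|?M. indicator E t * vt t z) = (LINT t|?M. indicator E t * g t)"
  proof (rule integral_cong_AE)
   show "(\<lambda>t. indicator E t * vt t z) \<in> borel_measurable ?M" "(\<lambda>t. indicator E t * g t) \<in> borel_measurable ?M"
    using Ei gM borel_measurable_integrable[OF dual_pairing_integrable[OF z]] by (auto intro!: borel_measurable_times)
   show "AE t in ?M. indicator E t * vt t z = indicator E t * g t" using g(3) by eventually_elim simp
  qed
  then show ?thesis using trans[OF g(2)] by (simp add: mult.commute)
 qed
 ultimately show ?thesis using average_tendsto[OF g(1) F] by simp
qed

lemma step_fun_sum: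
 assumes "step_fun T X S" "t \<in> {0<..<T}"
 shows "(F (S t) :: real) = (\<Sum>a\<in>S ` {0<..<T}. indicator {s \<in> {0<..<T}. S s = a} t * F a)"
proof -
 have fin: "finite (S ` {0<..<T})" using assms(1) by (simp add: step_fun_def)
 have m: "S t \<in> S ` {0<..<T}" using assms(2) by (rule imageI)
 have eq: "indicator {s \<in> {0<..<T}. S s = a} t * F a = (if a = S t then F a else 0)" for a
  using assms(2) by (cases "a = S t") (simp_all add: indicator_def)
 show ?thesis by (simp only: eq sum.delta[OF fin] m if_True)
qed

lemma dq_step_tendsto:
 assumes S: "step_fun T (H01 \<Omega>) S"
 shows "(\<lambda>j. LINT t|lebesgue_on {0<..<T}. dq j t (S t)) \<longlonglongrightarrow> (LINT t|lebesgue_on {0<..<T}. vt t (S t))"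
  "integrable (lebesgue_on {0<..<T}) (\<lambda>t. vt t (S t))" "integrable (lebesgue_on {0<..<T}) (\<lambda>t. dq j t (S t))"
proof -
 let ?M = "lebesgue_on {0<..<T}"
 let ?A = "S ` {0<..<T}" and ?E = "\<lambda>a. {s \<in> {0<..<T}. S s = a}"
 have E: "?E a \<in> sets lebesgue" "?E a \<subseteq> {0<..<T}" and A: "finite ?A" for a
  using S by (auto simp: step_fun_def)
 have AX: "a \<in> H01 \<Omega>" if "a \<in> ?A" for a using S that by (auto simp: step_fun_def)
 have i1: "integrable ?M (\<lambda>t. indicator (?E a) t * dq j t a)" if "a \<in> ?A" for a j
  by (rule indicator_integrable[OF dq_integrable[OF AX[OF that]] E])
 have i2: "integrable ?M (\<lambda>t. indicator (?E a) t * vt t a)" if "a \<in> ?A" for a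
  by (rule indicator_integrable[OF dual_pairing_integrable[OF AX[OF that]] E])
 have s1: "integrable ?M (\<lambda>t. \<Sum>a\<in>?A. indicator (?E a) t * dq j t a)" for j
  using i1 by (rule Bochner_Integration.integrable_sum)
 have s2: "integrable ?M (\<lambda>t. \<Sum>a\<in>?A. indicator (?E a) t * vt t a)"
  using i2 by (rule Bochner_Integration.integrable_sum)
 have e1: "dq j t (S t) = (\<Sum>a\<in>?A. indicator (?E a) t * dq j t a)" if "t \<in> space ?M" for t j
  using that by (intro step_fun_sum[OF S]) simp
 have e2: "vt t (S t) = (\<Sum>a\<in>?A. indicator (?E a) t * vt t a)" if "t \<in> space ?M" for t
  using that by (intro step_fun_sum[OF S, of _ "vt t"]) simp
 show "integrable ?M (\<lambda>t. vt t (S t))"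
  by (subst Bochner_Integration.integrable_cong[OF refl, where g="\<lambda>t. \<Sum>a\<in>?A. indicator (?E a) t * vt t a"])
    (fact e2, fact s2)
 show "integrable ?M (\<lambda>t. dq j t (S t))"
  by (subst Bochner_Integration.integrable_cong[OF refl, where g="\<lambda>t. \<Sum>a\<in>?A. indicator (?E a) t * dq j t a"])
    (fact e1, fact s1)
 have "(LINT t|?M. dq j t (S t)) = (\<Sum>a\<in>?A. LINT t|?M. indicator (?E a) t * dq j t a)" for j
  by (rule trans[OF Bochner_Integration.integral_cong[OF refl e1] Bochner_Integration.integral_sum[OF i1]])
 moreover have "(LINT t|?M. vt t (S t)) = (\<Sum>a\<in>?A. LINT t|?M. indicator (?E a) t * vt t a)"
  by (rule trans[OF Bochner_Integration.integral_cong[OF refl e2] Bochner_Integration.integral_sum[OF i2]])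
 ultimately show "(\<lambda>j. LINT t|?M. dq j t (S t)) \<longlonglongrightarrow> (LINT t|?M. vt t (S t))"
  using tendsto_sum[OF dq_set_tendsto[OF AX E]] by simp
qed

text \<open>Convergence of averages is available for a fixed argument, hence for step functions. A
  general \<open>\<phi>\<close> varies with time and is reached by density; the error is controlled
  uniformly in \<open>j\<close> by the mean square bound \<open>E\<close> from
  \<open>dq_bound\<close>.\<close>

lemma steklov_limit:
 assumes \<phi>: "\<phi> \<in> bochner_Lp 2 T (H01 \<Omega>) (H1_norm \<Omega>)"
 shows "(\<lambda>j. LINT t|lebesgue_on {0<..<T}. dq j t (\<phi> t)) \<longlonglongrightarrow> (LINT t|lebesgue_on {0<..<T}. vt t (\<phi> t))"
  "integrable (lebesgue_on {0<..<T}) (\<lambda>t. dq j t (\<phi> t))"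
proof -
 let ?M = "lebesgue_on {0<..<T}"
 obtain N \<kappa> E where N: "sqi lborel N" "\<And>s. 0 \<le> N s" "L2n lborel N \<le> E"
  "AE s in ?M. \<forall>z\<in>H01 \<Omega>. \<bar>vt s z\<bar> \<le> N s * H1_norm \<Omega> z"
  and k: "\<And>j::nat. sqi lborel (\<kappa> j)" "\<And>j. L2n lborel (\<kappa> j) \<le> E" "\<And>j s. 0 \<le> \<kappa> j s"
  "\<And>j t z. t \<in> {0<..<T} \<Longrightarrow> z \<in> H01 \<Omega> \<Longrightarrow> \<bar>dq j t z\<bar> \<le> \<kappa> j t * H1_norm \<Omega> z"
  by (rule dq_bound) blast
 obtain S where S: "\<And>j::nat. step_fun T (H01 \<Omega>) (S j)"
  "\<And>j. sqi ?M (\<lambda>t. H1_norm \<Omega> (\<lambda>x. \<phi> t x - S j t x))"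
  "(\<lambda>j. L2n ?M (\<lambda>t. H1_norm \<Omega> (\<lambda>x. \<phi> t x - S j t x))) \<longlonglongrightarrow> 0"
  "AE t in ?M. (\<lambda>j. H1_norm \<Omega> (\<lambda>x. \<phi> t x - S j t x)) \<longlonglongrightarrow> 0"
  using bochner_H01_approx[OF op bd T \<phi>] by blast
 have sm: "strongly_measurable T (H01 \<Omega>) (H1_norm \<Omega>) \<phi>" and i\<phi>: "integrable ?M (\<lambda>t. (H1_norm \<Omega> (\<phi> t))\<^sup>2)"
  using \<phi> bochner_H01_iff[OF op bd T] by blast+
 have X: "AE t in ?M. \<phi> t \<in> H01 \<Omega>" using sm by (simp add: strongly_measurable_def)
 have s\<phi>: "sqi ?M (\<lambda>t. H1_norm \<Omega> (\<phi> t))"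
  using i\<phi> H1_norm_borel[OF op bd T sm] by (simp add: sqi_def)
 have SX: "S i t \<in> H01 \<Omega>" if "t \<in> space ?M" for i t by (rule step_funD[OF S(1) that])
 note kM = sqi_lborel_restrict[OF k(1), of "{0<..<T}", simplified]
 note NM = sqi_lborel_restrict[OF N(1), of "{0<..<T}", simplified]
 let ?e = "\<lambda>i t. H1_norm \<Omega> (\<lambda>x. \<phi> t x - S i t x)"
 have dqm: "(\<lambda>t. dq j t (\<phi> t)) \<in> borel_measurable ?M" for j
 proof (rule measurable_limit_lebesgue_on[of _ "\<lambda>i t. dq j t (S i t)"])
  show "(\<lambda>t. dq j t (S i t)) \<in> borel_measurable ?M" for i
   by (rule borel_measurable_integrable[OF dq_step_tendsto(3)[OF S(1)]])
  show "AE t in ?M. (\<lambda>i. dq j t (S i t)) \<longlonglongrightarrow> dq j t (\<phi> t)"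
   using S(4) X AE_space
  proof eventually_elim
   case (elim t)
   have l: "(\<lambda>i. \<kappa> j t * ?e i t) \<longlonglongrightarrow> 0" using tendsto_mult[OF tendsto_const elim(1)] by simp
   show ?case
   proof (rule LIM_zero_cancel, rule Lim_null_comparison[OF _ l], intro always_eventually allI)
    fix i
    have "\<bar>dq j t (\<lambda>x. \<phi> t x - S i t x)\<bar> \<le> \<kappa> j t * ?e i t"
     using elim(2,3) SX[OF elim(3)] by (intro k(4) H01_diff) auto
    then show "norm (dq j t (S i t) - dq j t (\<phi> t)) \<le> \<kappa> j t * ?e i t"
     using dq_diff[of t "\<phi> t" "S i t" j] elim(2,3) SX[OF elim(3)] by (simp add: abs_minus_commute)
   qed
  qed
 qed simp
 have vtm: "(\<lambda>t. vt t (\<phi> t)) \<in> borel_measurable ?M"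
  by (rule pairing_measurable[OF op bd T vt_sm sm])
 have prod_int: "integrable ?M (\<lambda>t. f t * g t)" "\<bar>LINT t|?M. f t * g t\<bar> \<le> L2n ?M f * L2n ?M g"
  if "sqi ?M f" "sqi ?M g" for f g :: "real \<Rightarrow> real"
  using sqi_inner_integrable[OF that] L2n_Cauchy_Schwarz[OF that] by simp_all
 show dqi: "integrable ?M (\<lambda>t. dq j t (\<phi> t))" for j
 proof (rule Bochner_Integration.integrable_bound[OF prod_int(1)[OF kM(1) s\<phi>] dqm])
  show "AE t in ?M. norm (dq j t (\<phi> t)) \<le> norm (\<kappa> j t * H1_norm \<Omega> (\<phi> t))"
   using X AE_space by eventually_elim (use k(3,4) in \<open>simp add: H1_norm_nonneg\<close>)
 qed
 have vti: "integrable ?M (\<lambda>t. vt t (\<phi> t))"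
 proof (rule Bochner_Integration.integrable_bound[OF prod_int(1)[OF NM(1) s\<phi>] vtm])
  show "AE t in ?M. norm (vt t (\<phi> t)) \<le> norm (N t * H1_norm \<Omega> (\<phi> t))"
   using X N(4) by eventually_elim (use N(2) in \<open>simp add: H1_norm_nonneg\<close>)
 qed
 show "(\<lambda>j. LINT t|?M. dq j t (\<phi> t)) \<longlonglongrightarrow> (LINT t|?M. vt t (\<phi> t))"
 proof (rule tendsto_of_approximations[OF S(3) dq_step_tendsto(1)[OF S(1)], where C=E])
  fix i j
  have "\<bar>LINT t|?M. dq j t (\<phi> t) - dq j t (S i t)\<bar> \<le> (LINT t|?M. \<kappa> j t * ?e i t)"
  proof (rule integral_abs_bound_AE)
   show "AE t in ?M. \<bar>dq j t (\<phi> t) - dq j t (S i t)\<bar> \<le> \<kappa> j t * ?e i t"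
    using X AE_space
   proof eventually_elim
    case (elim t)
    then show ?case
     using k(4)[OF _ H01_diff[OF elim(1) SX[OF elim(2)]], of t j i] dq_diff[of t "\<phi> t" "S i t" j] SX[OF elim(2)]
     by simp
   qed
  qed (use dqi dq_step_tendsto(3)[OF S(1)] prod_int(1)[OF kM(1) S(2)] in auto)
  also have "\<dots> \<le> L2n ?M (\<kappa> j) * L2n ?M (?e i)" using prod_int(2)[OF kM(1)[of j] S(2)[of i]] by linarith
  also have "\<dots> \<le> E * L2n ?M (?e i)"
   using kM(2)[of j] k(2)[of j] by (intro mult_right_mono) auto
  finally show "\<bar>(LINT t|?M. dq j t (\<phi> t)) - (LINT t|?M. dq j t (S i t))\<bar> \<le> E * L2n ?M (?e i)"
   using dqi[of j] dq_step_tendsto(3)[OF S(1)[of i], of j] by simp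
 next
  fix i
  have "\<bar>LINT t|?M. vt t (\<phi> t) - vt t (S i t)\<bar> \<le> (LINT t|?M. N t * ?e i t)"
  proof (rule integral_abs_bound_AE)
   show "AE t in ?M. \<bar>vt t (\<phi> t) - vt t (S i t)\<bar> \<le> N t * ?e i t"
    using X AE_space N(4) vt_Hm1
   proof eventually_elim
    case (elim t)
    show ?case
     using elim(3) H01_diff[OF elim(1) SX[OF elim(2), of i]] Hm1_linear_diff[OF op bd T elim(4,1) SX[OF elim(2), of i]]
     by force
   qed
  qed (use vti dq_step_tendsto(2)[OF S(1)] prod_int(1)[OF NM(1) S(2)] in auto)
  also have "\<dots> \<le> L2n ?M N * L2n ?M (?e i)" using prod_int(2)[OF NM(1) S(2)[of i]] by linarith
  also have "\<dots> \<le> E * L2n ?M (?e i)"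
   using NM(2) N(3) by (intro mult_right_mono) auto
  finally show "\<bar>(LINT t|?M. vt t (\<phi> t)) - (LINT t|?M. vt t (S i t))\<bar> \<le> E * L2n ?M (?e i)"
   using vti dq_step_tendsto(2)[OF S(1)[of i]] by simp
 qed
qed

end

section \<open>Convex functionals along the evolution\<close>

context evolution
begin

text \<open>One half of the formal identity between the increment of the integral of
  \<open>H (w t x)\<close> and the pairing of the derivative with \<open>G (w t)\<close>. Convexity
  bounds the difference quotient of the functional by \<open>dq\<close> evaluated at
  \<open>G (w t)\<close>; integration in time and \<open>steklov_limit\<close> then remove the
  quotient.\<close>

lemma time_inequality:
 assumes H: "\<And>y. (H has_real_derivative G y) (at y)" "H 0 = 0"
  and G: "G \<in> borel_measurable borel" "mono G" "\<And>y. \<bar>G y\<bar> \<le> K"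
  and w0: "AE x in lebesgue_on \<Omega>. w 0 x = 0"
  and \<tau>: "0 < \<tau>" "\<tau> \<le> T"
  and \<phi>: "(\<lambda>t. if t < \<tau> then (\<lambda>x. G (w t x)) else (\<lambda>x. 0)) \<in> bochner_Lp 2 T (H01 \<Omega>) (H1_norm \<Omega>)"
 shows "(LINT x|lebesgue_on \<Omega>. H (w \<tau> x)) \<le>
   (LINT t|lebesgue_on {0<..<T}. vt t (if t < \<tau> then (\<lambda>x. G (w t x)) else (\<lambda>x. 0)))"
proof -
 let ?M = "lebesgue_on \<Omega>"
 define \<phi> where "\<phi> t = (if t < \<tau> then (\<lambda>x. G (w t x)) else (\<lambda>x. 0))" for t
 have K: "0 \<le> K" using G(3)[of 0] by simp
 have Hc: "continuous_on UNIV H" using H(1) by (auto intro!: DERIV_continuous_on)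
 have Hm [measurable]: "H \<in> borel_measurable borel" using Hc by (rule borel_measurable_continuous_onI)
 have HL: "\<bar>H a - H b\<bar> \<le> K * \<bar>a - b\<bar>" for a b
  using field_differentiable_bound[of UNIV H G K a b] H(1) G(3)
  by (auto simp: field_differentiable_def)
 have Hconv: "H b - H a \<le> G b * (b - a)" for a b
 proof -
  consider "a < b" | "a = b" | "b < a" by linarith
  then show ?thesis
  proof cases
   case 1
   from MVT2[OF this, of H G] H(1) obtain z where z: "z < b" "H b - H a = (b - a) * G z" by blast
   have "G z \<le> G b" using z(1) G(2) by (simp add: mono_def)
   then have "(b - a) * G z \<le> (b - a) * G b" using 1 by (intro mult_left_mono) auto
   then show ?thesis using z(2) by (simp add: mult.commute)
  next
   case 3
   from MVT2[OF this, of H G] H(1) obtain z where z: "b < z" "H a - H b = (a - b) * G z" by blast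
   have "G b \<le> G z" using z(1) G(2) by (simp add: mono_def)
   then have "(a - b) * G b \<le> (a - b) * G z" using 3 by (intro mult_left_mono) auto
   then show ?thesis using z(2) by (simp add: algebra_simps)
  qed simp
 qed
 have wm [measurable]: "w t \<in> borel_measurable ?M" if "t \<in> {0..T}" for t
  using w_sqi[OF that] by (rule sqi_measurable)
 have wi: "integrable ?M (w t)" if "t \<in> {0..T}" for t
  by (rule sqi_integrable1[OF op bd w_sqi[OF that]])
 have Hi: "integrable ?M (\<lambda>x. H (w t x))" if t: "t \<in> {0..T}" for t
 proof (rule Bochner_Integration.integrable_bound)
  show "integrable ?M (\<lambda>x. K * \<bar>w t x\<bar>)" using wi[OF t] by simp
  show "(\<lambda>x. H (w t x)) \<in> borel_measurable ?M" using wm[OF t] by measurable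
  show "AE x in ?M. norm (H (w t x)) \<le> norm (K * \<bar>w t x\<bar>)"
   using HL[of _ 0] H(2) K by (auto simp: abs_mult)
 qed
 define \<Phi> where "\<Phi> t = (LINT x|?M. H (w t x))" for t
 have one: "sqi ?M (\<lambda>x. 1 :: real)" by (rule sqi_bounded[OF op bd, of _ 1]) auto
 have \<Phi>c: "continuous_on {0..T} \<Phi>"
 proof (rule continuous_of_L2_bound)
  fix t s assume t: "t \<in> {0..T}" "s \<in> {0..T}"
  have d: "sqi ?M (\<lambda>x. \<bar>w t x - w s x\<bar>)"
   using sqi_diff[OF w_sqi[OF t(1)] w_sqi[OF t(2)]] by (auto simp: sqi_def)
  have "\<bar>\<Phi> t - \<Phi> s\<bar> = \<bar>LINT x|?M. H (w t x) - H (w s x)\<bar>" using Hi t by (simp add: \<Phi>_def)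
  also have "\<dots> \<le> (LINT x|?M. K * \<bar>w t x - w s x\<bar>)"
   by (rule integral_abs_bound_AE) (use HL Hi wi t in auto)
  also have "\<dots> = K * (LINT x|?M. \<bar>w t x - w s x\<bar> \<bullet> 1)" by simp
  also have "\<dots> \<le> K * (L2n ?M (\<lambda>x. \<bar>w t x - w s x\<bar>) * L2n ?M (\<lambda>x. 1::real))"
   using L2n_Cauchy_Schwarz[OF d one] K by (intro mult_left_mono) auto
  also have "L2n ?M (\<lambda>x. \<bar>w t x - w s x\<bar>) = L2n ?M (\<lambda>x. w t x - w s x)" by (simp add: L2n_def)
  finally show "\<bar>\<Phi> t - \<Phi> s\<bar> \<le> L2n ?M (\<lambda>x. w t x - w s x) * (K * L2n ?M (\<lambda>x. 1::real))" by (simp add: mult_ac)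
 qed
 \<comment> \<open>The clamped functional is constant before time zero, in agreement with the
   continuation of the curve inside \<open>dq\<close>.\<close>
 define U where "U t = \<Phi> (clamp0 t)" for t
 have Uc: "continuous_on UNIV U" unfolding U_def by (rule clamp0_continuous[OF \<Phi>c])
 have UcAt: "isCont U x" for x using Uc continuous_on_eq_continuous_at[OF open_UNIV] by blast
 have "\<exists>A. \<forall>x::real. -\<infinity> < ereal x \<longrightarrow> ereal x < \<infinity> \<longrightarrow> (A has_vector_derivative U x) (at x)"
  by (rule einterval_antiderivative) (use UcAt in auto)
 then obtain A where A: "\<And>x. (A has_real_derivative U x) (at x)"
  by (auto simp: has_real_derivative_iff_has_vector_derivative)
 have \<Phi>0: "\<Phi> 0 = 0"
  unfolding \<Phi>_def by (rule integral_eq_zero_AE) (use w0 in eventually_elim, simp add: H(2))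
 have dq_ge: "real (Suc j) * (U t - U (t - 1 / real (Suc j))) \<le> dq j t (\<phi> t)" if t: "t \<in> {0<..<T}" "t < \<tau>" for t j
 proof -
  let ?\<theta> = "max 0 (t - 1 / real (Suc j))"
  have "t - 1 / real (Suc j) \<le> T" by (rule order_trans[of _ t]) (use t in simp_all)
  then have tI: "t \<in> {0..T}" "?\<theta> \<in> {0..T}" using t T by auto
  have cl: "clamp0 t = t" "clamp0 (t - 1 / real (Suc j)) = ?\<theta>"
   using tI \<open>t - 1 / real (Suc j) \<le> T\<close> by (auto simp: clamp0_def)
  have Gm: "(\<lambda>x. G (w t x)) \<in> borel_measurable ?M" by (rule measurable_compose[OF wm[OF tI(1)] G(1)])
  have Gs: "sqi ?M (\<lambda>x. G (w t x))" by (rule sqi_bounded[OF op bd Gm, of K]) (use G(3) in simp)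
  have i: "integrable ?M (\<lambda>x. w s x * G (w t x))" if "s \<in> {0..T}" for s
   using ip_L2n(2)[OF w_sqi[OF that] Gs] .
  have "U t - U (t - 1 / real (Suc j)) = (LINT x|?M. H (w t x) - H (w ?\<theta> x))"
   unfolding U_def cl \<Phi>_def using Hi tI by simp
  also have "\<dots> \<le> (LINT x|?M. w t x * G (w t x) - w ?\<theta> x * G (w t x))"
  proof (rule integral_mono)
   show "H (w t x) - H (w ?\<theta> x) \<le> w t x * G (w t x) - w ?\<theta> x * G (w t x)" for x
    using Hconv[of "w t x" "w ?\<theta> x"] by (simp add: algebra_simps)
  qed (use Hi i tI in auto)
  also have "\<dots> = ip \<Omega> (w t) (\<phi> t) - ip \<Omega> (w ?\<theta>) (\<phi> t)"
   using i tI t by (simp add: ip_def \<phi>_def)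
  finally show ?thesis unfolding dq_def by (intro mult_left_mono) auto
 qed
 have dq0: "dq j t (\<phi> t) = 0" if "\<not> t < \<tau>" for j t
  using that by (simp add: dq_def ip_def \<phi>_def)
 note S = steklov_limit[OF \<phi>, folded \<phi>_def]
 \<comment> \<open>With \<open>A\<close> a primitive of \<open>U\<close>, the integrated difference
   quotient telescopes: what remains is the mean of \<open>U\<close> just before
   \<open>\<tau>\<close> minus its mean just before zero, and these tend to \<open>U \<tau>\<close>
   and \<open>U 0\<close>.\<close>
 let ?L = "\<lambda>j. real (Suc j) * ((A \<tau> - A (\<tau> - 1 / real (Suc j))) - (A 0 - A (0 - 1 / real (Suc j))))"
 have le: "?L j \<le> (LINT t|lebesgue_on {0<..<T}. dq j t (\<phi> t))" for j
 proof -
  let ?h = "1 / real (Suc j)"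
  let ?f = "\<lambda>t. U t - U (t - ?h)"
  have fc: "isCont ?f x" for x by (intro continuous_intros UcAt isCont_o2[OF _ UcAt])
  have int: "integrable lborel (\<lambda>t. ?f t * indicator {0..\<tau>} t)"
   using borel_integrable_atLeastAtMost[of 0 \<tau> ?f] fc by blast
  have FTC: "(LINT t|lborel. ?f t * indicator {0..\<tau>} t) = (A \<tau> - A (\<tau> - ?h)) - (A 0 - A (0 - ?h))"
  proof (rule integral_FTC_Icc_real[where F="\<lambda>t. A t - A (t - ?h)"])
   show "((\<lambda>t. A t - A (t - ?h)) has_real_derivative ?f x) (at x)" for x
    by (rule derivative_eq_intros A DERIV_chain2[OF A] refl | simp)+
  qed (use \<tau> fc in auto)
  have fm: "(\<lambda>t. ?f t * indicator {0..\<tau>} t) \<in> borel_measurable borel" using int by auto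
  have "(LINT t|lborel. ?f t * indicator {0..\<tau>} t) = (LINT t|lebesgue. ?f t * indicator {0..\<tau>} t)"
   by (rule integral_completion[symmetric]) (use fm in simp)
  also have "\<dots> = (LINT t|lebesgue. indicator {0<..<T} t *\<^sub>R (?f t * indicator {0..<\<tau>} t))"
  proof (rule integral_cong_AE)
   have "AE t in lebesgue. t \<noteq> 0" "AE t in lebesgue. t \<noteq> \<tau>"
    by (rule AE_completion[OF AE_lborel_singleton])+
   then show "AE t in lebesgue. ?f t * indicator {0..\<tau>} t = indicator {0<..<T} t *\<^sub>R (?f t * indicator {0..<\<tau>} t)"
    by eventually_elim (use \<tau> in \<open>auto simp: indicator_def\<close>)
   show "(\<lambda>t. ?f t * indicator {0..\<tau>} t) \<in> borel_measurable lebesgue"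
    by (rule measurable_completion) (use fm in simp)
   have "?f \<in> borel_measurable borel" using fc by (intro borel_measurable_continuous_onI continuous_at_imp_continuous_on) auto
   then show "(\<lambda>t. indicator {0<..<T} t *\<^sub>R (?f t * indicator {0..<\<tau>} t)) \<in> borel_measurable lebesgue"
    by (intro measurable_completion) simp
  qed
  also have "\<dots> = (LINT t|lebesgue_on {0<..<T}. ?f t * indicator {0..<\<tau>} t)"
   by (simp add: integral_restrict_space)
  finally have eq: "?L j = (LINT t|lebesgue_on {0<..<T}. real (Suc j) * (?f t * indicator {0..<\<tau>} t))"
   unfolding FTC by simp
  have dqi: "integrable (lebesgue_on {0<..<T}) (\<lambda>t. dq j t (\<phi> t))" by (rule S(2))
  have fi: "integrable (lebesgue_on {0<..<T}) (\<lambda>t. real (Suc j) * (?f t * indicator {0..<\<tau>} t))"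
  proof -
   have "integrable lborel (\<lambda>t. indicator {0..<\<tau>} t *\<^sub>R (?f t * indicator {0..\<tau>} t))"
    by (rule integrable_mult_indicator[OF _ int]) simp
   also have "(\<lambda>t. indicator {0..<\<tau>} t *\<^sub>R (?f t * indicator {0..\<tau>} t)) = (\<lambda>t. ?f t * indicator {0..<\<tau>} t)"
    by (auto simp: fun_eq_iff indicator_def)
   finally have "integrable lborel (\<lambda>t. ?f t * indicator {0..<\<tau>} t)" .
   then have "integrable lebesgue (\<lambda>t. ?f t * indicator {0..<\<tau>} t)"
    by (subst integrable_completion) auto
   then have "integrable lebesgue (\<lambda>t. indicator {0<..<T} t *\<^sub>R (?f t * indicator {0..<\<tau>} t))"
    by (intro integrable_mult_indicator) simp
   then have "integrable (lebesgue_on {0<..<T}) (\<lambda>t. ?f t * indicator {0..<\<tau>} t)"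
    by (subst integrable_restrict_space) (simp, assumption)
   then show ?thesis by (rule integrable_mult_right)
  qed
  show ?thesis unfolding eq
  proof (rule integral_mono[OF fi dqi])
   fix t assume "t \<in> space (lebesgue_on {0<..<T})"
   then have t: "t \<in> {0<..<T}" by simp
   show "real (Suc j) * (?f t * indicator {0..<\<tau>} t) \<le> dq j t (\<phi> t)"
   proof (cases "t < \<tau>")
    case True
    then have "indicator {0..<\<tau>} t = (1::real)" using t by simp
    then show ?thesis using dq_ge[OF t True, of j] by (simp only: mult_1_right)
   qed (simp add: dq0)
  qed
 qed
 have quot: "(\<lambda>j. real (Suc j) * (A x - A (x - 1 / real (Suc j)))) \<longlonglongrightarrow> U x" for x
 proof -
  have "((\<lambda>h. (A (x + h) - A x) / h) \<longlongrightarrow> U x) (at 0)"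
   using A[of x] by (simp add: DERIV_def)
  moreover have "filterlim (\<lambda>j. - (1 / real (Suc j))) (at 0) sequentially"
  proof -
   have "(\<lambda>j. - (1 / real (Suc j))) \<longlonglongrightarrow> - 0"
    using LIMSEQ_inverse_real_of_nat by (intro tendsto_minus) (simp add: inverse_eq_divide)
   then show ?thesis by (simp add: filterlim_at)
  qed
  ultimately have "(\<lambda>j. (A (x + - (1 / real (Suc j))) - A x) / - (1 / real (Suc j))) \<longlonglongrightarrow> U x"
   by (rule filterlim_compose)
  moreover have "(A (x + - (1 / real (Suc j))) - A x) / - (1 / real (Suc j)) = real (Suc j) * (A x - A (x - 1 / real (Suc j)))" for j
   by (simp add: algebra_simps)
  ultimately show ?thesis by simp
 qed
 have "?L j = real (Suc j) * (A \<tau> - A (\<tau> - 1 / real (Suc j))) - real (Suc j) * (A 0 - A (0 - 1 / real (Suc j)))" for j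
  by (rule right_diff_distrib)
 then have "?L \<longlonglongrightarrow> U \<tau> - U 0" using tendsto_diff[OF quot[of \<tau>] quot[of 0]] by (simp only:)
 from LIMSEQ_le[OF this S(1)] le have "U \<tau> - U 0 \<le> (LINT t|lebesgue_on {0<..<T}. vt t (\<phi> t))" by blast
 moreover have "U \<tau> = \<Phi> \<tau>" "U 0 = 0" using \<tau> T \<Phi>0 by (simp_all add: U_def clamp0_def)
 ultimately show ?thesis by (simp add: \<Phi>_def \<phi>_def)
qed

end

section \<open>Regularised powers and a smooth truncation\<close>

definition pw :: "real \<Rightarrow> nat \<Rightarrow> real \<Rightarrow> real \<Rightarrow> real" where
 "pw c i a v = v ^ i * (v\<^sup>2 + c) powr a"

lemma pw_DERIV:
 assumes "c > 0"
 shows "(pw c i a has_real_derivative (real i * pw c (i - 1) a v + 2 * a * pw c (i + 1) (a - 1) v)) (at v)"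
proof -
 have pos: "v\<^sup>2 + c > 0" using assms by (simp add: add_nonneg_pos)
 have "((\<lambda>v. (v\<^sup>2 + c) powr a) has_real_derivative a * (v\<^sup>2 + c) powr (a - 1) * (2 * v)) (at v)"
  using pos by (auto intro!: derivative_eq_intros)
 from DERIV_mult[OF DERIV_pow this, of i] show ?thesis
  unfolding pw_def[abs_def] by (rule DERIV_cong) (simp add: algebra_simps)
qed

text \<open>For \<open>c > 0\<close> the base of the real power stays positive, and derivatives
  remain combinations of members of the family, with \<open>i\<close> and \<open>a\<close>
  shifted.\<close>

lemma smooth_pw:
 assumes "c > 0" shows "smooth (pw c i a)"
 unfolding smooth_def
proof
 show "C_diff m (pw c i a)" for m
 proof (induction m arbitrary: i a)
  case 0
  show ?case using pw_DERIV[OF assms] by (auto intro!: DERIV_continuous_on)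
 next
  case (Suc m)
  have "C_diff m (\<lambda>v. real i * pw c (i - 1) a v + 2 * a * pw c (i + 1) (a - 1) v)"
   by (intro C_diff_add C_diff_mult Suc C_diff_const)
  then show ?case by (rule C_diff_real_SucI[OF pw_DERIV[OF assms]])
 qed
qed

text \<open>A smooth substitute for truncation at level \<open>M\<close>: strictly increasing,
  bounded by \<open>M\<close>, below the identity on the positive half-line, and convergent to the
  identity as \<open>M\<close> grows. Its derivative lies between zero and one. The negative power
  in place of a quotient by a root exhibits it as a multiple of a \<open>pw\<close>.\<close>

definition soft_trunc :: "real \<Rightarrow> real \<Rightarrow> real" where
 "soft_trunc M v = M * v * (v\<^sup>2 + M\<^sup>2) powr (- 1 / 2)"

lemma soft_trunc_sqrt: "soft_trunc M v = M * v / sqrt (v\<^sup>2 + M\<^sup>2)"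
proof -
 have "(- 1 / 2 :: real) = - (1 / 2)" by simp
 moreover have "(v\<^sup>2 + M\<^sup>2) powr (1 / 2) = sqrt (v\<^sup>2 + M\<^sup>2)" by (rule powr_half_sqrt) simp
 ultimately show ?thesis unfolding soft_trunc_def by (simp only: powr_minus divide_inverse)
qed

lemma smooth_soft_trunc: "M > 0 \<Longrightarrow> smooth (soft_trunc M)"
 using smooth_mult[OF smooth_const smooth_pw[of "M\<^sup>2" 1 "- 1 / 2"], of M]
 by (simp add: soft_trunc_def[abs_def] pw_def mult.assoc)

lemma soft_trunc_DERIV:
 assumes "M > 0"
 shows "(soft_trunc M has_real_derivative M ^ 3 * (v\<^sup>2 + M\<^sup>2) powr (- 3 / 2)) (at v)"
proof -
 have c: "M\<^sup>2 > 0" using assms by simp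
 then have pos: "v\<^sup>2 + M\<^sup>2 > 0" by (intro add_nonneg_pos) auto
 have "((\<lambda>v. M * pw (M\<^sup>2) 1 (- 1 / 2) v) has_real_derivative
   M * (real 1 * pw (M\<^sup>2) (1 - 1) (- 1 / 2) v + 2 * (- 1 / 2) * pw (M\<^sup>2) (1 + 1) (- 1 / 2 - 1) v)) (at v)"
  by (rule DERIV_cmult[OF pw_DERIV[OF c]])
 also have "(v\<^sup>2 + M\<^sup>2) powr (- 1 / 2) = (v\<^sup>2 + M\<^sup>2) * (v\<^sup>2 + M\<^sup>2) powr (- 3 / 2)"
  using pos powr_add[of "v\<^sup>2 + M\<^sup>2" 1 "- 3 / 2"] by simp
 then have "M * (real 1 * pw (M\<^sup>2) (1 - 1) (- 1 / 2) v + 2 * (- 1 / 2) * pw (M\<^sup>2) (1 + 1) (- 1 / 2 - 1) v)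
   = M ^ 3 * (v\<^sup>2 + M\<^sup>2) powr (- 3 / 2)"
  by (simp add: pw_def algebra_simps power2_eq_square power3_eq_cube)
 finally show ?thesis by (simp add: soft_trunc_def[abs_def] pw_def mult.assoc)
qed

lemma soft_trunc_deriv_bounds:
 fixes M v :: real
 assumes "M > 0"
 shows "0 < M ^ 3 * (v\<^sup>2 + M\<^sup>2) powr (- 3 / 2)" "M ^ 3 * (v\<^sup>2 + M\<^sup>2) powr (- 3 / 2) \<le> 1"
proof -
 have pos: "v\<^sup>2 + M\<^sup>2 > 0" using assms by (intro add_nonneg_pos) auto
 then show "0 < M ^ 3 * (v\<^sup>2 + M\<^sup>2) powr (- 3 / 2)" using assms by simp
 have "M ^ 3 = (M\<^sup>2) powr (3 / 2)"
 proof -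
  have "(M\<^sup>2) powr (3 / 2) = (M powr 2) powr (3 / 2)" by (simp only: powr_numeral[OF less_imp_le[OF assms]])
  also have "\<dots> = M powr 3" unfolding powr_powr by simp
  also have "\<dots> = M ^ 3" by (rule powr_numeral[OF less_imp_le[OF assms]])
  finally show ?thesis ..
 qed
 also have "\<dots> \<le> (v\<^sup>2 + M\<^sup>2) powr (3 / 2)" by (intro powr_mono2) auto
 finally show "M ^ 3 * (v\<^sup>2 + M\<^sup>2) powr (- 3 / 2) \<le> 1"
  using pos by (simp add: powr_minus field_simps divide_le_eq_1)
qed

lemma soft_trunc_bounds:
 assumes "M > 0"
 shows "\<bar>soft_trunc M v\<bar> \<le> M" "0 \<le> v \<Longrightarrow> 0 \<le> soft_trunc M v" "0 \<le> v \<Longrightarrow> soft_trunc M v \<le> v"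
  "v \<le> 0 \<Longrightarrow> soft_trunc M v \<le> 0" "v > 0 \<Longrightarrow> soft_trunc M v > 0" "soft_trunc M 0 = 0"
proof -
 have pos: "sqrt (v\<^sup>2 + M\<^sup>2) > 0" using assms by (simp add: add_nonneg_pos del: real_sqrt_gt_0_iff add: real_sqrt_gt_zero)
 have "\<bar>v\<bar> \<le> sqrt (v\<^sup>2 + M\<^sup>2)" by (intro real_le_rsqrt) simp
 then show "\<bar>soft_trunc M v\<bar> \<le> M"
  using assms pos by (simp add: soft_trunc_sqrt abs_mult field_simps)
 have "M \<le> sqrt (v\<^sup>2 + M\<^sup>2)" by (intro real_le_rsqrt) simp
 then show "0 \<le> v \<Longrightarrow> soft_trunc M v \<le> v"
  using assms pos mult_right_mono[of M "sqrt (v\<^sup>2 + M\<^sup>2)" v] by (simp add: soft_trunc_sqrt field_simps)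
 show "0 \<le> v \<Longrightarrow> 0 \<le> soft_trunc M v" "v > 0 \<Longrightarrow> soft_trunc M v > 0" "soft_trunc M 0 = 0"
  using assms pos by (auto simp: soft_trunc_sqrt)
 show "v \<le> 0 \<Longrightarrow> soft_trunc M v \<le> 0"
  using assms pos by (auto simp: soft_trunc_sqrt divide_le_0_iff mult_le_0_iff)
qed

lemma soft_trunc_tendsto: "(\<lambda>j. soft_trunc (real (Suc j)) v) \<longlonglongrightarrow> v"
proof -
 have "(\<lambda>j. v / sqrt ((v * inverse (real (Suc j)))\<^sup>2 + 1)) \<longlonglongrightarrow> v / sqrt ((v * 0)\<^sup>2 + 1)"
  by (intro tendsto_intros LIMSEQ_inverse_real_of_nat) simp
 moreover have "v / sqrt ((v * inverse (real (Suc j)))\<^sup>2 + 1) = soft_trunc (real (Suc j)) v" for j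
 proof -
  let ?M = "real (Suc j)"
  have "v\<^sup>2 + ?M\<^sup>2 = ?M\<^sup>2 * ((v * inverse ?M)\<^sup>2 + 1)" by (simp add: field_simps power_mult_distrib)
  then have "sqrt (v\<^sup>2 + ?M\<^sup>2) = ?M * sqrt ((v * inverse ?M)\<^sup>2 + 1)" by (simp add: real_sqrt_mult)
  then show ?thesis by (simp add: soft_trunc_sqrt del: of_nat_Suc)
 qed
 ultimately show ?thesis by simp
qed

subsection \<open>Test functions of power type\<close>

text \<open>Here \<open>P\<close> behaves like the power \<open>2 * \<sigma> - 1\<close> and
  \<open>\<Psi>\<close> like the power \<open>\<sigma>\<close> at infinity, while at the origin they
  vanish to the integer orders \<open>2 * l + 1\<close> and \<open>l + 1\<close>, which makes them
  smooth. The assumption \<open>\<gamma> \<le> 2 * real l + 1\<close> keeps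
  \<open>P x / x powr \<gamma>\<close> bounded near zero, and \<open>\<kappa>\<close> is the growth
  of that quotient measured in powers of \<open>\<Psi>\<close>. The functions \<open>p\<close> and
  \<open>r\<close> are the derivatives of \<open>P\<close> and \<open>\<Psi>\<close>.\<close>

locale power_nonlinearity =
 fixes \<sigma> \<gamma> :: real and l :: nat
 assumes \<sigma>: "1 < \<sigma>" and \<gamma>: "0 < \<gamma>" "\<gamma> + 1 < 2 * \<sigma>" "\<gamma> \<le> 2 * real l + 1"
begin

definition "s = \<sigma> - real l - 1"
definition "P = pw 1 (2 * l + 1) s"
definition "\<Psi> = pw 1 (l + 1) (s / 2)"
text \<open>The constant \<open>A\<close> bounds
  \<open>(\<sigma> * v\<^sup>2 + real l + 1) / (v\<^sup>2 + 1)\<close>, a factor of the derivative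
  of \<open>\<Psi>\<close>; \<open>CW\<close> is the constant for replacing
  \<open>(v\<^sup>2 + 1) powr (\<sigma> / 2)\<close> by \<open>1 + \<Psi> v\<close>.\<close>

definition "A = \<sigma> + real l + 1"
definition "\<kappa> = 2 - (1 + \<gamma>) / \<sigma>"
definition "CW = 2 powr ((\<sigma> + real l + 1) / 2)"

lemma A1: "A > 1" using \<sigma> by (simp add: A_def)

lemma \<kappa>_pos: "\<kappa> > 0" using \<sigma> \<gamma> by (simp add: \<kappa>_def field_simps)

definition p :: "real \<Rightarrow> real" where
 "p v = v ^ (2 * l) * (v\<^sup>2 + 1) powr (s - 1) * ((2 * \<sigma> - 1) * v\<^sup>2 + (2 * real l + 1))"

definition r :: "real \<Rightarrow> real" where
 "r v = v ^ l * (v\<^sup>2 + 1) powr (s / 2 - 1) * (\<sigma> * v\<^sup>2 + real l + 1)"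

lemma pos: "0 < (v::real)\<^sup>2 + 1" by (intro add_nonneg_pos) auto

lemma powr_step: "((v::real)\<^sup>2 + 1) powr a = (v\<^sup>2 + 1) powr (a - 1) * (v\<^sup>2 + 1)"
 using pos[of v] powr_add[of "v\<^sup>2 + 1" "a - 1" 1] by simp

lemma P_DERIV: "(P has_real_derivative p v) (at v)"
proof -
 have "real (2 * l + 1) * pw 1 (2 * l + 1 - 1) s v + 2 * s * pw 1 (2 * l + 1 + 1) (s - 1) v = p v"
  unfolding p_def pw_def powr_step[of v s] by (simp add: s_def algebra_simps power2_eq_square)
 then show ?thesis using pw_DERIV[of 1 "2 * l + 1" s v] by (simp add: P_def)
qed

lemma \<Psi>_DERIV: "(\<Psi> has_real_derivative r v) (at v)"
proof -
 have b: "(real l + 1) * (v\<^sup>2 + 1) + s * v\<^sup>2 = \<sigma> * v\<^sup>2 + real l + 1"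
  by (simp add: s_def algebra_simps)
 have "(real l + 1) * (v ^ l * (X * (v\<^sup>2 + 1))) + s * (v ^ (l + 2) * X) = v ^ l * X * ((real l + 1) * (v\<^sup>2 + 1) + s * v\<^sup>2)" for X
  by (simp add: algebra_simps power2_eq_square)
 from this[of "(v\<^sup>2 + 1) powr (s / 2 - 1)", unfolded b]
 have "real (l + 1) * pw 1 (l + 1 - 1) (s / 2) v + 2 * (s / 2) * pw 1 (l + 1 + 1) (s / 2 - 1) v = r v"
  unfolding r_def pw_def powr_step[of v "s / 2"] by (simp add: add.commute)
 then show ?thesis using pw_DERIV[of 1 "l + 1" "s / 2" v] by (simp add: \<Psi>_def)
qed

lemma p_ge: "v ^ (2 * l) * (v\<^sup>2 + 1) powr s \<le> p v" "0 \<le> p v"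
proof -
 have e: "0 \<le> v ^ (2 * l)" by (simp add: power_mult)
 have b: "v\<^sup>2 + 1 \<le> (2 * \<sigma> - 1) * v\<^sup>2 + (2 * real l + 1)"
  using \<sigma> mult_right_mono[of 1 "2 * \<sigma> - 1" "v\<^sup>2"] by simp
 have "v ^ (2 * l) * (v\<^sup>2 + 1) powr (s - 1) * (v\<^sup>2 + 1) \<le> p v"
  unfolding p_def using e b by (intro mult_left_mono mult_nonneg_nonneg) auto
 then show "v ^ (2 * l) * (v\<^sup>2 + 1) powr s \<le> p v" by (simp add: powr_step[of v s] mult.assoc)
 then show "0 \<le> p v" using mult_nonneg_nonneg[OF e powr_ge_zero[of "v\<^sup>2 + 1" s]] by linarith
qed

lemma bracket: "\<sigma> * (v::real)\<^sup>2 + real l + 1 \<le> A * (v\<^sup>2 + 1)" "0 \<le> \<sigma> * v\<^sup>2 + real l + 1"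
proof -
 have "0 \<le> (real l + 1) * v\<^sup>2" by simp
 then show "\<sigma> * v\<^sup>2 + real l + 1 \<le> A * (v\<^sup>2 + 1)" using \<sigma> by (simp add: A_def algebra_simps)
 show "0 \<le> \<sigma> * v\<^sup>2 + real l + 1" using \<sigma> by simp
qed

text \<open>This is the coercivity of the local form: by the chain rule it bounds the squared
  gradient of \<open>\<Psi> (w)\<close> by a multiple of the inner product of the gradients of
  \<open>w\<close> and \<open>P (w)\<close>.\<close>

lemma r_sq: "(r v)\<^sup>2 \<le> A\<^sup>2 * p v"
proof -
 have "(r v)\<^sup>2 = v ^ (2 * l) * (v\<^sup>2 + 1) powr (s - 2) * (\<sigma> * v\<^sup>2 + real l + 1)\<^sup>2"
  using pos[of v] powr_add[of "v\<^sup>2 + 1" "s / 2 - 1" "s / 2 - 1"]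
  by (simp add: r_def power_mult_distrib power2_eq_square[of "_ powr _"] mult.commute[of 2] power_mult)
 also have "\<dots> \<le> v ^ (2 * l) * (v\<^sup>2 + 1) powr (s - 2) * (A * (v\<^sup>2 + 1))\<^sup>2"
  using bracket[of v] by (intro mult_left_mono power_mono mult_nonneg_nonneg) (auto simp: power_mult)
 also have "\<dots> = A\<^sup>2 * (v ^ (2 * l) * (v\<^sup>2 + 1) powr s)"
  using powr_step[of v s] powr_step[of v "s - 1"] by (simp add: power_mult_distrib power2_eq_square)
 also have "\<dots> \<le> A\<^sup>2 * p v" by (intro mult_left_mono p_ge) auto
 finally show ?thesis .
qed

lemma \<Psi>_r: "\<Psi> v * r v = v * (v ^ (2 * l) * (v\<^sup>2 + 1) powr (s - 1) * (\<sigma> * v\<^sup>2 + real l + 1))"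
proof -
 have "(v\<^sup>2 + 1) powr (s / 2) * (v\<^sup>2 + 1) powr (s / 2 - 1) = (v\<^sup>2 + 1) powr (s - 1)"
  by (simp flip: powr_add)
 moreover have "v ^ (l + 1) * v ^ l = v * v ^ (2 * l)" by (simp add: mult_2 power_add)
 ultimately show ?thesis by (simp add: \<Psi>_def pw_def r_def mult_ac) (metis mult.commute mult.left_commute)
qed

text \<open>Half the derivative of the square of \<open>\<Psi>\<close> is compared with
  \<open>P\<close>, so that integration bounds that square by a primitive of \<open>P\<close>. Both
  sides change sign at the origin, hence the two cases.\<close>

lemma \<Psi>_r_le: "0 \<le> v \<Longrightarrow> 0 \<le> \<Psi> v * r v \<and> \<Psi> v * r v \<le> A * P v"
 "v \<le> 0 \<Longrightarrow> \<Psi> v * r v \<le> 0 \<and> A * P v \<le> \<Psi> v * r v"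
proof -
 define K where "K = v ^ (2 * l) * (v\<^sup>2 + 1) powr (s - 1)"
 have K: "0 \<le> K" by (simp add: K_def power_mult)
 have eq: "\<Psi> v * r v = v * (K * (\<sigma> * v\<^sup>2 + real l + 1))" by (simp add: \<Psi>_r K_def)
 have P: "A * P v = v * (K * (A * (v\<^sup>2 + 1)))"
  by (simp add: P_def pw_def K_def powr_step[of v s])
 have le: "K * (\<sigma> * v\<^sup>2 + real l + 1) \<le> K * (A * (v\<^sup>2 + 1))" "0 \<le> K * (\<sigma> * v\<^sup>2 + real l + 1)"
  using K bracket[of v] by (auto intro: mult_left_mono)
 show "0 \<le> v \<Longrightarrow> 0 \<le> \<Psi> v * r v \<and> \<Psi> v * r v \<le> A * P v"
  unfolding eq P using le by (auto intro: mult_left_mono)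
 show "v \<le> 0 \<Longrightarrow> \<Psi> v * r v \<le> 0 \<and> A * P v \<le> \<Psi> v * r v"
  unfolding eq P using le by (auto intro: mult_left_mono_neg mult_nonpos_nonneg)
qed

lemma smooth_P: "smooth P" and smooth_\<Psi>: "smooth \<Psi>"
 by (simp_all add: P_def \<Psi>_def smooth_pw)

lemma \<Psi>_nonneg: "0 \<le> v \<Longrightarrow> 0 \<le> \<Psi> v"
 by (simp add: \<Psi>_def pw_def)

text \<open>Below one the left side is bounded. Above one,
  \<open>x\<^sup>2 + 1 \<le> 2 * x\<^sup>2\<close> is used only in the factor with exponent
  \<open>(real l + 1) / 2\<close>; the other factor, whose exponent \<open>s / 2\<close> may be
  negative, already occurs in \<open>\<Psi> x\<close>.\<close>

lemma W_le:
 assumes x: "0 \<le> x" shows "(x\<^sup>2 + 1) powr (\<sigma> / 2) \<le> CW * (1 + \<Psi> x)"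
proof (cases "x \<le> 1")
 case True
 have "(x\<^sup>2 + 1) powr (\<sigma> / 2) \<le> 2 powr (\<sigma> / 2)"
  using \<sigma> x True by (intro powr_mono2) (auto simp: power_le_one)
 also have "\<dots> \<le> CW" unfolding CW_def by (intro powr_mono) auto
 also have "\<dots> \<le> CW * (1 + \<Psi> x)" using \<Psi>_nonneg[OF x] by (simp add: CW_def)
 finally show ?thesis .
next
 case False
 then have x1: "x > 1" by simp
 then have "1 \<le> x\<^sup>2" by simp
 have "(x\<^sup>2 + 1) powr ((real l + 1) / 2) \<le> (2 * x\<^sup>2) powr ((real l + 1) / 2)"
  using \<open>1 \<le> x\<^sup>2\<close> by (intro powr_mono2) auto
 also have "\<dots> = 2 powr ((real l + 1) / 2) * x ^ (l + 1)"
 proof -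
  have "(x\<^sup>2) powr ((real l + 1) / 2) = (x powr 2) powr ((real l + 1) / 2)" using x1 by simp
  also have "\<dots> = x powr (real (l + 1))"
  proof -
   have "2 * ((real l + 1) / 2) = real (l + 1)" by simp
   then show ?thesis by (simp only: powr_powr)
  qed
  also have "\<dots> = x ^ (l + 1)" using x1 by (simp only: powr_realpow)
  finally show ?thesis using x1 by (simp add: powr_mult)
 qed
 also have "\<dots> \<le> CW * x ^ (l + 1)"
  unfolding CW_def using \<sigma> x by (intro mult_right_mono powr_mono) auto
 finally have 1: "(x\<^sup>2 + 1) powr ((real l + 1) / 2) \<le> CW * x ^ (l + 1)" .
 have "(x\<^sup>2 + 1) powr (\<sigma> / 2) = (x\<^sup>2 + 1) powr ((real l + 1) / 2) * (x\<^sup>2 + 1) powr (s / 2)"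
  by (simp add: s_def flip: powr_add) (simp add: field_simps)
 also have "\<dots> \<le> CW * x ^ (l + 1) * (x\<^sup>2 + 1) powr (s / 2)"
  by (intro mult_right_mono 1) auto
 also have "\<dots> = CW * \<Psi> x" by (simp add: \<Psi>_def pw_def)
 also have "\<dots> \<le> CW * (1 + \<Psi> x)" by (simp add: CW_def)
 finally show ?thesis .
qed

text \<open>The exponent \<open>2 * real l + 1 - \<gamma>\<close> is nonnegative, so
  \<open>x\<^sup>2\<close> may be enlarged to \<open>x\<^sup>2 + 1\<close> in it. The exponents then
  add up to \<open>\<sigma> / 2 * \<kappa>\<close>, and \<open>W_le\<close> replaces the base by
  \<open>\<Psi>\<close>.\<close>

lemma source_le:
 assumes x: "0 < x" shows "P x / x powr \<gamma> \<le> (2 * CW) powr \<kappa> * (1 + \<Psi> x powr \<kappa>)"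
proof -
 let ?y = "\<Psi> x"
 have y: "0 \<le> ?y" using x by (intro \<Psi>_nonneg) simp
 have "P x / x powr \<gamma> = x powr (2 * real l + 1 - \<gamma>) * (x\<^sup>2 + 1) powr s"
 proof -
  have "x powr (2 * real l + 1 - \<gamma>) = x powr real (2 * l + 1) / x powr \<gamma>"
   by (simp add: powr_diff add.commute)
  also have "x powr real (2 * l + 1) = x ^ (2 * l + 1)" using x by (simp only: powr_realpow)
  finally show ?thesis by (simp add: P_def pw_def)
 qed
 also have "\<dots> \<le> (x\<^sup>2 + 1) powr ((2 * real l + 1 - \<gamma>) / 2) * (x\<^sup>2 + 1) powr s"
 proof (rule mult_right_mono)
  have "x powr (2 * real l + 1 - \<gamma>) = (x\<^sup>2) powr ((2 * real l + 1 - \<gamma>) / 2)"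
  proof -
   have "(x\<^sup>2) powr ((2 * real l + 1 - \<gamma>) / 2) = (x powr 2) powr ((2 * real l + 1 - \<gamma>) / 2)" using x by simp
   moreover have "2 * ((2 * real l + 1 - \<gamma>) / 2) = 2 * real l + 1 - \<gamma>" by simp
   ultimately show ?thesis by (simp only: powr_powr)
  qed
  also have "\<dots> \<le> (x\<^sup>2 + 1) powr ((2 * real l + 1 - \<gamma>) / 2)"
   using \<gamma>(3) by (intro powr_mono2) auto
  finally show "x powr (2 * real l + 1 - \<gamma>) \<le> (x\<^sup>2 + 1) powr ((2 * real l + 1 - \<gamma>) / 2)" .
 qed simp
 also have "\<dots> = ((x\<^sup>2 + 1) powr (\<sigma> / 2)) powr \<kappa>"
 proof -
  have "(2 * real l + 1 - \<gamma>) / 2 + s = \<sigma> / 2 * \<kappa>" using \<sigma> by (simp add: s_def \<kappa>_def field_simps)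
  then show ?thesis by (simp only: powr_powr powr_add[symmetric])
 qed
 also have "\<dots> \<le> (CW * (1 + ?y)) powr \<kappa>"
  using \<kappa>_pos W_le[of x] x by (intro powr_mono2) auto
 also have "\<dots> \<le> (CW * (2 * max 1 ?y)) powr \<kappa>"
  using \<kappa>_pos y by (intro powr_mono2 mult_left_mono) (auto simp: CW_def)
 also have "\<dots> = (2 * CW) powr \<kappa> * (max 1 ?y) powr \<kappa>"
  using y by (subst powr_mult[symmetric]) (auto simp: CW_def mult_ac)
 also have "\<dots> \<le> (2 * CW) powr \<kappa> * (1 + ?y powr \<kappa>)"
  by (intro mult_left_mono) (auto simp: max_def)
 finally show ?thesis .
qed

end

text \<open>Realised by \<open>G = P (soft_trunc M v)\<close>,
  \<open>Y = \<Psi> (soft_trunc M v)\<close> and the primitive \<open>H\<close> of \<open>G\<close>,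
  with \<open>l\<close> the ceiling of \<open>\<gamma>\<close>. The bound \<open>B\<close> may
  depend on \<open>M\<close>, whereas \<open>C\<close> is fixed before \<open>M\<close>. Composition
  with the truncation preserves the inequalities because its derivative is positive and at most
  one.\<close>

lemma test_nonlinearity:
 fixes \<sigma> \<gamma> :: real
 assumes "1 < \<sigma>" "0 < \<gamma>" "\<gamma> + 1 < 2 * \<sigma>"
 obtains C :: real where "C > 0"
  "\<And>M. M > 0 \<Longrightarrow> \<exists>G Y H B. smooth G \<and> smooth Y \<and> G 0 = 0 \<and> Y 0 = 0 \<and> H 0 = 0 \<and> mono G \<and>
    (\<forall>v. \<bar>G v\<bar> \<le> B) \<and> (\<forall>v. \<bar>deriv G v\<bar> \<le> B) \<and> (\<forall>v. \<bar>Y v\<bar> \<le> B) \<and> (\<forall>v. \<bar>deriv Y v\<bar> \<le> B) \<and>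
    (\<forall>v. (H has_real_derivative G v) (at v)) \<and>
    (\<forall>v. (deriv Y v)\<^sup>2 \<le> C * deriv G v) \<and> (\<forall>v. (Y v)\<^sup>2 \<le> C * H v) \<and> (\<forall>v\<ge>0. 0 \<le> Y v) \<and>
    (\<forall>v\<ge>0. \<forall>e>0. 0 \<le> G v \<and> G v / (v + e) powr \<gamma> \<le> C * (1 + Y v powr (2 - (1 + \<gamma>) / \<sigma>))) \<and>
    (\<forall>v\<ge>0. soft_trunc M v powr \<sigma> \<le> C * (1 + Y v))"
proof -
 interpret power_nonlinearity \<sigma> \<gamma> "nat \<lceil>\<gamma>\<rceil>"
  by standard (use assms in linarith)+
 \<comment> \<open>The summands are the constants of the comparison of derivatives, the comparison
   with \<open>H\<close>, the source bound and the bound for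
   \<open>soft_trunc M v powr \<sigma>\<close>.\<close>
 define C where "C = A\<^sup>2 + 2 * A + (2 * CW) powr \<kappa> + CW"
 have C: "A\<^sup>2 \<le> C" "2 * A \<le> C" "(2 * CW) powr \<kappa> \<le> C" "CW \<le> C" "C > 0"
  using A1 by (auto simp: C_def CW_def intro!: add_nonneg_nonneg add_nonneg_pos)
 have ex: "\<exists>G Y H B. smooth G \<and> smooth Y \<and> G 0 = 0 \<and> Y 0 = 0 \<and> H 0 = 0 \<and> mono G \<and>
    (\<forall>v. \<bar>G v\<bar> \<le> B) \<and> (\<forall>v. \<bar>deriv G v\<bar> \<le> B) \<and> (\<forall>v. \<bar>Y v\<bar> \<le> B) \<and> (\<forall>v. \<bar>deriv Y v\<bar> \<le> B) \<and>
    (\<forall>v. (H has_real_derivative G v) (at v)) \<and>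
    (\<forall>v. (deriv Y v)\<^sup>2 \<le> C * deriv G v) \<and> (\<forall>v. (Y v)\<^sup>2 \<le> C * H v) \<and> (\<forall>v\<ge>0. 0 \<le> Y v) \<and>
    (\<forall>v\<ge>0. \<forall>e>0. 0 \<le> G v \<and> G v / (v + e) powr \<gamma> \<le> C * (1 + Y v powr (2 - (1 + \<gamma>) / \<sigma>))) \<and>
    (\<forall>v\<ge>0. soft_trunc M v powr \<sigma> \<le> C * (1 + Y v))" if M: "M > 0" for M
 proof -
  let ?T = "soft_trunc M" and ?T' = "\<lambda>v. M ^ 3 * (v\<^sup>2 + M\<^sup>2) powr (- 3 / 2)"
  note TD = soft_trunc_DERIV[OF M] and Tb = soft_trunc_bounds[OF M] and T' = soft_trunc_deriv_bounds[OF M]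
  let ?G = "\<lambda>v. P (?T v)" and ?Y = "\<lambda>v. \<Psi> (?T v)"
  have GD: "(?G has_real_derivative p (?T v) * ?T' v) (at v)" for v by (rule DERIV_chain2[OF P_DERIV TD])
  have YD: "(?Y has_real_derivative r (?T v) * ?T' v) (at v)" for v by (rule DERIV_chain2[OF \<Psi>_DERIV TD])
  have sG: "smooth ?G" and sY: "smooth ?Y"
   by (rule smooth_compose[OF smooth_soft_trunc[OF M] smooth_P], rule smooth_compose[OF smooth_soft_trunc[OF M] smooth_\<Psi>])
  note dG = DERIV_imp_deriv[OF GD] and dY = DERIV_imp_deriv[OF YD]
  have bdd: "\<exists>B. \<forall>x. \<bar>x\<bar> \<le> M \<longrightarrow> \<bar>f x\<bar> \<le> B" if "continuous_on UNIV f" for f :: "real \<Rightarrow> real"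
  proof -
   have "bounded (f ` {- M..M})"
    by (intro compact_imp_bounded compact_continuous_image continuous_on_subset[OF that]) auto
   then obtain B where "\<forall>x\<in>{- M..M}. \<bar>f x\<bar> \<le> B" by (auto simp: bounded_iff)
   then show ?thesis by (intro exI[of _ B]) (simp add: abs_le_iff)
  qed
  have pc: "continuous_on UNIV p" "continuous_on UNIV r"
  proof -
   have nz: "\<forall>v\<in>UNIV. (v::real)\<^sup>2 + 1 \<noteq> 0" using pos less_irrefl by metis
   show "continuous_on UNIV p" "continuous_on UNIV r"
    unfolding p_def[abs_def] r_def[abs_def] by (intro continuous_intros nz)+
  qed
  obtain B1 B2 B3 B4 where B: "\<And>x. \<bar>x\<bar> \<le> M \<Longrightarrow> \<bar>P x\<bar> \<le> B1" "\<And>x. \<bar>x\<bar> \<le> M \<Longrightarrow> \<bar>\<Psi> x\<bar> \<le> B2"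
   "\<And>x. \<bar>x\<bar> \<le> M \<Longrightarrow> \<bar>p x\<bar> \<le> B3" "\<And>x. \<bar>x\<bar> \<le> M \<Longrightarrow> \<bar>r x\<bar> \<le> B4"
   using bdd[OF smooth_continuous[OF smooth_P]] bdd[OF smooth_continuous[OF smooth_\<Psi>]] bdd[OF pc(1)] bdd[OF pc(2)] by metis
  define B where "B = max (max B1 B2) (max B3 B4)"
  have Bd: "\<bar>f * ?T' v\<bar> \<le> B" if "\<bar>f\<bar> \<le> B" for f v
  proof -
   have "\<bar>f * ?T' v\<bar> \<le> \<bar>f\<bar> * 1"
    unfolding abs_mult using T'[of v] by (intro mult_left_mono) auto
   then show ?thesis using that by simp
  qed
  have "\<exists>H. \<forall>x::real. -\<infinity> < ereal x \<longrightarrow> ereal x < \<infinity> \<longrightarrow> (H has_vector_derivative ?G x) (at x)"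
   by (rule einterval_antiderivative)
     (use smooth_continuous[OF sG] continuous_on_eq_continuous_at[OF open_UNIV] in auto)
  then obtain H0 where H0: "\<And>x. (H0 has_real_derivative ?G x) (at x)"
   by (auto simp: has_real_derivative_iff_has_vector_derivative)
  define H where "H v = H0 v - H0 0" for v
  have HD: "(H has_real_derivative ?G v) (at v)" for v
   unfolding H_def using DERIV_diff[OF H0 DERIV_const] by simp
  \<comment> \<open>The difference of the two sides vanishes at zero, and its derivative is
    nonnegative to the right and nonpositive to the left of zero.\<close>
  have YH: "(?Y v)\<^sup>2 \<le> 2 * A * H v" for v
  proof -
   let ?k = "\<lambda>v. 2 * A * H v - (?Y v)\<^sup>2" and ?k' = "\<lambda>v. 2 * (A * ?G v - \<Psi> (?T v) * r (?T v) * ?T' v)"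
   have kD: "(?k has_real_derivative ?k' v) (at v)" for v
    by (rule derivative_eq_intros HD YD refl | simp)+
   have k0: "?k 0 = 0" using Tb(6) by (simp add: H_def \<Psi>_def pw_def)
   have kp: "?k' v \<ge> 0" if "v \<ge> 0" for v
   proof -
    have 1: "0 \<le> \<Psi> (?T v) * r (?T v)" "\<Psi> (?T v) * r (?T v) \<le> A * P (?T v)"
     using \<Psi>_r_le(1)[OF Tb(2)[OF that]] by auto
    have "\<Psi> (?T v) * r (?T v) * ?T' v \<le> \<Psi> (?T v) * r (?T v) * 1" using T'[of v] 1 by (intro mult_left_mono) auto
    then show ?thesis using 1 by simp
   qed
   have kn: "?k' v \<le> 0" if "v \<le> 0" for v
   proof -
    have 1: "\<Psi> (?T v) * r (?T v) \<le> 0" "A * P (?T v) \<le> \<Psi> (?T v) * r (?T v)"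
     using \<Psi>_r_le(2)[OF Tb(4)[OF that]] by auto
    have "\<Psi> (?T v) * r (?T v) * 1 \<le> \<Psi> (?T v) * r (?T v) * ?T' v" using T'[of v] 1 by (intro mult_left_mono_neg) auto
    then show ?thesis using 1 by simp
   qed
   have "?k v \<ge> 0"
   proof (cases "v \<ge> 0")
    case True
    have "?k 0 \<le> ?k v" by (rule DERIV_nonneg_imp_nondecreasing[OF True]) (use kD kp in blast)
    then show ?thesis using k0 by simp
   next
    case False
    then have "v \<le> 0" by simp
    have "?k v \<ge> ?k 0" by (rule DERIV_nonpos_imp_nonincreasing[OF \<open>v \<le> 0\<close>]) (use kD kn in blast)
    then show ?thesis using k0 by simp
   qed
   then show ?thesis by simp
  qed
  have Hnn: "0 \<le> H v" for v
  proof -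
   have "0 \<le> 2 * A * H v" using YH[of v] zero_le_power2[of "?Y v"] by linarith
   then show ?thesis using A1 by (simp add: zero_le_mult_iff)
  qed
  show ?thesis
  proof (rule exI[of _ ?G], rule exI[of _ ?Y], rule exI[of _ H], rule exI[of _ B], intro conjI allI impI sG sY HD)
   show "?G 0 = 0" "?Y 0 = 0" "H 0 = 0" using Tb(6) by (simp_all add: P_def \<Psi>_def pw_def H_def)
   show "mono ?G"
   proof (rule monoI)
    fix x y :: real assume "x \<le> y"
    then show "?G x \<le> ?G y"
     by (rule DERIV_nonneg_imp_nondecreasing) (use GD p_ge(2) T'(1) less_imp_le in \<open>blast intro: mult_nonneg_nonneg\<close>)
   qed
   show "\<bar>?G v\<bar> \<le> B" "\<bar>?Y v\<bar> \<le> B" for v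
    using B(1,2)[OF Tb(1)[of v]] by (auto simp: B_def)
   show "\<bar>deriv ?G v\<bar> \<le> B" "\<bar>deriv ?Y v\<bar> \<le> B" for v
    unfolding dG dY using B(3,4)[OF Tb(1)[of v]] by (intro Bd; simp add: B_def)+
   show "(deriv ?Y v)\<^sup>2 \<le> C * deriv ?G v" for v
   proof -
    \<comment> \<open>The square of a number between zero and one is at most the number; this
      reconciles the two factors \<open>?T' v\<close> in the square of \<open>deriv ?Y v\<close>
      with the single one in \<open>deriv ?G v\<close>.\<close>
    have t: "0 \<le> (?T' v)\<^sup>2" "(?T' v)\<^sup>2 \<le> ?T' v"
     using T'[of v] power_decreasing[of 1 2 "?T' v"] by auto
    have "(r (?T v))\<^sup>2 * (?T' v)\<^sup>2 \<le> (A\<^sup>2 * p (?T v)) * ?T' v"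
     using t r_sq[of "?T v"] p_ge(2)[of "?T v"] by (intro mult_mono) auto
    also have "\<dots> \<le> (C * p (?T v)) * ?T' v"
     using C(1) p_ge(2)[of "?T v"] T'(1)[of v] by (intro mult_right_mono) auto
    finally show ?thesis unfolding dG dY by (simp add: power_mult_distrib mult.assoc)
   qed
   show "(?Y v)\<^sup>2 \<le> C * H v" for v
    using YH[of v] mult_right_mono[OF C(2) Hnn[of v]] by linarith
   show "0 \<le> ?Y v" if "v \<ge> 0" for v using Tb(2)[OF that] by (rule \<Psi>_nonneg)
   show "0 \<le> ?G v" if "v \<ge> 0" "e > 0" for v e :: real using Tb(2)[OF that(1)] by (simp add: P_def pw_def)
   show "?G v / (v + e) powr \<gamma> \<le> C * (1 + ?Y v powr (2 - (1 + \<gamma>) / \<sigma>))" if v: "v \<ge> 0" and e: "e > 0" for v e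
   proof (cases "v = 0")
    case True
    then show ?thesis using Tb(6) C(5) by (simp add: P_def pw_def)
   next
    case False
    then have x: "?T v > 0" using v by (intro Tb(5)) simp
    \<comment> \<open>Truncation decreases positive arguments, so the shifted denominator may be
      replaced by the truncated value. This is where the dependence on \<open>e\<close>, later
      \<open>1 / k\<close>, disappears.\<close>
    have "?T v powr \<gamma> \<le> (v + e) powr \<gamma>"
     using Tb(3)[OF v] x e \<gamma>(1) by (intro powr_mono2) auto
    moreover have "0 \<le> P (?T v)" using x by (simp add: P_def pw_def)
    ultimately have "?G v / (v + e) powr \<gamma> \<le> P (?T v) / ?T v powr \<gamma>"
     using x by (intro divide_left_mono) (auto intro!: mult_pos_pos simp: v e add_nonneg_pos)
    also have "\<dots> \<le> (2 * CW) powr \<kappa> * (1 + ?Y v powr \<kappa>)" by (rule source_le[OF x])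
    also have "\<dots> \<le> C * (1 + ?Y v powr \<kappa>)" by (intro mult_right_mono C) auto
    finally show ?thesis by (simp add: \<kappa>_def)
   qed
   show "?T v powr \<sigma> \<le> C * (1 + ?Y v)" if v: "v \<ge> 0" for v
   proof -
    let ?x = "?T v"
    have x: "0 \<le> ?x" using v by (rule Tb(2))
    have "?x powr \<sigma> = (?x\<^sup>2) powr (\<sigma> / 2)"
    proof -
     have "(?x\<^sup>2) powr (\<sigma> / 2) = (?x powr 2) powr (\<sigma> / 2)" using x by simp
     then show ?thesis unfolding powr_powr by simp
    qed
    also have "\<dots> \<le> (?x\<^sup>2 + 1) powr (\<sigma> / 2)" using \<sigma> by (intro powr_mono2) auto
    also have "\<dots> \<le> CW * (1 + ?Y v)" by (rule W_le[OF x])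
    also have "\<dots> \<le> C * (1 + ?Y v)" using \<Psi>_nonneg[OF x] C(4) by (intro mult_right_mono) auto
    finally show ?thesis .
   qed
  qed
 qed
 show ?thesis by (rule that[OF C(5) ex])
qed

subsection \<open>The energy inequality\<close>

text \<open>The exceptional set is enclosed in a Borel null set, to which Fubini's theorem for the
  product of the Borel measures applies.\<close>

lemma AE_slices:
 fixes \<Omega> :: "'a::euclidean_space set" and J :: "real set"
 assumes op: "open \<Omega>" "open J" and ae: "AE z in lebesgue_on (\<Omega> \<times> J). P z"
 shows "AE t in lebesgue_on J. AE x in lebesgue_on \<Omega>. P (x, t)"
proof -
 have "open (\<Omega> \<times> J)" using op by (rule open_Times)
 then have "AE z in lebesgue. z \<in> \<Omega> \<times> J \<longrightarrow> P z"
  using ae by (simp add: AE_restrict_space_iff)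
 then have "AE z in lborel. z \<in> \<Omega> \<times> J \<longrightarrow> P z" by (simp add: AE_completion_iff)
 then obtain N where N: "N \<in> null_sets lborel" "{z \<in> space lborel. \<not> (z \<in> \<Omega> \<times> J \<longrightarrow> P z)} \<subseteq> N"
  by (auto simp: eventually_ae_filter)
 have Nb: "N \<in> sets (lborel \<Otimes>\<^sub>M lborel)" by (metis N(1) lborel_prod null_setsD2)
 have "AE z in lborel \<Otimes>\<^sub>M lborel. z \<notin> N" unfolding lborel_prod by (rule AE_not_in[OF N(1)])
 from lborel_pair.AE_pair[OF this] have "AE x in lborel. AE t in lborel. (x, t) \<notin> N" .
 moreover have "{z \<in> space (lborel \<Otimes>\<^sub>M lborel). z \<notin> N} \<in> sets (lborel \<Otimes>\<^sub>M lborel)"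
  using sets.compl_sets[OF Nb] by (simp add: set_diff_eq)
 ultimately have "AE t in lborel. AE x in lborel. (x, t) \<notin> N"
  using lborel_pair.AE_commute[of "\<lambda>x t. (x, t) \<notin> N"] by (simp add: case_prod_beta')
 then have "AE t in lborel. t \<in> J \<longrightarrow> (AE x in lebesgue_on \<Omega>. P (x, t))"
 proof eventually_elim
  case (elim t)
  show ?case
  proof
   assume t: "t \<in> J"
   from elim have "AE x in lborel. x \<in> \<Omega> \<longrightarrow> P (x, t)"
    by eventually_elim (use N(2) t in force)
   from AE_completion[OF this] show "AE x in lebesgue_on \<Omega>. P (x, t)"
    using op(1) by (simp add: AE_restrict_space_iff)
  qed
 qed
 from AE_completion[OF this] show ?thesis using op(2) by (simp add: AE_restrict_space_iff)
qed

lemma joint_representative: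
 fixes \<Omega> :: "'a::euclidean_space set" and J :: "real set" and v :: "'a \<times> real \<Rightarrow> real"
 assumes op: "open \<Omega>" "open J" and v: "v \<in> borel_measurable (lebesgue_on (\<Omega> \<times> J))"
 obtains v' where "v' \<in> borel_measurable borel" "AE t in lebesgue_on J. AE x in lebesgue_on \<Omega>. v' (x, t) = v (x, t)"
  "AE t in lebesgue_on J. (\<lambda>x. v (x, t)) \<in> borel_measurable (lebesgue_on \<Omega>)"
proof -
 have "\<Omega> \<times> J \<in> sets borel" using open_Times[OF op] by simp
 from borel_representative[OF v this] obtain v' where v': "v' \<in> borel_measurable borel"
  "AE z in lebesgue_on (\<Omega> \<times> J). v' z = v z" by blast
 note ae = AE_slices[OF op v'(2)]
 have "AE t in lebesgue_on J. (\<lambda>x. v (x, t)) \<in> borel_measurable (lebesgue_on \<Omega>)"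
  using ae
 proof eventually_elim
  case (elim t)
  have "(\<lambda>x. v' (x, t)) \<in> borel_measurable borel"
   by (rule measurable_compose[OF _ v'(1)]) simp
  then have "(\<lambda>x. v' (x, t)) \<in> borel_measurable (lebesgue_on \<Omega>)"
   by (intro measurable_restrict_space1 measurable_completion) simp
  then show ?case by (rule measurable_AE_lebesgue_on[rotated, OF _ elim]) (use op in simp)
 qed
 with v'(1) ae show ?thesis by (rule that)
qed

text \<open>An integral of a function that is not integrable has the value zero, which is still
  below the integral of a nonnegative function. Upper bounds thus need no integrability of the left
  side.\<close>

lemma integral_mono_or_zero:
 fixes f g :: "'x \<Rightarrow> real"
 assumes "integrable M g" "AE x in M. f x \<le> g x" "AE x in M. 0 \<le> g x"
 shows "(LINT x|M. f x) \<le> (LINT x|M. g x)"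
proof (cases "integrable M f")
 case True
 then show ?thesis using assms by (intro integral_mono_AE) auto
next
 case False
 then show ?thesis using assms(3) by (simp add: not_integrable_integral_eq integral_nonneg_AE)
qed

text \<open>The integrand is nonnegative at every pair of points by monotonicity. Should it fail to
  be integrable, the integral is zero and the conclusion persists.\<close>

lemma fractional_form_nonneg:
 assumes "mono G" shows "0 \<le> fractional_form s w (\<lambda>x. G (w x))"
proof -
 have "0 \<le> (a - b) * (G a - G b)" for a b :: real
  using assms by (cases "a \<le> b") (auto simp: mono_def mult_nonpos_nonpos)
 then show ?thesis
  unfolding fractional_form_def by (intro mult_nonneg_nonneg integral_nonneg_AE AE_I2) (auto simp: split_beta')
qed

lemma fractional_form_zero: "fractional_form s w (\<lambda>x. 0) = 0"
 by (simp add: fractional_form_def split_beta')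

text \<open>The weak formulation is tested with \<open>G (v)\<close> switched off from time
  \<open>\<tau>\<close> on. The time term is bounded below through \<open>time_inequality\<close>,
  the gradient term through \<open>C(2)\<close>, and the nonlocal term is dropped because of its
  sign.\<close>

lemma energy_inequality:
 fixes \<Omega> :: "'a::euclidean_space set"
 assumes op: "open \<Omega>" and bd: "bounded \<Omega>" and T: "0 < T"
  and es: "energy_solution \<Omega> T s g (\<lambda>x. 0) v"
  and G: "smooth G" "G 0 = 0" "mono G" "\<And>y. \<bar>G y\<bar> \<le> B" "\<And>y. \<bar>deriv G y\<bar> \<le> B"
  and Y: "smooth Y" "Y 0 = 0" "\<And>y. \<bar>Y y\<bar> \<le> B" "\<And>y. \<bar>deriv Y y\<bar> \<le> B"
  and H: "\<And>y. (H has_real_derivative G y) (at y)" "H 0 = 0"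
  and C: "C > 0" "\<And>y. (deriv Y y)\<^sup>2 \<le> C * deriv G y" "\<And>y. (Y y)\<^sup>2 \<le> C * H y"
 defines "D \<equiv> \<lambda>t. (L2n (lebesgue_on \<Omega>) (weak_grad \<Omega> (\<lambda>x. Y (v (x, t)))))\<^sup>2"
 shows "integrable (lebesgue_on {0<..<T}) D"
  "\<And>\<tau>. 0 < \<tau> \<Longrightarrow> \<tau> \<le> T \<Longrightarrow>
   (LINT x|lebesgue_on \<Omega>. (Y (v (x, \<tau>)))\<^sup>2) + (LINT t|lebesgue_on {0<..<T}. indicator {..<\<tau>} t * D t)
   \<le> C * (LINT t|lebesgue_on {0<..<T}. LINT x|lebesgue_on \<Omega>. g (x, t) * (if t < \<tau> then G (v (x, t)) else 0))"
proof -
 let ?M = "lebesgue_on {0<..<T}" and ?N = "lebesgue_on \<Omega>"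
 define w where "w = slices v"
 have wv: "w t x = v (x, t)" for t x by (simp add: w_def slices_def)
 from es have wB: "w \<in> bochner_Lp 2 T (H01 \<Omega>) (H1_norm \<Omega>)" and cont: "continuous_into_L2 T \<Omega> w"
  and init: "((\<lambda>t. Lp_norm 2 \<Omega> (\<lambda>x. v (x, t) - 0)) \<longlongrightarrow> 0) (at_right 0)"
  by (auto simp: energy_solution_def w_def)
 from es obtain vt where vt: "vt \<in> bochner_Lp 2 T (Hm1 \<Omega>) (Hm1_norm \<Omega>)" "weak_time_derivative \<Omega> T v vt"
  and weak: "\<And>\<phi>. \<phi> \<in> bochner_Lp 2 T (H01 \<Omega>) (H1_norm \<Omega>) \<Longrightarrow>
      (LINT t|?M. vt t (\<phi> t)) + (LINT t|?M. LINT x|?N. weak_grad \<Omega> (w t) x \<bullet> weak_grad \<Omega> (\<phi> t) x) +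
      (LINT t|?M. fractional_form s (w t) (\<phi> t)) = (LINT t|?M. LINT x|?N. g (x, t) * \<phi> t x)"
  unfolding energy_solution_def w_def by blast
 interpret evolution \<Omega> T w vt
  by standard (use op bd T cont vt in \<open>auto simp: weak_time_derivative_def ip_def wv\<close>)
 have sm: "strongly_measurable T (H01 \<Omega>) (H1_norm \<Omega>) w" and wi: "integrable ?M (\<lambda>t. (H1_norm \<Omega> (w t))\<^sup>2)"
  using wB bochner_H01_iff[OF op bd T] by blast+
 have wX: "AE t in ?M. w t \<in> H01 \<Omega>" using sm by (simp add: strongly_measurable_def)
 have ws: "sqi ?M (\<lambda>t. H1_norm \<Omega> (w t))" using wi H1_norm_borel[OF op bd T sm] by (simp add: sqi_def)
 \<comment> \<open>The initial condition is a limit from the right, while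
   \<open>time_inequality\<close> needs the slice at time zero. Continuity of the curve identifies
   the two along the times \<open>T / real (Suc j)\<close>.\<close>
 have w0: "AE x in ?N. w 0 x = 0"
 proof -
  define tj where "tj j = T / real (Suc j)" for j
  have tj: "tj j > 0" "tj j \<le> T" for j using T by (auto simp: tj_def divide_le_eq mult_le_cancel_left1)
  have tl: "tj \<longlonglongrightarrow> 0"
   using tendsto_mult[OF tendsto_const LIMSEQ_inverse_real_of_nat, of T] by (simp add: tj_def[abs_def] divide_inverse)
  have f1: "filterlim tj (at_right 0) sequentially"
   using tl tj less_imp_neq[OF tj(1), symmetric] by (simp add: filterlim_at)
  have f2: "filterlim tj (at 0 within {0..T}) sequentially"
   using tl tj less_imp_le[OF tj(1)] less_imp_neq[OF tj(1), symmetric] by (simp add: filterlim_at)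
  have "(\<lambda>j. L2n ?N (w (tj j))) \<longlonglongrightarrow> 0"
   using filterlim_compose[OF init f1] by (simp add: Lp_norm_2 wv[symmetric])
  moreover have "(\<lambda>j. L2n ?N (\<lambda>x. w (tj j) x - w 0 x)) \<longlonglongrightarrow> 0"
   using filterlim_compose[OF w_tendsto[of 0] f2] T by simp
  ultimately have "(\<lambda>j. L2n ?N (w (tj j)) + L2n ?N (\<lambda>x. w (tj j) x - w 0 x)) \<longlonglongrightarrow> 0 + 0" by (rule tendsto_add)
  moreover have "L2n ?N (w 0) \<le> L2n ?N (w (tj j)) + L2n ?N (\<lambda>x. w (tj j) x - w 0 x)" for j
   using L2n_reverse_triangle[OF w_sqi[of "tj j"] w_sqi[of 0]] tj[of j] T by (auto simp: less_imp_le)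
  ultimately have "L2n ?N (w 0) \<le> 0 + 0" by (intro LIMSEQ_le_const) auto
  then have "L2n ?N (w 0) = 0" using L2n_nonneg[of ?N "w 0"] by simp
  then have "(LINT x|?N. (norm (w 0 x))\<^sup>2) = 0" using L2n_sq[of ?N "w 0"] by simp
  then have "AE x in ?N. (norm (w 0 x))\<^sup>2 = 0"
   using w_sqi[of 0] T by (subst (asm) integral_nonneg_eq_0_iff_AE) (auto simp: sqi_def)
  then show ?thesis by simp
 qed
 have grad_int: "integrable ?M (\<lambda>t. LINT x|?N. weak_grad \<Omega> (y t) x \<bullet> weak_grad \<Omega> (z t) x)"
  if y: "y \<in> bochner_Lp 2 T (H01 \<Omega>) (H1_norm \<Omega>)" and z: "z \<in> bochner_Lp 2 T (H01 \<Omega>) (H1_norm \<Omega>)" for y z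
 proof -
  have ym: "strongly_measurable T (H01 \<Omega>) (H1_norm \<Omega>) y" and zm: "strongly_measurable T (H01 \<Omega>) (H1_norm \<Omega>) z"
   and yi: "integrable ?M (\<lambda>t. (H1_norm \<Omega> (y t))\<^sup>2)" "integrable ?M (\<lambda>t. (H1_norm \<Omega> (z t))\<^sup>2)"
   using y z bochner_H01_iff[OF op bd T] by blast+
  have s: "sqi ?M (\<lambda>t. H1_norm \<Omega> (y t))" "sqi ?M (\<lambda>t. H1_norm \<Omega> (z t))"
   using yi H1_norm_borel[OF op bd T] ym zm by (simp_all add: sqi_def)
  have i: "integrable ?M (\<lambda>t. H1_norm \<Omega> (y t) * H1_norm \<Omega> (z t))"
   using sqi_inner_integrable[OF s] by simp
  have "AE t in ?M. y t \<in> H01 \<Omega>" "AE t in ?M. z t \<in> H01 \<Omega>"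
   using ym zm by (simp_all add: strongly_measurable_def)
  then have "AE t in ?M. norm (LINT x|?N. weak_grad \<Omega> (y t) x \<bullet> weak_grad \<Omega> (z t) x) \<le> norm (H1_norm \<Omega> (y t) * H1_norm \<Omega> (z t))"
  proof eventually_elim
   case (elim t)
   note h = H01_H1[OF elim(1)] H01_H1[OF elim(2)]
   have "\<bar>LINT x|?N. weak_grad \<Omega> (y t) x \<bullet> weak_grad \<Omega> (z t) x\<bar> \<le> L2n ?N (weak_grad \<Omega> (y t)) * L2n ?N (weak_grad \<Omega> (z t))"
    by (intro L2n_Cauchy_Schwarz H1_D(3)[OF op bd] h)
   also have "\<dots> \<le> H1_norm \<Omega> (y t) * H1_norm \<Omega> (z t)"
    by (intro mult_mono H1_L2n_le(2)[OF op bd] h) (auto simp: H1_norm_nonneg)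
   finally show ?case by (simp add: H1_norm_nonneg)
  qed
  from Bochner_Integration.integrable_bound[OF i grad_pairing_measurable[OF op bd T ym zm] this] show ?thesis .
 qed
 \<comment> \<open>A switching time beyond \<open>T\<close> leaves \<open>Y (w t)\<close> unchanged
   on the whole interval, so the composition result also covers this case.\<close>
 define \<psi> where "\<psi> t = (if t < T + 1 then (\<lambda>x. Y (w t x)) else (\<lambda>x. 0))" for t
 have \<psi>B: "\<psi> \<in> bochner_Lp 2 T (H01 \<Omega>) (H1_norm \<Omega>)"
  unfolding \<psi>_def by (rule bochner_H01_compose[OF op bd T wB Y(1,2,4)])
 have D\<psi>: "D t = (LINT x|?N. weak_grad \<Omega> (\<psi> t) x \<bullet> weak_grad \<Omega> (\<psi> t) x)" if "t \<in> {0<..<T}" for t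
  using that by (simp add: D_def L2n_sq \<psi>_def wv power2_norm_eq_inner)
 show Di: "integrable ?M D"
  using grad_int[OF \<psi>B \<psi>B] by (rule Bochner_Integration.integrable_cong[THEN iffD1, rotated -1]) (use D\<psi> in auto)
 fix \<tau> assume \<tau>: "0 < \<tau>" "\<tau> \<le> T"
 define \<phi> where "\<phi> t = (if t < \<tau> then (\<lambda>x. G (w t x)) else (\<lambda>x. 0))" for t
 have \<phi>B: "\<phi> \<in> bochner_Lp 2 T (H01 \<Omega>) (H1_norm \<Omega>)"
  unfolding \<phi>_def by (rule bochner_H01_compose[OF op bd T wB G(1,2,5)])
 have 1: "(LINT x|?N. H (w \<tau> x)) \<le> (LINT t|?M. vt t (\<phi> t))"
  unfolding \<phi>_def
  by (rule time_inequality[OF H smooth_borel[OF G(1)] G(3,4) w0 \<tau> \<phi>B[unfolded \<phi>_def[abs_def]]])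
 have 3: "0 \<le> (LINT t|?M. fractional_form s (w t) (\<phi> t))"
  by (intro integral_nonneg_AE AE_I2) (simp add: \<phi>_def fractional_form_nonneg[OF G(3)] fractional_form_zero)
 have "(LINT t|?M. (1 / C) * (indicator {..<\<tau>} t * D t)) \<le> (LINT t|?M. LINT x|?N. weak_grad \<Omega> (w t) x \<bullet> weak_grad \<Omega> (\<phi> t) x)"
 proof (rule integral_mono_AE)
  have "integrable ?M (\<lambda>t. indicator ({..<\<tau>} \<inter> {0<..<T}) t * D t)"
   by (rule indicator_integrable[OF Di]) auto
  then have "integrable ?M (\<lambda>t. indicator {..<\<tau>} t * D t)"
   by (rule Bochner_Integration.integrable_cong[THEN iffD1, rotated -1]) (auto simp: indicator_def)
  then show "integrable ?M (\<lambda>t. (1 / C) * (indicator {..<\<tau>} t * D t))" by (rule integrable_mult_right)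
  show "integrable ?M (\<lambda>t. LINT x|?N. weak_grad \<Omega> (w t) x \<bullet> weak_grad \<Omega> (\<phi> t) x)" by (rule grad_int[OF wB \<phi>B])
  show "AE t in ?M. (1 / C) * (indicator {..<\<tau>} t * D t) \<le> (LINT x|?N. weak_grad \<Omega> (w t) x \<bullet> weak_grad \<Omega> (\<phi> t) x)"
   using wX AE_space
  proof eventually_elim
   case (elim t)
   note gw = H1_D(3)[OF op bd H01_H1[OF elim(1)]]
   show ?case
   proof (cases "t < \<tau>")
    case True
    note cG = H01_compose[OF op bd elim(1) G(1,2,5)] and cY = H01_compose[OF op bd elim(1) Y(1,2,4)]
    note gG = H1_D(3)[OF op bd H01_H1[OF cG(1)]] and gY = H1_D(3)[OF op bd H01_H1[OF cY(1)]]
    have "(1 / C) * D t = (LINT x|?N. (1 / C) * (norm (weak_grad \<Omega> (\<lambda>x. Y (w t x)) x))\<^sup>2)"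
     by (simp add: D_def L2n_sq wv)
    also have "\<dots> \<le> (LINT x|?N. weak_grad \<Omega> (w t) x \<bullet> weak_grad \<Omega> (\<lambda>x. G (w t x)) x)"
    proof (rule integral_mono_AE)
     show "AE x in ?N. (1 / C) * (norm (weak_grad \<Omega> (\<lambda>x. Y (w t x)) x))\<^sup>2 \<le> weak_grad \<Omega> (w t) x \<bullet> weak_grad \<Omega> (\<lambda>x. G (w t x)) x"
      using cG(2) cY(2)
     proof eventually_elim
      case (elim x)
      have "(1 / C) * ((deriv Y (w t x))\<^sup>2 * (norm (weak_grad \<Omega> (w t) x))\<^sup>2) \<le> (1 / C) * (C * deriv G (w t x) * (norm (weak_grad \<Omega> (w t) x))\<^sup>2)"
       using C(1) C(2)[of "w t x"] by (intro mult_left_mono mult_right_mono) auto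
      then show ?case using elim C(1) by (simp add: power_mult_distrib power2_norm_eq_inner)
     qed
    qed (use sqi_integrable[OF gY] sqi_inner_integrable[OF gw gG] in auto)
    finally show ?thesis using True by (simp add: \<phi>_def)
   next
    case False
    \<comment> \<open>The chosen weak gradient of the zero function is only zero almost everywhere,
      so its vanishing is read off from the norm.\<close>
    have "(LINT x|?N. weak_grad \<Omega> (w t) x \<bullet> weak_grad \<Omega> (\<lambda>x. 0) x) = 0"
    proof -
     have z: "H1_norm \<Omega> (\<lambda>x. 0) = 0" "(\<lambda>x. 0) \<in> H1 \<Omega>" using H01_zero[OF op bd] H01_H1 by auto
     have "\<bar>LINT x|?N. weak_grad \<Omega> (w t) x \<bullet> weak_grad \<Omega> (\<lambda>x. 0) x\<bar> \<le> L2n ?N (weak_grad \<Omega> (w t)) * L2n ?N (weak_grad \<Omega> (\<lambda>x. 0))"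
      by (rule L2n_Cauchy_Schwarz[OF gw H1_D(3)[OF op bd z(2)]])
     moreover have "L2n ?N (weak_grad \<Omega> (\<lambda>x. 0)) = 0"
      using H1_L2n_le(2)[OF op bd z(2)] z(1) L2n_nonneg[of ?N "weak_grad \<Omega> (\<lambda>x. 0)"] by linarith
     ultimately show ?thesis by simp
    qed
    then show ?thesis using False by (simp add: \<phi>_def)
   qed
  qed
 qed
 then have 2: "(1 / C) * (LINT t|?M. indicator {..<\<tau>} t * D t) \<le> (LINT t|?M. LINT x|?N. weak_grad \<Omega> (w t) x \<bullet> weak_grad \<Omega> (\<phi> t) x)"
  by simp
 have \<tau>I: "\<tau> \<in> {0..T}" using \<tau> by auto
 have wm: "w \<tau> \<in> borel_measurable ?N" using w_sqi[OF \<tau>I] by (rule sqi_measurable)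
 have "(LINT x|?N. (1 / C) * (Y (w \<tau> x))\<^sup>2) \<le> (LINT x|?N. H (w \<tau> x))"
 proof (rule integral_mono_or_zero)
  have Hm: "H \<in> borel_measurable borel"
   by (intro borel_measurable_continuous_onI DERIV_continuous_on[where D=G]) (use H(1) in auto)
  have HB: "\<bar>H y\<bar> \<le> B * \<bar>y\<bar>" for y
   using field_differentiable_bound[of UNIV H G B y 0] H G(4) by (auto simp: field_differentiable_def)
  show "integrable ?N (\<lambda>x. H (w \<tau> x))"
  proof (rule Bochner_Integration.integrable_bound)
   show "integrable ?N (\<lambda>x. B * \<bar>w \<tau> x\<bar>)" using sqi_integrable1[OF op bd w_sqi[OF \<tau>I]] by simp
   show "AE x in ?N. norm (H (w \<tau> x)) \<le> norm (B * \<bar>w \<tau> x\<bar>)" using order_trans[OF HB abs_ge_self] by simp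
  qed (rule measurable_compose[OF wm Hm])
  have le: "(1 / C) * (Y y)\<^sup>2 \<le> H y" for y using C(1) C(3)[of y] by (simp add: field_simps)
  then show "AE x in ?N. (1 / C) * (Y (w \<tau> x))\<^sup>2 \<le> H (w \<tau> x)" by simp
  have "0 \<le> H y" for y by (rule order_trans[OF _ le[of y]]) (use C(1) in simp)
  then show "AE x in ?N. 0 \<le> H (w \<tau> x)" by simp
 qed
 then have 0: "(1 / C) * (LINT x|?N. (Y (w \<tau> x))\<^sup>2) \<le> (LINT x|?N. H (w \<tau> x))" by simp
 have "(1 / C) * ((LINT x|?N. (Y (w \<tau> x))\<^sup>2) + (LINT t|?M. indicator {..<\<tau>} t * D t)) \<le> (LINT t|?M. LINT x|?N. g (x, t) * \<phi> t x)"
  using 0 1 2 3 weak[OF \<phi>B] by (simp add: distrib_left)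
 then have "(LINT x|?N. (Y (w \<tau> x))\<^sup>2) + (LINT t|?M. indicator {..<\<tau>} t * D t) \<le> C * (LINT t|?M. LINT x|?N. g (x, t) * \<phi> t x)"
  using C(1) by (simp add: field_simps)
 moreover have "\<phi> t x = (if t < \<tau> then G (v (x, t)) else 0)" for t x by (simp add: \<phi>_def wv)
 ultimately show "(LINT x|?N. (Y (v (x, \<tau>)))\<^sup>2) + (LINT t|?M. indicator {..<\<tau>} t * D t)
   \<le> C * (LINT t|?M. LINT x|?N. g (x, t) * (if t < \<tau> then G (v (x, t)) else 0))"
  by (simp add: wv)
qed

subsection \<open>Uniform estimates\<close>

lemma epow_ennreal_pos: "0 < x \<Longrightarrow> epow (ennreal x) p = ennreal (x powr p)"
 by (cases "p = 0") (auto simp: epow_ennreal)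

text \<open>Hoelder with the three weights \<open>1 / q\<close>, \<open>a\<close> and
  \<open>b * (n - 2) / n\<close>: the power \<open>2 * (a + b)\<close> of
  \<open>\<bar>y x\<bar>\<close> is split between its square and its Sobolev power. Positivity of
  \<open>S\<close> matters when \<open>a = 0\<close>, since \<open>0 powr 0 = 0\<close> while the
  factor of weight zero equals one.\<close>

lemma Holder_slice:
 fixes \<Omega> :: "'a::euclidean_space set" and y h :: "'a \<Rightarrow> real"
 assumes n: "n > 2" and q: "1 < q" and ab: "0 \<le> a" "0 < b" "1 / q + a + b * (n - 2) / n = 1"
  and h: "h \<in> Lp q \<Omega>" and y: "y \<in> borel_measurable (lebesgue_on \<Omega>)"
  and y2: "integrable (lebesgue_on \<Omega>) (\<lambda>x. (y x)\<^sup>2)" "(LINT x|lebesgue_on \<Omega>. (y x)\<^sup>2) \<le> S" "S > 0"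
  and yp: "integrable (lebesgue_on \<Omega>) (\<lambda>x. \<bar>y x\<bar> powr (2 * n / (n - 2)))"
   "(LINT x|lebesgue_on \<Omega>. \<bar>y x\<bar> powr (2 * n / (n - 2))) powr ((n - 2) / n) \<le> E"
 shows "(\<integral>\<^sup>+x. ennreal (\<bar>h x\<bar> * \<bar>y x\<bar> powr (2 * (a + b))) \<partial>lebesgue_on \<Omega>)
  \<le> ennreal (Lp_norm q \<Omega> h * S powr a * E powr b)"
proof -
 let ?M = "lebesgue_on \<Omega>"
 let ?p = "2 * n / (n - 2)" and ?\<beta> = "b * (n - 2) / n"
 define F where "F j x = (if j = 0 then ennreal (\<bar>h x\<bar> powr q) else if j = 1 then ennreal ((y x)\<^sup>2) else ennreal (\<bar>y x\<bar> powr ?p))"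
  for j :: nat and x
 define A where "A j = (if j = 0 then 1 / q else if j = 1 then a else ?\<beta>)" for j :: nat
 have hm: "h \<in> borel_measurable ?M" and hi: "integrable ?M (\<lambda>x. \<bar>h x\<bar> powr q)" using h by (auto simp: Lp_def)
 have \<beta>: "?\<beta> > 0" using ab n by simp
 have set3: "{0, 1, 2::nat} = insert 0 (insert 1 {2})" by auto
 have prod3: "prod P {0, 1, 2::nat} = P 0 * P 1 * P 2" for P :: "nat \<Rightarrow> ennreal" by (simp add: mult.assoc)
 have pw: "ennreal (\<bar>h x\<bar> * \<bar>y x\<bar> powr (2 * (a + b))) = (\<Prod>j\<in>{0, 1, 2}. epow (F j x) (A j))" for x
 proof (cases "y x = 0")
  case True
  have "2 * (a + b) \<noteq> 0" using ab by simp
  moreover have "epow 0 ?\<beta> = 0" by (rule epow_zero[OF less_imp_neq[OF \<beta>, symmetric]])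
  ultimately show ?thesis using True n by (simp add: prod3 F_def A_def)
 next
  case False
  have 0: "epow (ennreal (\<bar>h x\<bar> powr q)) (1 / q) = ennreal \<bar>h x\<bar>"
   using q by (simp add: epow_ennreal powr_powr)
  have 1: "epow (ennreal ((y x)\<^sup>2)) a = ennreal (\<bar>y x\<bar> powr (2 * a))"
  proof -
   have "(y x)\<^sup>2 = \<bar>y x\<bar> powr 2" using False by simp
   then have "((y x)\<^sup>2) powr a = \<bar>y x\<bar> powr (2 * a)" by (simp only: powr_powr)
   then show ?thesis using False by (simp add: epow_ennreal_pos)
  qed
  have 2: "epow (ennreal (\<bar>y x\<bar> powr ?p)) ?\<beta> = ennreal (\<bar>y x\<bar> powr (2 * b))"
  proof -
   have "?p * ?\<beta> = 2 * b" using n by (simp add: field_simps)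
   then show ?thesis using False by (simp add: epow_ennreal_pos powr_powr)
  qed
  have "\<bar>y x\<bar> powr (2 * (a + b)) = \<bar>y x\<bar> powr (2 * a) * \<bar>y x\<bar> powr (2 * b)" by (simp add: powr_add distrib_left)
  moreover have "epow (F 0 x) (A 0) = ennreal \<bar>h x\<bar>" "epow (F 1 x) (A 1) = ennreal (\<bar>y x\<bar> powr (2 * a))"
   "epow (F 2 x) (A 2) = ennreal (\<bar>y x\<bar> powr (2 * b))"
   using 0 1 2 by (simp_all add: F_def A_def)
  ultimately show ?thesis by (simp only: prod3) (simp add: ennreal_mult mult.assoc)
 qed
 have "(\<integral>\<^sup>+x. ennreal (\<bar>h x\<bar> * \<bar>y x\<bar> powr (2 * (a + b))) \<partial>?M) = (\<integral>\<^sup>+x. (\<Prod>j\<in>{0, 1, 2}. epow (F j x) (A j)) \<partial>?M)"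
  by (simp only: pw)
 also have "\<dots> \<le> (\<Prod>j\<in>{0, 1, 2}. epow (\<integral>\<^sup>+x. F j x \<partial>?M) (A j))"
 proof (rule nn_integral_Holder)
  show "sum A {0, 1, 2} = 1" using ab(3) by (simp add: A_def)
  show "0 \<le> A j" for j using q ab \<beta> by (simp add: A_def)
  show "F j \<in> borel_measurable ?M" for j
   using hm y by (simp add: F_def[abs_def])
 qed simp
 also have "\<dots> = epow (\<integral>\<^sup>+x. ennreal (\<bar>h x\<bar> powr q) \<partial>?M) (1 / q) * epow (\<integral>\<^sup>+x. ennreal ((y x)\<^sup>2) \<partial>?M) a *
   epow (\<integral>\<^sup>+x. ennreal (\<bar>y x\<bar> powr ?p) \<partial>?M) ?\<beta>"
  by (simp add: prod3 F_def A_def mult.assoc)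
 also have "\<dots> \<le> ennreal (Lp_norm q \<Omega> h) * ennreal (S powr a) * ennreal (E powr b)"
 proof (intro mult_mono)
  show "epow (\<integral>\<^sup>+x. ennreal (\<bar>h x\<bar> powr q) \<partial>?M) (1 / q) \<le> ennreal (Lp_norm q \<Omega> h)"
   using hi q by (simp add: nn_integral_eq_integral epow_ennreal Lp_norm_def)
  have "epow (\<integral>\<^sup>+x. ennreal ((y x)\<^sup>2) \<partial>?M) a \<le> epow (ennreal S) a"
   using y2 ab by (intro epow_mono) (simp_all add: nn_integral_eq_integral)
  then show "epow (\<integral>\<^sup>+x. ennreal ((y x)\<^sup>2) \<partial>?M) a \<le> ennreal (S powr a)"
   using y2(3) by (simp add: epow_ennreal_pos)
  have "(LINT x|?M. \<bar>y x\<bar> powr ?p) powr ?\<beta> = ((LINT x|?M. \<bar>y x\<bar> powr ?p) powr ((n - 2) / n)) powr b"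
   by (simp add: powr_powr mult.commute)
  also have "\<dots> \<le> E powr b" using yp(2) ab by (intro powr_mono2) auto
  finally show "epow (\<integral>\<^sup>+x. ennreal (\<bar>y x\<bar> powr ?p) \<partial>?M) ?\<beta> \<le> ennreal (E powr b)"
   using yp(1) by (simp add: nn_integral_eq_integral epow_ennreal[OF _ less_imp_neq[OF \<beta>, symmetric]] ennreal_leI)
 qed auto
 also have "\<dots> = ennreal (Lp_norm q \<Omega> h * S powr a * E powr b)"
  by (simp add: ennreal_mult Lp_norm_def)
 finally show ?thesis .
qed

text \<open>The weighted inequality of means with weights \<open>b\<close> and \<open>1 - b\<close>
  for \<open>\<delta> * D\<close> and the last summand, whose value is chosen so that the weighted
  product is the left side.\<close>

lemma Young_powr:
 fixes b :: real
 assumes b: "0 < b" "b < 1" and nn: "0 \<le> A" "0 \<le> D" "0 < \<delta>"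
 shows "A * D powr b \<le> \<delta> * D + (A * \<delta> powr (- b)) powr (1 / (1 - b))"
proof -
 let ?z = "(A * \<delta> powr (- b)) powr (1 / (1 - b))"
 have "(\<Prod>j\<in>{0, 1::nat}. (if j = 0 then \<delta> * D else ?z) powr (if j = 0 then b else 1 - b)) \<le>
   (\<Sum>j\<in>{0, 1::nat}. (if j = 0 then b else 1 - b) * (if j = 0 then \<delta> * D else ?z))"
  using b nn by (intro weighted_am_gm) auto
 then have "(\<delta> * D) powr b * ?z powr (1 - b) \<le> b * (\<delta> * D) + (1 - b) * ?z" by simp
 moreover have "?z powr (1 - b) = A * \<delta> powr (- b)" using b nn by (simp add: powr_powr)
 moreover have "(\<delta> * D) powr b * (A * \<delta> powr (- b)) = A * D powr b"
  using nn by (simp add: powr_mult powr_minus field_simps)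
 moreover have "b * (\<delta> * D) \<le> 1 * (\<delta> * D)" "(1 - b) * ?z \<le> 1 * ?z" using b nn by (intro mult_right_mono; simp)+
 ultimately show ?thesis by simp
qed

lemma add_powr_le:
 fixes y p :: real
 assumes "0 \<le> x" "0 \<le> y" "0 \<le> p"
 shows "(x + y) powr p \<le> 2 powr p * (x powr p + y powr p)"
proof -
 have "(x + y) powr p \<le> (2 * max x y) powr p" using assms by (intro powr_mono2) auto
 also have "\<dots> = 2 powr p * max x y powr p" using assms by (simp add: powr_mult)
 also have "\<dots> \<le> 2 powr p * (x powr p + y powr p)" by (intro mult_left_mono) (auto simp: max_def)
 finally show ?thesis .
qed

text \<open>With \<open>S\<close> one more than the supremum, \<open>step\<close> gives
  \<open>S \<le> (1 + K) * S powr \<theta>\<close>, which can be solved for \<open>S\<close> as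
  \<open>\<theta> < 1\<close>. The bound \<open>B\<close> only guarantees that the supremum is
  finite and leaves no trace in the conclusion.\<close>

lemma sublinear_closing:
 fixes e :: "real \<Rightarrow> real"
 assumes bnd: "\<And>\<tau>. \<tau> \<in> I \<Longrightarrow> e \<tau> \<le> B" and I: "I \<noteq> {}" and \<theta>: "0 \<le> \<theta>" "\<theta> < 1" and K: "0 \<le> K"
  and nn: "\<And>\<tau>. \<tau> \<in> I \<Longrightarrow> 0 \<le> e \<tau>"
  and step: "\<And>S \<tau>. 1 \<le> S \<Longrightarrow> (\<And>t. t \<in> I \<Longrightarrow> e t \<le> S) \<Longrightarrow> \<tau> \<in> I \<Longrightarrow> e \<tau> \<le> K * S powr \<theta>"
 shows "\<tau> \<in> I \<Longrightarrow> e \<tau> \<le> (1 + K) powr (1 / (1 - \<theta>))"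
proof -
 define S where "S = 1 + (SUP \<tau>\<in>I. e \<tau>)"
 have bdd: "bdd_above (e ` I)" using bnd by (auto intro!: bdd_aboveI2)
 have eS: "e t \<le> S - 1" if "t \<in> I" for t unfolding S_def using cSUP_upper[OF that bdd] by simp
 obtain t0 where "t0 \<in> I" using I by blast
 then have S1: "1 \<le> S" using eS[of t0] nn[of t0] by simp
 have "(SUP \<tau>\<in>I. e \<tau>) \<le> K * S powr \<theta>"
 proof (rule cSUP_least[OF I], rule step[OF S1])
  show "e t \<le> S" if "t \<in> I" for t using eS[OF that] by simp
 qed
 then have "S \<le> 1 + K * S powr \<theta>" by (simp add: S_def)
 also have "\<dots> \<le> (1 + K) * S powr \<theta>" using S1 \<theta> ge_one_powr_ge_zero[of S \<theta>] by (simp add: distrib_right)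
 finally have "S powr (1 - \<theta>) \<le> 1 + K" using S1 by (simp add: powr_diff field_simps)
 then have "(S powr (1 - \<theta>)) powr (1 / (1 - \<theta>)) \<le> (1 + K) powr (1 / (1 - \<theta>))"
  using \<theta> by (intro powr_mono2) auto
 then have "S \<le> (1 + K) powr (1 / (1 - \<theta>))" using \<theta> S1 by (simp add: powr_powr)
 then show "\<tau> \<in> I \<Longrightarrow> e \<tau> \<le> (1 + K) powr (1 / (1 - \<theta>))" using eS[of \<tau>] by simp
qed

lemma Lp_integrable1:
 fixes \<Omega> :: "'a::euclidean_space set"
 assumes "open \<Omega>" "bounded \<Omega>" "1 \<le> q" "h \<in> Lp q \<Omega>"
 shows "integrable (lebesgue_on \<Omega>) h"
proof (rule Bochner_Integration.integrable_bound)
 show "integrable (lebesgue_on \<Omega>) (\<lambda>x. 1 + \<bar>h x\<bar> powr q)"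
  using assms const_integrable[OF assms(1,2)] by (simp add: Lp_def)
 have "norm y \<le> norm (1 + \<bar>y\<bar> powr q)" for y :: real
 proof (cases "\<bar>y\<bar> \<le> 1")
  case True
  then show ?thesis by (simp add: add_increasing2)
 next
  case False
  then have "\<bar>y\<bar> powr 1 \<le> \<bar>y\<bar> powr q" using assms(3) by (intro powr_mono) auto
  then show ?thesis using False by simp
 qed
 then show "AE x in lebesgue_on \<Omega>. norm (h x) \<le> norm (1 + \<bar>h x\<bar> powr q)" by simp
qed (use assms in \<open>simp add: Lp_def\<close>)

text \<open>\<open>Holder_slice\<close> is used twice, for \<open>y\<close> and, on account of the
  summand one, for the constant function one. In the second use \<open>S0\<close> bounds the square
  integral, and its power \<open>(n - 2) / n\<close> replaces \<open>E\<close>.\<close>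

lemma slice_source_bound:
 fixes \<Omega> :: "'a::euclidean_space set" and y h g :: "'a \<Rightarrow> real"
 assumes op: "open \<Omega>" and bd: "bounded \<Omega>"
  and n: "n > 2" and q: "1 < q" and ab: "0 \<le> a" "0 < b" "1 / q + a + b * (n - 2) / n = 1"
  and h: "h \<in> Lp q \<Omega>" and y: "y \<in> borel_measurable (lebesgue_on \<Omega>)" "\<And>x. \<bar>y x\<bar> \<le> B"
  and S: "(LINT x|lebesgue_on \<Omega>. (y x)\<^sup>2) \<le> S" "S > 0"
  and E: "(LINT x|lebesgue_on \<Omega>. \<bar>y x\<bar> powr (2 * n / (n - 2))) powr ((n - 2) / n) \<le> E"
  and S0: "measure lebesgue \<Omega> \<le> S0" "S0 > 0"
  and g: "AE x in lebesgue_on \<Omega>. g x \<le> C * (\<bar>h x\<bar> * (1 + \<bar>y x\<bar> powr (2 * (a + b))))" "C > 0"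
 shows "(LINT x|lebesgue_on \<Omega>. g x) \<le> C * (Lp_norm q \<Omega> h * S0 powr a * (S0 powr ((n - 2) / n)) powr b
  + Lp_norm q \<Omega> h * S powr a * E powr b)"
proof -
 let ?M = "lebesgue_on \<Omega>" and ?p = "2 * n / (n - 2)"
 let ?Q = "Lp_norm q \<Omega> h * S0 powr a * (S0 powr ((n - 2) / n)) powr b"
 let ?R = "Lp_norm q \<Omega> h * S powr a * E powr b"
 have hi: "integrable ?M (\<lambda>x. \<bar>h x\<bar>)" using Lp_integrable1[OF op bd _ h] q by simp
 have yP: "integrable ?M (\<lambda>x. \<bar>y x\<bar> powr p)" if "p \<ge> 0" for p
 proof (rule Bochner_Integration.integrable_bound[OF const_integrable[OF op bd, of "B powr p"]])
  show "AE x in ?M. norm (\<bar>y x\<bar> powr p) \<le> norm (B powr p)" using y(2) that by (auto intro!: powr_mono2)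
 qed (use y(1) in simp)
 have y2: "integrable ?M (\<lambda>x. (y x)\<^sup>2)" using yP[of 2] by simp
 have m: "(LINT x|?M. 1) = measure lebesgue \<Omega>"
  using op by (simp add: measure_restrict_space)
 have "(\<integral>\<^sup>+x. ennreal (\<bar>h x\<bar> * \<bar>1\<bar> powr (2 * (a + b))) \<partial>?M) \<le> ennreal ?Q"
  by (rule Holder_slice[OF n q ab h, where y="\<lambda>_. 1" and S=S0 and E="S0 powr ((n - 2) / n)"])
   (use const_integrable[OF op bd] m S0 n in \<open>auto intro!: powr_mono2\<close>)
 then have n0: "(\<integral>\<^sup>+x. ennreal \<bar>h x\<bar> \<partial>?M) \<le> ennreal ?Q" by simp
 have n1: "(\<integral>\<^sup>+x. ennreal (\<bar>h x\<bar> * \<bar>y x\<bar> powr (2 * (a + b))) \<partial>?M) \<le> ennreal ?R"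
  by (rule Holder_slice[OF n q ab h y(1) y2 S _ E]) (use yP n in auto)
 have nn: "0 \<le> ?Q" "0 \<le> ?R" by (simp_all add: Lp_norm_def)
 have i1: "integrable ?M (\<lambda>x. \<bar>h x\<bar> * \<bar>y x\<bar> powr (2 * (a + b)))"
 proof (rule Bochner_Integration.integrable_bound)
  show "integrable ?M (\<lambda>x. B powr (2 * (a + b)) * \<bar>h x\<bar>)" using hi by simp
  have "\<bar>y x\<bar> powr (2 * (a + b)) \<le> B powr (2 * (a + b))" for x using y(2) ab by (intro powr_mono2) auto
  then have "\<bar>y x\<bar> powr (2 * (a + b)) * \<bar>h x\<bar> \<le> B powr (2 * (a + b)) * \<bar>h x\<bar>" for x by (intro mult_right_mono) auto
  then show "AE x in ?M. norm (\<bar>h x\<bar> * \<bar>y x\<bar> powr (2 * (a + b))) \<le> norm (B powr (2 * (a + b)) * \<bar>h x\<bar>)"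
   by (simp add: abs_mult mult.commute)
 qed (use y(1) h in \<open>auto simp: Lp_def\<close>)
 have "(LINT x|?M. g x) \<le> (LINT x|?M. C * (\<bar>h x\<bar> + \<bar>h x\<bar> * \<bar>y x\<bar> powr (2 * (a + b))))"
 proof (rule integral_mono_or_zero)
  show "integrable ?M (\<lambda>x. C * (\<bar>h x\<bar> + \<bar>h x\<bar> * \<bar>y x\<bar> powr (2 * (a + b))))" using hi i1 by simp
  show "AE x in ?M. g x \<le> C * (\<bar>h x\<bar> + \<bar>h x\<bar> * \<bar>y x\<bar> powr (2 * (a + b)))"
   using g(1) by (simp add: distrib_left)
  show "AE x in ?M. 0 \<le> C * (\<bar>h x\<bar> + \<bar>h x\<bar> * \<bar>y x\<bar> powr (2 * (a + b)))" using g(2) by simp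
 qed
 also have "\<dots> = C * ((LINT x|?M. \<bar>h x\<bar>) + (LINT x|?M. \<bar>h x\<bar> * \<bar>y x\<bar> powr (2 * (a + b))))"
  using hi i1 by simp
 also have "\<dots> \<le> C * (?Q + ?R)"
 proof (intro mult_left_mono add_mono)
  show "(LINT x|?M. \<bar>h x\<bar>) \<le> ?Q" by (rule integral_real_bounded[OF nn(1) n0])
  show "(LINT x|?M. \<bar>h x\<bar> * \<bar>y x\<bar> powr (2 * (a + b))) \<le> ?R" by (rule integral_real_bounded[OF nn(2) n1])
 qed (use g(2) in simp)
 finally show ?thesis .
qed

lemma powr_le_one_plus:
 fixes x :: real
 assumes "0 \<le> x" "0 \<le> p" "p \<le> r" shows "x powr p \<le> 1 + x powr r"
proof (cases "x \<le> 1")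
 case True
 then have "x powr p \<le> 1" using assms powr_mono2[of p x 1] by simp
 then show ?thesis by (simp add: add_increasing2)
next
 case False
 then have "x powr p \<le> x powr r" using assms by (intro powr_mono) auto
 then show ?thesis by simp
qed

text \<open>Young's inequality detaches a small multiple of the dissipation \<open>D\<close> and
  leaves the power \<open>1 / (1 - b)\<close> of \<open>F\<close> and of \<open>S powr a\<close>.
  The assumption \<open>1 / (1 - b) \<le> r\<close> brings the former under
  \<open>1 + F powr r\<close>, which is integrable in time; the latter is the exponent
  \<open>\<theta> = a / (1 - b)\<close>, below one precisely when \<open>a + b < 1\<close>.\<close>

lemma absorb_source:
 fixes F S D C :: real
 assumes b: "0 < b" "b < 1" "1 / (1 - b) \<le> r" and r: "1 \<le> r" and a: "0 \<le> a"
  and nn: "0 \<le> F" "1 \<le> S" "0 \<le> D" "0 < CS" "0 < \<delta>" "0 \<le> c0"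
 shows "c0 * F + F * S powr a * (CS * D) powr b
  \<le> \<delta> * D + (c0 + (CS powr b * \<delta> powr (- b)) powr (1 / (1 - b))) * S powr (a / (1 - b)) * (1 + F powr r)"
proof -
 let ?\<theta> = "a / (1 - b)" and ?c = "(CS powr b * \<delta> powr (- b)) powr (1 / (1 - b))"
 have S\<theta>: "1 \<le> S powr ?\<theta>" using nn a b by (intro ge_one_powr_ge_zero) auto
 have F1: "F \<le> 1 + F powr r" using powr_le_one_plus[of F 1 r] nn r by simp
 have "c0 * F \<le> c0 * (S powr ?\<theta> * (1 + F powr r))"
 proof (rule mult_left_mono[OF _ nn(6)])
  have "F \<le> 1 * (1 + F powr r)" using F1 by simp
  also have "\<dots> \<le> S powr ?\<theta> * (1 + F powr r)" using S\<theta> by (intro mult_right_mono) auto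
  finally show "F \<le> S powr ?\<theta> * (1 + F powr r)" .
 qed
 moreover have "F * S powr a * (CS * D) powr b \<le> \<delta> * D + ?c * (S powr ?\<theta> * (1 + F powr r))"
 proof -
  have "F * S powr a * (CS * D) powr b = (F * S powr a * CS powr b) * D powr b"
   using nn by (simp add: powr_mult)
  also have "\<dots> \<le> \<delta> * D + ((F * S powr a * CS powr b) * \<delta> powr (- b)) powr (1 / (1 - b))"
   using nn b by (intro Young_powr) auto
  also have "((F * S powr a * CS powr b) * \<delta> powr (- b)) powr (1 / (1 - b)) = ?c * (S powr ?\<theta> * F powr (1 / (1 - b)))"
   using nn by (simp add: powr_mult powr_powr mult_ac)
  also have "\<dots> \<le> ?c * (S powr ?\<theta> * (1 + F powr r))"
   using nn b by (intro mult_left_mono powr_le_one_plus) auto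
  finally show ?thesis by simp
 qed
 ultimately show ?thesis by (simp add: algebra_simps)
qed

text \<open>All constants are built from the data before \<open>k\<close>, \<open>v\<close> and
  \<open>M\<close> are introduced. The only facts used about the truncated source are that it lies
  between zero and \<open>f\<close> and that the shift \<open>1 / k\<close> in the denominator is
  positive.\<close>

lemma uniform_estimates:
 fixes \<Omega> :: "'a::euclidean_space set" and f :: "'a \<times> real \<Rightarrow> real"
 assumes op: "open \<Omega>" and bd: "bounded \<Omega>" and n: "n = real DIM('a)" "n > 2" and T: "0 < T"
  and rq: "1 < r" "1 < q" and \<gamma>\<sigma>: "0 < \<gamma>" "1 < \<sigma>" "\<gamma> + 1 < 2 * \<sigma>"
  and ab: "0 \<le> a" "0 < b" "b \<le> 1 - 1 / r" "a + b = 1 - (1 + \<gamma>) / (2 * \<sigma>)" "1 / q + a + b * (n - 2) / n = 1"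
  and f: "AE z in lebesgue_on (\<Omega> \<times> {0<..<T}). 0 \<le> f z" "slices f \<in> bochner_Lp r T (Lp q \<Omega>) (Lp_norm q \<Omega>)"
 obtains K :: real where "K > 0"
  "\<And>k v M. 1 \<le> k \<Longrightarrow> energy_solution \<Omega> T s (\<lambda>z. trunc (real k) (f z) / (v z + 1 / real k) powr \<gamma>) (\<lambda>x. 0) v \<Longrightarrow>
   AE z in lebesgue_on (\<Omega> \<times> {0<..<T}). 0 \<le> v z \<Longrightarrow> M > 0 \<Longrightarrow>
   (AE t in lebesgue_on {0<..<T}. (\<integral>\<^sup>+x. ennreal (soft_trunc M (v (x, t)) powr (2 * \<sigma>)) \<partial>lebesgue_on \<Omega>) \<le> ennreal K) \<and>
   (\<integral>\<^sup>+t. epow (\<integral>\<^sup>+x. ennreal (soft_trunc M (v (x, t)) powr (2 * n / (n - 2) * \<sigma>)) \<partial>lebesgue_on \<Omega>) ((n - 2) / n)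
    \<partial>lebesgue_on {0<..<T}) \<le> ennreal K"
proof -
 let ?I = "{0<..<T}" and ?p = "2 * n / (n - 2)" and ?\<beta> = "(n - 2) / n"
 let ?M = "lebesgue_on {0<..<T}" and ?N = "lebesgue_on \<Omega>"
 obtain C :: real where C: "C > 0" and nonlin:
  "\<And>M. M > 0 \<Longrightarrow> \<exists>G Y H B. smooth G \<and> smooth Y \<and> G 0 = 0 \<and> Y 0 = 0 \<and> H 0 = 0 \<and> mono G \<and>
    (\<forall>v. \<bar>G v\<bar> \<le> B) \<and> (\<forall>v. \<bar>deriv G v\<bar> \<le> B) \<and> (\<forall>v. \<bar>Y v\<bar> \<le> B) \<and> (\<forall>v. \<bar>deriv Y v\<bar> \<le> B) \<and>
    (\<forall>v. (H has_real_derivative G v) (at v)) \<and>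
    (\<forall>v. (deriv Y v)\<^sup>2 \<le> C * deriv G v) \<and> (\<forall>v. (Y v)\<^sup>2 \<le> C * H v) \<and> (\<forall>v\<ge>0. 0 \<le> Y v) \<and>
    (\<forall>v\<ge>0. \<forall>e>0. 0 \<le> G v \<and> G v / (v + e) powr \<gamma> \<le> C * (1 + Y v powr (2 - (1 + \<gamma>) / \<sigma>))) \<and>
    (\<forall>v\<ge>0. soft_trunc M v powr \<sigma> \<le> C * (1 + Y v))"
  (is "\<And>M. _ \<Longrightarrow> \<exists>G Y H B. ?P M G Y H B")
  using test_nonlinearity[OF \<gamma>\<sigma>(2,1,3)] by metis
 define F where "F t = Lp_norm q \<Omega> (slices f t)" for t
 have F0: "0 \<le> F t" for t by (simp add: F_def Lp_norm_def)
 have Fi: "integrable ?M (\<lambda>t. 1 + F t powr r)"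
  using f(2) const_integrable[of ?I 1] by (simp add: bochner_Lp_def F_def)
 have FX: "AE t in ?M. slices f t \<in> Lp q \<Omega>"
  using f(2) by (simp add: bochner_Lp_def strongly_measurable_def)
 have opI: "open ?I" "bounded ?I" by auto
 note f0 = AE_slices[OF op opI(1) f(1)]
 define S0 where "S0 = 1 + measure lebesgue \<Omega>"
 have S0: "measure lebesgue \<Omega> \<le> S0" "S0 > 0" by (simp_all add: S0_def add_pos_nonneg)
 define CS where "CS = (2 * (n - 1) / (n - 2))\<^sup>2"
 have CS: "CS > 0" using n by (simp add: CS_def)
 define c0 where "c0 = S0 powr a * (S0 powr ?\<beta>) powr b"
 \<comment> \<open>One factor \<open>C\<close> comes from the energy inequality and one from the
   bound of the source; with this value exactly half of the dissipation is absorbed.\<close>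
 define \<delta> where "\<delta> = 1 / (2 * C\<^sup>2)"
 define c where "c = c0 + (CS powr b * \<delta> powr (- b)) powr (1 / (1 - b))"
 define \<theta> where "\<theta> = a / (1 - b)"
 define J where "J = (LINT t|?M. 1 + F t powr r)"
 \<comment> \<open>\<open>K0\<close> is the factor of \<open>S powr \<theta>\<close> after
   absorption, \<open>K1\<close> the resulting bound for the energy at every time, and
   \<open>K2\<close> the bound for the integral of the dissipation. Finally \<open>K\<close>
   collects the losses of passing from \<open>Y\<close> back to the truncated solution.\<close>
 define K0 where "K0 = C * (C * c) * J"
 define K1 where "K1 = (1 + K0) powr (1 / (1 - \<theta>))"
 define K2 where "K2 = 2 * (K0 * K1 powr \<theta>)"
 define K where "K = 1 + 2 * C\<^sup>2 * (S0 + K1) + 4 * C\<^sup>2 * 2 powr ?\<beta> * (S0 powr ?\<beta> * T + CS * K2)"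
 have c00: "0 \<le> c0" by (simp add: c0_def)
 have c: "0 \<le> c" using c00 by (simp add: c_def)
 have \<delta>: "\<delta> > 0" "C * (C * \<delta>) = 1 / 2" using C by (auto simp: \<delta>_def power2_eq_square)
 have b1: "b < 1" "1 / (1 - b) \<le> r"
 proof -
  have "1 / r > 0" using rq by simp
  then show "b < 1" using ab(3) by linarith
  then have "1 / r \<le> 1 - b" "0 < 1 - b" using ab(3) by auto
  then show "1 / (1 - b) \<le> r" using rq by (simp add: field_simps)
 qed
 have "(1 + \<gamma>) / (2 * \<sigma>) > 0" using \<gamma>\<sigma> by simp
 then have ab1: "a + b < 1" using ab(4) by simp
 have \<theta>: "0 \<le> \<theta>" "\<theta> < 1" using ab1 ab(1) b1 by (auto simp: \<theta>_def)
 have J: "0 \<le> J" unfolding J_def by (intro integral_nonneg_AE AE_I2) simp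
 have K0: "0 \<le> K0" using C c J by (simp add: K0_def)
 have K1: "1 \<le> K1" unfolding K1_def using K0 \<theta> by (intro ge_one_powr_ge_zero) auto
 have K2: "0 \<le> K2" using K0 by (simp add: K2_def)
 have two_ab: "2 * (a + b) = 2 - (1 + \<gamma>) / \<sigma>" using ab(4) \<gamma>\<sigma> by (simp add: field_simps)
 show thesis
 proof (rule that)
  show "K > 0" unfolding K_def using C S0 K1 K2 CS T by (intro add_pos_nonneg mult_nonneg_nonneg add_nonneg_nonneg) auto
  fix k :: nat and v :: "'a \<times> real \<Rightarrow> real" and M :: real
  assume k: "1 \<le> k" and es: "energy_solution \<Omega> T s (\<lambda>z. trunc (real k) (f z) / (v z + 1 / real k) powr \<gamma>) (\<lambda>x. 0) v"
   and v0: "AE z in lebesgue_on (\<Omega> \<times> {0<..<T}). 0 \<le> v z" and M: "M > 0"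
  obtain G Y H B where GYHB: "?P M G Y H B" using nonlin[OF M] by (elim exE) (rule that)
  have G: "smooth G" "G 0 = 0" "mono G" "\<And>y. \<bar>G y\<bar> \<le> B" "\<And>y. \<bar>deriv G y\<bar> \<le> B"
   and Y: "smooth Y" "Y 0 = 0" "\<And>y. \<bar>Y y\<bar> \<le> B" "\<And>y. \<bar>deriv Y y\<bar> \<le> B"
   and H: "\<And>y. (H has_real_derivative G y) (at y)" "H 0 = 0"
   and CC: "\<And>y. (deriv Y y)\<^sup>2 \<le> C * deriv G y" "\<And>y. (Y y)\<^sup>2 \<le> C * H y"
   and Y0: "\<And>y. 0 \<le> y \<Longrightarrow> 0 \<le> Y y"
   and GY: "\<And>y e. 0 \<le> y \<Longrightarrow> 0 < e \<Longrightarrow> 0 \<le> G y \<and> G y / (y + e) powr \<gamma> \<le> C * (1 + Y y powr (2 - (1 + \<gamma>) / \<sigma>))"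
   and softY: "\<And>y. 0 \<le> y \<Longrightarrow> soft_trunc M y powr \<sigma> \<le> C * (1 + Y y)"
   using GYHB by auto
  define D where "D = (\<lambda>t. (L2n ?N (weak_grad \<Omega> (\<lambda>x. Y (v (x, t)))))\<^sup>2)"
  define e where "e t = (LINT x|?N. (Y (v (x, t)))\<^sup>2)" for t
  note energy = energy_inequality[OF op bd T es G Y H C CC, folded D_def e_def]
  have D0: "0 \<le> D t" for t by (simp add: D_def)
  have e0: "0 \<le> e t" for t unfolding e_def by (intro integral_nonneg_AE AE_I2) simp
  \<comment> \<open>Finiteness of the energies beforehand, with a bound that depends on
    \<open>M\<close> through \<open>B\<close>.\<close>
  have eB: "e t \<le> (LINT x|?N. B\<^sup>2)" for t
   unfolding e_def by (rule integral_mono_or_zero[OF const_integrable[OF op bd]]) (use Y(3) in \<open>auto simp: abs_le_square_iff[symmetric] intro!: AE_I2 order_trans[OF _ abs_ge_self]\<close>)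
  note v0' = AE_slices[OF op opI(1) v0]
  have vX: "AE t in ?M. slices v t \<in> H01 \<Omega>"
   using es by (auto simp: energy_solution_def bochner_Lp_def strongly_measurable_def)
  have slice: "AE t in ?M. (\<lambda>x. Y (v (x, t))) \<in> borel_measurable ?N \<and>
    integrable ?N (\<lambda>x. \<bar>Y (v (x, t))\<bar> powr ?p) \<and> integrable ?N (\<lambda>x. (Y (v (x, t)))\<^sup>2) \<and>
    (LINT x|?N. \<bar>Y (v (x, t))\<bar> powr ?p) powr ?\<beta> \<le> CS * D t"
   using vX
  proof eventually_elim
   case (elim t)
   have YH: "(\<lambda>x. Y (v (x, t))) \<in> H01 \<Omega>"
    using H01_compose(1)[OF op bd elim Y(1,2,4)] by (simp add: slices_def)
   have "sqi ?N (\<lambda>x. Y (v (x, t)))" using H1_D(2)[OF op bd H01_H1[OF YH]] .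
   then show ?case using sobolev_H01[OF op bd YH n] by (simp add: sqi_def D_def CS_def)
  qed
  \<comment> \<open>Here \<open>S\<close> is an arbitrary common bound of the energies. It is
    inserted for the energy of every slice in the source term.\<close>
  have step: "e \<tau> + 1 / 2 * (LINT t|?M. indicator {..<\<tau>} t * D t) \<le> K0 * S powr \<theta>"
   if S: "1 \<le> S" "\<And>t. t \<in> ?I \<Longrightarrow> e t \<le> S" and \<tau>: "0 < \<tau>" "\<tau> \<le> T" for S \<tau>
  proof -
   have indD: "integrable ?M (\<lambda>t. indicator {..<\<tau>} t * D t)"
   proof -
    have "integrable ?M (\<lambda>t. indicator ({..<\<tau>} \<inter> {0<..<T}) t *\<^sub>R D t)"
     by (rule integrable_mult_indicator[OF _ energy(1)]) (simp add: sets_restrict_space_iff)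
    then show ?thesis
     by (rule Bochner_Integration.integrable_cong[THEN iffD1, rotated -1]) (auto simp: indicator_def)
   qed
   let ?g = "\<lambda>x t. trunc (real k) (f (x, t)) / (v (x, t) + 1 / real k) powr \<gamma> * (if t < \<tau> then G (v (x, t)) else 0)"
   let ?R = "\<lambda>t. C * \<delta> * (indicator {..<\<tau>} t * D t) + C * c * S powr \<theta> * (1 + F t powr r)"
   have R0: "0 \<le> C * c * S powr \<theta> * (1 + F t powr r)" for t using C c by (intro mult_nonneg_nonneg) auto
   have Ri: "integrable ?M ?R" by (intro Bochner_Integration.integrable_add integrable_mult_right indD Fi)
   have "(LINT t|?M. LINT x|?N. ?g x t) \<le> (LINT t|?M. ?R t)"
   proof (rule integral_mono_or_zero[OF Ri])
    show "AE t in ?M. 0 \<le> ?R t" by (intro AE_I2 add_nonneg_nonneg[OF _ R0] mult_nonneg_nonneg D0) (use C \<delta> in auto)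
    show "AE t in ?M. (LINT x|?N. ?g x t) \<le> ?R t"
     using f0 v0' FX slice AE_space
    proof eventually_elim
     case (elim t)
     show ?case
     proof (cases "t < \<tau>")
      case False
      then show ?thesis using R0 by simp
     next
      case True
      let ?y = "\<lambda>x. Y (v (x, t))" and ?h = "slices f t"
      \<comment> \<open>The singular factor is paired with \<open>G\<close>, whose zero at the
        origin compensates it; this is the place where the estimate becomes uniform in
        \<open>k\<close>.\<close>
      have gle: "AE x in ?N. ?g x t \<le> C * (\<bar>?h x\<bar> * (1 + \<bar>?y x\<bar> powr (2 * (a + b))))"
       using elim(1,2)
      proof eventually_elim
       case (elim x)
       have t1: "0 \<le> trunc (real k) (f (x, t))" "trunc (real k) (f (x, t)) \<le> f (x, t)"
        using elim(1) by (auto simp: trunc_def)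
       note gy = GY[OF elim(2), of "1 / real k"]
       have "?g x t = trunc (real k) (f (x, t)) * (G (v (x, t)) / (v (x, t) + 1 / real k) powr \<gamma>)"
        using True by simp
       also have "\<dots> \<le> f (x, t) * (C * (1 + Y (v (x, t)) powr (2 - (1 + \<gamma>) / \<sigma>)))"
        using t1 gy k elim(1) by (intro mult_mono) auto
       finally show ?case
        by (simp only: slices_def two_ab abs_of_nonneg[OF elim(1)] abs_of_nonneg[OF Y0[OF elim(2)]] mult.left_commute)
      qed
      have "(LINT x|?N. ?g x t) \<le> C * (Lp_norm q \<Omega> ?h * S0 powr a * (S0 powr ?\<beta>) powr b
        + Lp_norm q \<Omega> ?h * S powr a * (CS * D t) powr b)"
       by (rule slice_source_bound[OF op bd n(2) rq(2) ab(1,2,5) elim(3), where y="?y" and B=B])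
        (use elim(4,5) Y(3) S S0 gle C in \<open>auto simp: e_def\<close>)
      also have "\<dots> = C * (c0 * F t + F t * S powr a * (CS * D t) powr b)"
       by (simp add: F_def c0_def mult_ac)
      also have "\<dots> \<le> C * (\<delta> * D t + c * S powr \<theta> * (1 + F t powr r))"
       unfolding c_def \<theta>_def
       using C rq by (intro mult_left_mono absorb_source ab b1 F0 S(1) D0 CS \<delta>(1) c00) auto
      finally show ?thesis using True by (simp add: algebra_simps)
     qed
    qed
   qed
   also have "(LINT t|?M. ?R t) = C * \<delta> * (LINT t|?M. indicator {..<\<tau>} t * D t) + C * c * S powr \<theta> * J"
    unfolding J_def using indD Fi
    by (subst Bochner_Integration.integral_add) (simp_all only: integrable_mult_right integral_mult_right_zero)
   finally have "C * (LINT t|?M. LINT x|?N. ?g x t) \<le> C * (C * \<delta> * (LINT t|?M. indicator {..<\<tau>} t * D t) + C * c * S powr \<theta> * J)"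
    using C by (intro mult_left_mono) auto
   also have "\<dots> = (C * (C * \<delta>)) * (LINT t|?M. indicator {..<\<tau>} t * D t) + K0 * S powr \<theta>"
    by (simp add: K0_def algebra_simps)
   also have "\<dots> = 1 / 2 * (LINT t|?M. indicator {..<\<tau>} t * D t) + K0 * S powr \<theta>" by (simp only: \<delta>(2))
   finally show ?thesis using energy(2)[OF \<tau>] by (simp add: D_def)
  qed
  have ind0: "0 \<le> (LINT t|?M. indicator {..<\<tau>} t * D t)" for \<tau>
   using D0 by (intro integral_nonneg_AE AE_I2) auto
  have eK: "e t \<le> K1" if "t \<in> ?I" for t
   unfolding K1_def
  proof (rule sublinear_closing[of ?I, OF eB _ \<theta> K0 e0 _ that])
   show "?I \<noteq> {}" using T by simp
   fix S \<tau> assume *: "1 \<le> S" "\<And>t. t \<in> ?I \<Longrightarrow> e t \<le> S" "\<tau> \<in> ?I"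
   then show "e \<tau> \<le> K0 * S powr \<theta>" using step[OF *(1,2), of \<tau>] ind0[of \<tau>] by simp
  qed
  have DK: "(LINT t|?M. D t) \<le> K2"
  proof -
   have "(LINT t|?M. D t) = (LINT t|?M. indicator {..<T} t * D t)"
    by (intro Bochner_Integration.integral_cong) (auto simp: indicator_def)
   then show ?thesis using step[OF K1 eK T order_refl] e0[of T] by (simp add: K2_def)
  qed
  have soft0: "0 \<le> soft_trunc M y" if "0 \<le> y" for y using soft_trunc_bounds(2)[OF M that] .
  have soft_p: "soft_trunc M y powr (p * \<sigma>) \<le> C powr p * (1 + Y y) powr p" if "0 \<le> y" "0 \<le> p" for y p
  proof -
   have "soft_trunc M y powr (p * \<sigma>) = (soft_trunc M y powr \<sigma>) powr p" by (simp add: powr_powr mult.commute)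
   also have "\<dots> \<le> (C * (1 + Y y)) powr p" using softY[OF that(1)] that(2) by (intro powr_mono2) auto
   finally show ?thesis using C Y0[OF that(1)] by (simp add: powr_mult)
  qed
  have m: "(LINT x|?N. 1) = measure lebesgue \<Omega>" using op by (simp add: measure_restrict_space)
  show "(AE t in ?M. (\<integral>\<^sup>+x. ennreal (soft_trunc M (v (x, t)) powr (2 * \<sigma>)) \<partial>?N) \<le> ennreal K) \<and>
   (\<integral>\<^sup>+t. epow (\<integral>\<^sup>+x. ennreal (soft_trunc M (v (x, t)) powr (?p * \<sigma>)) \<partial>?N) ?\<beta> \<partial>?M) \<le> ennreal K"
  proof
   show "AE t in ?M. (\<integral>\<^sup>+x. ennreal (soft_trunc M (v (x, t)) powr (2 * \<sigma>)) \<partial>?N) \<le> ennreal K"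
    using v0' slice AE_space
   proof eventually_elim
    case (elim t)
    have i: "integrable ?N (\<lambda>x. 2 * C\<^sup>2 * (1 + (Y (v (x, t)))\<^sup>2))"
     using elim(2) const_integrable[OF op bd] by simp
    have "(\<integral>\<^sup>+x. ennreal (soft_trunc M (v (x, t)) powr (2 * \<sigma>)) \<partial>?N) \<le> (\<integral>\<^sup>+x. ennreal (2 * C\<^sup>2 * (1 + (Y (v (x, t)))\<^sup>2)) \<partial>?N)"
    proof (rule nn_integral_mono_AE)
     show "AE x in ?N. ennreal (soft_trunc M (v (x, t)) powr (2 * \<sigma>)) \<le> ennreal (2 * C\<^sup>2 * (1 + (Y (v (x, t)))\<^sup>2))"
      using elim(1)
     proof eventually_elim
      case (elim x)
      have "soft_trunc M (v (x, t)) powr (2 * \<sigma>) \<le> C powr 2 * (1 + Y (v (x, t))) powr 2"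
       using soft_p[OF elim, of 2] by simp
      also have "\<dots> = C\<^sup>2 * (1 + Y (v (x, t)))\<^sup>2" using C Y0[OF elim] by simp
      also have "\<dots> \<le> C\<^sup>2 * (2 * (1 + (Y (v (x, t)))\<^sup>2))"
       using sum_squares_bound[of 1 "Y (v (x, t))"] by (intro mult_left_mono) (auto simp: power2_sum)
      finally have "soft_trunc M (v (x, t)) powr (2 * \<sigma>) \<le> 2 * C\<^sup>2 * (1 + (Y (v (x, t)))\<^sup>2)"
       by (simp only: mult.assoc mult.left_commute)
      then show ?case by (rule ennreal_leI)
     qed
    qed
    also have "\<dots> = ennreal (LINT x|?N. 2 * C\<^sup>2 * (1 + (Y (v (x, t)))\<^sup>2))"
     using i by (intro nn_integral_eq_integral AE_I2) auto
    also have "(LINT x|?N. 2 * C\<^sup>2 * (1 + (Y (v (x, t)))\<^sup>2)) = 2 * C\<^sup>2 * (measure lebesgue \<Omega> + e t)"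
     using elim(2) const_integrable[OF op bd] by (simp add: m[simplified] e_def)
    also have "ennreal \<dots> \<le> ennreal K"
    proof (rule ennreal_leI)
     have "2 * C\<^sup>2 * (measure lebesgue \<Omega> + e t) \<le> 2 * C\<^sup>2 * (S0 + K1)"
      using S0 eK[of t] elim(3) by (intro mult_left_mono add_mono) auto
     moreover have "0 \<le> 4 * C\<^sup>2 * 2 powr ?\<beta> * (S0 powr ?\<beta> * T + CS * K2)"
      using T CS K2 by (intro mult_nonneg_nonneg add_nonneg_nonneg) auto
     ultimately show "2 * C\<^sup>2 * (measure lebesgue \<Omega> + e t) \<le> K" by (simp add: K_def)
    qed
    finally show ?case .
   qed
   \<comment> \<open>The part \<open>4 * C\<^sup>2\<close> is the power \<open>?\<beta>\<close> of
     \<open>C powr ?p * 2 powr ?p\<close>, as \<open>?p * ?\<beta> = 2\<close>; the remaining factor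
     comes from splitting the sum of the measure and the Sobolev integral.\<close>
   let ?c = "4 * C\<^sup>2 * 2 powr ?\<beta>"
   have \<beta>: "?\<beta> > 0" using n by simp
   have p0: "?p > 0" "?p * ?\<beta> = 2" using n by (simp_all add: field_simps)
   have "(\<integral>\<^sup>+t. epow (\<integral>\<^sup>+x. ennreal (soft_trunc M (v (x, t)) powr (?p * \<sigma>)) \<partial>?N) ?\<beta> \<partial>?M)
     \<le> (\<integral>\<^sup>+t. ennreal (?c * (S0 powr ?\<beta> + CS * D t)) \<partial>?M)"
   proof (rule nn_integral_mono_AE)
    show "AE t in ?M. epow (\<integral>\<^sup>+x. ennreal (soft_trunc M (v (x, t)) powr (?p * \<sigma>)) \<partial>?N) ?\<beta>
      \<le> ennreal (?c * (S0 powr ?\<beta> + CS * D t))"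
     using v0' slice
    proof eventually_elim
     case (elim t)
     let ?P = "LINT x|?N. \<bar>Y (v (x, t))\<bar> powr ?p"
     have P0: "0 \<le> ?P" by (intro integral_nonneg_AE AE_I2) simp
     let ?a = "C powr ?p * 2 powr ?p"
     have i: "integrable ?N (\<lambda>x. ?a * (1 + \<bar>Y (v (x, t))\<bar> powr ?p))"
      using elim(2) const_integrable[OF op bd] by simp
     have "(\<integral>\<^sup>+x. ennreal (soft_trunc M (v (x, t)) powr (?p * \<sigma>)) \<partial>?N) \<le> (\<integral>\<^sup>+x. ennreal (?a * (1 + \<bar>Y (v (x, t))\<bar> powr ?p)) \<partial>?N)"
     proof (rule nn_integral_mono_AE)
      show "AE x in ?N. ennreal (soft_trunc M (v (x, t)) powr (?p * \<sigma>)) \<le> ennreal (?a * (1 + \<bar>Y (v (x, t))\<bar> powr ?p))"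
       using elim(1)
      proof eventually_elim
       case (elim x)
       have "soft_trunc M (v (x, t)) powr (?p * \<sigma>) \<le> C powr ?p * (1 + Y (v (x, t))) powr ?p"
        by (rule soft_p[OF elim]) (use p0 in simp)
       also have "\<dots> \<le> C powr ?p * (2 powr ?p * (1 powr ?p + Y (v (x, t)) powr ?p))"
        by (intro mult_left_mono add_powr_le) (use Y0[OF elim] p0 in auto)
       finally show ?case using Y0[OF elim] by (simp add: ennreal_leI mult.assoc)
      qed
     qed
     also have "\<dots> = ennreal (LINT x|?N. ?a * (1 + \<bar>Y (v (x, t))\<bar> powr ?p))"
      using i by (intro nn_integral_eq_integral AE_I2) auto
     also have "(LINT x|?N. ?a * (1 + \<bar>Y (v (x, t))\<bar> powr ?p)) = ?a * (measure lebesgue \<Omega> + ?P)"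
      using elim(2) const_integrable[OF op bd] by (simp add: m[simplified])
     finally have "epow (\<integral>\<^sup>+x. ennreal (soft_trunc M (v (x, t)) powr (?p * \<sigma>)) \<partial>?N) ?\<beta> \<le> epow (ennreal (?a * (measure lebesgue \<Omega> + ?P))) ?\<beta>"
      using \<beta> by (intro epow_mono) auto
     also have "\<dots> = ennreal ((?a * (measure lebesgue \<Omega> + ?P)) powr ?\<beta>)"
      using \<beta> P0 by (intro epow_ennreal) auto
     also have "\<dots> \<le> ennreal (?c * (S0 powr ?\<beta> + CS * D t))"
     proof (rule ennreal_leI)
      have "?a powr ?\<beta> = C powr (?p * ?\<beta>) * 2 powr (?p * ?\<beta>)"
       by (subst powr_mult) (simp_all only: powr_powr powr_ge_zero)
      then have a: "?a powr ?\<beta> = 4 * C\<^sup>2" using C p0 by simp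
      have "(?a * (measure lebesgue \<Omega> + ?P)) powr ?\<beta> = ?a powr ?\<beta> * (measure lebesgue \<Omega> + ?P) powr ?\<beta>"
       by (rule powr_mult)
      also have "\<dots> \<le> ?a powr ?\<beta> * (2 powr ?\<beta> * (measure lebesgue \<Omega> powr ?\<beta> + ?P powr ?\<beta>))"
       using \<beta> P0 by (intro mult_left_mono add_powr_le) auto
      also have "\<dots> \<le> ?a powr ?\<beta> * (2 powr ?\<beta> * (S0 powr ?\<beta> + CS * D t))"
       using \<beta> S0(1) elim(2) by (intro mult_left_mono add_mono powr_mono2) auto
      finally show "(?a * (measure lebesgue \<Omega> + ?P)) powr ?\<beta> \<le> ?c * (S0 powr ?\<beta> + CS * D t)"
       by (simp only: a mult.assoc)
     qed
     finally show ?case .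
    qed
   qed
   also have "\<dots> = ennreal (LINT t|?M. ?c * (S0 powr ?\<beta> + CS * D t))"
    using energy(1) const_integrable[OF opI] D0 CS
    by (intro nn_integral_eq_integral AE_I2 mult_nonneg_nonneg add_nonneg_nonneg) auto
   also have "(LINT t|?M. ?c * (S0 powr ?\<beta> + CS * D t)) = ?c * (S0 powr ?\<beta> * T + CS * (LINT t|?M. D t))"
    using energy(1) const_integrable[OF opI] T by (simp add: measure_restrict_space)
   also have "ennreal \<dots> \<le> ennreal K"
   proof (rule ennreal_leI)
    have "?c * (S0 powr ?\<beta> * T + CS * (LINT t|?M. D t)) \<le> ?c * (S0 powr ?\<beta> * T + CS * K2)"
     using DK CS by (intro mult_left_mono add_mono) auto
    moreover have "0 \<le> 2 * C\<^sup>2 * (S0 + K1)" using S0 K1 by (intro mult_nonneg_nonneg add_nonneg_nonneg) auto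
    ultimately show "?c * (S0 powr ?\<beta> * T + CS * (LINT t|?M. D t)) \<le> K" unfolding K_def by linarith
   qed
   finally show "(\<integral>\<^sup>+t. epow (\<integral>\<^sup>+x. ennreal (soft_trunc M (v (x, t)) powr (?p * \<sigma>)) \<partial>?N) ?\<beta> \<partial>?M) \<le> ennreal K" .
  qed
 qed
qed

subsection \<open>Exponents and lower semicontinuity\<close>

text \<open>The identity \<open>1 / q + a + b * (n - 2) / n = 1\<close> leaves one free parameter.
  In the first case \<open>a = 0\<close> is possible, because the corresponding \<open>b\<close> is
  below \<open>1 - 1 / r\<close>. Otherwise \<open>b\<close> takes its largest value
  \<open>1 - 1 / r\<close> and \<open>a\<close> is the remainder, which is nonnegative by the case
  condition. The two formulas for \<open>\<sigma>\<close> are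
  \<open>a + b = 1 - (1 + \<gamma>) / (2 * \<sigma>)\<close> solved in each case.\<close>

lemma exponents:
 fixes n r q \<gamma> \<sigma> :: real
 assumes n: "n > 2" and \<gamma>: "0 < \<gamma>" and rq: "1 < r" "1 < q" "1 < 1 / r + n / (2 * q)"
  and i: "\<gamma> < 1 \<Longrightarrow> 1 / r < n / (n - 2) * (1 / q) - 2 / (n - 2) \<Longrightarrow> q > holder_conj (two_star n / (1 - \<gamma>))"
  and ii: "\<gamma> < 1 \<Longrightarrow> 1 / r \<ge> n / (n - 2) * (1 / q) - 2 / (n - 2) \<Longrightarrow> r > 2 / (1 + \<gamma>)"
  and \<sigma>: "\<sigma> = (if 1 / r < n / (n - 2) * (1 / q) - 2 / (n - 2)
        then q * (n - 2) * (\<gamma> + 1) / (2 * (n - 2 * q))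
        else q * r * n * (\<gamma> + 1) / (2 * (n * r + 2 * q - 2 * q * r)))"
 obtains a b where "0 \<le> a" "0 < b" "b \<le> 1 - 1 / r" "a + b = 1 - (1 + \<gamma>) / (2 * \<sigma>)"
  "1 / q + a + b * (n - 2) / n = 1" "1 < \<sigma>" "\<gamma> + 1 < 2 * \<sigma>"
proof -
 define m where "m = n - 2"
 have m: "n = m + 2" "m > 0" using n by (auto simp: m_def)
 have nz: "n \<noteq> 0" "n - 2 \<noteq> 0" "q \<noteq> 0" using n rq by auto
 have cancel: "g / (2 * (W * g / (2 * Z))) = Z / W" if "g > 0" "W > 0" "Z > 0" for g W Z :: real
  using that by (simp add: field_simps)
 show ?thesis
proof (cases "1 / r < n / (n - 2) * (1 / q) - 2 / (n - 2)")
 case True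
 have eq: "n / (n - 2) * (1 / q) - 2 / (n - 2) = (n - 2 * q) / (q * (n - 2))"
  using m(2) rq by (simp add: m(1) field_simps)
 have lt: "1 / r < (n - 2 * q) / (q * (n - 2))" using True eq by simp
 have "0 < (n - 2 * q) / (q * (n - 2))" using lt rq by (intro less_trans[OF _ lt]) simp
 moreover have qn: "0 < q * (n - 2)" using n rq by simp
 ultimately have pos: "0 < n - 2 * q" by (simp only: pos_less_divide_eq mult_zero_left)
 have \<sigma>1: "\<sigma> = q * (n - 2) * (\<gamma> + 1) / (2 * (n - 2 * q))" using \<sigma> True by simp
 have \<sigma>0: "\<sigma> > 0" unfolding \<sigma>1 using pos n rq \<gamma> by (intro divide_pos_pos mult_pos_pos) auto
 have \<kappa>: "(1 + \<gamma>) / (2 * \<sigma>) = (n - 2 * q) / (q * (n - 2))"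
  unfolding \<sigma>1 add.commute[of 1 \<gamma>] by (rule cancel) (use pos qn \<gamma> in auto)
 let ?b = "n * (q - 1) / (q * (n - 2))"
 have b: "1 - (1 + \<gamma>) / (2 * \<sigma>) = ?b" unfolding \<kappa> using m(2) rq by (simp add: m(1) field_simps)
 have b0: "?b > 0" using n rq by simp
 show ?thesis
 proof (rule that[of 0 ?b])
  show "?b \<le> 1 - 1 / r" using lt b \<kappa> by simp
  have "?b * (n - 2) / n = (q - 1) / q" using nz by simp
  then show "1 / q + 0 + ?b * (n - 2) / n = 1" using nz by (simp add: add_divide_distrib[symmetric])
  have "(1 + \<gamma>) / (2 * \<sigma>) < 1" using b b0 by simp
  then show "\<gamma> + 1 < 2 * \<sigma>" using \<sigma>0 by (simp add: field_simps)
  \<comment> \<open>This is \<open>1 < \<sigma>\<close> with denominators cleared. For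
    \<open>\<gamma> < 1\<close> it is condition (i) with the conjugate exponent written out; for
    larger \<open>\<gamma>\<close> it follows from \<open>q > 1\<close>.\<close>
  have "2 * (n - 2 * q) < q * (n - 2) * (\<gamma> + 1)"
  proof (cases "\<gamma> < 1")
   case g: True
   have d: "2 * n - (n - 2) * (1 - \<gamma>) > 0"
   proof -
    have "2 * \<gamma> \<le> n * \<gamma>" using n \<gamma> by simp
    then show ?thesis using n by (simp add: algebra_simps)
   qed
   have "holder_conj (two_star n / (1 - \<gamma>)) = 2 * n / (2 * n - (n - 2) * (1 - \<gamma>))"
   proof -
    have m: "(n - 2) * (1 - \<gamma>) > 0" using n g by simp
    have "two_star n / (1 - \<gamma>) = 2 * n / ((n - 2) * (1 - \<gamma>))" by (simp add: two_star_def)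
    then have "holder_conj (two_star n / (1 - \<gamma>)) = (2 * n / ((n - 2) * (1 - \<gamma>))) / ((2 * n - (n - 2) * (1 - \<gamma>)) / ((n - 2) * (1 - \<gamma>)))"
     using m by (simp only: holder_conj_def diff_divide_distrib divide_self[OF less_imp_neq[OF m, symmetric]])
    also have "\<dots> = 2 * n / (2 * n - (n - 2) * (1 - \<gamma>))"
    proof -
     have "(x / y) / ((x - y) / y) = x / (x - y)" if "y > 0" for x y :: real using that by simp
     from this[OF m] show ?thesis .
    qed
    finally show ?thesis .
   qed
   then have "2 * n < q * (2 * n - (n - 2) * (1 - \<gamma>))" using i[OF g True] d by (simp add: divide_less_eq)
   then show ?thesis by (simp add: algebra_simps)
  next
   case False
   have "2 * n < 2 * (n * q)" using n rq by simp
   then have "2 * (n - 2 * q) < q * (n - 2) * 2" by (simp add: algebra_simps)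
   also have "\<dots> \<le> q * (n - 2) * (\<gamma> + 1)" using False n rq by (intro mult_left_mono) auto
   finally show ?thesis .
  qed
  then show "1 < \<sigma>" unfolding \<sigma>1 using pos by (simp add: less_divide_eq)
 qed (use b b0 in auto)
next
 case False
 let ?d = "n * r + 2 * q - 2 * q * r"
 have \<sigma>1: "\<sigma> = q * r * n * (\<gamma> + 1) / (2 * ?d)" using \<sigma> False by simp
 have d: "?d > 0"
 proof -
  \<comment> \<open>Positivity of the denominator of \<open>\<sigma>\<close> is the scaling
    condition \<open>1 < 1 / r + n / (2 * q)\<close> multiplied by \<open>2 * q * r\<close>.\<close>
  have "1 * (2 * q * r) < (1 / r + n / (2 * q)) * (2 * q * r)" using rq by (intro mult_strict_right_mono) auto
  also have "\<dots> = 2 * q + n * r" using rq by (simp add: field_simps)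
  finally show ?thesis by simp
 qed
 have \<sigma>0: "\<sigma> > 0" unfolding \<sigma>1 using d n rq \<gamma> by (intro divide_pos_pos mult_pos_pos) auto
 have \<kappa>: "(1 + \<gamma>) / (2 * \<sigma>) = ?d / (q * r * n)"
  unfolding \<sigma>1 add.commute[of 1 \<gamma>] by (rule cancel) (use d n rq \<gamma> in auto)
 have \<kappa>': "?d / (q * r * n) = 1 / q + 2 / (r * n) - 2 / n" using n rq by (simp add: field_simps)
 let ?b = "1 - 1 / r" and ?a = "1 / r - 1 / q - 2 / (r * n) + 2 / n"
 have ab: "?a + ?b = 1 - (1 + \<gamma>) / (2 * \<sigma>)" unfolding \<kappa> \<kappa>' by simp
 have a: "0 \<le> ?a"
 proof -
  \<comment> \<open>Up to the positive factor \<open>(n - 2) / n\<close>, the remainder is the gap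
    in the inequality that separates the two cases.\<close>
  have "?a = (1 / r - (n / (n - 2) * (1 / q) - 2 / (n - 2))) * ((n - 2) / n)"
  proof -
   have "n / (n - 2) * (1 / q) * ((n - 2) / n) = 1 / q" using nz by simp
   moreover have "x / y * (y / z) = x / z" if "y \<noteq> 0" for x y z :: real using that by simp
   note this[OF nz(2), of 2 n]
   moreover have "1 / r * ((n - 2) / n) = 1 / r - 2 / (r * n)" using nz by (simp add: diff_divide_distrib)
   ultimately show ?thesis by (simp only: left_diff_distrib)
  qed
  also have "\<dots> \<ge> 0" using False n by (intro mult_nonneg_nonneg) auto
  finally show ?thesis .
 qed
 have b: "?b > 0" using rq by simp
 show ?thesis
 proof (rule that[of ?a ?b])
  show "1 / q + ?a + ?b * (n - 2) / n = 1" using n rq by (simp add: field_simps)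
  have "(1 + \<gamma>) / (2 * \<sigma>) < 1" using ab a b by linarith
  then show "\<gamma> + 1 < 2 * \<sigma>" using \<sigma>0 by (simp add: field_simps)
  \<comment> \<open>As \<open>?a\<close> is nonnegative, \<open>1 < \<sigma>\<close> reduces to
    \<open>2 < r * (1 + \<gamma>)\<close>, which is condition (ii) for \<open>\<gamma> < 1\<close>
    and follows from \<open>r > 1\<close> otherwise.\<close>
  have "(1 + \<gamma>) / (2 * \<sigma>) \<le> 1 / r" using ab a by linarith
  then have "r * (1 + \<gamma>) \<le> 2 * \<sigma>" using \<sigma>0 rq by (simp add: field_simps)
  moreover have "2 < r * (1 + \<gamma>)"
  proof (cases "\<gamma> < 1")
   case True
   have "r > 2 / (1 + \<gamma>)" by (rule ii[OF True]) (use False in linarith)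
   then show ?thesis using \<gamma> by (simp add: divide_less_eq)
  next
   case g: False
   have "1 * 2 < r * 2" using rq by simp
   also have "\<dots> \<le> r * (1 + \<gamma>)" using g rq by (intro mult_left_mono) auto
   finally show ?thesis by simp
  qed
  ultimately show "1 < \<sigma>" by simp
 qed (use a b ab in auto)
qed
qed

lemma epow_inverse: "0 < p \<Longrightarrow> epow (epow x (1 / p)) p = x"
 by (cases x) (auto simp: epow_ennreal powr_powr infinity_ennreal_def)

lemma epow_less_iff:
 assumes "0 < p" shows "epow x p < epow y p \<longleftrightarrow> x < y"
proof
 show "x < y" if "epow x p < epow y p" using that epow_mono[of y x p] assms by (meson less_imp_le not_le)
 have inj: "epow (epow z p) (1 / p) = z" for z using epow_inverse[of "1 / p" z] assms by simp
 show "epow x p < epow y p" if "x < y"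
 proof (rule ccontr)
  assume "\<not> epow x p < epow y p"
  then have "epow (epow y p) (1 / p) \<le> epow (epow x p) (1 / p)" using assms by (intro epow_mono[of "epow y p"]) auto
  then show False using that by (simp add: inj)
 qed
qed

text \<open>A positive power is an order isomorphism of the extended half-line, with the reciprocal
  power as inverse, so strict lower bounds can be transported in both directions.\<close>

lemma epow_liminf:
 fixes A :: "nat \<Rightarrow> ennreal"
 assumes p: "0 < p" shows "epow (liminf A) p \<le> liminf (\<lambda>j. epow (A j) p)"
 unfolding le_Liminf_iff
proof (intro allI impI)
 fix y assume "y < epow (liminf A) p"
 then have "epow (epow y (1 / p)) p < epow (liminf A) p" by (simp add: epow_inverse p)
 then have "epow y (1 / p) < liminf A" by (simp add: epow_less_iff p)
 then have "\<forall>\<^sub>F j in sequentially. epow y (1 / p) < A j" using le_Liminf_iff[of "liminf A" sequentially A] by simp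
 then show "\<forall>\<^sub>F j in sequentially. y < epow (A j) p"
 proof eventually_elim
  case (elim j)
  then have "epow (epow y (1 / p)) p < epow (A j) p" by (simp add: epow_less_iff p)
  then show ?case by (simp add: epow_inverse p)
 qed
qed

lemma nn_integral_lebesgue_on:
 fixes g :: "'a::euclidean_space \<Rightarrow> ennreal"
 assumes g: "g \<in> borel_measurable borel" and op: "open S"
 shows "(\<integral>\<^sup>+x. g x \<partial>lebesgue_on S) = (\<integral>\<^sup>+x. indicator S x * g x \<partial>lborel)"
proof -
 have "(\<integral>\<^sup>+x. g x \<partial>lebesgue_on S) = (\<integral>\<^sup>+x. g x * indicator S x \<partial>lebesgue)"
  using op by (subst nn_integral_restrict_space) auto
 also have "\<dots> = (\<integral>\<^sup>+x. g x * indicator S x \<partial>lborel)"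
  by (rule nn_integral_completion)
 finally show ?thesis by (simp add: mult.commute)
qed

text \<open>Tonelli's theorem is applied to a Borel representative, whose slice integrals are
  measurable in time. Those of \<open>v\<close> itself agree with them at almost every time.\<close>

lemma slice_nn_integral:
 fixes \<Omega> :: "'a::euclidean_space set" and J :: "real set" and v :: "'a \<times> real \<Rightarrow> real"
 assumes op: "open \<Omega>" "open J" and v: "v \<in> borel_measurable (lebesgue_on (\<Omega> \<times> J))"
  and F: "F \<in> borel_measurable borel"
 obtains \<Phi> :: "real \<Rightarrow> ennreal" where "\<Phi> \<in> borel_measurable (lebesgue_on J)"
  "AE t in lebesgue_on J. (\<integral>\<^sup>+x. F (v (x, t)) \<partial>lebesgue_on \<Omega>) = \<Phi> t"
  "(\<integral>\<^sup>+z. F (v z) \<partial>lebesgue_on (\<Omega> \<times> J)) = (\<integral>\<^sup>+t. \<Phi> t \<partial>lebesgue_on J)"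
proof -
 have opp: "open (\<Omega> \<times> J)" using op by (rule open_Times)
 have Sb: "\<Omega> \<times> J \<in> sets borel" using opp by simp
 from borel_representative[OF v Sb] obtain v' where v': "v' \<in> borel_measurable borel"
  "AE z in lebesgue_on (\<Omega> \<times> J). v' z = v z" by blast
 have Fv: "(\<lambda>z. F (v' z)) \<in> borel_measurable borel" by (rule measurable_compose[OF v'(1) F])
 define g where "g = (\<lambda>z. indicator (\<Omega> \<times> J) z * F (v' z) :: ennreal)"
 have gb: "g \<in> borel_measurable borel" using Fv opp unfolding g_def by (intro borel_measurable_times_ennreal) auto
 then have gp: "g \<in> borel_measurable (lborel \<Otimes>\<^sub>M lborel)" by (simp add: lborel_prod)
 define \<Phi> where "\<Phi> = (\<lambda>t. \<integral>\<^sup>+x. g (x, t) \<partial>lborel)"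
 have \<Phi>b: "\<Phi> \<in> borel_measurable borel"
  unfolding \<Phi>_def using lborel.borel_measurable_nn_integral_fst[OF measurable_pair_swap[OF gp]] by simp
 have sl: "(\<lambda>x. F (v' (x, t))) \<in> borel_measurable borel" for t
  by (rule measurable_compose[OF _ Fv]) simp
 have \<Phi>I: "\<Phi> t = (\<integral>\<^sup>+x. F (v' (x, t)) \<partial>lebesgue_on \<Omega>)" if "t \<in> J" for t
  using that unfolding \<Phi>_def g_def nn_integral_lebesgue_on[OF sl op(1)] by (simp add: indicator_def cong: if_cong)
 have \<Phi>0: "\<Phi> t = 0" if "t \<notin> J" for t using that by (simp add: \<Phi>_def g_def)
 show ?thesis
 proof (rule that)
  show "\<Phi> \<in> borel_measurable (lebesgue_on J)"
   using \<Phi>b by (intro measurable_restrict_space1 measurable_completion) simp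
  show "AE t in lebesgue_on J. (\<integral>\<^sup>+x. F (v (x, t)) \<partial>lebesgue_on \<Omega>) = \<Phi> t"
   using AE_slices[OF op v'(2)] AE_space
  proof eventually_elim
   case (elim t)
   have "(\<integral>\<^sup>+x. F (v (x, t)) \<partial>lebesgue_on \<Omega>) = (\<integral>\<^sup>+x. F (v' (x, t)) \<partial>lebesgue_on \<Omega>)"
    by (rule nn_integral_cong_AE) (use elim(1) in eventually_elim, simp)
   then show ?case using \<Phi>I elim(2) by simp
  qed
  have "(\<integral>\<^sup>+z. F (v z) \<partial>lebesgue_on (\<Omega> \<times> J)) = (\<integral>\<^sup>+z. F (v' z) \<partial>lebesgue_on (\<Omega> \<times> J))"
   by (rule nn_integral_cong_AE) (use v'(2) in eventually_elim, simp)
  also have "\<dots> = (\<integral>\<^sup>+z. g z \<partial>(lborel \<Otimes>\<^sub>M lborel))"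
   unfolding lborel_prod g_def by (rule nn_integral_lebesgue_on[OF Fv opp])
  also have "\<dots> = (\<integral>\<^sup>+t. \<Phi> t \<partial>lborel)"
   unfolding \<Phi>_def by (rule lborel_pair.nn_integral_snd[OF gp, symmetric])
  also have "\<dots> = (\<integral>\<^sup>+t. indicator J t * \<Phi> t \<partial>lborel)"
   by (intro nn_integral_cong) (auto simp: indicator_def \<Phi>0)
  also have "\<dots> = (\<integral>\<^sup>+t. \<Phi> t \<partial>lebesgue_on J)" by (rule nn_integral_lebesgue_on[OF \<Phi>b op(2), symmetric])
  finally show "(\<integral>\<^sup>+z. F (v z) \<partial>lebesgue_on (\<Omega> \<times> J)) = (\<integral>\<^sup>+t. \<Phi> t \<partial>lebesgue_on J)" .
 qed
qed

lemma Fatou_slices: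
 fixes \<Omega> :: "'a::euclidean_space set" and J :: "real set" and w :: "nat \<Rightarrow> 'a \<times> real \<Rightarrow> real"
 assumes op: "open \<Omega>" "open J" and w: "\<And>j. w j \<in> borel_measurable (lebesgue_on (\<Omega> \<times> J))"
  and lim: "AE z in lebesgue_on (\<Omega> \<times> J). (\<lambda>j. w j z) \<longlonglongrightarrow> v z"
 shows "AE t in lebesgue_on J. (\<integral>\<^sup>+x. ennreal (\<bar>v (x, t)\<bar> powr p) \<partial>lebesgue_on \<Omega>)
  \<le> liminf (\<lambda>j. \<integral>\<^sup>+x. ennreal (\<bar>w j (x, t)\<bar> powr p) \<partial>lebesgue_on \<Omega>)"
proof -
 have "AE t in lebesgue_on J. \<forall>j. (\<lambda>x. w j (x, t)) \<in> borel_measurable (lebesgue_on \<Omega>)"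
  unfolding AE_all_countable by (rule allI, rule joint_representative[OF op w])
 then show ?thesis using AE_slices[OF op lim]
 proof eventually_elim
  case (elim t)
  have "(\<integral>\<^sup>+x. ennreal (\<bar>v (x, t)\<bar> powr p) \<partial>lebesgue_on \<Omega>)
    \<le> (\<integral>\<^sup>+x. liminf (\<lambda>j. ennreal (\<bar>w j (x, t)\<bar> powr p)) \<partial>lebesgue_on \<Omega>)"
  proof (rule nn_integral_mono_AE)
   show "AE x in lebesgue_on \<Omega>. ennreal (\<bar>v (x, t)\<bar> powr p) \<le> liminf (\<lambda>j. ennreal (\<bar>w j (x, t)\<bar> powr p))"
    using elim(2)
   proof eventually_elim
    case (elim x)
    \<comment> \<open>A zero of the limit is treated apart: there the left side is zero, while
      continuity of the power at the origin would need a positive exponent.\<close>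
    show ?case
    proof (cases "v (x, t) = 0")
     case False
     then have "(\<lambda>j. ennreal (\<bar>w j (x, t)\<bar> powr p)) \<longlonglongrightarrow> ennreal (\<bar>v (x, t)\<bar> powr p)"
      using elim by (intro tendsto_intros) auto
     from lim_imp_Liminf[OF _ this] show ?thesis by simp
    qed simp
   qed
  qed
  also have "\<dots> \<le> liminf (\<lambda>j. \<integral>\<^sup>+x. ennreal (\<bar>w j (x, t)\<bar> powr p) \<partial>lebesgue_on \<Omega>)"
   by (intro nn_integral_liminf measurable_compose[OF spec[OF elim(1)], where g="\<lambda>y. ennreal (\<bar>y\<bar> powr p)"]) simp
  finally show ?case .
 qed
qed

text \<open>Used once to let the level of the soft truncation tend to infinity and once for the
  limit in \<open>k\<close>. The measurable functions \<open>\<Phi> j\<close> stand in for the slice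
  integrals, since Fatou's lemma in time asks for measurable integrands.\<close>

lemma Fatou_mixed_bounds:
 fixes \<Omega> :: "'a::euclidean_space set" and J :: "real set" and w :: "nat \<Rightarrow> 'a \<times> real \<Rightarrow> real"
 assumes op: "open \<Omega>" "open J" and w: "\<And>j. w j \<in> borel_measurable (lebesgue_on (\<Omega> \<times> J))"
  and lim: "AE z in lebesgue_on (\<Omega> \<times> J). (\<lambda>j. w j z) \<longlonglongrightarrow> v z" and \<beta>: "0 < \<beta>"
  and b1: "\<And>j. AE t in lebesgue_on J. (\<integral>\<^sup>+x. ennreal (\<bar>w j (x, t)\<bar> powr p) \<partial>lebesgue_on \<Omega>) \<le> K"
  and b2: "\<And>j. (\<integral>\<^sup>+t. epow (\<integral>\<^sup>+x. ennreal (\<bar>w j (x, t)\<bar> powr p') \<partial>lebesgue_on \<Omega>) \<beta> \<partial>lebesgue_on J) \<le> K"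
 shows "AE t in lebesgue_on J. (\<integral>\<^sup>+x. ennreal (\<bar>v (x, t)\<bar> powr p) \<partial>lebesgue_on \<Omega>) \<le> K"
  "(\<integral>\<^sup>+t. epow (\<integral>\<^sup>+x. ennreal (\<bar>v (x, t)\<bar> powr p') \<partial>lebesgue_on \<Omega>) \<beta> \<partial>lebesgue_on J) \<le> K"
proof -
 have "AE t in lebesgue_on J. \<forall>j. (\<integral>\<^sup>+x. ennreal (\<bar>w j (x, t)\<bar> powr p) \<partial>lebesgue_on \<Omega>) \<le> K"
  using b1 by (simp add: AE_all_countable)
 then show "AE t in lebesgue_on J. (\<integral>\<^sup>+x. ennreal (\<bar>v (x, t)\<bar> powr p) \<partial>lebesgue_on \<Omega>) \<le> K"
  using Fatou_slices[OF op w lim, of p]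
 proof eventually_elim
  case (elim t)
  have "liminf (\<lambda>j. \<integral>\<^sup>+x. ennreal (\<bar>w j (x, t)\<bar> powr p) \<partial>lebesgue_on \<Omega>) \<le> liminf (\<lambda>j::nat. K)"
   using elim(1) by (intro Liminf_mono always_eventually) auto
  then show ?case using elim(2) by (simp add: Liminf_const)
 qed
 have "\<forall>j. \<exists>\<Phi>. \<Phi> \<in> borel_measurable (lebesgue_on J) \<and>
   (AE t in lebesgue_on J. (\<integral>\<^sup>+x. ennreal (\<bar>w j (x, t)\<bar> powr p') \<partial>lebesgue_on \<Omega>) = \<Phi> t)"
 proof
  fix j
  show "\<exists>\<Phi>. \<Phi> \<in> borel_measurable (lebesgue_on J) \<and>
   (AE t in lebesgue_on J. (\<integral>\<^sup>+x. ennreal (\<bar>w j (x, t)\<bar> powr p') \<partial>lebesgue_on \<Omega>) = \<Phi> t)"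
  proof (rule slice_nn_integral[OF op w[of j], of "\<lambda>y. ennreal (\<bar>y\<bar> powr p')"])
   show "(\<lambda>y. ennreal (\<bar>y\<bar> powr p')) \<in> borel_measurable borel" by simp
  qed blast
 qed
 then obtain \<Phi> :: "nat \<Rightarrow> real \<Rightarrow> ennreal" where "\<forall>j. \<Phi> j \<in> borel_measurable (lebesgue_on J) \<and>
  (AE t in lebesgue_on J. (\<integral>\<^sup>+x. ennreal (\<bar>w j (x, t)\<bar> powr p') \<partial>lebesgue_on \<Omega>) = \<Phi> j t)"
  by (rule choice[THEN exE])
 note \<Phi> = this[THEN spec, THEN conjunct1] this[THEN spec, THEN conjunct2]
 have \<Phi>': "AE t in lebesgue_on J. \<forall>j. (\<integral>\<^sup>+x. ennreal (\<bar>w j (x, t)\<bar> powr p') \<partial>lebesgue_on \<Omega>) = \<Phi> j t"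
  using \<Phi>(2) by (simp add: AE_all_countable)
 have \<Phi>K: "(\<integral>\<^sup>+t. epow (\<Phi> j t) \<beta> \<partial>lebesgue_on J) \<le> K" for j
 proof -
  have "(\<integral>\<^sup>+t. epow (\<Phi> j t) \<beta> \<partial>lebesgue_on J) = (\<integral>\<^sup>+t. epow (\<integral>\<^sup>+x. ennreal (\<bar>w j (x, t)\<bar> powr p') \<partial>lebesgue_on \<Omega>) \<beta> \<partial>lebesgue_on J)"
   by (rule nn_integral_cong_AE) (use \<Phi>(2)[of j] in eventually_elim, simp)
  then show ?thesis using b2[of j] by simp
 qed
 have "(\<integral>\<^sup>+t. epow (\<integral>\<^sup>+x. ennreal (\<bar>v (x, t)\<bar> powr p') \<partial>lebesgue_on \<Omega>) \<beta> \<partial>lebesgue_on J)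
   \<le> (\<integral>\<^sup>+t. liminf (\<lambda>j. epow (\<Phi> j t) \<beta>) \<partial>lebesgue_on J)"
 proof (rule nn_integral_mono_AE)
  show "AE t in lebesgue_on J. epow (\<integral>\<^sup>+x. ennreal (\<bar>v (x, t)\<bar> powr p') \<partial>lebesgue_on \<Omega>) \<beta> \<le> liminf (\<lambda>j. epow (\<Phi> j t) \<beta>)"
   using Fatou_slices[OF op w lim, of p'] \<Phi>'
  proof eventually_elim
   case (elim t)
   have "epow (\<integral>\<^sup>+x. ennreal (\<bar>v (x, t)\<bar> powr p') \<partial>lebesgue_on \<Omega>) \<beta> \<le> epow (liminf (\<lambda>j. \<Phi> j t)) \<beta>"
    using elim \<beta> by (intro epow_mono) auto
   also have "\<dots> \<le> liminf (\<lambda>j. epow (\<Phi> j t) \<beta>)" by (rule epow_liminf[OF \<beta>])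
   finally show ?case .
  qed
 qed
 also have "\<dots> \<le> liminf (\<lambda>j. \<integral>\<^sup>+t. epow (\<Phi> j t) \<beta> \<partial>lebesgue_on J)"
  using \<Phi>(1) by (intro nn_integral_liminf epow_measurable)
 also have "\<dots> \<le> liminf (\<lambda>j::nat. K)" using \<Phi>K by (intro Liminf_mono always_eventually) auto
 also have "\<dots> = K" by (simp add: Liminf_const)
 finally show "(\<integral>\<^sup>+t. epow (\<integral>\<^sup>+x. ennreal (\<bar>v (x, t)\<bar> powr p') \<partial>lebesgue_on \<Omega>) \<beta> \<partial>lebesgue_on J) \<le> K" .
qed

subsection \<open>Strong measurability in \<open>L\<^sup>p\<close>\<close>

lemma trunc_simps:
 assumes "0 \<le> m"
 shows "\<bar>trunc m y\<bar> \<le> m" "\<bar>trunc m y - trunc m z\<bar> \<le> \<bar>y - z\<bar>" "\<bar>y - trunc m y\<bar> \<le> \<bar>y\<bar>" "\<bar>trunc m y\<bar> \<le> \<bar>y\<bar>"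
 using assms by (auto simp: trunc_def)

lemma trunc_borel: "trunc m \<in> borel_measurable borel"
 unfolding trunc_def[abs_def] by measurable

lemma trunc_tendsto_const: "(\<lambda>j. trunc (real j) y) \<longlonglongrightarrow> y"
proof (rule tendsto_eventually)
 obtain N :: nat where "\<bar>y\<bar> < real N" using reals_Archimedean2 by blast
 then show "\<forall>\<^sub>F j in sequentially. trunc (real j) y = y"
  by (intro eventually_sequentiallyI[of N]) (auto simp: trunc_def)
qed

lemma trunc_tendsto: "(g \<longlongrightarrow> y) F \<Longrightarrow> ((\<lambda>j. trunc m (g j)) \<longlongrightarrow> trunc m y) F"
 unfolding trunc_def by (intro tendsto_intros)

text \<open>Integrals of \<open>p\<close>-th powers are compared instead of norms; the triangle
  inequality with factor \<open>2 powr p\<close> is all that the approximation arguments below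
  require.\<close>

lemma Lp_diff:
 assumes p: "0 < p" and u: "u \<in> Lp p \<Omega>" "v \<in> Lp p \<Omega>"
 shows "(\<lambda>x. u x - v x) \<in> Lp p \<Omega>"
  "(LINT x|lebesgue_on \<Omega>. \<bar>u x - v x\<bar> powr p) \<le>
   2 powr p * ((LINT x|lebesgue_on \<Omega>. \<bar>u x\<bar> powr p) + (LINT x|lebesgue_on \<Omega>. \<bar>v x\<bar> powr p))"
proof -
 let ?M = "lebesgue_on \<Omega>"
 have m [measurable]: "u \<in> borel_measurable ?M" "v \<in> borel_measurable ?M" using u by (auto simp: Lp_def)
 have i: "integrable ?M (\<lambda>x. 2 powr p * (\<bar>u x\<bar> powr p + \<bar>v x\<bar> powr p))" using u by (simp add: Lp_def)
 have le: "\<bar>u x - v x\<bar> powr p \<le> 2 powr p * (\<bar>u x\<bar> powr p + \<bar>v x\<bar> powr p)" for x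
 proof -
  have "\<bar>u x - v x\<bar> powr p \<le> (\<bar>u x\<bar> + \<bar>v x\<bar>) powr p" using p by (intro powr_mono2) auto
  also have "\<dots> \<le> 2 powr p * (\<bar>u x\<bar> powr p + \<bar>v x\<bar> powr p)" using p by (intro add_powr_le) auto
  finally show ?thesis .
 qed
 have j: "integrable ?M (\<lambda>x. \<bar>u x - v x\<bar> powr p)"
 proof (rule Bochner_Integration.integrable_bound[OF i])
  show "AE x in ?M. norm (\<bar>u x - v x\<bar> powr p) \<le> norm (2 powr p * (\<bar>u x\<bar> powr p + \<bar>v x\<bar> powr p))"
   using le by (simp add: abs_of_nonneg[OF order_trans[OF powr_ge_zero le]])
 qed measurable
 then show "(\<lambda>x. u x - v x) \<in> Lp p \<Omega>" by (simp add: Lp_def)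
 have "(LINT x|?M. \<bar>u x - v x\<bar> powr p) \<le> (LINT x|?M. 2 powr p * (\<bar>u x\<bar> powr p + \<bar>v x\<bar> powr p))"
  by (rule integral_mono[OF j i le])
 also have "\<dots> = 2 powr p * ((LINT x|?M. \<bar>u x\<bar> powr p) + (LINT x|?M. \<bar>v x\<bar> powr p))"
  using u by (simp add: Lp_def)
 finally show "(LINT x|?M. \<bar>u x - v x\<bar> powr p) \<le> 2 powr p * ((LINT x|?M. \<bar>u x\<bar> powr p) + (LINT x|?M. \<bar>v x\<bar> powr p))" .
qed

lemma Lp_triangle:
 assumes p: "0 < p" and u: "u \<in> Lp p \<Omega>" "v \<in> Lp p \<Omega>" "w \<in> Lp p \<Omega>"
 shows "(LINT x|lebesgue_on \<Omega>. \<bar>u x - w x\<bar> powr p) \<le>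
   2 powr p * ((LINT x|lebesgue_on \<Omega>. \<bar>u x - v x\<bar> powr p) + (LINT x|lebesgue_on \<Omega>. \<bar>v x - w x\<bar> powr p))"
proof -
 have "(LINT x|lebesgue_on \<Omega>. \<bar>w x - v x\<bar> powr p) = (LINT x|lebesgue_on \<Omega>. \<bar>v x - w x\<bar> powr p)"
  by (simp add: abs_minus_commute)
 then show ?thesis
  using Lp_diff(2)[OF p Lp_diff(1)[OF p u(1,2)] Lp_diff(1)[OF p u(3,2)]] by simp
qed

lemma trunc_Lp:
 assumes op: "open \<Omega>" "bounded \<Omega>" and p: "0 < p" and m: "0 \<le> m" and v: "v \<in> borel_measurable (lebesgue_on \<Omega>)"
 shows "(\<lambda>x. trunc m (v x)) \<in> Lp p \<Omega>"
proof -
 have mm: "(\<lambda>x. trunc m (v x)) \<in> borel_measurable (lebesgue_on \<Omega>)" by (rule measurable_compose[OF v trunc_borel])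
 have "integrable (lebesgue_on \<Omega>) (\<lambda>x. \<bar>trunc m (v x)\<bar> powr p)"
 proof (rule Bochner_Integration.integrable_bound[OF const_integrable[OF op, of "m powr p"]])
  show "AE x in lebesgue_on \<Omega>. norm (\<bar>trunc m (v x)\<bar> powr p) \<le> norm (m powr p)"
   using trunc_simps[OF m] p by (auto intro!: powr_mono2)
 qed (use mm in simp)
 then show ?thesis using mm by (simp add: Lp_def)
qed

lemma powr_tendsto_zero:
 fixes g :: "nat \<Rightarrow> real"
 assumes "g \<longlonglongrightarrow> 0" "0 < p" shows "(\<lambda>j. \<bar>g j\<bar> powr p) \<longlonglongrightarrow> 0"
 using tendsto_powr2[OF tendsto_rabs_zero[OF assms(1)] tendsto_const[of p]] assms(2) by simp

text \<open>Three links of an approximation chain: removing the truncation, a pointwise limit under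
  a fixed truncation, and a limit in \<open>L2n\<close> under a fixed truncation. In the last one
  boundedness turns the \<open>p\<close>-th power into a multiple of the square, which is where
  \<open>2 \<le> p\<close> enters.\<close>

lemma trunc_Lp_limits:
 fixes \<Omega> :: "'a::euclidean_space set" and v :: "'a \<Rightarrow> real"
 assumes op: "open \<Omega>" "bounded \<Omega>" and p: "2 \<le> p"
 shows "v \<in> Lp p \<Omega> \<Longrightarrow> (\<lambda>j. LINT x|lebesgue_on \<Omega>. \<bar>v x - trunc (real j) (v x)\<bar> powr p) \<longlonglongrightarrow> 0"
  "v \<in> borel_measurable (lebesgue_on \<Omega>) \<Longrightarrow> (\<And>j. g j \<in> borel_measurable (lebesgue_on \<Omega>)) \<Longrightarrow>
   AE x in lebesgue_on \<Omega>. (\<lambda>j::nat. g j x) \<longlonglongrightarrow> v x \<Longrightarrow> 0 \<le> m \<Longrightarrow>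
   (\<lambda>j. LINT x|lebesgue_on \<Omega>. \<bar>trunc m (v x) - trunc m (g j x)\<bar> powr p) \<longlonglongrightarrow> 0"
  "sqi (lebesgue_on \<Omega>) v \<Longrightarrow> (\<And>j. sqi (lebesgue_on \<Omega>) (g j)) \<Longrightarrow>
   (\<lambda>j::nat. L2n (lebesgue_on \<Omega>) (\<lambda>x. v x - g j x)) \<longlonglongrightarrow> 0 \<Longrightarrow> 0 \<le> m \<Longrightarrow>
   (\<lambda>j. LINT x|lebesgue_on \<Omega>. \<bar>trunc m (v x) - trunc m (g j x)\<bar> powr p) \<longlonglongrightarrow> 0"
proof -
 let ?M = "lebesgue_on \<Omega>"
 have p0: "0 < p" using p by simp
 have tm: "(\<lambda>x. trunc m (v x)) \<in> borel_measurable ?M" if "v \<in> borel_measurable ?M" for v m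
  by (rule measurable_compose[OF that trunc_borel])
 show "(\<lambda>j. LINT x|?M. \<bar>v x - trunc (real j) (v x)\<bar> powr p) \<longlonglongrightarrow> 0" if v: "v \<in> Lp p \<Omega>"
 proof -
  have vm: "v \<in> borel_measurable ?M" using v by (simp add: Lp_def)
  have "(\<lambda>j. LINT x|?M. \<bar>v x - trunc (real j) (v x)\<bar> powr p) \<longlonglongrightarrow> (LINT x|?M. 0)"
  proof (rule integral_dominated_convergence[where w="\<lambda>x. \<bar>v x\<bar> powr p"])
   show "(\<lambda>x. \<bar>v x - trunc (real j) (v x)\<bar> powr p) \<in> borel_measurable ?M" for j
    using vm tm[OF vm, of "real j"] by measurable
   show "AE x in ?M. (\<lambda>j. \<bar>v x - trunc (real j) (v x)\<bar> powr p) \<longlonglongrightarrow> 0"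
   proof (rule AE_I2, rule powr_tendsto_zero[OF _ p0])
    show "(\<lambda>j. v x - trunc (real j) (v x)) \<longlonglongrightarrow> 0" for x
     using tendsto_diff[OF tendsto_const[of "v x"] trunc_tendsto_const[of "v x"]] by simp
   qed
   show "AE x in ?M. norm (\<bar>v x - trunc (real j) (v x)\<bar> powr p) \<le> \<bar>v x\<bar> powr p" for j
    using p0 trunc_simps(3)[of "real j"] by (auto intro!: powr_mono2)
  qed (use v in \<open>auto simp: Lp_def\<close>)
  then show ?thesis by simp
 qed
 show "(\<lambda>j. LINT x|?M. \<bar>trunc m (v x) - trunc m (g j x)\<bar> powr p) \<longlonglongrightarrow> 0"
  if v: "v \<in> borel_measurable ?M" and g: "\<And>j. g j \<in> borel_measurable ?M"
   and ae: "AE x in ?M. (\<lambda>j::nat. g j x) \<longlonglongrightarrow> v x" and m: "0 \<le> m"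
 proof -
  have "(\<lambda>j. LINT x|?M. \<bar>trunc m (v x) - trunc m (g j x)\<bar> powr p) \<longlonglongrightarrow> (LINT x|?M. 0)"
  proof (rule integral_dominated_convergence[where w="\<lambda>x. (2 * m) powr p"])
   show "(\<lambda>x. \<bar>trunc m (v x) - trunc m (g j x)\<bar> powr p) \<in> borel_measurable ?M" for j
    using tm[OF v, of m] tm[OF g, of m j] by measurable
   show "AE x in ?M. (\<lambda>j. \<bar>trunc m (v x) - trunc m (g j x)\<bar> powr p) \<longlonglongrightarrow> 0"
    using ae
   proof eventually_elim
    case (elim x)
    show ?case
     using tendsto_diff[OF tendsto_const[of "trunc m (v x)"] trunc_tendsto[OF elim, of m]]
     by (intro powr_tendsto_zero[OF _ p0]) simp
   qed
   show "AE x in ?M. norm (\<bar>trunc m (v x) - trunc m (g j x)\<bar> powr p) \<le> (2 * m) powr p" for j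
   proof (rule AE_I2)
    fix x
    have "\<bar>trunc m (v x) - trunc m (g j x)\<bar> \<le> 2 * m"
     using trunc_simps(1)[OF m, of "v x"] trunc_simps(1)[OF m, of "g j x"] by linarith
    then show "norm (\<bar>trunc m (v x) - trunc m (g j x)\<bar> powr p) \<le> (2 * m) powr p"
     using p0 by (simp add: powr_mono2)
   qed
  qed (use const_integrable[OF op] in auto)
  then show ?thesis by simp
 qed
 show "(\<lambda>j. LINT x|?M. \<bar>trunc m (v x) - trunc m (g j x)\<bar> powr p) \<longlonglongrightarrow> 0"
  if v: "sqi ?M v" and g: "\<And>j. sqi ?M (g j)" and lim: "(\<lambda>j::nat. L2n ?M (\<lambda>x. v x - g j x)) \<longlonglongrightarrow> 0" and m: "0 \<le> m"
 proof (rule tendsto_sandwich[OF _ _ tendsto_const])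
  show "(\<lambda>j. (2 * m + 1) powr (p - 2) * (L2n ?M (\<lambda>x. v x - g j x))\<^sup>2) \<longlonglongrightarrow> 0"
   using tendsto_mult[OF tendsto_const[of "(2 * m + 1) powr (p - 2)"] tendsto_power[OF lim, of 2]] by simp
  show "\<forall>\<^sub>F j in sequentially. 0 \<le> (LINT x|?M. \<bar>trunc m (v x) - trunc m (g j x)\<bar> powr p)"
   by (intro always_eventually allI integral_nonneg_AE AE_I2) simp
  show "\<forall>\<^sub>F j in sequentially. (LINT x|?M. \<bar>trunc m (v x) - trunc m (g j x)\<bar> powr p)
    \<le> (2 * m + 1) powr (p - 2) * (L2n ?M (\<lambda>x. v x - g j x))\<^sup>2"
  proof (intro always_eventually allI)
   fix j
   have "(LINT x|?M. \<bar>trunc m (v x) - trunc m (g j x)\<bar> powr p) \<le> (LINT x|?M. (2 * m + 1) powr (p - 2) * (norm (v x - g j x))\<^sup>2)"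
   proof (rule integral_mono_or_zero)
    show "integrable ?M (\<lambda>x. (2 * m + 1) powr (p - 2) * (norm (v x - g j x))\<^sup>2)"
     using sqi_diff[OF v g[of j]] by (simp add: sqi_def)
    show "AE x in ?M. \<bar>trunc m (v x) - trunc m (g j x)\<bar> powr p \<le> (2 * m + 1) powr (p - 2) * (norm (v x - g j x))\<^sup>2"
    proof (rule AE_I2)
     fix x
     let ?d = "\<bar>trunc m (v x) - trunc m (g j x)\<bar>"
     have d: "?d \<le> 2 * m + 1" "?d \<le> \<bar>v x - g j x\<bar>"
      using trunc_simps(1)[OF m, of "v x"] trunc_simps(1)[OF m, of "g j x"] trunc_simps(2)[OF m, of "v x" "g j x"] by linarith+
     show "?d powr p \<le> (2 * m + 1) powr (p - 2) * (norm (v x - g j x))\<^sup>2"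
     proof (cases "?d = 0")
      case False
      have "?d powr p = ?d powr ((p - 2) + 2)" by simp
      also have "\<dots> = ?d powr (p - 2) * ?d powr 2" by (rule powr_add)
      also have "\<dots> = ?d powr (p - 2) * ?d\<^sup>2" using False by simp
      also have "\<dots> \<le> (2 * m + 1) powr (p - 2) * (norm (v x - g j x))\<^sup>2"
       using d p by (intro mult_mono powr_mono2 power_mono) auto
      finally show ?thesis .
     qed simp
    qed
   qed simp
   then show "(LINT x|?M. \<bar>trunc m (v x) - trunc m (g j x)\<bar> powr p) \<le> (2 * m + 1) powr (p - 2) * (L2n ?M (\<lambda>x. v x - g j x))\<^sup>2"
    by (simp add: L2n_sq)
  qed
 qed
qed

text \<open>A countable family that comes arbitrarily close to almost every slice suffices: at stage
  \<open>j\<close> the slice is replaced by the nearest of the members with index up to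
  \<open>j\<close>. The choice is measurable in time because, by Fubini's theorem, each distance
  is.\<close>

lemma strongly_measurable_Lp:
 fixes \<Omega> :: "'a::euclidean_space set" and w :: "'a \<times> real \<Rightarrow> real"
 assumes op: "open \<Omega>" and T: "0 < T" and p: "0 < p"
  and w: "w \<in> borel_measurable (lebesgue_on (\<Omega> \<times> {0<..<T}))" and wL: "AE t in lebesgue_on {0<..<T}. slices w t \<in> Lp p \<Omega>"
  and D: "\<And>i::nat. D i \<in> Lp p \<Omega>"
  and dense: "AE t in lebesgue_on {0<..<T}. \<forall>e>0. \<exists>i. (LINT x|lebesgue_on \<Omega>. \<bar>w (x, t) - D i x\<bar> powr p) < e"
 shows "strongly_measurable T (Lp p \<Omega>) (Lp_norm p \<Omega>) (slices w)"
proof -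
 let ?I = "{0<..<T}" and ?M = "lebesgue_on {0<..<T}" and ?N = "lebesgue_on \<Omega>"
 have opI: "open ?I" by simp
 have opp: "open (\<Omega> \<times> ?I)" using op opI by (rule open_Times)
 have "\<exists>\<Phi>. \<Phi> \<in> borel_measurable ?M \<and> (AE t in ?M. (\<integral>\<^sup>+x. ennreal (\<bar>w (x, t) - D i x\<bar> powr p) \<partial>?N) = \<Phi> t)" for i
 proof -
  have Dm: "D i \<in> borel_measurable ?N" using D by (simp add: Lp_def)
  have \<Omega>b: "\<Omega> \<in> sets borel" using op by simp
  from borel_representative[OF Dm \<Omega>b] obtain d where d: "d \<in> borel_measurable borel" "AE x in ?N. d x = D i x" by blast
  have "(\<lambda>z. d (fst z)) \<in> borel_measurable borel"
   by (rule measurable_compose[OF _ d(1)]) (intro borel_measurable_continuous_onI continuous_intros)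
  then have "(\<lambda>z. d (fst z)) \<in> borel_measurable (lebesgue_on (\<Omega> \<times> ?I))"
   by (intro measurable_restrict_space1 measurable_completion) simp
  with w have wd: "(\<lambda>z. w z - d (fst z)) \<in> borel_measurable (lebesgue_on (\<Omega> \<times> ?I))" by (rule borel_measurable_diff)
  show ?thesis
  proof (rule slice_nn_integral[OF op opI wd, of "\<lambda>y. ennreal (\<bar>y\<bar> powr p)"])
   fix \<Phi> assume \<Phi>: "\<Phi> \<in> borel_measurable ?M"
    "AE t in ?M. (\<integral>\<^sup>+x. ennreal (\<bar>w (x, t) - d (fst (x, t))\<bar> powr p) \<partial>?N) = \<Phi> t"
   have "(\<integral>\<^sup>+x. ennreal (\<bar>w (x, t) - d (fst (x, t))\<bar> powr p) \<partial>?N) = (\<integral>\<^sup>+x. ennreal (\<bar>w (x, t) - D i x\<bar> powr p) \<partial>?N)" for t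
    by (rule nn_integral_cong_AE) (use d(2) in eventually_elim, simp)
   with \<Phi> show ?thesis by auto
  qed simp
 qed
 then have "\<forall>i. \<exists>\<Phi>. \<Phi> \<in> borel_measurable ?M \<and> (AE t in ?M. (\<integral>\<^sup>+x. ennreal (\<bar>w (x, t) - D i x\<bar> powr p) \<partial>?N) = \<Phi> t)" by (rule allI)
 then obtain \<Phi> :: "nat \<Rightarrow> real \<Rightarrow> ennreal" where "\<forall>i. \<Phi> i \<in> borel_measurable ?M \<and>
  (AE t in ?M. (\<integral>\<^sup>+x. ennreal (\<bar>w (x, t) - D i x\<bar> powr p) \<partial>?N) = \<Phi> i t)"
  by (rule choice[THEN exE])
 note \<Phi> [measurable] = this[THEN spec, THEN conjunct1] and \<Phi>w = this[THEN spec, THEN conjunct2]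
 \<comment> \<open>A running minimiser: the index moves only if the new member is strictly closer,
   so ties keep the earlier index.\<close>
 define idx :: "nat \<Rightarrow> real \<Rightarrow> nat" where
  "idx = rec_nat (\<lambda>t. 0) (\<lambda>j g t. if \<Phi> (Suc j) t < \<Phi> (g t) t then Suc j else g t)"
 have idx0: "idx 0 t = 0" and idxS: "idx (Suc j) t = (if \<Phi> (Suc j) t < \<Phi> (idx j t) t then Suc j else idx j t)" for j t
  by (simp_all add: idx_def)
 have idxm: "idx j \<in> measurable ?M (count_space UNIV)" for j
 proof (induction j)
  case 0
  then show ?case by (simp add: idx0[abs_def])
 next
  case (Suc j)
  have [measurable]: "idx j \<in> measurable ?M (count_space UNIV)" by fact
  have [measurable]: "(\<lambda>t. \<Phi> (idx j t) t) \<in> borel_measurable ?M"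
   by (rule measurable_compose_countable[OF \<Phi> Suc])
  show ?case unfolding idxS[abs_def] by measurable
 qed
 have idxle: "idx j t \<le> j" for j t
  by (induction j) (auto simp: idx0 idxS le_SucI)
 have idxmin: "l \<le> j \<Longrightarrow> \<Phi> (idx j t) t \<le> \<Phi> l t" for l j t
 proof (induction j)
  case (Suc j)
  then show ?case by (cases "l = Suc j") (auto simp: idxS not_less intro: order_trans less_imp_le)
 qed (simp add: idx0)
 show ?thesis unfolding strongly_measurable_iff
 proof (intro conjI exI[of _ "\<lambda>j t. D (idx j t)"] allI)
  show "step_fun T (Lp p \<Omega>) (\<lambda>t. D (idx j t))" for j
   unfolding step_fun_def
  proof (intro conjI allI)
   have "(\<lambda>t. D (idx j t)) ` ?I \<subseteq> D ` {..j}" using idxle by auto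
   then show "finite ((\<lambda>t. D (idx j t)) ` ?I)" by (rule finite_subset) simp
   fix a
   have "idx j -` {i. D i = a} \<inter> space ?M \<in> sets ?M" using idxm by (rule measurable_sets) simp
   moreover have "idx j -` {i. D i = a} \<inter> space ?M = {t \<in> ?I. D (idx j t) = a}" by auto
   ultimately show "{t \<in> ?I. D (idx j t) = a} \<in> sets lebesgue" by (auto simp: sets_restrict_space_iff)
  qed (use D in auto)
  have "AE t in ?M. \<forall>i. (\<integral>\<^sup>+x. ennreal (\<bar>w (x, t) - D i x\<bar> powr p) \<partial>?N) = \<Phi> i t"
   using \<Phi>w by (simp add: AE_all_countable)
  then show "AE t in ?M. (\<lambda>j. Lp_norm p \<Omega> (\<lambda>x. slices w t x - D (idx j t) x)) \<longlonglongrightarrow> 0"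
   using wL dense
  proof eventually_elim
   case (elim t)
   let ?A = "\<lambda>i. LINT x|?N. \<bar>w (x, t) - D i x\<bar> powr p"
   have A: "ennreal (?A i) = \<Phi> i t" for i
   proof -
    have "(\<lambda>x. slices w t x - D i x) \<in> Lp p \<Omega>" by (rule Lp_diff(1)[OF p elim(2) D])
    then have "integrable ?N (\<lambda>x. \<bar>w (x, t) - D i x\<bar> powr p)" by (simp add: Lp_def slices_def)
    then have "(\<integral>\<^sup>+x. ennreal (\<bar>w (x, t) - D i x\<bar> powr p) \<partial>?N) = ennreal (?A i)"
     by (rule nn_integral_eq_integral) simp
    then show ?thesis using spec[OF elim(1), of i] by (rule trans[OF sym])
   qed
   have A0: "0 \<le> ?A i" for i by (intro integral_nonneg_AE AE_I2) simp
   have mono: "?A (idx j t) \<le> ?A l" if "l \<le> j" for l j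
    using idxmin[OF that, of t] by (simp add: A[symmetric] A0)
   have "(\<lambda>j. ?A (idx j t)) \<longlonglongrightarrow> 0"
   proof (rule LIMSEQ_I)
    fix e :: real assume "0 < e"
    then obtain i where "?A i < e" using elim(3) by blast
    then have "norm (?A (idx j t) - 0) < e" if "i \<le> j" for j
     using mono[OF that] A0[of "idx j t"] by simp
    then show "\<exists>no. \<forall>j\<ge>no. norm (?A (idx j t) - 0) < e" by blast
   qed
   then have "(\<lambda>j. \<bar>?A (idx j t)\<bar> powr (1 / p)) \<longlonglongrightarrow> 0" using p by (intro powr_tendsto_zero) auto
   then show ?case by (simp add: Lp_norm_def slices_def A0)
  qed
 qed (rule wL)
qed

text \<open>The countable family consists of the values of the step functions that approximate each
  \<open>v k\<close> in \<open>H01 \<Omega>\<close>, truncated at integer levels. Truncation makes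
  them elements of \<open>Lp p \<Omega>\<close> and lets closeness in \<open>L2n\<close> and
  pointwise convergence be turned into closeness in the \<open>p\<close>-th power.\<close>

lemma strongly_measurable_Lp_limit:
 fixes \<Omega> :: "'a::euclidean_space set" and w :: "'a \<times> real \<Rightarrow> real" and v :: "nat \<Rightarrow> 'a \<times> real \<Rightarrow> real"
 assumes op: "open \<Omega>" and bd: "bounded \<Omega>" and T: "0 < T" and p: "2 \<le> p"
  and w: "w \<in> borel_measurable (lebesgue_on (\<Omega> \<times> {0<..<T}))" and wL: "AE t in lebesgue_on {0<..<T}. slices w t \<in> Lp p \<Omega>"
  and v: "\<And>k. strongly_measurable T (H01 \<Omega>) (H1_norm \<Omega>) (slices (v k))"
  and lim: "AE z in lebesgue_on (\<Omega> \<times> {0<..<T}). (\<lambda>k. v k z) \<longlonglongrightarrow> w z"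
 shows "strongly_measurable T (Lp p \<Omega>) (Lp_norm p \<Omega>) (slices w)"
proof -
 let ?I = "{0<..<T}" and ?M = "lebesgue_on {0<..<T}" and ?N = "lebesgue_on \<Omega>"
 have p0: "0 < p" using p by simp
 have opI: "open ?I" by simp
 have "\<forall>k. \<exists>S. (\<forall>j::nat. step_fun T (H01 \<Omega>) (S j)) \<and>
   (AE t in ?M. (\<lambda>j. H1_norm \<Omega> (\<lambda>x. slices (v k) t x - S j t x)) \<longlonglongrightarrow> 0)"
  using v unfolding strongly_measurable_iff by blast
 then obtain S where "\<forall>k. (\<forall>j::nat. step_fun T (H01 \<Omega>) (S k j)) \<and>
   (AE t in ?M. (\<lambda>j. H1_norm \<Omega> (\<lambda>x. slices (v k) t x - S k j t x)) \<longlonglongrightarrow> 0)"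
  by (rule choice[THEN exE])
 note S = this[THEN spec, THEN conjunct1, THEN spec] this[THEN spec, THEN conjunct2]
 define Z where "Z = (\<Union>k j. S k j ` ?I)"
 have fin: "finite (S k j ` ?I)" and sub: "S k j ` ?I \<subseteq> H01 \<Omega>" for k j
  using S(1)[of k j] by (simp_all add: step_fun_def)
 have Zc: "countable Z" unfolding Z_def by (intro countable_UN countableI_type countable_finite[OF fin])
 have ZH: "a \<in> H01 \<Omega>" if "a \<in> Z" for a using that sub unfolding Z_def by blast
 have Zs: "sqi ?N a" if "a \<in> Z" for a using H1_D(2)[OF op bd H01_H1[OF ZH[OF that]]] .
 have "T / 2 \<in> ?I" using T by simp
 then have Z0: "Z \<noteq> {}" by (auto simp: Z_def)
 \<comment> \<open>The index encodes a pair of a truncation level and a position in the enumeration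
   of \<open>Z\<close>.\<close>
 define D where "D i = (\<lambda>x. trunc (real (fst (prod_decode i))) (from_nat_into Z (snd (prod_decode i)) x))" for i
 have DL: "D i \<in> Lp p \<Omega>" for i
  unfolding D_def using Zs[OF from_nat_into[OF Z0]] by (intro trunc_Lp[OF op bd p0]) (auto intro: sqi_measurable)
 have Dex: "\<exists>i. D i = (\<lambda>x. trunc (real m) (a x))" if a: "a \<in> Z" for m :: nat and a
 proof
  show "D (prod_encode (m, to_nat_on Z a)) = (\<lambda>x. trunc (real m) (a x))"
   using from_nat_into_to_nat_on[OF Zc a] by (simp add: D_def)
 qed
 show ?thesis
 proof (rule strongly_measurable_Lp[OF op T p0 w wL DL])
  have S': "AE t in ?M. \<forall>k. (\<lambda>j::nat. H1_norm \<Omega> (\<lambda>x. slices (v k) t x - S k j t x)) \<longlonglongrightarrow> 0"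
   using S(2) by (simp add: AE_all_countable)
  have vH: "AE t in ?M. \<forall>k. slices (v k) t \<in> H01 \<Omega>"
   using v by (simp add: AE_all_countable strongly_measurable_def)
  show "AE t in ?M. \<forall>e>0. \<exists>i. (LINT x|?N. \<bar>w (x, t) - D i x\<bar> powr p) < e"
   using S' vH wL AE_slices[OF op opI lim] AE_space
  proof eventually_elim
   case (elim t)
   let ?w = "\<lambda>x. w (x, t)"
   have wt: "?w \<in> Lp p \<Omega>" using elim(3) by (simp add: slices_def[abs_def])
   then have wm: "?w \<in> borel_measurable ?N" by (simp add: Lp_def)
   have vs: "sqi ?N (slices (v k) t)" for k using H1_D(2)[OF op bd H01_H1] elim(2) by blast
   have tI: "t \<in> ?I" using elim(5) by simp
   have SZ: "S k j t \<in> Z" for k j using imageI[OF tI, of "S k j"] unfolding Z_def by blast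
   note vm = sqi_measurable[OF vs]
   show ?case
   proof (intro allI impI)
    fix e :: real assume e: "0 < e"
    define c where "c = 2 powr p"
    \<comment> \<open>Three errors below \<open>d\<close> are combined by two uses of the triangle
      inequality with factor \<open>c\<close>, which costs at most \<open>3 * c\<^sup>2 * d\<close>,
      less than \<open>e\<close>.\<close>
    define d where "d = e / (4 * c\<^sup>2)"
    have c: "1 \<le> c" unfolding c_def using p0 by (intro ge_one_powr_ge_zero) auto
    have d: "0 < d" using e c by (simp add: d_def)
    note l1 = trunc_Lp_limits(1)[OF op bd p wt]
    have "\<forall>\<^sub>F j in sequentially. (LINT x|?N. \<bar>?w x - trunc (real j) (?w x)\<bar> powr p) < d"
     by (rule order_tendstoD(2)[OF l1 d])
    then obtain m :: nat where 1: "(LINT x|?N. \<bar>?w x - trunc (real m) (?w x)\<bar> powr p) < d"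
     by (auto simp: eventually_sequentially)
    have vlim: "AE x in ?N. (\<lambda>k. slices (v k) t x) \<longlonglongrightarrow> ?w x" using elim(4) by (simp add: slices_def)
    note l2 = trunc_Lp_limits(2)[OF op bd p wm vm vlim, of "real m"]
    have "\<forall>\<^sub>F k in sequentially. (LINT x|?N. \<bar>trunc (real m) (?w x) - trunc (real m) (slices (v k) t x)\<bar> powr p) < d"
     by (rule order_tendstoD(2)[OF l2 d]) simp
    then obtain k where 2: "(LINT x|?N. \<bar>trunc (real m) (?w x) - trunc (real m) (slices (v k) t x)\<bar> powr p) < d"
     by (auto simp: eventually_sequentially)
    have L2lim: "(\<lambda>j. L2n ?N (\<lambda>x. slices (v k) t x - S k j t x)) \<longlonglongrightarrow> 0"
    proof (rule tendsto_sandwich[OF _ _ tendsto_const spec[OF elim(1), of k]])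
     show "\<forall>\<^sub>F j in sequentially. L2n ?N (\<lambda>x. slices (v k) t x - S k j t x) \<le> H1_norm \<Omega> (\<lambda>x. slices (v k) t x - S k j t x)"
      using H1_diff_L2n_le(1)[OF op bd] H01_H1 elim(2) ZH[OF SZ] by (intro always_eventually allI) blast
    qed simp
    note l3 = trunc_Lp_limits(3)[OF op bd p vs Zs[OF SZ] L2lim, of "real m"]
    have "\<forall>\<^sub>F j in sequentially. (LINT x|?N. \<bar>trunc (real m) (slices (v k) t x) - trunc (real m) (S k j t x)\<bar> powr p) < d"
     by (rule order_tendstoD(2)[OF l3 d]) simp
    then obtain j where 3: "(LINT x|?N. \<bar>trunc (real m) (slices (v k) t x) - trunc (real m) (S k j t x)\<bar> powr p) < d"
     by (auto simp: eventually_sequentially)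
    obtain i where i: "D i = (\<lambda>x. trunc (real m) (S k j t x))" using Dex[OF SZ] by blast
    note tL = trunc_Lp[OF op bd p0 of_nat_0_le_iff[of m]]
    note L = tL[OF wm] tL[OF vm[of k]] tL[OF sqi_measurable[OF Zs[OF SZ[of k j]]]]
    have "(LINT x|?N. \<bar>trunc (real m) (?w x) - trunc (real m) (S k j t x)\<bar> powr p) \<le> c * (d + d)"
     using order_trans[OF Lp_triangle[OF p0 L] mult_left_mono[OF add_mono[OF less_imp_le[OF 2] less_imp_le[OF 3]]]] by (simp add: c_def)
    then have "(LINT x|?N. \<bar>?w x - trunc (real m) (S k j t x)\<bar> powr p) \<le> c * (d + c * (d + d))"
     using order_trans[OF Lp_triangle[OF p0 wt L(1,3)] mult_left_mono[OF add_mono[OF less_imp_le[OF 1]]]] by (simp add: c_def)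
    also have "\<dots> < e"
    proof -
     have "c * (d + c * (d + d)) \<le> c * (c * d + c * (d + d))" using c d by (intro mult_left_mono add_mono) auto
     also have "\<dots> = 3 * c\<^sup>2 * d" by (simp add: power2_eq_square algebra_simps)
     also have "\<dots> < e" using c e by (simp add: d_def)
     finally show ?thesis .
    qed
    finally have "(LINT x|?N. \<bar>?w x - D i x\<bar> powr p) < e" by (simp only: i)
    then show "\<exists>i. (LINT x|?N. \<bar>?w x - D i x\<bar> powr p) < e" ..
   qed
  qed
 qed
qed

subsection \<open>Conclusion\<close>

text \<open>A translation from bounds for iterated integrals to membership and norms in the Bochner
  spaces. The sequence \<open>v\<close> carries the strong measurability over to
  \<open>w\<close>.\<close>

lemma mixed_norm_bounds:
 fixes \<Omega> :: "'a::euclidean_space set" and w :: "'a \<times> real \<Rightarrow> real"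
 assumes op: "open \<Omega>" and bd: "bounded \<Omega>" and T: "0 < T" and n: "n > 2" and \<sigma>: "1 < \<sigma>" and K: "0 < K"
  and w: "w \<in> borel_measurable (lebesgue_on (\<Omega> \<times> {0<..<T}))"
  and v: "\<And>k::nat. strongly_measurable T (H01 \<Omega>) (H1_norm \<Omega>) (slices (v k))"
  and lim: "AE z in lebesgue_on (\<Omega> \<times> {0<..<T}). (\<lambda>k. v k z) \<longlonglongrightarrow> w z"
  and b1: "AE t in lebesgue_on {0<..<T}. (\<integral>\<^sup>+x. ennreal (\<bar>w (x, t)\<bar> powr (2 * \<sigma>)) \<partial>lebesgue_on \<Omega>) \<le> ennreal K"
  and b2: "(\<integral>\<^sup>+t. epow (\<integral>\<^sup>+x. ennreal (\<bar>w (x, t)\<bar> powr (two_star n * \<sigma>)) \<partial>lebesgue_on \<Omega>) ((n - 2) / n)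
    \<partial>lebesgue_on {0<..<T}) \<le> ennreal K"
 shows "slices w \<in> bochner_Linf T (Lp (2 * \<sigma>) \<Omega>) (Lp_norm (2 * \<sigma>) \<Omega>)"
  "slices w \<in> bochner_Lp (2 * \<sigma>) T (Lp (two_star n * \<sigma>) \<Omega>) (Lp_norm (two_star n * \<sigma>) \<Omega>)"
  "bochner_Linf_norm T (Lp_norm (2 * \<sigma>) \<Omega>) (slices w) \<le> K powr (1 / (2 * \<sigma>))"
  "bochner_Lp_norm (2 * \<sigma>) T (Lp_norm (two_star n * \<sigma>) \<Omega>) (slices w) \<le> K powr (1 / (2 * \<sigma>))"
proof -
 let ?I = "{0<..<T}" and ?M = "lebesgue_on {0<..<T}" and ?N = "lebesgue_on \<Omega>"
 let ?p = "2 * \<sigma>" and ?r = "two_star n * \<sigma>" and ?\<beta> = "(n - 2) / n"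
 have opI: "open ?I" by simp
 have ts: "2 \<le> two_star n" using n by (simp add: two_star_def le_divide_eq)
 have p: "2 \<le> ?p" "0 < ?p" using \<sigma> by auto
 have r: "2 \<le> ?r" "0 < ?r"
 proof -
  have "2 * 1 \<le> two_star n * \<sigma>" using ts \<sigma> by (intro mult_mono) auto
  then show "2 \<le> ?r" "0 < ?r" by auto
 qed
 \<comment> \<open>The quotient of the two exponents is \<open>2 / two_star n\<close>, so the time
   integrand of the Bochner norm is exactly the \<open>epow\<close> expression of the
   assumption.\<close>
 have \<beta>: "0 < ?\<beta>" "1 / ?r * ?p = ?\<beta>" using n \<sigma> by (auto simp: two_star_def)
 have wm: "AE t in ?M. (\<lambda>x. w (x, t)) \<in> borel_measurable ?N"
  by (rule joint_representative[OF op opI w])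
 have LpI: "slices w t \<in> Lp a \<Omega> \<and> (\<integral>\<^sup>+x. ennreal (\<bar>w (x, t)\<bar> powr a) \<partial>?N) = ennreal (LINT x|?N. \<bar>w (x, t)\<bar> powr a)"
  if m: "(\<lambda>x. w (x, t)) \<in> borel_measurable ?N" and fin: "(\<integral>\<^sup>+x. ennreal (\<bar>w (x, t)\<bar> powr a) \<partial>?N) < \<infinity>" for t a
 proof -
  have pm: "(\<lambda>x. \<bar>w (x, t)\<bar> powr a) \<in> borel_measurable ?N" using m by measurable
  have i: "integrable ?N (\<lambda>x. \<bar>w (x, t)\<bar> powr a)"
   by (rule integrableI_nonneg[OF pm _ fin]) simp
  then show ?thesis using m by (simp add: Lp_def slices_def nn_integral_eq_integral)
 qed
 obtain \<Phi> :: "real \<Rightarrow> ennreal" where \<Phi>: "\<Phi> \<in> borel_measurable ?M"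
  "AE t in ?M. (\<integral>\<^sup>+x. ennreal (\<bar>w (x, t)\<bar> powr ?p) \<partial>?N) = \<Phi> t"
  by (rule slice_nn_integral[OF op opI w, of "\<lambda>y. ennreal (\<bar>y\<bar> powr (2 * \<sigma>))"]) simp
 obtain \<Psi> :: "real \<Rightarrow> ennreal" where \<Psi>: "\<Psi> \<in> borel_measurable ?M"
  "AE t in ?M. (\<integral>\<^sup>+x. ennreal (\<bar>w (x, t)\<bar> powr ?r) \<partial>?N) = \<Psi> t"
  by (rule slice_nn_integral[OF op opI w, of "\<lambda>y. ennreal (\<bar>y\<bar> powr (two_star n * \<sigma>))"]) simp
 have A: "AE t in ?M. slices w t \<in> Lp ?p \<Omega> \<and> Lp_norm ?p \<Omega> (slices w t) = enn2real (\<Phi> t) powr (1 / ?p) \<and>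
   Lp_norm ?p \<Omega> (slices w t) \<le> K powr (1 / ?p)"
  using wm b1 \<Phi>(2)
 proof eventually_elim
  case (elim t)
  have "(\<integral>\<^sup>+x. ennreal (\<bar>w (x, t)\<bar> powr ?p) \<partial>?N) < \<infinity>" using elim(2) by (rule order_le_less_trans) simp
  note L = LpI[OF elim(1) this]
  have 0: "0 \<le> (LINT x|?N. \<bar>w (x, t)\<bar> powr ?p)" by (intro integral_nonneg_AE AE_I2) simp
  have \<Phi>t: "\<Phi> t = ennreal (LINT x|?N. \<bar>w (x, t)\<bar> powr ?p)" using L elim(3) by simp
  have le: "(LINT x|?N. \<bar>w (x, t)\<bar> powr ?p) \<le> K" using elim(2) L K by simp
  have "(LINT x|?N. \<bar>w (x, t)\<bar> powr ?p) powr (1 / ?p) \<le> K powr (1 / ?p)"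
   by (rule powr_mono2[OF _ 0 le]) (use p(2) in simp)
  then show ?case using L 0 by (simp add: Lp_norm_def slices_def \<Phi>t)
 qed
 have fin: "AE t in ?M. epow (\<Psi> t) ?\<beta> \<noteq> \<infinity>"
 proof (rule nn_integral_PInf_AE)
  show "(\<lambda>t. epow (\<Psi> t) ?\<beta>) \<in> borel_measurable ?M" by (rule epow_measurable[OF \<Psi>(1)])
  have "(\<integral>\<^sup>+t. epow (\<Psi> t) ?\<beta> \<partial>?M) = (\<integral>\<^sup>+t. epow (\<integral>\<^sup>+x. ennreal (\<bar>w (x, t)\<bar> powr ?r) \<partial>?N) ?\<beta> \<partial>?M)"
   by (rule nn_integral_cong_AE) (use \<Psi>(2) in eventually_elim, simp)
  then show "(\<integral>\<^sup>+t. epow (\<Psi> t) ?\<beta> \<partial>?M) \<noteq> \<infinity>" using order_le_less_trans[OF b2 ennreal_less_top] by (metis infinity_ennreal_def less_irrefl)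
 qed
 have B: "AE t in ?M. slices w t \<in> Lp ?r \<Omega> \<and> Lp_norm ?r \<Omega> (slices w t) powr ?p = enn2real (epow (\<Psi> t) ?\<beta>) \<and>
   ennreal (Lp_norm ?r \<Omega> (slices w t) powr ?p) = epow (\<integral>\<^sup>+x. ennreal (\<bar>w (x, t)\<bar> powr ?r) \<partial>?N) ?\<beta>"
  using wm fin \<Psi>(2)
 proof eventually_elim
  case (elim t)
  have "\<Psi> t \<noteq> \<infinity>" using elim(2) epow_top[OF less_imp_neq[OF \<beta>(1), symmetric]] by auto
  then have "(\<integral>\<^sup>+x. ennreal (\<bar>w (x, t)\<bar> powr ?r) \<partial>?N) < \<infinity>" using elim(3) by (simp add: less_top)
  note L = LpI[OF elim(1) this]
  have 0: "0 \<le> (LINT x|?N. \<bar>w (x, t)\<bar> powr ?r)" by (intro integral_nonneg_AE AE_I2) simp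
  have \<Psi>t: "\<Psi> t = ennreal (LINT x|?N. \<bar>w (x, t)\<bar> powr ?r)" using L elim(3) by simp
  have e: "epow (\<Psi> t) ?\<beta> = ennreal ((LINT x|?N. \<bar>w (x, t)\<bar> powr ?r) powr ?\<beta>)"
   unfolding \<Psi>t by (rule epow_ennreal[OF 0 less_imp_neq[OF \<beta>(1), symmetric]])
  have N: "Lp_norm ?r \<Omega> (slices w t) powr ?p = (LINT x|?N. \<bar>w (x, t)\<bar> powr ?r) powr ?\<beta>"
   by (simp only: Lp_norm_def slices_def powr_powr \<beta>(2))
  show ?case unfolding N elim(3) e using L[THEN conjunct1] by simp
 qed
 have sm: "strongly_measurable T (Lp ?p \<Omega>) (Lp_norm ?p \<Omega>) (slices w)"
  by (rule strongly_measurable_Lp_limit[OF op bd T p(1) w _ v lim]) (use A in eventually_elim, simp)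
 have sm': "strongly_measurable T (Lp ?r \<Omega>) (Lp_norm ?r \<Omega>) (slices w)"
  by (rule strongly_measurable_Lp_limit[OF op bd T r(1) w _ v lim]) (use B in eventually_elim, simp)
 \<comment> \<open>Measurability is settled before the essential supremum is touched, because
   \<open>esssup\<close> is top by default for a function that is not measurable.\<close>
 have Am: "(\<lambda>t. Lp_norm ?p \<Omega> (slices w t)) \<in> borel_measurable ?M"
 proof (rule measurable_AE_lebesgue_on)
  show "(\<lambda>t. enn2real (\<Phi> t) powr (1 / ?p)) \<in> borel_measurable ?M" using \<Phi>(1) by measurable
  show "AE t in ?M. enn2real (\<Phi> t) powr (1 / ?p) = Lp_norm ?p \<Omega> (slices w t)" using A by eventually_elim simp
 qed simp
 have ess: "esssup ?M (\<lambda>t. ereal (Lp_norm ?p \<Omega> (slices w t))) \<le> ereal (K powr (1 / ?p))"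
 proof (rule esssup_I)
  show "(\<lambda>t. ereal (Lp_norm ?p \<Omega> (slices w t))) \<in> borel_measurable ?M" using Am by measurable
  show "AE t in ?M. ereal (Lp_norm ?p \<Omega> (slices w t)) \<le> ereal (K powr (1 / ?p))" using A by eventually_elim simp
 qed
 then have "esssup ?M (\<lambda>t. ereal (Lp_norm ?p \<Omega> (slices w t))) < \<infinity>" by (rule order_le_less_trans) simp
 then show "slices w \<in> bochner_Linf T (Lp ?p \<Omega>) (Lp_norm ?p \<Omega>)" using sm by (simp add: bochner_Linf_def)
 show "bochner_Linf_norm T (Lp_norm ?p \<Omega>) (slices w) \<le> K powr (1 / ?p)"
  unfolding bochner_Linf_norm_def using ess
  by (cases "esssup ?M (\<lambda>t. ereal (Lp_norm ?p \<Omega> (slices w t)))") auto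
 have Bm: "(\<lambda>t. Lp_norm ?r \<Omega> (slices w t) powr ?p) \<in> borel_measurable ?M"
 proof (rule measurable_AE_lebesgue_on)
  show "(\<lambda>t. enn2real (epow (\<Psi> t) ?\<beta>)) \<in> borel_measurable ?M"
   by (rule measurable_compose[OF epow_measurable[OF \<Psi>(1)] borel_measurable_enn2real[OF measurable_ident_sets]]) simp
  show "AE t in ?M. enn2real (epow (\<Psi> t) ?\<beta>) = Lp_norm ?r \<Omega> (slices w t) powr ?p" using B by eventually_elim simp
 qed simp
 have "(\<integral>\<^sup>+t. ennreal (Lp_norm ?r \<Omega> (slices w t) powr ?p) \<partial>?M) =
   (\<integral>\<^sup>+t. epow (\<integral>\<^sup>+x. ennreal (\<bar>w (x, t)\<bar> powr ?r) \<partial>?N) ?\<beta> \<partial>?M)"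
  by (rule nn_integral_cong_AE) (use B in eventually_elim, blast)
 then have nB: "(\<integral>\<^sup>+t. ennreal (Lp_norm ?r \<Omega> (slices w t) powr ?p) \<partial>?M) \<le> ennreal K" using b2 by simp
 have "integrable ?M (\<lambda>t. Lp_norm ?r \<Omega> (slices w t) powr ?p)"
  by (rule integrableI_nonneg[OF Bm]) (use nB in \<open>auto intro: order_le_less_trans\<close>)
 then show "slices w \<in> bochner_Lp ?p T (Lp ?r \<Omega>) (Lp_norm ?r \<Omega>)" using sm' by (simp add: bochner_Lp_def)
 have "(LINT t|?M. Lp_norm ?r \<Omega> (slices w t) powr ?p) \<le> K"
  by (rule integral_real_bounded[OF less_imp_le[OF K] nB])
 then show "bochner_Lp_norm ?p T (Lp_norm ?r \<Omega>) (slices w) \<le> K powr (1 / ?p)"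
  unfolding bochner_Lp_norm_def using p(2) by (intro powr_mono2 integral_nonneg_AE AE_I2) auto
qed

text \<open>By Fatou's lemma on the space-time cylinder the lower limit of
  \<open>\<bar>u k z\<bar> powr p\<close> is integrable, hence finite almost everywhere; at a point
  where \<open>U z\<close> is infinite it would be infinite.\<close>

lemma limit_finite_AE:
 fixes \<Omega> :: "'a::euclidean_space set" and u :: "nat \<Rightarrow> 'a \<times> real \<Rightarrow> real" and U :: "'a \<times> real \<Rightarrow> ereal"
 assumes op: "open \<Omega>" and u: "\<And>k. u k \<in> borel_measurable (lebesgue_on (\<Omega> \<times> {0<..<T}))"
  and b: "\<And>k. AE t in lebesgue_on {0<..<T}. (\<integral>\<^sup>+x. ennreal (\<bar>u k (x, t)\<bar> powr p) \<partial>lebesgue_on \<Omega>) \<le> ennreal K"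
  and p: "0 < p" and lim: "AE z in lebesgue_on (\<Omega> \<times> {0<..<T}). (\<lambda>k. ereal (u k z)) \<longlonglongrightarrow> U z"
 shows "AE z in lebesgue_on (\<Omega> \<times> {0<..<T}). \<bar>U z\<bar> \<noteq> \<infinity>"
proof -
 let ?I = "{0<..<T}" and ?M = "lebesgue_on {0<..<T}" and ?P = "lebesgue_on (\<Omega> \<times> {0<..<T})"
 have opI: "open ?I" "bounded ?I" by auto
 have m: "(\<lambda>z. ennreal (\<bar>u k z\<bar> powr p)) \<in> borel_measurable ?P" for k using u[of k] by measurable
 have le: "(\<integral>\<^sup>+z. ennreal (\<bar>u k z\<bar> powr p) \<partial>?P) \<le> (\<integral>\<^sup>+t. ennreal K \<partial>?M)" for k
 proof -
  obtain \<Phi> :: "real \<Rightarrow> ennreal" where \<Phi>: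
   "AE t in ?M. (\<integral>\<^sup>+x. ennreal (\<bar>u k (x, t)\<bar> powr p) \<partial>lebesgue_on \<Omega>) = \<Phi> t"
   "(\<integral>\<^sup>+z. ennreal (\<bar>u k z\<bar> powr p) \<partial>?P) = (\<integral>\<^sup>+t. \<Phi> t \<partial>?M)"
   by (rule slice_nn_integral[OF op opI(1) u[of k], of "\<lambda>y. ennreal (\<bar>y\<bar> powr p)"]) simp
  have "(\<integral>\<^sup>+t. \<Phi> t \<partial>?M) \<le> (\<integral>\<^sup>+t. ennreal K \<partial>?M)"
   by (rule nn_integral_mono_AE) (use \<Phi>(1) b[of k] in eventually_elim, simp)
  then show ?thesis using \<Phi>(2) by simp
 qed
 have fin: "AE z in ?P. liminf (\<lambda>k. ennreal (\<bar>u k z\<bar> powr p)) \<noteq> \<infinity>"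
 proof (rule nn_integral_PInf_AE)
  show "(\<lambda>z. liminf (\<lambda>k. ennreal (\<bar>u k z\<bar> powr p))) \<in> borel_measurable ?P" using m by measurable
  have "(\<integral>\<^sup>+z. liminf (\<lambda>k. ennreal (\<bar>u k z\<bar> powr p)) \<partial>?P) \<le> liminf (\<lambda>k. \<integral>\<^sup>+z. ennreal (\<bar>u k z\<bar> powr p) \<partial>?P)"
   using m by (rule nn_integral_liminf)
  also have "\<dots> \<le> liminf (\<lambda>k::nat. \<integral>\<^sup>+t. ennreal K \<partial>?M)" using le by (intro Liminf_mono always_eventually) auto
  also have "\<dots> = (\<integral>\<^sup>+t. ennreal K \<partial>?M)" by (simp add: Liminf_const)
  also have "\<dots> < \<infinity>"
  proof -
   have "emeasure ?M (space ?M) < \<infinity>"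
    using finite_measure.emeasure_finite[OF finite_measure_leb[OF opI]] by (simp add: less_top)
   then show ?thesis by (simp add: ennreal_mult_less_top)
  qed
  finally show "(\<integral>\<^sup>+z. liminf (\<lambda>k. ennreal (\<bar>u k z\<bar> powr p)) \<partial>?P) \<noteq> \<infinity>" by simp
 qed
 show ?thesis using fin lim
 proof eventually_elim
  case (elim z)
  show ?case
  proof
   assume U: "\<bar>U z\<bar> = \<infinity>"
   have "(\<lambda>k. \<bar>ereal (u k z)\<bar>) \<longlonglongrightarrow> \<infinity>" using tendsto_abs_ereal[OF elim(2)] U by simp
   then have up: "filterlim (\<lambda>k. \<bar>u k z\<bar>) at_top sequentially"
    by (simp add: tendsto_PInfty_eq_at_top)
   have "filterlim (\<lambda>k. \<bar>u k z\<bar> powr p) at_top sequentially"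
    unfolding filterlim_at_top_dense
   proof
    fix R :: real
    have "\<forall>\<^sub>F k in sequentially. max R 0 powr (1 / p) < \<bar>u k z\<bar>"
     using up by (simp add: filterlim_at_top_dense)
    then show "\<forall>\<^sub>F k in sequentially. R < \<bar>u k z\<bar> powr p"
    proof eventually_elim
     case (elim k)
     have "(max R 0 powr (1 / p)) powr p < \<bar>u k z\<bar> powr p" by (rule powr_less_mono2[OF p _ elim]) simp
     then show ?case using p by (simp add: powr_powr)
    qed
   qed
   then have "(\<lambda>k. ennreal (\<bar>u k z\<bar> powr p)) \<longlonglongrightarrow> top"
    by (simp add: ennreal_tendsto_top_eq_at_top)
   then have "liminf (\<lambda>k. ennreal (\<bar>u k z\<bar> powr p)) = top" by (intro lim_imp_Liminf) auto
   then show False using elim(1) by simp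
  qed
 qed
qed

theorem theorem2p36:
  fixes \<Omega> :: "(real ^ 'n) set"
    and s T \<gamma> r q n \<sigma> :: real
    and f :: "(real ^ 'n) \<times> real \<Rightarrow> real"
    and u :: "nat \<Rightarrow> (real ^ 'n) \<times> real \<Rightarrow> real"
  assumes "n = real CARD('n)" and "n > 2"
    and "bounded_lipschitz_domain \<Omega>"
    and "0 < s" and "s < 1" and "0 < T" and "0 < \<gamma>"
    and "1 < r" and "1 < q"
    and "f \<in> borel_measurable (lebesgue_on (\<Omega> \<times> {0<..<T}))"
    and "AE z in lebesgue_on (\<Omega> \<times> {0<..<T}). 0 \<le> f z"
    and "slices f \<in> bochner_Lp r T (Lp q \<Omega>) (Lp_norm q \<Omega>)"
    and "1 < 1 / r + n / (2 * q)"
    and "\<gamma> < 1 \<Longrightarrow> 1 / r < n / (n - 2) * (1 / q) - 2 / (n - 2) \<Longrightarrow>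
           q > holder_conj (two_star n / (1 - \<gamma>))"
    and "\<gamma> < 1 \<Longrightarrow> 1 / r \<ge> n / (n - 2) * (1 / q) - 2 / (n - 2) \<Longrightarrow> r > 2 / (1 + \<gamma>)"
    and "\<And>k. k \<ge> 1 \<Longrightarrow>
           energy_solution \<Omega> T s
             (\<lambda>z. trunc (real k) (f z) / (u k z + 1 / real k) powr \<gamma>) (\<lambda>x. 0) (u k)"
    and "\<And>k. k \<ge> 1 \<Longrightarrow> AE z in lebesgue_on (\<Omega> \<times> {0<..<T}). 0 \<le> u k z"
    and "\<sigma> = (if 1 / r < n / (n - 2) * (1 / q) - 2 / (n - 2)
               then q * (n - 2) * (\<gamma> + 1) / (2 * (n - 2 * q))
               else q * r * n * (\<gamma> + 1) / (2 * (n * r + 2 * q - 2 * q * r)))"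
  shows "(\<exists>c>0. \<forall>k\<ge>1.
            slices (u k) \<in> bochner_Linf T (Lp (2 * \<sigma>) \<Omega>) (Lp_norm (2 * \<sigma>) \<Omega>) \<and>
            slices (u k) \<in> bochner_Lp (2 * \<sigma>) T
                             (Lp (two_star n * \<sigma>) \<Omega>) (Lp_norm (two_star n * \<sigma>) \<Omega>) \<and>
            bochner_Linf_norm T (Lp_norm (2 * \<sigma>) \<Omega>) (slices (u k)) +
            bochner_Lp_norm (2 * \<sigma>) T (Lp_norm (two_star n * \<sigma>) \<Omega>) (slices (u k)) \<le> c) \<and>
         (\<forall>U :: (real ^ 'n) \<times> real \<Rightarrow> ereal.
            (AE z in lebesgue_on (\<Omega> \<times> {0<..<T}). (\<lambda>k. ereal (u k z)) \<longlonglongrightarrow> U z) \<longrightarrow>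
            (AE z in lebesgue_on (\<Omega> \<times> {0<..<T}). \<bar>U z\<bar> \<noteq> \<infinity>) \<and>
            slices (\<lambda>z. real_of_ereal (U z))
              \<in> bochner_Linf T (Lp (2 * \<sigma>) \<Omega>) (Lp_norm (2 * \<sigma>) \<Omega>) \<and>
            slices (\<lambda>z. real_of_ereal (U z))
              \<in> bochner_Lp (2 * \<sigma>) T
                  (Lp (two_star n * \<sigma>) \<Omega>) (Lp_norm (two_star n * \<sigma>) \<Omega>))"
proof -
 let ?J = "{0<..<T}" and ?M = "lebesgue_on {0<..<T}" and ?N = "lebesgue_on \<Omega>"
 let ?P = "lebesgue_on (\<Omega> \<times> {0<..<T})" and ?\<beta> = "(n - 2) / n"
 note hyp = assms
 have op: "open \<Omega>" and bd: "bounded \<Omega>" using hyp(3) by (simp_all add: bounded_lipschitz_domain_def)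
 have opJ: "open ?J" by simp
 have dim: "n = real DIM(real ^ 'n)" using hyp(1) by simp
 obtain a b where ab: "0 \<le> a" "0 < b" "b \<le> 1 - 1 / r" "a + b = 1 - (1 + \<gamma>) / (2 * \<sigma>)"
  "1 / q + a + b * (n - 2) / n = 1" "1 < \<sigma>" "\<gamma> + 1 < 2 * \<sigma>"
  by (rule exponents[OF hyp(2,7,8,9,13-15,18)])
 obtain K :: real where K: "K > 0" and est:
  "\<And>k v M. 1 \<le> k \<Longrightarrow> energy_solution \<Omega> T s (\<lambda>z. trunc (real k) (f z) / (v z + 1 / real k) powr \<gamma>) (\<lambda>x. 0) v \<Longrightarrow>
   AE z in ?P. 0 \<le> v z \<Longrightarrow> M > 0 \<Longrightarrow>
   (AE t in ?M. (\<integral>\<^sup>+x. ennreal (soft_trunc M (v (x, t)) powr (2 * \<sigma>)) \<partial>?N) \<le> ennreal K) \<and>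
   (\<integral>\<^sup>+t. epow (\<integral>\<^sup>+x. ennreal (soft_trunc M (v (x, t)) powr (2 * n / (n - 2) * \<sigma>)) \<partial>?N) ?\<beta> \<partial>?M) \<le> ennreal K"
  by (rule uniform_estimates[OF op bd dim hyp(2,6,8,9,7) ab(6,7,1-5) hyp(11,12), of s]) blast
 have \<beta>: "0 < ?\<beta>" using hyp(2) by simp
 have um: "u k \<in> borel_measurable ?P" and usm: "strongly_measurable T (H01 \<Omega>) (H1_norm \<Omega>) (slices (u k))" if "k \<ge> 1" for k
  using hyp(16)[OF that] by (auto simp: energy_solution_def bochner_Lp_def)
 have N: "AE t in ?M. (\<integral>\<^sup>+x. ennreal (\<bar>u k (x, t)\<bar> powr (2 * \<sigma>)) \<partial>?N) \<le> ennreal K"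
  "(\<integral>\<^sup>+t. epow (\<integral>\<^sup>+x. ennreal (\<bar>u k (x, t)\<bar> powr (two_star n * \<sigma>)) \<partial>?N) ?\<beta> \<partial>?M) \<le> ennreal K"
  if k: "k \<ge> 1" for k
 proof -
  \<comment> \<open>The bound \<open>K\<close> holds at every truncation level, so the level is sent
    to infinity for fixed \<open>k\<close>.\<close>
  let ?w = "\<lambda>j z. soft_trunc (real (Suc j)) (u k z)"
  have pos: "0 < real (Suc j)" for j by simp
  have wm: "?w j \<in> borel_measurable ?P" for j
   by (rule measurable_compose[OF um[OF k] smooth_borel[OF smooth_soft_trunc[OF pos]]])
  have lim: "AE z in ?P. (\<lambda>j. ?w j z) \<longlonglongrightarrow> u k z" by (rule AE_I2) (rule soft_trunc_tendsto)
  note e = est[OF k hyp(16)[OF k] hyp(17)[OF k] pos]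
  have abs: "AE t in ?M. (\<integral>\<^sup>+x. ennreal (\<bar>?w j (x, t)\<bar> powr p) \<partial>?N) = (\<integral>\<^sup>+x. ennreal (?w j (x, t) powr p) \<partial>?N)" for j p
   using AE_slices[OF op opJ hyp(17)[OF k]]
  proof eventually_elim
   case (elim t)
   show ?case
   proof (rule nn_integral_cong_AE)
    show "AE x in ?N. ennreal (\<bar>?w j (x, t)\<bar> powr p) = ennreal (?w j (x, t) powr p)"
     using elim by eventually_elim (simp only: abs_of_nonneg[OF soft_trunc_bounds(2)[OF pos]])
   qed
  qed
  have 1: "AE t in ?M. (\<integral>\<^sup>+x. ennreal (\<bar>?w j (x, t)\<bar> powr (2 * \<sigma>)) \<partial>?N) \<le> ennreal K" for j
   using abs[of j "2 * \<sigma>"] e[of j, THEN conjunct1] by eventually_elim simp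
  have 2: "(\<integral>\<^sup>+t. epow (\<integral>\<^sup>+x. ennreal (\<bar>?w j (x, t)\<bar> powr (two_star n * \<sigma>)) \<partial>?N) ?\<beta> \<partial>?M) \<le> ennreal K" for j
  proof -
   have "(\<integral>\<^sup>+t. epow (\<integral>\<^sup>+x. ennreal (\<bar>?w j (x, t)\<bar> powr (two_star n * \<sigma>)) \<partial>?N) ?\<beta> \<partial>?M) =
     (\<integral>\<^sup>+t. epow (\<integral>\<^sup>+x. ennreal (?w j (x, t) powr (two_star n * \<sigma>)) \<partial>?N) ?\<beta> \<partial>?M)"
    by (rule nn_integral_cong_AE) (use abs[of j "two_star n * \<sigma>"] in eventually_elim, simp only:)
   then show ?thesis using e[of j, THEN conjunct2] by (simp only: two_star_def)
  qed
  note F = Fatou_mixed_bounds[OF op opJ wm lim \<beta> 1 2]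
  show "AE t in ?M. (\<integral>\<^sup>+x. ennreal (\<bar>u k (x, t)\<bar> powr (2 * \<sigma>)) \<partial>?N) \<le> ennreal K" by (rule F(1))
  show "(\<integral>\<^sup>+t. epow (\<integral>\<^sup>+x. ennreal (\<bar>u k (x, t)\<bar> powr (two_star n * \<sigma>)) \<partial>?N) ?\<beta> \<partial>?M) \<le> ennreal K" by (rule F(2))
 qed
 have Suc1: "1 \<le> Suc k" for k by simp
 show ?thesis
 proof (intro conjI exI[of _ "2 * K powr (1 / (2 * \<sigma>))"] allI impI)
  show "0 < 2 * K powr (1 / (2 * \<sigma>))" using K by simp
  fix k :: nat assume k: "1 \<le> k"
  \<comment> \<open>For a single solution the constant sequence serves as the approximating
    sequence, and its strong measurability is part of being an energy solution.\<close>
  have c: "AE z in ?P. (\<lambda>j::nat. u k z) \<longlonglongrightarrow> u k z" by simp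
  note m = mixed_norm_bounds[OF op bd hyp(6,2) ab(6) K um[OF k] usm[OF k] c N[OF k]]
  show "slices (u k) \<in> bochner_Linf T (Lp (2 * \<sigma>) \<Omega>) (Lp_norm (2 * \<sigma>) \<Omega>)" by (rule m(1))
  show "slices (u k) \<in> bochner_Lp (2 * \<sigma>) T (Lp (two_star n * \<sigma>) \<Omega>) (Lp_norm (two_star n * \<sigma>) \<Omega>)" by (rule m(2))
  show "bochner_Linf_norm T (Lp_norm (2 * \<sigma>) \<Omega>) (slices (u k)) +
    bochner_Lp_norm (2 * \<sigma>) T (Lp_norm (two_star n * \<sigma>) \<Omega>) (slices (u k)) \<le> 2 * K powr (1 / (2 * \<sigma>))"
   using m(3,4) by simp
 next
  fix U :: "(real ^ 'n) \<times> real \<Rightarrow> ereal"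
  assume "AE z in ?P. (\<lambda>k. ereal (u k z)) \<longlonglongrightarrow> U z"
  \<comment> \<open>The assumptions on \<open>u k\<close> begin with \<open>k = 1\<close>, so the
    sequence is shifted by one before the limit theorems are applied.\<close>
  then have lim: "AE z in ?P. (\<lambda>k. ereal (u (Suc k) z)) \<longlonglongrightarrow> U z"
   by eventually_elim (rule LIMSEQ_Suc)
  have "0 < 2 * \<sigma>" using ab(6) by simp
  note fin = limit_finite_AE[OF op um[OF Suc1] N(1)[OF Suc1] this lim]
  then show "AE z in ?P. \<bar>U z\<bar> \<noteq> \<infinity>" .
  have lim': "AE z in ?P. (\<lambda>k. u (Suc k) z) \<longlonglongrightarrow> real_of_ereal (U z)"
   using fin lim
  proof eventually_elim
   case (elim z)
   then show ?case by (cases "U z") auto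
  qed
  have Ps: "\<Omega> \<times> ?J \<in> sets lebesgue" using open_Times[OF op opJ] by (intro sets_completionI_sets) simp
  note Um = measurable_limit_lebesgue_on[OF Ps um[OF Suc1] lim']
  note F = Fatou_mixed_bounds[OF op opJ um[OF Suc1] lim' \<beta> N(1)[OF Suc1] N(2)[OF Suc1]]
  note m = mixed_norm_bounds[OF op bd hyp(6,2) ab(6) K Um usm[OF Suc1] lim' F]
  show "slices (\<lambda>z. real_of_ereal (U z)) \<in> bochner_Linf T (Lp (2 * \<sigma>) \<Omega>) (Lp_norm (2 * \<sigma>) \<Omega>)" by (rule m(1))
  show "slices (\<lambda>z. real_of_ereal (U z)) \<in> bochner_Lp (2 * \<sigma>) T (Lp (two_star n * \<sigma>) \<Omega>) (Lp_norm (two_star n * \<sigma>) \<Omega>)"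
   by (rule m(2))
 qed
qed

end
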